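(* For any constant $\epsilon>0$, given a balanced list decodable coding scheme with constant list size that tolerates error rate $1/4 - \epsilon$, there is a (non-adaptive) unique decoding coding scheme that tolerates error rate $1/4 - 2\epsilon$ and has, up to constant factors, the same round complexity, alphabet size and computational complexity as the given list decodable scheme.
   Context: Interactive coding setting. Coding schemes simulate an $n$-round two-party protocol $\Pi$ (between Alice and Bob) by a protocol $\Pi'$ with $N$ rounds over a constant-size alphabet. In a non-adaptive scheme, which party transmits in a round is fixed in advance, exactly one party per round; an adversary may replace any transmitted symbol arbitrarily (a corruption), and error rate $\rho$ means at most $\rho N$ corruptions. A scheme is balanced if in any execution both parties transmit equally often. Unique decoding: from any execution with at most a $\rho$ fraction of corruptions, both parties output the transcript of the error-free execution of $\Pi$. $s$-list decoding: each party outputs a list of at most $s$ transcripts containing that transcript. Computational complexity counts computation steps over the $N$ rounds, with each oracle access to $\Pi$ counted as one step. *)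

theory Defs
  imports Complex_Main
begin

section \<open>Noiseless protocols\<close>

text \<open>A two-party protocol. \<open>alice_speaks k\<close> says whether Alice (otherwise Bob) transmits in
  round \<open>k\<close>; \<open>alice_msg h\<close> and \<open>bob_msg h\<close> are the symbols the parties transmit after the
  history \<open>h\<close>. Private inputs are absorbed into these two functions.\<close>

record protocol =
  alice_speaks :: "nat \<Rightarrow> bool"
  alice_msg :: "nat list \<Rightarrow> nat"
  bob_msg :: "nat list \<Rightarrow> nat"

definition protocol_over :: "nat \<Rightarrow> protocol \<Rightarrow> bool" where
  "protocol_over p \<Pi> \<longleftrightarrow> (\<forall>h. alice_msg \<Pi> h < p \<and> bob_msg \<Pi> h < p)"

primrec transcript :: "protocol \<Rightarrow> nat \<Rightarrow> nat list" where
  "transcript \<Pi> 0 = []"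
| "transcript \<Pi> (Suc k) = (let h = transcript \<Pi> k in
     h @ [if alice_speaks \<Pi> k then alice_msg \<Pi> h else bob_msg \<Pi> h])"

text \<open>Oracle access of each party to its own half of the protocol: \<open>0\<close> means that it is the
  other party's turn, \<open>Suc v\<close> that this party transmits \<open>v\<close>.\<close>

definition alice_oracle :: "protocol \<Rightarrow> nat list \<Rightarrow> nat" where
  "alice_oracle \<Pi> h = (if alice_speaks \<Pi> (length h) then Suc (alice_msg \<Pi> h) else 0)"

definition bob_oracle :: "protocol \<Rightarrow> nat list \<Rightarrow> nat" where
  "bob_oracle \<Pi> h = (if alice_speaks \<Pi> (length h) then 0 else Suc (bob_msg \<Pi> h))"


section \<open>The machine model\<close>

text \<open>The parties are unit-cost random access machines (addition, truncated subtraction,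
  indirect addressing), written as structured programs over natural-number variables and
  arrays. A program mentions only finitely many variables and arrays; these are named by
  literals. In addition to computing, a program can transmit a symbol, receive a symbol, and
  query the oracle on a history stored contiguously in an array.\<close>

datatype com =
    Skip
  | SetC nat nat            \<comment> \<open>\<open>x := literal\<close>\<close>
  | Add nat nat nat         \<comment> \<open>\<open>x := y + z\<close>\<close>
  | Sub nat nat nat         \<comment> \<open>\<open>x := y - z\<close>, truncated at 0\<close>
  | Load nat nat nat        \<comment> \<open>\<open>x := a[i]\<close>\<close>
  | Store nat nat nat       \<comment> \<open>\<open>a[i] := x\<close>\<close>
  | Send nat                \<comment> \<open>transmit the value of \<open>x\<close>\<close>
  | Recv nat                \<comment> \<open>\<open>x :=\<close> received symbol\<close>
  | Query nat nat nat nat   \<comment> \<open>\<open>x := oracle (a[i], \<dots>, a[i + l - 1])\<close>\<close>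
  | Seq com com
  | IfNZ nat com com
  | WhileNZ nat com

datatype event = Snd (sym: nat) | Rcv (sym: nat)

record state =
  vars :: "nat \<Rightarrow> nat"
  arrs :: "nat \<Rightarrow> nat \<Rightarrow> nat"
  trace :: "event list"

definition set_var :: "nat \<Rightarrow> nat \<Rightarrow> state \<Rightarrow> state" where
  "set_var x v st = st\<lparr>vars := (vars st)(x := v)\<rparr>"

definition set_arr :: "nat \<Rightarrow> nat \<Rightarrow> nat \<Rightarrow> state \<Rightarrow> state" where
  "set_arr a i v st = st\<lparr>arrs := (arrs st)(a := (arrs st a)(i := v))\<rparr>"

definition log_event :: "event \<Rightarrow> state \<Rightarrow> state" where
  "log_event e st = st\<lparr>trace := trace st @ [e]\<rparr>"

definition segment :: "(nat \<Rightarrow> nat) \<Rightarrow> nat \<Rightarrow> nat \<Rightarrow> nat list" where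
  "segment f i l = map f [i..<i + l]"

text \<open>\<open>big_step orc inp c st t st'\<close>: started in \<open>st\<close>, the program \<open>c\<close> halts in \<open>st'\<close> after \<open>t\<close>
  computation steps. Every transmission and every reception takes one round, so the length of
  the trace is the number of the current round; \<open>inp i\<close> is the symbol the channel delivers if
  the party listens in round \<open>i\<close>.\<close>

inductive big_step ::
  "(nat list \<Rightarrow> nat) \<Rightarrow> (nat \<Rightarrow> nat) \<Rightarrow> com \<Rightarrow> state \<Rightarrow> nat \<Rightarrow> state \<Rightarrow> bool"
  for orc :: "nat list \<Rightarrow> nat" and inp :: "nat \<Rightarrow> nat" where
  Skip: "big_step orc inp Skip st 1 st"
| SetC: "big_step orc inp (SetC x v) st 1 (set_var x v st)"
| Add: "big_step orc inp (Add x y z) st 1 (set_var x (vars st y + vars st z) st)"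
| Sub: "big_step orc inp (Sub x y z) st 1 (set_var x (vars st y - vars st z) st)"
| Load: "big_step orc inp (Load x a i) st 1 (set_var x (arrs st a (vars st i)) st)"
| Store: "big_step orc inp (Store a i x) st 1 (set_arr a (vars st i) (vars st x) st)"
| Send: "big_step orc inp (Send x) st 1 (log_event (Snd (vars st x)) st)"
| Recv: "v = inp (length (trace st)) \<Longrightarrow>
    big_step orc inp (Recv x) st 1 (log_event (Rcv v) (set_var x v st))"
| Query: "h = segment (arrs st a) (vars st i) (vars st l) \<Longrightarrow>
    big_step orc inp (Query x a i l) st 1 (set_var x (orc h) st)"
| Seq: "big_step orc inp c st t st' \<Longrightarrow> big_step orc inp d st' u st'' \<Longrightarrow>
    big_step orc inp (Seq c d) st (t + u) st''"
| IfTrue: "vars st x \<noteq> 0 \<Longrightarrow> big_step orc inp c st t st' \<Longrightarrow>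
    big_step orc inp (IfNZ x c d) st (Suc t) st'"
| IfFalse: "vars st x = 0 \<Longrightarrow> big_step orc inp d st t st' \<Longrightarrow>
    big_step orc inp (IfNZ x c d) st (Suc t) st'"
| WhileTrue: "vars st x \<noteq> 0 \<Longrightarrow> big_step orc inp c st t st' \<Longrightarrow>
    big_step orc inp (WhileNZ x c) st' u st'' \<Longrightarrow>
    big_step orc inp (WhileNZ x c) st (Suc (t + u)) st''"
| WhileFalse: "vars st x = 0 \<Longrightarrow> big_step orc inp (WhileNZ x c) st 1 st"

inductive_cases big_step_SkipE: "big_step orc inp Skip st t st'"
inductive_cases big_step_SetCE: "big_step orc inp (SetC x v) st t st'"
inductive_cases big_step_AddE: "big_step orc inp (Add x y z) st t st'"
inductive_cases big_step_SubE: "big_step orc inp (Sub x y z) st t st'"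
inductive_cases big_step_LoadE: "big_step orc inp (Load x a i) st t st'"
inductive_cases big_step_StoreE: "big_step orc inp (Store a i x) st t st'"
inductive_cases big_step_SendE: "big_step orc inp (Send x) st t st'"
inductive_cases big_step_RecvE: "big_step orc inp (Recv x) st t st'"
inductive_cases big_step_QueryE: "big_step orc inp (Query x a i l) st t st'"
inductive_cases big_step_SeqE: "big_step orc inp (Seq c d) st t st'"
inductive_cases big_step_IfE: "big_step orc inp (IfNZ x c d) st t st'"
inductive_cases big_step_WhileE: "big_step orc inp (WhileNZ x c) st t st'"

lemma big_step_det:
  assumes "big_step orc inp c st t st'" and "big_step orc inp c st u st''"
  shows "t = u \<and> st' = st''"
  using assms
proof (induction arbitrary: u st'' rule: big_step.induct)
  case (Seq c st t st1 d w st2)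
  from Seq.prems obtain t' w' st1' where *: "u = t' + w'" "big_step orc inp c st t' st1'"
    "big_step orc inp d st1' w' st''"
    by (elim big_step_SeqE) metis
  from Seq.IH(1)[OF *(2)] have "t = t'" "st1 = st1'" by simp_all
  with Seq.IH(2) * show ?case by simp
next
  case (IfTrue st x c t st1 d)
  from IfTrue.prems obtain t' where "u = Suc t'" "big_step orc inp c st t' st''"
    by (rule big_step_IfE) (use IfTrue.hyps in simp_all)
  with IfTrue.IH show ?case by simp
next
  case (IfFalse st x d t st1 c)
  from IfFalse.prems obtain t' where "u = Suc t'" "big_step orc inp d st t' st''"
    by (rule big_step_IfE) (use IfFalse.hyps in simp_all)
  with IfFalse.IH show ?case by simp
next
  case (WhileTrue st x c t st1 w st2)
  from WhileTrue.prems obtain t' w' st1' where *: "u = Suc (t' + w')"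
    "big_step orc inp c st t' st1'" "big_step orc inp (WhileNZ x c) st1' w' st''"
    by (rule big_step_WhileE) (use WhileTrue.hyps in simp_all)
  from WhileTrue.IH(1)[OF *(2)] have "t = t'" "st1 = st1'" by simp_all
  with WhileTrue.IH(2) * show ?case by simp
next
  case (WhileFalse st x c)
  from WhileFalse.prems show ?case
    by (rule big_step_WhileE) (use WhileFalse.hyps in simp_all)
qed (erule big_step_SkipE big_step_SetCE big_step_AddE big_step_SubE big_step_LoadE
      big_step_StoreE big_step_SendE big_step_RecvE big_step_QueryE; simp)+


section \<open>Coding schemes\<close>

text \<open>A scheme consists of one program for each party, working for every number \<open>n\<close> of rounds
  of the simulated protocol. \<open>alice_sends S n i\<close> is the schedule fixed in advance: it says
  whether Alice (otherwise Bob) transmits in round \<open>i < rounds S n\<close>.\<close>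

record scheme =
  alice_prog :: com
  bob_prog :: com
  rounds :: "nat \<Rightarrow> nat"
  alice_sends :: "nat \<Rightarrow> nat \<Rightarrow> bool"

text \<open>The number \<open>n\<close> is passed in variable 0; everything else is initialised with 0.\<close>

definition init_state :: "nat \<Rightarrow> state" where
  "init_state n = \<lparr>vars = (\<lambda>x. if x = 0 then n else 0), arrs = (\<lambda>a i. 0), trace = []\<rparr>"

text \<open>On halting, variable 0 holds the number of transcripts that are output, and array 0 holds
  these transcripts (\<open>n\<close> cells each) one after the other.\<close>

definition outputs :: "nat \<Rightarrow> state \<Rightarrow> nat list list" where
  "outputs n st = map (\<lambda>k. segment (arrs st 0) (k * n) n) [0..<vars st 0]"

definition conforms :: "nat \<Rightarrow> nat \<Rightarrow> (nat \<Rightarrow> bool) \<Rightarrow> event list \<Rightarrow> bool" where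
  "conforms q N sends tr \<longleftrightarrow> length tr = N \<and>
     (\<forall>i<N. is_Snd (tr ! i) = sends i \<and> sym (tr ! i) < q)"

text \<open>Non-adaptive coding scheme over the alphabet \<open>{0..<q}\<close> for protocols over \<open>{0..<p}\<close>, of
  computational complexity at most \<open>T\<close>: whatever symbols the channel delivers, each party
  follows the schedule and halts after at most \<open>T n\<close> steps.\<close>

definition coding_scheme :: "nat \<Rightarrow> nat \<Rightarrow> scheme \<Rightarrow> (nat \<Rightarrow> nat) \<Rightarrow> bool" where
  "coding_scheme p q S T \<longleftrightarrow> 0 < q \<and>
     (\<forall>n \<Pi> inp. protocol_over p \<Pi> \<longrightarrow> (\<forall>i. inp i < q) \<longrightarrow>
        (\<exists>t st. big_step (alice_oracle \<Pi>) inp (alice_prog S) (init_state n) t st \<and> t \<le> T n \<and>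
           conforms q (rounds S n) (alice_sends S n) (trace st)) \<and>
        (\<exists>t st. big_step (bob_oracle \<Pi>) inp (bob_prog S) (init_state n) t st \<and> t \<le> T n \<and>
           conforms q (rounds S n) (\<lambda>i. \<not> alice_sends S n i) (trace st)))"

text \<open>The adversary determines which symbols \<open>inA\<close> and \<open>inB\<close> are delivered to the parties;
  \<open>stA\<close> and \<open>stB\<close> are the final states of Alice and Bob.\<close>

definition execution ::
  "nat \<Rightarrow> scheme \<Rightarrow> nat \<Rightarrow> protocol \<Rightarrow> state \<Rightarrow> state \<Rightarrow> bool" where
  "execution q S n \<Pi> stA stB \<longleftrightarrow> (\<exists>inA inB tA tB. (\<forall>i. inA i < q \<and> inB i < q) \<and>
     big_step (alice_oracle \<Pi>) inA (alice_prog S) (init_state n) tA stA \<and>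
     big_step (bob_oracle \<Pi>) inB (bob_prog S) (init_state n) tB stB)"

text \<open>In each round one party has sent and the other received; the round is corrupted iff the
  two symbols differ.\<close>

definition corruptions :: "state \<Rightarrow> state \<Rightarrow> nat" where
  "corruptions stA stB =
     card {i. i < length (trace stA) \<and> sym (trace stA ! i) \<noteq> sym (trace stB ! i)}"

definition balanced :: "nat \<Rightarrow> nat \<Rightarrow> scheme \<Rightarrow> bool" where
  "balanced p q S \<longleftrightarrow> (\<forall>n \<Pi> stA stB. protocol_over p \<Pi> \<longrightarrow> execution q S n \<Pi> stA stB \<longrightarrow>
     length (filter is_Snd (trace stA)) = length (filter is_Snd (trace stB)))"

definition unique_decoding :: "nat \<Rightarrow> nat \<Rightarrow> real \<Rightarrow> scheme \<Rightarrow> bool" where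
  "unique_decoding p q \<rho> S \<longleftrightarrow>
     (\<forall>n \<Pi> stA stB. protocol_over p \<Pi> \<longrightarrow> execution q S n \<Pi> stA stB \<longrightarrow>
        real (corruptions stA stB) \<le> \<rho> * real (rounds S n) \<longrightarrow>
        outputs n stA = [transcript \<Pi> n] \<and> outputs n stB = [transcript \<Pi> n])"

definition list_decoding :: "nat \<Rightarrow> nat \<Rightarrow> nat \<Rightarrow> real \<Rightarrow> scheme \<Rightarrow> bool" where
  "list_decoding s p q \<rho> S \<longleftrightarrow>
     (\<forall>n \<Pi> stA stB. protocol_over p \<Pi> \<longrightarrow> execution q S n \<Pi> stA stB \<longrightarrow>
        real (corruptions stA stB) \<le> \<rho> * real (rounds S n) \<longrightarrow>
        length (outputs n stA) \<le> s \<and> transcript \<Pi> n \<in> set (outputs n stA) \<and>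
        length (outputs n stB) \<le> s \<and> transcript \<Pi> n \<in> set (outputs n stB))"

end

theory Submission
  imports Defs "HOL-Computational_Algebra.Primes" "HOL-Computational_Algebra.Polynomial"
begin

text \<open>Each party runs the given scheme \<open>R * v\<close> times, in \<open>R\<close> epochs of \<open>v\<close> runs, on independent
  copies of its program. A transcript that occurs in many of the output lists of an epoch and agrees
  with the party's own half of the protocol becomes a candidate; there are only constantly many. The
  only transcript that agrees with both halves is the correct one, so it is the only possible common
  candidate of the two parties. In the following epochs every symbol additionally carries one
  symbol of the encoding of each own candidate, under a code of large distance over an alphabet
  of constant size.

  If an epoch suffers corruptions at a rate below \<open>1/4 - 3/2 * \<epsilon>\<close>, many of its runs are
  corrupted at a rate of at most \<open>1/4 - \<epsilon>\<close>, so the correct transcript is a candidate of both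
  parties from then on. Thus the epochs before the first such one have used up more corruptions than
  their share, and in the later ones a received symbol that does not speak for the correct
  transcript is corrupted or one of the rare coincidences of the code. A party accepts a candidate if,
  for some epoch at which the candidate may have become common, this accounts for fewer than half
  of the received symbols; by a counting argument this cannot hold for two candidates.

  Counting transcripts gives \<open>n \<le> s + q * N\<close> for \<open>N\<close> rounds, so a code that is constructed and encoded in time
  linear in \<open>n\<close> on the unit-cost machine suffices. It is the concatenation of the fourth tensor
  power of a Reed--Solomon code with a greedily computed inner code, whose size is
  about the fourth root of that of the message.\<close>

section \<open>Reasoning about programs\<close>

text \<open>The machine can neither multiply nor divide, but a variable may hold an arbitrarily
  large number and an addition always costs one step. Encoding exploits this: a whole row of
  residues is packed into one number, so that a linear combination of rows takes a number of
  additions that does not depend on their length. Everything else has to cost O(g k^4) for k =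
  \<open>p ^ g\<close>, which is the order of n. This is the reason for the fourth tensor power: for
  an outer code of length M per axis, with M of order k, the modulus P is only known to be at most 2
  M^2, the greedy inner code treats all pairs of outer symbols in each of its O(g) columns, and P^2
  = O(k^4). A modulus that is merely free of small divisors replaces a prime: the evaluation points
  then differ by units, which is all that the Reed-Solomon code asks for, and it can be found with a
  sieve. The second constraint is the order of the constants: the growth of the alphabet may depend
  on \<epsilon> and s only, whereas the number of runs in an epoch may depend on p and q too, as an
  epoch must be long enough for a whole codeword.\<close>

definition wp ::
  "(nat list \<Rightarrow> nat) \<times> (nat \<Rightarrow> nat) \<Rightarrow> com \<Rightarrow> (nat \<Rightarrow> state \<Rightarrow> bool) \<Rightarrow> state \<Rightarrow> bool" where
  "wp e c Q st \<longleftrightarrow> (\<exists>t st'. big_step (fst e) (snd e) c st t st' \<and> Q t st')"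

lemma wp_Skip: "wp e Skip Q st = Q 1 st"
  unfolding wp_def by (metis big_step.Skip big_step_SkipE)

lemma wp_SetC: "wp e (SetC x v) Q st = Q 1 (set_var x v st)"
  unfolding wp_def by (metis big_step.SetC big_step_SetCE)

lemma wp_Add: "wp e (Add x y z) Q st = Q 1 (set_var x (vars st y + vars st z) st)"
  unfolding wp_def by (metis big_step.Add big_step_AddE)

lemma wp_Sub: "wp e (Sub x y z) Q st = Q 1 (set_var x (vars st y - vars st z) st)"
  unfolding wp_def by (metis big_step.Sub big_step_SubE)

lemma wp_Load: "wp e (Load x a i) Q st = Q 1 (set_var x (arrs st a (vars st i)) st)"
  unfolding wp_def by (metis big_step.Load big_step_LoadE)

lemma wp_Store: "wp e (Store a i x) Q st = Q 1 (set_arr a (vars st i) (vars st x) st)"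
  unfolding wp_def by (metis big_step.Store big_step_StoreE)

lemma wp_Send: "wp e (Send x) Q st = Q 1 (log_event (Snd (vars st x)) st)"
  unfolding wp_def by (metis big_step.Send big_step_SendE)

lemma wp_Recv: "wp e (Recv x) Q st =
    Q 1 (log_event (Rcv (snd e (length (trace st)))) (set_var x (snd e (length (trace st))) st))"
  unfolding wp_def by (metis big_step.Recv big_step_RecvE)

lemma wp_Query: "wp e (Query x a i l) Q st =
    Q 1 (set_var x (fst e (segment (arrs st a) (vars st i) (vars st l))) st)"
  unfolding wp_def by (metis big_step.Query big_step_QueryE)

lemma wp_Seq: "wp e (Seq c d) Q st = wp e c (\<lambda>t s. wp e d (\<lambda>u. Q (t + u)) s) st"
  unfolding wp_def by (blast intro: big_step.Seq elim: big_step_SeqE)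

lemma wp_If: "wp e (IfNZ x c d) Q st =
    (if vars st x \<noteq> 0 then wp e c (\<lambda>t. Q (Suc t)) st else wp e d (\<lambda>t. Q (Suc t)) st)"
  unfolding wp_def by (auto intro: big_step.IfTrue big_step.IfFalse elim!: big_step_IfE)

lemmas wp_simps = wp_Skip wp_SetC wp_Add wp_Sub wp_Load wp_Store wp_Send wp_Recv wp_Query
  wp_Seq wp_If

lemma wp_mono: "wp e c P st \<Longrightarrow> (\<And>t s. P t s \<Longrightarrow> Q t s) \<Longrightarrow> wp e c Q st"
  unfolding wp_def by blast

lemma state_simps [simp]:
  "vars (set_var x v st) y = (if y = x then v else vars st y)"
  "arrs (set_var x v st) = arrs st"
  "trace (set_var x v st) = trace st"
  "vars (set_arr a i v st) = vars st"
  "arrs (set_arr a i v st) b = (if b = a then (arrs st a)(i := v) else arrs st b)"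
  "trace (set_arr a i v st) = trace st"
  "vars (log_event ev st) = vars st"
  "arrs (log_event ev st) = arrs st"
  "trace (log_event ev st) = trace st @ [ev]"
  by (simp_all add: set_var_def set_arr_def log_event_def)

section \<open>Syntactic frame conditions\<close>

primrec wv :: "com \<Rightarrow> nat set" where
  "wv Skip = {}"
| "wv (SetC x v) = {x}"
| "wv (Add x y z) = {x}"
| "wv (Sub x y z) = {x}"
| "wv (Load x a i) = {x}"
| "wv (Store a i x) = {}"
| "wv (Send x) = {}"
| "wv (Recv x) = {x}"
| "wv (Query x a i l) = {x}"
| "wv (Seq c d) = wv c \<union> wv d"
| "wv (IfNZ x c d) = wv c \<union> wv d"
| "wv (WhileNZ x c) = wv c"

primrec wa :: "com \<Rightarrow> nat set" where
  "wa Skip = {}"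
| "wa (SetC x v) = {}"
| "wa (Add x y z) = {}"
| "wa (Sub x y z) = {}"
| "wa (Load x a i) = {}"
| "wa (Store a i x) = {a}"
| "wa (Send x) = {}"
| "wa (Recv x) = {}"
| "wa (Query x a i l) = {}"
| "wa (Seq c d) = wa c \<union> wa d"
| "wa (IfNZ x c d) = wa c \<union> wa d"
| "wa (WhileNZ x c) = wa c"

primrec silent :: "com \<Rightarrow> bool" where
  "silent Skip = True"
| "silent (SetC x v) = True"
| "silent (Add x y z) = True"
| "silent (Sub x y z) = True"
| "silent (Load x a i) = True"
| "silent (Store a i x) = True"
| "silent (Send x) = False"
| "silent (Recv x) = False"
| "silent (Query x a i l) = True"
| "silent (Seq c d) = (silent c \<and> silent d)"
| "silent (IfNZ x c d) = (silent c \<and> silent d)"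
| "silent (WhileNZ x c) = silent c"

text \<open>What a program leaves alone is read off its text. Loop invariants then speak only about
  what changes; any other fact is recovered from \<open>fr\<close> between the state before the loop
  and the current state.\<close>

definition fr :: "com \<Rightarrow> state \<Rightarrow> state \<Rightarrow> bool" where
  "fr c st st' \<longleftrightarrow> (\<forall>x. x \<notin> wv c \<longrightarrow> vars st' x = vars st x) \<and>
     (\<forall>a. a \<notin> wa c \<longrightarrow> arrs st' a = arrs st a) \<and> (silent c \<longrightarrow> trace st' = trace st)"

lemma frD:
  assumes "fr c st st'"
  shows "x \<notin> wv c \<Longrightarrow> vars st' x = vars st x" "a \<notin> wa c \<Longrightarrow> arrs st' a = arrs st a"
    "silent c \<Longrightarrow> trace st' = trace st"
  using assms by (auto simp: fr_def)

lemma fr_refl: "fr c st st" by (simp add: fr_def)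

lemma fr_trans: "fr c st st' \<Longrightarrow> fr c st' st'' \<Longrightarrow> fr c st st''"
  by (auto simp: fr_def)

lemma big_step_fr: "big_step orc inp c st t st' \<Longrightarrow> fr c st st'"
  by (induction rule: big_step.induct) (auto simp: fr_def)

lemma wp_fr: "wp e c (\<lambda>t s. fr c st s \<longrightarrow> Q t s) st \<Longrightarrow> wp e c Q st"
  unfolding wp_def using big_step_fr by blast

lemma wp_SeqI:
  assumes "wp e c P st"
    and "\<And>t s. P t s \<Longrightarrow> fr c st s \<Longrightarrow> wp e d (\<lambda>u. Q (t + u)) s"
  shows "wp e (Seq c d) Q st"
  unfolding wp_Seq by (rule wp_fr, rule wp_mono[OF assms(1)]) (use assms(2) in blast)

text \<open>The loops of the construction run a number of times that is known beforehand, so the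
  invariant is indexed by the iteration and no termination measure is needed. The induction is on
  the iterations that remain: each costs the body and one test, and a last test fails.\<close>

lemma wp_WhileI:
  assumes "I 0 st"
    and step: "\<And>j s. j < N \<Longrightarrow> I j s \<Longrightarrow> fr c st s \<Longrightarrow>
      vars s x \<noteq> 0 \<and> wp e c (\<lambda>t s'. t \<le> b \<and> I (Suc j) s') s"
    and fin: "\<And>s. I N s \<Longrightarrow> vars s x = 0"
    and Q: "\<And>t s. t \<le> N * (b + 1) + 1 \<Longrightarrow> I N s \<Longrightarrow> fr c st s \<Longrightarrow> Q t s"
  shows "wp e (WhileNZ x c) Q st"
proof -
  have "wp e (WhileNZ x c) (\<lambda>t s'. t \<le> k * (b + 1) + 1 \<and> I N s' \<and> fr c st s') s"
    if "k \<le> N" "I (N - k) s" "fr c st s" for k s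
    using that
  proof (induction k arbitrary: s)
    case 0
    then have "vars s x = 0" using fin by simp
    then have "big_step (fst e) (snd e) (WhileNZ x c) s 1 s" by (rule big_step.WhileFalse)
    with 0 show ?case unfolding wp_def by force
  next
    case (Suc k)
    from step[OF _ Suc.prems(2,3)] Suc.prems(1)
    obtain t s' where *: "vars s x \<noteq> 0" "big_step (fst e) (snd e) c s t s'" "t \<le> b"
        "I (Suc (N - Suc k)) s'"
      unfolding wp_def by auto
    have eq: "Suc (N - Suc k) = N - k" using Suc.prems(1) by simp
    have "fr c st s'" using Suc.prems(3) big_step_fr[OF *(2)] by (rule fr_trans)
    with Suc.IH[of s'] * eq Suc.prems(1)
    obtain u s'' where "big_step (fst e) (snd e) (WhileNZ x c) s' u s''"
      "u \<le> k * (b + 1) + 1" "I N s''" "fr c st s''"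
      unfolding wp_def by auto
    with * big_step.WhileTrue[OF *(1,2)] show ?case unfolding wp_def
      by (intro exI[of _ "Suc (t + u)"] exI[of _ s'']) auto
  qed
  from this[of N st] assms(1)
  have "wp e (WhileNZ x c) (\<lambda>t s'. t \<le> N * (b + 1) + 1 \<and> I N s' \<and> fr c st s') st"
    by (simp add: fr_refl)
  then show ?thesis by (rule wp_mono) (use Q in blast)
qed

text \<open>Variable 2 is a scratch variable for literals.\<close>

definition INC :: "nat \<Rightarrow> com" where "INC x = Seq (SetC 2 1) (Add x x 2)"
definition DEC :: "nat \<Rightarrow> com" where "DEC x = Seq (SetC 2 1) (Sub x x 2)"
definition MOV :: "nat \<Rightarrow> nat \<Rightarrow> com" where "MOV x y = Seq (SetC 2 0) (Add x y 2)"

primrec ADDN :: "nat \<Rightarrow> nat \<Rightarrow> nat \<Rightarrow> com" where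
  "ADDN y x 0 = Skip"
| "ADDN y x (Suc k) = Seq (Add y y x) (ADDN y x k)"

definition MULC :: "nat \<Rightarrow> nat \<Rightarrow> nat \<Rightarrow> com" where
  "MULC y x k = Seq (SetC y 0) (ADDN y x k)"

definition FOR :: "nat \<Rightarrow> nat \<Rightarrow> nat \<Rightarrow> com \<Rightarrow> com" where
  "FOR i c n body =
     Seq (MOV c n) (Seq (SetC i 0) (WhileNZ c (Seq body (Seq (INC i) (DEC c)))))"

lemma wp_INC: "x \<noteq> 2 \<Longrightarrow> wp e (INC x) Q st = Q 2 (set_var x (Suc (vars st x)) (set_var 2 1 st))"
  by (simp add: INC_def wp_simps numeral_2_eq_2)

lemma wp_DEC: "x \<noteq> 2 \<Longrightarrow> wp e (DEC x) Q st = Q 2 (set_var x (vars st x - 1) (set_var 2 1 st))"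
  by (simp add: DEC_def wp_simps numeral_2_eq_2)

lemma wp_MOV: "y \<noteq> 2 \<Longrightarrow> wp e (MOV x y) Q st = Q 2 (set_var x (vars st y) (set_var 2 0 st))"
  by (simp add: MOV_def wp_simps numeral_2_eq_2)

lemma set_var_set_var [simp]: "set_var x v (set_var x w st) = set_var x v st"
  by (simp add: set_var_def)

lemma set_var_triv [simp]: "set_var x (vars st x) st = st"
  by (simp add: set_var_def)

lemma wp_ADDN: "x \<noteq> y \<Longrightarrow>
    wp e (ADDN y x k) Q st = Q (Suc k) (set_var y (vars st y + k * vars st x) st)"
  by (induction k arbitrary: st Q) (simp_all add: wp_simps algebra_simps)

lemma wp_MULC: "x \<noteq> y \<Longrightarrow> wp e (MULC y x k) Q st = Q (k + 2) (set_var y (k * vars st x) st)"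
  by (simp add: MULC_def wp_simps wp_ADDN)

lemma macro_wv [simp]:
  "wv (INC x) = {2, x}" "wv (DEC x) = {2, x}" "wv (MOV x y) = {2, x}"
  "wv (MULC y x k) = {y}"
  "wv (FOR i c n body) = insert 2 (insert i (insert c (wv body)))"
proof -
  have "wv (ADDN y x k) \<subseteq> {y}" by (induction k) auto
  then show "wv (MULC y x k) = {y}" by (auto simp: MULC_def)
qed (auto simp: INC_def DEC_def MOV_def FOR_def)

lemma macro_wa [simp]:
  "wa (INC x) = {}" "wa (DEC x) = {}" "wa (MOV x y) = {}" "wa (MULC y x k) = {}"
  "wa (FOR i c n body) = wa body"
proof -
  have "wa (ADDN y x k) = {}" by (induction k) auto
  then show "wa (MULC y x k) = {}" by (auto simp: MULC_def)
qed (auto simp: INC_def DEC_def MOV_def FOR_def)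

lemma macro_silent [simp]:
  "silent (INC x)" "silent (DEC x)" "silent (MOV x y)" "silent (MULC y x k)"
  "silent (FOR i c n body) = silent body"
proof -
  have "silent (ADDN y x k)" by (induction k) auto
  then show "silent (MULC y x k)" by (auto simp: MULC_def)
qed (auto simp: INC_def DEC_def MOV_def FOR_def)

text \<open>The premise \<open>stable\<close> says that the invariant ignores the scratch variable,
  the index and the countdown, so that the bookkeeping of the loop cannot destroy it. This
  bookkeeping costs 5 steps per iteration: the increment and the decrement with 2 steps each, and
  the test.\<close>

lemma wp_FOR:
  assumes loopvars': "i \<noteq> c \<and> i \<noteq> 2 \<and> c \<noteq> 2 \<and> n \<noteq> 2 \<and> i \<notin> wv body \<and> c \<notin> wv body"
    and N: "vars st n = N"
    and stable: "\<And>j s v. I j (set_var 2 v s) = I j s \<and> I j (set_var i v s) = I j s \<and>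
      I j (set_var c v s) = I j s"
    and base: "I 0 st"
    and step: "\<And>j s. j < N \<Longrightarrow> vars s i = j \<Longrightarrow> fr (FOR i c n body) st s \<Longrightarrow> I j s \<Longrightarrow>
      wp e body (\<lambda>t s'. t \<le> b \<and> I (Suc j) s') s"
    and Q: "\<And>t s. t \<le> N * (b + 5) + 4 \<Longrightarrow> fr (FOR i c n body) st s \<Longrightarrow> I N s \<Longrightarrow> Q t s"
  shows "wp e (FOR i c n body) Q st"
proof -
  note loopvars = loopvars'[THEN conjunct1] loopvars'[THEN conjunct2]
  let ?B = "Seq body (Seq (INC i) (DEC c))"
  let ?st = "set_var i 0 (set_var c N (set_var 2 0 st))"
  have frB: "fr (FOR i c n body) st s" if "fr ?B ?st s" for s
    using that by (auto simp: fr_def)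
  have "wp e (WhileNZ c ?B) (\<lambda>t s. Q (t + 3) s) ?st"
  proof (rule wp_WhileI[where I = "\<lambda>j s. I j s \<and> vars s i = j \<and> vars s c = N - j" and b = "b + 4"
        and N = N])
    show "I 0 ?st \<and> vars ?st i = 0 \<and> vars ?st c = N - 0"
      using base loopvars stable by simp
  next
    fix j s assume j: "j < N" and I: "I j s \<and> vars s i = j \<and> vars s c = N - j"
      and f: "fr ?B ?st s"
    have "wp e ?B (\<lambda>t s'. t \<le> b + 4 \<and> I (Suc j) s' \<and> vars s' i = Suc j \<and>
        vars s' c = N - Suc j) s"
    proof (rule wp_SeqI[OF step[OF j _ frB[OF f]]])
      fix t s' assume *: "t \<le> b \<and> I (Suc j) s'" and f': "fr body s s'"
      have "vars s' i = j" "vars s' c = N - j" using I frD(1)[OF f'] loopvars by auto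
      then show "wp e (Seq (INC i) (DEC c)) (\<lambda>u s'. t + u \<le> b + 4 \<and> I (Suc j) s' \<and>
          vars s' i = Suc j \<and> vars s' c = N - Suc j) s'"
        using * loopvars j by (simp add: wp_Seq wp_INC wp_DEC stable)
    qed (use I in auto)
    then show "vars s c \<noteq> 0 \<and> wp e ?B (\<lambda>t s'. t \<le> b + 4 \<and> I (Suc j) s' \<and> vars s' i = Suc j \<and>
        vars s' c = N - Suc j) s" using I j by simp
  next
    fix t s assume "t \<le> N * (b + 4 + 1) + 1" "I N s \<and> vars s i = N \<and> vars s c = N - N"
      "fr ?B ?st s"
    then show "Q (t + 3) s" using Q frB by (auto simp: algebra_simps)
  qed auto
  then show ?thesis
    using N loopvars by (simp add: FOR_def wp_Seq wp_MOV wp_SetC numeral_3_eq_3)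
qed

text \<open>Division by repeated subtraction. The test variable \<open>z\<close> holds x + 1 - w,
  which truncation makes nonzero exactly if w <= x. The cost is linear in the quotient, so every use
  has to come with a bound on the quotient.\<close>

definition DIVMOD :: "nat \<Rightarrow> nat \<Rightarrow> nat \<Rightarrow> nat \<Rightarrow> com" where
  "DIVMOD x w u z = Seq (SetC u 0) (Seq (Seq (SetC 2 1) (Seq (Add z x 2) (Sub z z w)))
     (WhileNZ z (Seq (Sub x x w) (Seq (INC u) (Seq (Add z x 2) (Sub z z w))))))"

lemma DIVMOD_frame [simp]:
  "wv (DIVMOD x w u z) = {2, x, u, z}" "wa (DIVMOD x w u z) = {}" "silent (DIVMOD x w u z)"
  by (auto simp: DIVMOD_def)

lemma wp_DIVMOD:
  assumes d: "distinct [2, x, w, u, z]" and w: "vars st w > 0"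
    and Q: "\<And>t s. t \<le> 6 * (vars st x div vars st w) + 5 \<Longrightarrow> fr (DIVMOD x w u z) st s \<Longrightarrow>
      vars s x = vars st x mod vars st w \<Longrightarrow> vars s u = vars st x div vars st w \<Longrightarrow> Q t s"
  shows "wp e (DIVMOD x w u z) Q st"
proof -
  let ?X = "vars st x" and ?W = "vars st w"
  let ?st = "set_var z (Suc ?X - ?W) (set_var 2 1 (set_var u 0 st))"
  let ?B = "Seq (Sub x x w) (Seq (INC u) (Seq (Add z x 2) (Sub z z w)))"
  let ?I = "\<lambda>j (s::state). vars s w = ?W \<and> vars s 2 = 1 \<and> vars s x = ?X - j * ?W \<and> vars s u = j \<and>
      vars s z = Suc (?X - j * ?W) - ?W"
  have "wp e (WhileNZ z ?B) (\<lambda>t s. Q (t + 4) s) ?st"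
  proof (rule wp_WhileI[where I = ?I and b = 5 and N = "?X div ?W"])
    show "?I 0 ?st" using d by auto
  next
    fix j s assume j: "j < ?X div ?W" and I: "?I j s"
    have "Suc j * ?W \<le> ?X div ?W * ?W" using j by (intro mult_right_mono) auto
    also have "\<dots> \<le> ?X" by (simp add: div_times_less_eq_dividend)
    finally have le: "?W + j * ?W \<le> ?X" by simp
    then show "vars s z \<noteq> 0 \<and> wp e ?B (\<lambda>t s'. t \<le> 5 \<and> ?I (Suc j) s') s"
      using I d by (auto simp: wp_simps wp_INC add_ac)
  next
    fix s assume "?I (?X div ?W) s"
    moreover have "?X - ?X div ?W * ?W = ?X mod ?W" by (simp add: minus_div_mult_eq_mod)
    ultimately show "vars s z = 0" using mod_less_divisor[OF w, of ?X] by auto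
  next
    fix t s assume t: "t \<le> ?X div ?W * (5 + 1) + 1" and I: "?I (?X div ?W) s" and "fr ?B ?st s"
    then have "fr (DIVMOD x w u z) st s" by (auto simp: fr_def)
    with t I show "Q (t + 4) s"
      by (intro Q) (auto simp: minus_div_mult_eq_mod)
  qed
  then show ?thesis using d by (auto simp: DIVMOD_def wp_simps eval_nat_numeral)
qed

section \<open>A prime of polynomial size\<close>

text \<open>This is the recursion of Leibniz' harmonic triangle, whose entries are the reciprocals of
  \<open>Suc n * (n choose k)\<close>.\<close>

lemma leibniz_triangle_dvd:
  fixes Z :: nat
  assumes "\<And>j. 1 \<le> j \<Longrightarrow> j \<le> Suc n \<Longrightarrow> j dvd Z" "k \<le> n"
  shows "Suc n * (n choose k) dvd Z"
  using assms
proof (induction k arbitrary: n)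
  case 0
  then show ?case by simp
next
  case (Suc k)
  then obtain n' where n: "n = Suc n'" by (cases n) auto
  let ?c = "Suc n * (n choose Suc k)"
  from Suc.IH[of n'] Suc.prems n obtain x where x: "Z = (n * (n' choose k)) * x"
    by (auto simp: dvd_def)
  from Suc.IH[of n] Suc.prems obtain y where y: "Z = (Suc n * (n choose k)) * y"
    by (auto simp: dvd_def)
  have a: "n * (n' choose k) = Suc k * (n choose Suc k)"
    using Suc_times_binomial_eq[of n' k] n by (simp add: mult.commute)
  have b: "Suc k * (n choose Suc k) = (n - k) * (n choose k)"
    using binomial_absorb_comp[of n k] binomial_absorption[of k n] by simp
  have "Suc k * ?c * x = Suc n * Z" using x a by (simp add: algebra_simps)
  moreover have "Suc k * ?c * y = (n - k) * Z" using y b by (metis mult.assoc mult.left_commute)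
  \<comment> \<open>The integers avoid truncated subtraction. The right-hand side has the factor n +
    1 - (n - k) = k + 1, which cancels.\<close>
  ultimately have "int (Suc k) * (int ?c * (int x - int y)) = int (Suc n) * Z - int (n - k) * Z"
    by (simp only: right_diff_distrib mult.assoc[symmetric] of_nat_mult[symmetric])
  also have "\<dots> = int (Suc k) * int Z" using Suc.prems(2)
    by (simp add: of_nat_diff algebra_simps)
  finally have "int ?c * (int x - int y) = int Z" by (simp only: mult_cancel_left) simp
  then have "int ?c dvd int Z" by (metis dvd_triv_left)
  then show ?case by (simp only: int_dvd_int_iff)
qed

text \<open>An argument in the style of Chebyshev. If all primes up to Y = 2 m^2 are at most m, then
  every j <= Y divides a product Z of at most m prime powers, each at most Y, so Z <= Y^m. But some
  number of size at least 2^(Y - 1) in the triangle also divides Z, and it is too large.\<close>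

lemma exists_prime_below_square:
  assumes "2 \<le> (m::nat)"
  shows "\<exists>P. prime P \<and> m < P \<and> P \<le> 2 * m ^ 2"
proof (rule ccontr)
  assume none: "\<not> ?thesis"
  define Y where "Y = 2 * m ^ 2"
  have Y: "1 \<le> Y" using assms by (simp add: Y_def)
  have "\<exists>e. r ^ e \<le> Y \<and> Y < r ^ (e + 1)" if "2 \<le> r" for r
    using ex_power_ivl1[OF that Y] .
  then obtain e where e: "\<And>r. 2 \<le> r \<Longrightarrow> r ^ e r \<le> Y" "\<And>r. 2 \<le> r \<Longrightarrow> Y < r ^ (e r + 1)" by metis
  define S where "S = {r. prime r \<and> r \<le> m}"
  have fS: "finite S" by (simp add: S_def)
  define Z where "Z = (\<Prod>r\<in>S. r ^ e r)"
  have S2: "2 \<le> r" if "r \<in> S" for r using that by (simp add: S_def prime_ge_2_nat)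
  have "S \<subseteq> {1..m}" by (auto simp: S_def Suc_le_eq prime_gt_0_nat)
  then have "card S \<le> m" using card_mono[of "{1..m}" S] by simp
  have "Z \<le> (\<Prod>r\<in>S. Y)" unfolding Z_def by (intro prod_mono) (simp add: e S2)
  also have "\<dots> \<le> Y ^ m" using \<open>card S \<le> m\<close> Y by (simp add: power_increasing)
  finally have ZY: "Z \<le> Y ^ m" .
  have Zpos: "0 < Z" unfolding Z_def by (intro prod_pos) (use S2 in fastforce)
  have dvd: "j dvd Z" if "1 \<le> j" "j \<le> Y" for j
  proof -
    have "j = (\<Prod>r\<in>prime_factors j. r ^ multiplicity r j)"
      using that by (intro prime_factorization_nat) simp
    also have "\<dots> dvd (\<Prod>r\<in>S. r ^ e r)"
    proof (rule prod_dvd_prod_subset2[OF fS])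
      show sub: "prime_factors j \<subseteq> S"
      proof
        fix r assume r: "r \<in> prime_factors j"
        then have "prime r" "r dvd j" by auto
        then have "r \<le> Y" using that dvd_imp_le[of r j] by simp
        then have "r \<le> m" using none \<open>prime r\<close> not_less unfolding Y_def by blast
        then show "r \<in> S" using \<open>prime r\<close> by (simp add: S_def)
      qed
      fix r assume r: "r \<in> prime_factors j"
      have "r ^ multiplicity r j \<le> Y"
        using multiplicity_dvd[of r j] that dvd_imp_le[of "r ^ multiplicity r j" j] by simp
      then have "r ^ multiplicity r j < r ^ (e r + 1)" using e(2)[of r] S2 sub r
        by (meson le_less_trans subsetD)
      then have "multiplicity r j \<le> e r" using S2 sub r
        by (metis Suc_eq_plus1 less_Suc_eq_le power_less_imp_less_exp subsetD Suc_1 Suc_le_lessD)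
      then show "r ^ multiplicity r j dvd r ^ e r" by (rule le_imp_power_dvd)
    qed
    finally show ?thesis unfolding Z_def .
  qed
  define n where "n = Y - 1"
  have nY: "Suc n = Y" using Y by (simp add: n_def)
  \<comment> \<open>The average over row n: its Suc n binomials sum to 2^n.\<close>
  have "\<exists>k\<le>n. 2 ^ n \<le> Suc n * (n choose k)"
  proof (rule ccontr)
    assume "\<not> ?thesis"
    then have "(\<Sum>k\<le>n. Suc n * (n choose k)) < (\<Sum>k\<le>n. 2 ^ n)"
      by (intro sum_strict_mono) auto
    then show False by (simp add: sum_distrib_left[symmetric] choose_row_sum del: mult_Suc)
  qed
  then obtain k where "k \<le> n" "2 ^ n \<le> Suc n * (n choose k)" by blast
  moreover have "Suc n * (n choose k) dvd Z"
    by (rule leibniz_triangle_dvd[OF dvd \<open>k \<le> n\<close>]) (simp_all add: nY)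
  ultimately have "2 ^ n \<le> Z" using dvd_imp_le[OF _ Zpos] by (meson le_trans)
  with ZY have "2 ^ n \<le> Y ^ m" by simp
  moreover have "Y ^ m < 2 ^ n"
  proof -
    \<comment> \<open>This crude bound suffices: it gives Y <= 2^(2m - 1), and (2m - 1) m is below Y
      - 1 because m >= 2.\<close>
    have "m \<le> 2 ^ (m - 1)" by (cases m) (auto simp: Suc_le_eq less_exp)
    then have "m ^ 2 \<le> (2 ^ (m - 1)) ^ 2" by (rule power_mono) simp
    then have "Y \<le> 2 * 2 ^ ((m - 1) * 2)" by (simp add: Y_def power_mult)
    also have "\<dots> = 2 ^ (2 * m - 1)"
    proof -
      have "Suc ((m - 1) * 2) = 2 * m - 1" using assms by simp
      then show ?thesis by (metis power_Suc)
    qed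
    finally have "Y ^ m \<le> (2 ^ (2 * m - 1)) ^ m" by (rule power_mono) simp
    also have "\<dots> = 2 ^ ((2 * m - 1) * m)" by (simp add: power_mult)
    also have "\<dots> < 2 ^ n"
    proof (rule power_strict_increasing)
      have "(2 * m - 1) * m = 2 * m ^ 2 - m" by (simp add: power2_eq_square diff_mult_distrib)
      also have "\<dots> < 2 * m ^ 2 - 1" using assms
        using mult_le_mono[of 2 m 2 m] by (intro diff_less_mono2) (auto simp: power2_eq_square)
      finally show "(2 * m - 1) * m < n" by (simp add: n_def Y_def)
    qed simp
    finally show ?thesis .
  qed
  ultimately show False by simp
qed

section \<open>Reed--Solomon codes and their tensor powers\<close>

text \<open>The usual bound on the number of roots, modulo a number P that need not be prime. It is
  enough that the points differ by units: a root is split off by synthetic division, and at the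
  other points the factor x - x0 can be cancelled modulo P.\<close>

lemma coeff_dvd_of_many_roots:
  fixes f :: "int poly"
  assumes "finite X" "degree f < card X"
    and "\<And>x. x \<in> X \<Longrightarrow> P dvd poly f x"
    and "\<And>x y. x \<in> X \<Longrightarrow> y \<in> X \<Longrightarrow> x \<noteq> y \<Longrightarrow> coprime (x - y) P"
  shows "P dvd coeff f i"
  using assms
proof (induction "card X" arbitrary: X f i)
  case 0
  then show ?case by simp
next
  case (Suc k)
  then obtain x0 where x0: "x0 \<in> X" by (metis card.empty ex_in_conv nat.distinct(1))
  define g where "g = synthetic_div f x0"
  have f: "f = [:-x0, 1:] * g + [:poly f x0:]"
    unfolding g_def by (rule synthetic_div_correct'[symmetric])
  have g: "P dvd coeff g j" for j
  proof (cases "degree f = 0")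
    case True
    then show ?thesis by (simp add: g_def synthetic_div_eq_0_iff[THEN iffD2])
  next
    case False
    have card: "card (X - {x0}) = k" using Suc x0 by simp
    show ?thesis
    proof (rule Suc.hyps(1)[of "X - {x0}"])
      show "degree g < card (X - {x0})" using False Suc card by (simp add: g_def degree_synthetic_div)
      fix x assume x: "x \<in> X - {x0}"
      have "poly f x = (x - x0) * poly g x + poly f x0"
        by (subst f) (simp add: algebra_simps)
      then have "P dvd (x - x0) * poly g x"
        using Suc.prems(3) x x0 by (metis DiffD1 dvd_add_left_iff)
      moreover have "coprime (x - x0) P" using Suc.prems(4) x x0 by blast
      ultimately show "P dvd poly g x"
        by (simp add: coprime_commute coprime_dvd_mult_right_iff)
    qed (use Suc card in auto)
  qed
  have "coeff f i = coeff (smult (-x0) g + pCons 0 g + [:poly f x0:]) i"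
    by (subst f) (simp add: algebra_simps)
  moreover have "P dvd coeff (pCons 0 g) i" "P dvd coeff [:poly f x0:] i"
    using g Suc.prems(3)[OF x0] by (auto simp: coeff_pCons split: nat.split)
  ultimately show ?case using g[of i] by simp
qed

text \<open>With k agreements the difference polynomial, of degree below k, would have k roots
  modulo P, so all its coefficients would vanish modulo P; but they are differences of residues. The
  powers are reduced because the program works with a table of reduced powers.\<close>

lemma reed_solomon_agreements:
  fixes a b :: "nat \<Rightarrow> nat"
  assumes P: "\<And>j. 0 < j \<Longrightarrow> j < M \<Longrightarrow> coprime j P"
    and a: "\<And>i. i < k \<Longrightarrow> a i < P" and b: "\<And>i. i < k \<Longrightarrow> b i < P"
    and ne: "i0 < k" "a i0 \<noteq> b i0"
  shows "card {x. x < M \<and> (\<Sum>i<k. a i * (x ^ i mod P)) mod P = (\<Sum>i<k. b i * (x ^ i mod P)) mod P}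
    < k" (is "card ?X < k")
proof (rule ccontr)
  assume "\<not> ?thesis"
  then have card: "k \<le> card ?X" by simp
  define f :: "int poly" where "f = (\<Sum>i<k. monom (int (a i) - int (b i)) i)"
  have coeff: "coeff f i = (if i < k then int (a i) - int (b i) else 0)" for i
    by (simp add: f_def coeff_sum if_distrib cong: if_cong)
  have "degree f < k" using ne coeff by (intro degree_lessI) auto
  have "int P dvd coeff f i0"
  proof (rule coeff_dvd_of_many_roots[where X = "int ` ?X"])
    show "degree f < card (int ` ?X)" using \<open>degree f < k\<close> card
      by (simp add: card_image)
    fix z assume "z \<in> int ` ?X"
    then obtain x where z: "z = int x" and x: "x \<in> ?X" by blast
    have "(\<Sum>i<k. a i * x ^ i) mod P = (\<Sum>i<k. b i * x ^ i) mod P"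
    proof -
      have *: "(\<Sum>i<k. c i * (x ^ i mod P)) mod P = (\<Sum>i<k. c i * x ^ i) mod P" for c :: "nat \<Rightarrow> nat"
      proof -
        have "(\<Sum>i<k. c i * (x ^ i mod P)) mod P = (\<Sum>i<k. c i * (x ^ i mod P) mod P) mod P"
          by (rule mod_sum_eq[symmetric])
        also have "\<dots> = (\<Sum>i<k. c i * x ^ i mod P) mod P" by (simp only: mod_mult_right_eq)
        also have "\<dots> = (\<Sum>i<k. c i * x ^ i) mod P" by (rule mod_sum_eq)
        finally show ?thesis .
      qed
      show ?thesis using x by (simp add: *)
    qed
    then have "int (\<Sum>i<k. a i * x ^ i) mod int P = int (\<Sum>i<k. b i * x ^ i) mod int P"
      unfolding zmod_int[symmetric] by simp
    then have "int P dvd int (\<Sum>i<k. a i * x ^ i) - int (\<Sum>i<k. b i * x ^ i)"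
      by (simp add: mod_eq_dvd_iff)
    then show "int P dvd poly f z"
      by (simp add: f_def z poly_sum poly_monom sum_subtractf[symmetric] algebra_simps)
  next
    fix z y assume "z \<in> int ` ?X" "y \<in> int ` ?X" "z \<noteq> y"
    then obtain u v where uv: "z = int u" "y = int v" "u < M" "v < M" "u \<noteq> v" by auto
    show "coprime (z - y) (int P)"
    proof (cases "u < v")
      case True
      then have "coprime (v - u) P" using P uv by simp
      then have "coprime (int (v - u)) (int P)" by simp
      moreover have "z - y = - int (v - u)" using True uv by simp
      ultimately show ?thesis by simp
    next
      case False
      then have "coprime (u - v) P" using P uv by simp
      then have "coprime (int (u - v)) (int P)" by simp
      moreover have "z - y = int (u - v)" using False uv by simp
      ultimately show ?thesis by simp
    qed
  qed simp
  then have "int P dvd int (a i0) - int (b i0)" using ne coeff by simp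
  then have "int (a i0) mod int P = int (b i0) mod int P" by (simp add: mod_eq_dvd_iff)
  then show False using a[OF ne(1)] b[OF ne(1)] ne(2) by simp
qed

text \<open>One axis of the tensor code: the leading index of \<open>A\<close> (of range \<open>k\<close>, the remaining indices
  having \<open>r\<close> values altogether) is encoded and becomes the last one.\<close>

definition ax :: "nat \<Rightarrow> nat \<Rightarrow> nat \<Rightarrow> nat \<Rightarrow> (nat \<Rightarrow> nat) \<Rightarrow> nat \<Rightarrow> nat" where
  "ax P k M r A x = (\<Sum>i<k. A (i * r + x div M) * ((x mod M) ^ i mod P)) mod P"

text \<open>Here \<open>m\<close> counts the values of the coordinates that are encoded already, so
  the array has \<open>k ^ s * m\<close> entries when \<open>s\<close> axes remain. As every axis
  moves to the end when it is encoded, the next one is always the leading one.\<close>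

primrec ten :: "nat \<Rightarrow> nat \<Rightarrow> nat \<Rightarrow> nat \<Rightarrow> nat \<Rightarrow> (nat \<Rightarrow> nat) \<Rightarrow> nat \<Rightarrow> nat" where
  "ten P k M 0 = (\<lambda>m A. A)"
| "ten P k M (Suc s) = (\<lambda>m A. ten P k M s (m * M) (ax P k M (k ^ s * m) A))"

text \<open>The distance of a tensor code is the product of the distances, shown axis by axis.
  \<open>J\<close> collects positions in the encoded coordinates above which the two arrays still
  differ somewhere. For each of them, encoding one more axis yields at least M - k evaluation points
  above which a difference survives.\<close>

lemma ten_differences:
  assumes P: "\<And>j. 0 < j \<Longrightarrow> j < M \<Longrightarrow> coprime j P" "0 < P" and kM: "k \<le> M" "0 < k"
    and "\<And>i. i < k ^ s * m \<Longrightarrow> A i < P" "\<And>i. i < k ^ s * m \<Longrightarrow> B i < P"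
    and "J \<subseteq> {..<m}" "\<And>j. j \<in> J \<Longrightarrow> \<exists>i<k ^ s. A (i * m + j) \<noteq> B (i * m + j)"
  shows "card J * (M - k) ^ s \<le> card {x. x < M ^ s * m \<and> ten P k M s m A x \<noteq> ten P k M s m B x}"
  using assms(5-)
proof (induction s arbitrary: m A B J)
  case 0
  then show ?case by (auto intro!: card_mono)
next
  case (Suc s)
  have M: "0 < M" using kM by simp
  let ?A = "ax P k M (k ^ s * m) A" and ?B = "ax P k M (k ^ s * m) B"
  define X where "X j = {x. x < M \<and> (\<exists>i<k ^ s. ?A ((i * m + j) * M + x) \<noteq> ?B ((i * m + j) * M + x))}"
    for j
  have X: "M - k \<le> card (X j)" if "j \<in> J" for j
  proof -
    from Suc.prems(4)[OF that] obtain i where i: "i < k ^ Suc s" "A (i * m + j) \<noteq> B (i * m + j)"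
      by blast
    \<comment> \<open>The index of the difference is split into the coordinate \<open>u\<close> of
      the current axis and the rest \<open>w\<close>. Along this axis the two arrays are different
      Reed-Solomon messages.\<close>
    define u where "u = i div k ^ s"
    define w where "w = i mod k ^ s"
    have iu: "i = u * k ^ s + w" using div_mult_mod_eq[of i "k ^ s"] by (simp add: u_def w_def)
    have w: "w < k ^ s" using kM by (simp add: w_def)
    have u: "u < k" using i(1) by (simp add: u_def less_mult_imp_div_less mult.commute)
    have j: "j < m" using that Suc.prems(3) by auto
    have wmj: "w * m + j < k ^ s * m"
    proof -
      have "w * m + j < (w + 1) * m" using j by simp
      also have "\<dots> \<le> k ^ s * m" using w by (intro mult_right_mono) auto
      finally show ?thesis .
    qed
    have bound: "u' * (k ^ s * m) + (w * m + j) < k ^ Suc s * m" if "u' < k" for u'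
    proof -
      have "u' * (k ^ s * m) + (w * m + j) < (u' + 1) * (k ^ s * m)" using wmj by simp
      also have "\<dots> \<le> k * (k ^ s * m)" using that by (intro mult_right_mono) auto
      finally show ?thesis by simp
    qed
    let ?a = "\<lambda>u. A (u * (k ^ s * m) + (w * m + j))" and ?b = "\<lambda>u. B (u * (k ^ s * m) + (w * m + j))"
    have "card {x. x < M \<and> (\<Sum>i<k. ?a i * (x ^ i mod P)) mod P = (\<Sum>i<k. ?b i * (x ^ i mod P)) mod P} < k"
    proof (rule reed_solomon_agreements[where a = ?a and b = ?b and ?i0.0 = u])
      show "?a u \<noteq> ?b u" using i(2) by (simp add: iu algebra_simps)
      show "?a i < P" "?b i < P" if "i < k" for i
        using Suc.prems(1,2) bound[OF that] by blast+
    qed (fact P(1) u)+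
    moreover have "{..<M} - X j \<subseteq>
      {x. x < M \<and> (\<Sum>i<k. ?a i * (x ^ i mod P)) mod P = (\<Sum>i<k. ?b i * (x ^ i mod P)) mod P}"
    proof
      fix x assume "x \<in> {..<M} - X j"
      then have x: "x < M" and "?A ((w * m + j) * M + x) = ?B ((w * m + j) * M + x)"
        using w by (auto simp only: X_def mem_Collect_eq lessThan_iff Diff_iff)
      moreover have "((w * m + j) * M + x) div M = w * m + j" "((w * m + j) * M + x) mod M = x"
        using x by simp_all
      ultimately show "x \<in> {x. x < M \<and>
        (\<Sum>i<k. ?a i * (x ^ i mod P)) mod P = (\<Sum>i<k. ?b i * (x ^ i mod P)) mod P}"
        by (simp only: ax_def) simp
    qed
    ultimately have "card ({..<M} - X j) < k"
      using card_mono[of "{x. x < M \<and> (\<Sum>i<k. ?a i * (x ^ i mod P)) mod P =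
        (\<Sum>i<k. ?b i * (x ^ i mod P)) mod P}" "{..<M} - X j"] by simp
    moreover have "card ({..<M} - X j) = M - card (X j)"
      by (subst card_Diff_subset) (auto simp: X_def)
    ultimately show ?thesis by simp
  qed
  define J' where "J' = (\<lambda>(j, x). j * M + x) ` (SIGMA j:J. X j)"
  have fin: "finite J" using Suc.prems(3) finite_subset by blast
  have "inj_on (\<lambda>(j, x). j * M + x) (SIGMA j:J. X j)"
  proof (rule inj_onI, clarify)
    fix j x j' x' assume "x \<in> X j" "x' \<in> X j'" and eq: "j * M + x = j' * M + x'"
    then have lt: "x < M" "x' < M" by (auto simp: X_def)
    from arg_cong[OF eq, of "\<lambda>z. z div M"] arg_cong[OF eq, of "\<lambda>z. z mod M"] lt
    show "j = j' \<and> x = x'" by simp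
  qed
  moreover have "finite (X j)" for j by (simp add: X_def)
  ultimately have "card J' = (\<Sum>j\<in>J. card (X j))"
    unfolding J'_def using fin by (simp add: card_image)
  then have "card J * (M - k) \<le> card J'" using sum_bounded_below[of J "M - k" "\<lambda>j. card (X j)"] X
    by simp
  then have "card J * (M - k) ^ Suc s \<le> card J' * (M - k) ^ s" by simp
  also have "\<dots> \<le> card {x. x < M ^ s * (m * M) \<and> ten P k M s (m * M) ?A x \<noteq> ten P k M s (m * M) ?B x}"
  proof (rule Suc.IH)
    show "J' \<subseteq> {..<m * M}"
    proof
      fix z assume "z \<in> J'"
      then obtain j x where z: "z = j * M + x" "j < m" "x < M"
        using Suc.prems(3) by (auto simp: J'_def X_def)
      then have "z < (j + 1) * M" by simp
      also have "\<dots> \<le> m * M" using z by (intro mult_right_mono) auto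
      finally show "z \<in> {..<m * M}" by simp
    qed
    fix z assume "z \<in> J'"
    then obtain j x i where "z = j * M + x" "i < k ^ s"
      "?A ((i * m + j) * M + x) \<noteq> ?B ((i * m + j) * M + x)"
      by (auto simp: J'_def X_def)
    then show "\<exists>i<k ^ s. ?A (i * (m * M) + z) \<noteq> ?B (i * (m * M) + z)"
      by (intro exI[of _ i]) (auto simp: algebra_simps)
  qed (simp_all add: ax_def P)
  finally show ?case by (simp add: algebra_simps)
qed

section \<open>A greedy inner code\<close>

text \<open>The code is found column by column. A pair of words that agree in \<open>a\<close> of the previous columns
  has weight \<open>Q ^ a\<close>; in the new column, the entry of each word \<open>w\<close> is chosen such that the words
  before \<open>w\<close> with the same entry carry at most a fraction \<open>1 / Q\<close> of the weight. Hence
  the total weight at most doubles per column.\<close>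

definition conf :: "(nat \<Rightarrow> nat) \<Rightarrow> (nat \<Rightarrow> nat) \<Rightarrow> nat \<Rightarrow> nat \<Rightarrow> nat" where
  "conf col wt w \<sigma> = (\<Sum>v<w. if col v = \<sigma> then wt v else 0)"

text \<open>The largest admissible symbol is taken, since that is what an ascending loop computes
  that overwrites its result.\<close>

primrec best :: "nat \<Rightarrow> (nat \<Rightarrow> nat) \<Rightarrow> (nat \<Rightarrow> nat) \<Rightarrow> nat \<Rightarrow> nat \<Rightarrow> nat" where
  "best Q col wt w 0 = 0"
| "best Q col wt w (Suc \<sigma>) =
     (if Q * conf col wt w \<sigma> \<le> (\<Sum>v<w. wt v) then \<sigma> else best Q col wt w \<sigma>)"

primrec gcol :: "nat \<Rightarrow> (nat \<Rightarrow> nat \<Rightarrow> nat) \<Rightarrow> nat \<Rightarrow> nat \<Rightarrow> nat" where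
  "gcol Q wt 0 = (\<lambda>_. 0)"
| "gcol Q wt (Suc w) = (gcol Q wt w)(w := best Q (gcol Q wt w) (wt w) w Q)"

primrec gwt :: "nat \<Rightarrow> nat \<Rightarrow> nat \<Rightarrow> nat \<Rightarrow> nat \<Rightarrow> nat" where
  "gwt Q P 0 = (\<lambda>_ _. 1)"
| "gwt Q P (Suc j) = (\<lambda>w v. if gcol Q (gwt Q P j) P w = gcol Q (gwt Q P j) P v
     then Q * gwt Q P j w v else gwt Q P j w v)"

definition inner_code :: "nat \<Rightarrow> nat \<Rightarrow> nat \<Rightarrow> nat \<Rightarrow> nat" where
  "inner_code Q P j = gcol Q (gwt Q P j) P"

lemma best_less: "0 < Q \<Longrightarrow> \<sigma> \<le> Q \<Longrightarrow> best Q' col wt w \<sigma> < Q"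
  by (induction \<sigma>) auto

lemma gcol_less: "0 < Q \<Longrightarrow> gcol Q wt w v < Q"
  by (induction w) (auto simp: best_less)

lemma inner_code_less: "0 < Q \<Longrightarrow> inner_code Q P j w < Q"
  by (simp add: inner_code_def gcol_less)

text \<open>Pigeonhole: every weight is counted for exactly one symbol, so not all Q symbols can
  carry more than a fraction 1 / Q of the total.\<close>

lemma best_correct:
  assumes "0 < Q" "\<And>v. v < w \<Longrightarrow> col v < Q"
  shows "Q * conf col wt w (best Q col wt w Q) \<le> (\<Sum>v<w. wt v)"
proof -
  have ex: "\<exists>\<sigma><Q. Q * conf col wt w \<sigma> \<le> (\<Sum>v<w. wt v)"
  proof (rule ccontr)
    assume *: "\<not> ?thesis"
    have "(\<Sum>\<sigma><Q. conf col wt w \<sigma>) = (\<Sum>v<w. \<Sum>\<sigma><Q. if col v = \<sigma> then wt v else 0)"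
      unfolding conf_def by (rule sum.swap)
    also have "\<dots> = (\<Sum>v<w. wt v)" using assms(2) by simp
    finally have "Q * (\<Sum>v<w. wt v) = (\<Sum>\<sigma><Q. Q * conf col wt w \<sigma>)"
      by (simp add: sum_distrib_left[symmetric])
    also have "\<dots> > (\<Sum>\<sigma><Q. (\<Sum>v<w. wt v))"
      using * assms(1) by (intro sum_strict_mono) (auto simp: not_le)
    finally show False by simp
  qed
  have "\<exists>\<sigma><n. Q * conf col wt w \<sigma> \<le> (\<Sum>v<w. wt v) \<Longrightarrow>
      Q * conf col wt w (best Q col wt w n) \<le> (\<Sum>v<w. wt v)" for n
    by (induction n) (auto simp: less_Suc_eq)
  with ex show ?thesis by blast
qed

lemma gcol_stable: "v < w \<Longrightarrow> w \<le> u \<Longrightarrow> gcol Q wt u v = gcol Q wt w v"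
proof (induction u)
  case (Suc u)
  then show ?case by (cases "w = Suc u") auto
qed simp

lemma gcol_conf:
  assumes "0 < Q" "w < P"
  shows "Q * (\<Sum>v<w. if gcol Q wt P w = gcol Q wt P v then wt w v else 0) \<le> (\<Sum>v<w. wt w v)"
proof -
  have "gcol Q wt P w = gcol Q wt (Suc w) w" using gcol_stable[of w "Suc w" P Q wt] assms(2) by simp
  then have w: "gcol Q wt P w = best Q (gcol Q wt w) (wt w) w Q" by simp
  have "(\<Sum>v<w. if gcol Q wt P w = gcol Q wt P v then wt w v else 0) =
      conf (gcol Q wt w) (wt w) w (gcol Q wt P w)"
    unfolding conf_def using assms(2)
    by (intro sum.cong) (auto simp: gcol_stable[of _ w P])
  then show ?thesis using best_correct[of Q w "gcol Q wt w" "wt w"] assms(1) w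
    by (simp add: gcol_less)
qed

lemma gwt_agreements: "gwt Q P l w v = Q ^ card {j. j < l \<and> inner_code Q P j w = inner_code Q P j v}"
proof (induction l)
  case (Suc l)
  have "{j. j < Suc l \<and> inner_code Q P j w = inner_code Q P j v} =
    (if inner_code Q P l w = inner_code Q P l v then {l} else {}) \<union>
    {j. j < l \<and> inner_code Q P j w = inner_code Q P j v}" by (auto simp: less_Suc_eq)
  then show ?case using Suc by (simp add: inner_code_def card_insert_if)
qed simp

lemma gwt_total:
  assumes "0 < Q"
  shows "(\<Sum>w<P. \<Sum>v<w. gwt Q P l w v) \<le> 2 ^ l * (P * P)"
proof (induction l)
  case 0
  have "(\<Sum>w<P. \<Sum>v<w. 1::nat) \<le> (\<Sum>w<P. P)" by (intro sum_mono) simp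
  then show ?case by simp
next
  case (Suc l)
  have "(\<Sum>w<P. \<Sum>v<w. gwt Q P (Suc l) w v) \<le> (\<Sum>w<P. \<Sum>v<w. gwt Q P l w v) + (\<Sum>w<P. Q * (\<Sum>v<w.
      if gcol Q (gwt Q P l) P w = gcol Q (gwt Q P l) P v then gwt Q P l w v else 0))"
    by (simp add: sum.distrib[symmetric] sum_distrib_left) (intro sum_mono, auto)
  also have "\<dots> \<le> (\<Sum>w<P. \<Sum>v<w. gwt Q P l w v) + (\<Sum>w<P. \<Sum>v<w. gwt Q P l w v)"
    by (intro add_left_mono sum_mono gcol_conf) (use assms in auto)
  finally show ?case using Suc by simp
qed

text \<open>The base 8 is 2 * 4: the total weight at most doubles in each of the l columns, and
  there are at most P^2 <= 4^l pairs at the beginning, so it ends at no more than 8^l. A single pair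
  with a agreements has the weight (8^d)^a.\<close>

lemma inner_code_agreements:
  assumes "P \<le> 2 ^ l" "w < P" "v < P" "w \<noteq> v"
  shows "d * card {j. j < l \<and> inner_code (8 ^ d) P j w = inner_code (8 ^ d) P j v} \<le> l"
proof -
  have *: "d * card {j. j < l \<and> inner_code (8 ^ d) P j w = inner_code (8 ^ d) P j v} \<le> l"
    if "w < P" "v < w" for w v
  proof -
    have "gwt (8 ^ d) P l w v \<le> (\<Sum>v<w. gwt (8 ^ d) P l w v)"
      by (rule member_le_sum) (use that in auto)
    also have "\<dots> \<le> (\<Sum>w<P. \<Sum>v<w. gwt (8 ^ d) P l w v)"
      by (rule member_le_sum[of _ _ "\<lambda>w. \<Sum>v<w. gwt (8 ^ d) P l w v"]) (use that in auto)
    also have "\<dots> \<le> 2 ^ l * (P * P)" by (rule gwt_total) simp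
    also have "\<dots> \<le> 2 ^ l * (2 ^ l * 2 ^ l)" using assms(1) by (intro mult_le_mono) auto
    also have "\<dots> = 8 ^ l" by (simp flip: power_mult_distrib)
    finally have "(8::nat) ^ (d * card {j. j < l \<and> inner_code (8 ^ d) P j w = inner_code (8 ^ d) P j v}) \<le> 8 ^ l"
      by (simp add: gwt_agreements power_mult)
    then show ?thesis by (simp add: power_increasing_iff)
  qed
  show ?thesis
  proof (cases "v < w")
    case True
    then show ?thesis using * assms by blast
  next
    case False
    then have "w < v" using assms by simp
    from *[OF assms(3) this] show ?thesis by (simp add: eq_commute)
  qed
qed

section \<open>Positional notation\<close>

text \<open>Horner's rule with the most significant digit first, so that digit 0 is the first symbol
  of a transcript or the first entry of a packed row; \<open>sl\<close> reads the digits off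
  again.\<close>

primrec hn :: "(nat \<Rightarrow> nat) \<Rightarrow> nat \<Rightarrow> nat \<Rightarrow> nat" where
  "hn f B 0 = 0"
| "hn f B (Suc j) = hn f B j * B + f j"

definition sl :: "nat \<Rightarrow> nat \<Rightarrow> nat \<Rightarrow> nat \<Rightarrow> nat" where
  "sl B S Y j = Y div B ^ (S - Suc j) mod B"

lemma hn_cong: "(\<And>j. j < S \<Longrightarrow> f j = g j) \<Longrightarrow> hn f B S = hn g B S"
  by (induction S) auto

lemma hn_less: "(\<And>j. j < S \<Longrightarrow> f j < B) \<Longrightarrow> hn f B S < B ^ S"
proof (induction S)
  case (Suc S)
  then have "hn f B S + 1 \<le> B ^ S" by (simp add: Suc_leI)
  then have "(hn f B S + 1) * B \<le> B ^ S * B" by (rule mult_right_mono) simp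
  moreover have "f S < B" using Suc by simp
  ultimately show ?case by (simp add: algebra_simps)
qed simp

lemma hn_div: "(\<And>i. i < j + r \<Longrightarrow> f i < B) \<Longrightarrow> hn f B (j + r) div B ^ r = hn f B j"
proof (induction r)
  case (Suc r)
  have "f (j + r) < B" using Suc.prems by simp
  then have "hn f B (j + Suc r) div B = hn f B (j + r)" by simp
  then have "hn f B (j + Suc r) div (B * B ^ r) = hn f B (j + r) div B ^ r"
    by (simp add: div_mult2_eq del: hn.simps add_Suc_right)
  then show ?case using Suc by simp
qed simp

lemma sl_hn:
  assumes "\<And>i. i < S \<Longrightarrow> f i < B" "j < S"
  shows "sl B S (hn f B S) j = f j"
proof -
  have "hn f B (Suc j + (S - Suc j)) div B ^ (S - Suc j) = hn f B (Suc j)"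
    by (rule hn_div) (use assms in auto)
  then have "sl B S (hn f B S) j = (hn f B j * B + f j) mod B" using assms(2) by (simp add: sl_def)
  then show ?thesis using assms by simp
qed

lemma hn_sl: "X < B ^ S \<Longrightarrow> 0 < B \<Longrightarrow> hn (sl B S X) B S = X"
proof -
  have "hn (sl B S X) B j = X div B ^ (S - j)" if "X < B ^ S" "0 < B" "j \<le> S" for j
    using that(3)
  proof (induction j)
    case (Suc j)
    then have "B ^ (S - j) = B ^ (S - Suc j) * B" by (metis Suc_diff_Suc Suc_le_lessD power_Suc2)
    then show ?case using Suc by (simp add: sl_def div_mult2_eq)
  qed (use that in simp)
  then show "X < B ^ S \<Longrightarrow> 0 < B \<Longrightarrow> hn (sl B S X) B S = X" by simp
qed

lemma sl_inj:
  assumes "X < B ^ S" "Y < B ^ S" "0 < B" "X \<noteq> Y"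
  shows "\<exists>j<S. sl B S X j \<noteq> sl B S Y j"
proof (rule ccontr)
  assume "\<not> ?thesis"
  then have "hn (sl B S X) B S = hn (sl B S Y) B S" by (intro hn_cong) auto
  then show False using assms by (simp add: hn_sl)
qed

text \<open>This is why linear combinations may be formed on packed numbers. Bounds on the digits
  enter only when the result is read off.\<close>

lemma hn_linear: "(\<Sum>i<k. c i * hn (f i) B S) = hn (\<lambda>j. \<Sum>i<k. c i * f i j) B S"
proof (induction S)
  case (Suc S)
  then show ?case
    by (simp add: sum.distrib sum_distrib_left algebra_simps flip: Suc)
qed simp

section \<open>The code\<close>

text \<open>The first number above M that survives a sieve with the divisors up to M. All positive
  numbers below M are units modulo it, as the Reed-Solomon code requires; primes serve only to bound
  its size.\<close>

definition code_modulus :: "nat \<Rightarrow> nat" where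
  "code_modulus M = (LEAST P. M < P \<and> (\<forall>j. 2 \<le> j \<longrightarrow> j \<le> M \<longrightarrow> \<not> j dvd P))"

lemma code_modulus:
  assumes "2 \<le> M"
  shows "M < code_modulus M" "code_modulus M \<le> 2 * M ^ 2"
    "\<And>j. 2 \<le> j \<Longrightarrow> j \<le> M \<Longrightarrow> \<not> j dvd code_modulus M"
    "\<And>j. 0 < j \<Longrightarrow> j < M \<Longrightarrow> coprime j (code_modulus M)"
proof -
  let ?C = "\<lambda>P. M < P \<and> (\<forall>j. 2 \<le> j \<longrightarrow> j \<le> M \<longrightarrow> \<not> j dvd P)"
  obtain P where P: "prime P" "M < P" "P \<le> 2 * M ^ 2" using exists_prime_below_square[OF assms] by blast
  have "\<not> j dvd P" if "2 \<le> j" "j \<le> M" for j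
  proof
    assume "j dvd P"
    then have "j = 1 \<or> j = P" using P(1) prime_nat_iff by blast
    then show False using that P(2) by auto
  qed
  with P have C: "?C P" by blast
  then have *: "?C (code_modulus M)" unfolding code_modulus_def by (rule LeastI)
  then show "M < code_modulus M" "\<And>j. 2 \<le> j \<Longrightarrow> j \<le> M \<Longrightarrow> \<not> j dvd code_modulus M" by auto
  have "code_modulus M \<le> P" unfolding code_modulus_def using C by (rule Least_le)
  then show "code_modulus M \<le> 2 * M ^ 2" using P by simp
  fix j assume j: "0 < j" "j < M"
  show "coprime j (code_modulus M)"
  proof (rule ccontr)
    assume "\<not> ?thesis"
    then have "gcd j (code_modulus M) \<noteq> 1" by (simp add: coprime_iff_gcd_eq_1)
    moreover have "gcd j (code_modulus M) \<noteq> 0" using j by simp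
    ultimately have "2 \<le> gcd j (code_modulus M)" by linarith
    moreover have "gcd j (code_modulus M) \<le> M"
      using j dvd_imp_le[OF gcd_dvd1[of j "code_modulus M"]] by linarith
    ultimately show False using * gcd_dvd2 by blast
  qed
qed

text \<open>The parameter \<open>g\<close> measures the size of the messages (numbers below
  \<open>p ^ (g * (p ^ g) ^ 4)\<close>) and \<open>d\<close> the quality of the code.\<close>

definition "axis_in p g = (p::nat) ^ g"
definition "axis_out p d g = 4 * d * axis_in p g"
definition "symmod p d g = code_modulus (axis_out p d g)"
definition "inner_len p d g = 2 * p * g + 8 * d + 1"
definition "code_len p d g = axis_out p d g ^ 4 * inner_len p d g"
definition "outer_code p d g X =
  ten (symmod p d g) (axis_in p g) (axis_out p d g) 4 1 (sl (axis_in p g) (axis_in p g ^ 4) X)"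
definition "code p d g X i =
  inner_code (8 ^ d) (symmod p d g) (i mod inner_len p d g) (outer_code p d g X (i div inner_len p d g))"

lemma code_less: "code p d g X i < 8 ^ d"
  by (simp add: code_def inner_code_less)

context
  fixes p d g :: nat
  assumes pdg: "2 \<le> p" "0 < d" "0 < g"
begin

lemma axis_in_ge: "2 \<le> axis_in p g"
  using pdg power_increasing[of 1 g p] by (simp add: axis_in_def)

lemma axis_out_ge: "2 \<le> axis_out p d g" "axis_in p g \<le> axis_out p d g"
  using axis_in_ge pdg by (auto simp: axis_out_def intro: order_trans)

lemma symmod:
  "axis_out p d g < symmod p d g" "symmod p d g \<le> 2 * axis_out p d g ^ 2"
  "\<And>j. 2 \<le> j \<Longrightarrow> j \<le> axis_out p d g \<Longrightarrow> \<not> j dvd symmod p d g"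
  "\<And>j. 0 < j \<Longrightarrow> j < axis_out p d g \<Longrightarrow> coprime j (symmod p d g)"
  unfolding symmod_def using code_modulus[OF axis_out_ge(1)] by blast+

lemma axis_in_less_symmod: "axis_in p g < symmod p d g"
  using axis_out_ge symmod(1) by simp

text \<open>The greedy code needs this length, and the summands of \<open>inner_len\<close> are made
  for it: p^(2g) <= 2^(2pg), (4d)^2 <= 2^(8d), and one more factor 2 from P <= 2 M^2.\<close>

lemma symmod_le_power: "symmod p d g \<le> 2 ^ inner_len p d g"
proof -
  have "p \<le> 2 ^ p" using less_exp[of p] by simp
  then have "p ^ g \<le> (2 ^ p) ^ g" by (rule power_mono) simp
  then have "(p ^ g) ^ 2 \<le> ((2 ^ p) ^ g) ^ 2" by (rule power_mono) simp
  then have a: "axis_in p g ^ 2 \<le> 2 ^ (2 * p * g)"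
    by (simp add: axis_in_def power_mult[symmetric] algebra_simps)
  have "4 * d \<le> 2 ^ (4 * d)" using less_exp[of "4 * d"] by simp
  then have "(4 * d) ^ 2 \<le> (2 ^ (4 * d)) ^ 2" by (rule power_mono) simp
  then have b: "(4 * d) ^ 2 \<le> 2 ^ (8 * d)" by (simp add: power_mult[symmetric])
  have "symmod p d g \<le> 2 * ((4 * d) ^ 2 * axis_in p g ^ 2)"
    using symmod(2) by (simp add: axis_out_def power_mult_distrib)
  also have "\<dots> \<le> 2 * (2 ^ (8 * d) * 2 ^ (2 * p * g))" using a b by (intro mult_le_mono) auto
  also have "\<dots> = 2 ^ inner_len p d g" by (simp add: inner_len_def power_add)
  finally show ?thesis .
qed

lemma outer_code_less: "outer_code p d g X i < symmod p d g"
  using axis_in_less_symmod by (simp add: outer_code_def eval_nat_numeral ax_def)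

text \<open>Agreements have two sources, each a fraction of at most 1 / d: outer positions at which
  the tensor codewords coincide, and places at which the inner codewords of different outer symbols
  coincide.\<close>

lemma code_agreements:
  assumes "X < p ^ (g * axis_in p g ^ 4)" "Y < p ^ (g * axis_in p g ^ 4)" "X \<noteq> Y"
  shows "d * card {i. i < code_len p d g \<and> code p d g X i = code p d g Y i} \<le> 2 * code_len p d g"
proof -
  let ?k = "axis_in p g" and ?M = "axis_out p d g" and ?P = "symmod p d g" and ?L = "inner_len p d g"
  let ?F = "outer_code p d g"
  have k: "0 < ?k" using axis_in_ge by simp
  have "p ^ (g * ?k ^ 4) = ?k ^ (?k ^ 4)" by (simp add: axis_in_def power_mult)
  with assms sl_inj[of X ?k "?k ^ 4" Y] k
  obtain j where j: "j < ?k ^ 4" "sl ?k (?k ^ 4) X j \<noteq> sl ?k (?k ^ 4) Y j" by auto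
  define D where "D = {i. i < ?M ^ 4 \<and> ?F X i \<noteq> ?F Y i}"
  have "card {0::nat} * (?M - ?k) ^ 4 \<le> card {x. x < ?M ^ 4 * 1 \<and>
      ten ?P ?k ?M 4 1 (sl ?k (?k ^ 4) X) x \<noteq> ten ?P ?k ?M 4 1 (sl ?k (?k ^ 4) Y) x}"
  proof (rule ten_differences)
    have *: "sl ?k (?k ^ 4) Z i < ?P" for Z i
      using axis_in_less_symmod k by (simp add: sl_def) (meson less_trans mod_less_divisor)
    show "sl ?k (?k ^ 4) X i < ?P" "sl ?k (?k ^ 4) Y i < ?P" for i by (rule *)+
  qed (use symmod(4) axis_in_less_symmod axis_out_ge k j in auto)
  then have D: "(?M - ?k) ^ 4 \<le> card D" by (simp add: D_def outer_code_def)
  have finD: "finite D" "D \<subseteq> {..<?M ^ 4}" by (auto simp: D_def)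
  \<comment> \<open>Bernoulli's inequality: the tensor codewords agree in at most a fraction 4 k / M
    of the positions, which is 1 / d for M = 4 d k.\<close>
  have M4: "?M ^ 4 \<le> (?M - ?k) ^ 4 + 4 * ?k * ?M ^ 3"
  proof -
    obtain x where x: "?M = x + ?k" using axis_out_ge(2) by (metis add.commute le_iff_add)
    show ?thesis unfolding x by (simp add: eval_nat_numeral algebra_simps)
  qed
  have L: "0 < ?L" by (simp add: inner_len_def)
  let ?ag = "\<lambda>i. {j. j < ?L \<and> inner_code (8 ^ d) ?P j (?F X i) = inner_code (8 ^ d) ?P j (?F Y i)}"
  let ?E = "{i. i < code_len p d g \<and> code p d g X i = code p d g Y i}"
  have "?E \<subseteq> (\<lambda>(i, j). i * ?L + j) ` (SIGMA i:{..<?M ^ 4}. ?ag i)"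
  proof
    fix z assume z: "z \<in> ?E"
    then have "(z div ?L, z mod ?L) \<in> (SIGMA i:{..<?M ^ 4}. ?ag i)"
      using L by (auto simp: code_def code_len_def less_mult_imp_div_less)
    moreover have "z = (\<lambda>(i, j). i * ?L + j) (z div ?L, z mod ?L)" by simp
    ultimately show "z \<in> (\<lambda>(i, j). i * ?L + j) ` (SIGMA i:{..<?M ^ 4}. ?ag i)" by blast
  qed
  then have "card ?E \<le> card (SIGMA i:{..<?M ^ 4}. ?ag i)"
    by (rule surj_card_le[rotated]) simp
  also have "\<dots> = (\<Sum>i<?M ^ 4. card (?ag i))" by simp
  finally have "d * card ?E \<le> (\<Sum>i<?M ^ 4. d * card (?ag i))"
    by (simp add: sum_distrib_left[symmetric])
  also have "\<dots> = (\<Sum>i\<in>D. d * card (?ag i)) + (\<Sum>i\<in>{..<?M ^ 4} - D. d * card (?ag i))"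
    using finD by (subst sum.subset_diff[of D]) auto
  also have "\<dots> \<le> (\<Sum>i\<in>D. ?L) + (\<Sum>i\<in>{..<?M ^ 4} - D. d * ?L)"
  proof (intro add_mono sum_mono)
    fix i assume "i \<in> D"
    then show "d * card (?ag i) \<le> ?L"
      by (intro inner_code_agreements symmod_le_power outer_code_less) (simp add: D_def)
  next
    fix i
    have "card (?ag i) \<le> card {..<?L}" by (intro card_mono) auto
    then show "d * card (?ag i) \<le> d * ?L" by simp
  qed
  also have "\<dots> = card D * ?L + (?M ^ 4 - card D) * (d * ?L)"
    using finD by (simp add: card_Diff_subset)
  also have "\<dots> \<le> ?M ^ 4 * ?L + (4 * ?k * ?M ^ 3) * (d * ?L)"
  proof (intro add_mono mult_right_mono)
    show "card D \<le> ?M ^ 4" using card_mono[OF _ finD(2)] by simp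
    show "?M ^ 4 - card D \<le> 4 * ?k * ?M ^ 3" using M4 D by linarith
  qed auto
  also have "(4 * ?k * ?M ^ 3) * (d * ?L) = ?M ^ 4 * ?L"
    by (simp add: axis_out_def eval_nat_numeral algebra_simps)
  finally show ?thesis by (simp add: code_len_def)
qed

end

section \<open>Computing the parameters of the code\<close>

text \<open>The number of base-p digits reserved for one residue in a packed row. It leaves room for
  a sum of k products of residues; see \<open>slot_capacity\<close>.\<close>

definition slot_len :: "nat \<Rightarrow> nat \<Rightarrow> nat" where "slot_len d g = 5 * g + 16 * d + 2"

definition prm :: "nat \<Rightarrow> nat \<Rightarrow> nat \<Rightarrow> state \<Rightarrow> bool" where
  "prm p d g st \<longleftrightarrow> vars st 4 = g \<and> vars st 5 = axis_in p g \<and> vars st 6 = axis_in p g ^ 3 \<and>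
     vars st 7 = axis_in p g ^ 4 \<and> vars st 8 = g * axis_in p g ^ 4 \<and>
     vars st 9 = axis_out p d g \<and> vars st 11 = inner_len p d g \<and> vars st 12 = code_len p d g \<and>
     vars st 13 = slot_len d g \<and> vars st 14 = axis_out p d g ^ 4 * slot_len d g"

text \<open>A message of n base-p digits is cut into k^4 blocks of g digits for k =
  \<open>p ^ g\<close>, one for every position of a four-dimensional array of side k.\<close>

definition code_size :: "nat \<Rightarrow> nat \<Rightarrow> nat" where
  "code_size p n = (LEAST g. 1 \<le> g \<and> n \<le> g * (p ^ g) ^ 4)"

text \<open>Only multiplication by literals is available, so k, k^3, k^4 and g k^4 are all carried
  along: adding k^4 and then multiplying by p^4 turns g k^4 into (g + 1) (p k)^4.\<close>

definition PARAMS :: "nat \<Rightarrow> nat \<Rightarrow> com" where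
  "PARAMS p d = Seq (SetC 4 1) (Seq (SetC 5 p) (Seq (SetC 6 (p ^ 3)) (Seq (SetC 7 (p ^ 4))
    (Seq (SetC 8 (p ^ 4)) (Seq (Sub 20 3 8)
    (Seq (WhileNZ 20 (Seq (INC 4) (Seq (MULC 21 5 p) (Seq (MOV 5 21) (Seq (MULC 21 6 (p ^ 3))
      (Seq (MOV 6 21) (Seq (Add 8 8 7) (Seq (MULC 21 8 (p ^ 4)) (Seq (MOV 8 21)
      (Seq (MULC 21 7 (p ^ 4)) (Seq (MOV 7 21) (Sub 20 3 8))))))))))))
    (Seq (MULC 9 5 (4 * d))
    (Seq (MULC 11 4 (2 * p)) (Seq (SetC 20 (8 * d + 1)) (Seq (Add 11 11 20)
    (Seq (MULC 20 8 ((4 * d) ^ 4 * (2 * p))) (Seq (MULC 21 7 ((4 * d) ^ 4 * (8 * d + 1)))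
    (Seq (Add 12 20 21)
    (Seq (MULC 13 4 5) (Seq (SetC 20 (16 * d + 2)) (Seq (Add 13 13 20)
    (Seq (MULC 20 8 ((4 * d) ^ 4 * 5)) (Seq (MULC 21 7 ((4 * d) ^ 4 * (16 * d + 2)))
    (Add 14 20 21)))))))))))))))))))"

lemma code_size:
  assumes "2 \<le> p"
  shows "1 \<le> code_size p n" "n \<le> code_size p n * (p ^ code_size p n) ^ 4"
    "\<And>g. 1 \<le> g \<Longrightarrow> g < code_size p n \<Longrightarrow> g * (p ^ g) ^ 4 < n"
proof -
  have "1 \<le> Suc n \<and> n \<le> Suc n * (p ^ Suc n) ^ 4"
    using assms by (simp add: trans_le_add2 mult_le_mono)
  then have "1 \<le> code_size p n \<and> n \<le> code_size p n * (p ^ code_size p n) ^ 4"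
    unfolding code_size_def by (rule LeastI)
  then show "1 \<le> code_size p n" "n \<le> code_size p n * (p ^ code_size p n) ^ 4" by auto
  fix g assume "1 \<le> g" "g < code_size p n"
  moreover from this(2) have "\<not> (1 \<le> g \<and> n \<le> g * (p ^ g) ^ 4)"
    unfolding code_size_def by (rule not_less_Least)
  ultimately show "g * (p ^ g) ^ 4 < n" by linarith
qed

lemma PARAMS_frame [simp]:
  "wv (PARAMS p d) = {2, 4, 5, 6, 7, 8, 9, 11, 12, 13, 14, 20, 21}" "wa (PARAMS p d) = {}"
  "silent (PARAMS p d)"
  by (auto simp: PARAMS_def)

lemma wp_PARAMS:
  assumes p: "2 \<le> p" and n: "vars st 3 = n"
  shows "wp e (PARAMS p d) (\<lambda>t s. t \<le> code_size p n * (2 * p ^ 4 + p ^ 3 + p + 22) +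
      (4 * d) ^ 4 * (2 * p + 24 * d + 8) + 4 * d + 2 * p + 60 \<and> prm p d (code_size p n) s) st"
proof -
  let ?g = "code_size p n"
  let ?I = "\<lambda>j s. vars s 3 = n \<and> vars s 4 = Suc j \<and> vars s 5 = p ^ Suc j \<and>
    vars s 6 = (p ^ Suc j) ^ 3 \<and> vars s 7 = (p ^ Suc j) ^ 4 \<and> vars s 8 = Suc j * (p ^ Suc j) ^ 4 \<and>
    vars s 20 = n - Suc j * (p ^ Suc j) ^ 4"
  \<comment> \<open>The search starts with size 1, so the loop runs one time less than the final
    size.\<close>
  obtain g' where g': "?g = Suc g'" using code_size(1)[OF p] by (metis Suc_le_D One_nat_def)
  show ?thesis
    unfolding PARAMS_def
    apply (simp add: wp_SetC wp_Seq wp_Sub)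
    apply (rule wp_WhileI[where I = ?I and N = g' and b = "2 * p ^ 4 + p ^ 3 + p + 20"])
    subgoal using n by (simp add: power3_eq_cube power4_eq_xxxx)
    subgoal for j s
    proof -
      assume j: "j < g'" and I: "?I j s"
      have "n - Suc j * (p ^ Suc j) ^ 4 \<noteq> 0" using code_size(3)[OF p, of "Suc j" n] j g' by simp
      with I show ?thesis
        by (simp add: wp_simps wp_INC wp_MOV wp_MULC power_mult_distrib)
          (simp add: algebra_simps)
    qed
    subgoal for s using code_size(2)[OF p, of n] g' by simp
    subgoal for t s
      using g' by (simp add: wp_simps wp_MULC prm_def axis_in_def axis_out_def inner_len_def
          code_len_def slot_len_def power_mult_distrib algebra_simps)
    done
qed

section \<open>Tables for the outer code: powers of p, the modulus, reduced powers of the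
  points\<close>

definition POWERS :: "nat \<Rightarrow> com" where
  "POWERS p = Seq (SetC 20 1) (FOR 22 23 14 (Seq (Store 2 22 20) (Seq (MULC 21 20 p) (MOV 20 21))))"

lemma POWERS_frame [simp]:
  "wv (POWERS p) = {2, 20, 21, 22, 23}" "wa (POWERS p) = {2}" "silent (POWERS p)"
  by (auto simp: POWERS_def)

lemma wp_POWERS:
  "wp e (POWERS p) (\<lambda>t s. t \<le> vars st 14 * (p + 10) + 5 \<and> (\<forall>i<vars st 14. arrs s 2 i = p ^ i)) st"
  unfolding POWERS_def wp_Seq wp_SetC
  apply (rule wp_FOR[where I = "\<lambda>j s. vars s 20 = p ^ j \<and> (\<forall>i<j. arrs s 2 i = p ^ i)"
      and N = "vars st 14" and b = "p + 5"])
  by (auto simp: wp_simps wp_MULC wp_MOV less_Suc_eq algebra_simps)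

text \<open>Every divisor strikes out the same number B = 2 (4d)^2 k^3 of multiples. A bound of
  order k^2 would cover the modulus, but k^3 is at hand in variable 6, and the total M B is still of
  order k^4.\<close>

definition SIEVE :: "nat \<Rightarrow> com" where
  "SIEVE d = Seq (MOV 24 9) (Seq (DEC 24) (Seq (MULC 30 6 (2 * (4 * d) ^ 2)) (Seq
    (FOR 22 23 24 (Seq (MOV 25 22) (Seq (INC 25) (Seq (INC 25) (Seq (SetC 26 0) (Seq (SetC 28 1)
      (FOR 27 29 30 (Seq (Add 26 26 25) (Store 3 26 28)))))))))
    (Seq (MOV 10 9) (Seq (INC 10) (Seq (Load 24 3 10) (WhileNZ 24 (Seq (INC 10) (Load 24 3 10)))))))))"

lemma SIEVE_frame [simp]:
  "wv (SIEVE d) = {2, 10, 22, 23, 24, 25, 26, 27, 28, 29, 30}" "wa (SIEVE d) = {3}"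
  "silent (SIEVE d)"
  by (auto simp: SIEVE_def)

lemma wp_SIEVE:
  assumes pdg: "2 \<le> p" "0 < d" "0 < g" and prm: "prm p d g st" and z: "\<And>i. arrs st 3 i = 0"
  shows "wp e (SIEVE d) (\<lambda>t s. t \<le> axis_out p d g * (2 * (4 * d) ^ 2 * axis_in p g ^ 3 * 8 + 20) +
    4 * symmod p d g + 2 * (4 * d) ^ 2 + 30 \<and> vars s 10 = symmod p d g) st"
proof -
  let ?M = "axis_out p d g"
  define B where "B = 2 * (4 * d) ^ 2 * axis_in p g ^ 3"
  define mult where "mult j i x \<longleftrightarrow> (\<exists>a. 1 \<le> a \<and> a \<le> i \<and> x = a * (j + 2))" for j i x :: nat
  define mark where "mark j x \<longleftrightarrow> (\<exists>i<j. mult i B x)" for j x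
  have mult_0: "\<not> mult j 0 x" for j x by (auto simp: mult_def)
  have mult_Suc: "mult j (Suc i) x \<longleftrightarrow> x = i * (j + 2) + (j + 2) \<or> mult j i x" for j i x
  proof -
    have "Suc i * (j + 2) = i * (j + 2) + (j + 2)" by simp
    then show ?thesis unfolding mult_def le_Suc_eq by (metis le_add1 plus_1_eq_Suc)
  qed
  have mark_0: "\<not> mark 0 x" for x by (auto simp: mark_def)
  have mark_Suc: "mark (Suc j) x \<longleftrightarrow> mark j x \<or> mult j B x" for j x
    by (auto simp: mark_def less_Suc_eq)
  note M = axis_out_ge[OF pdg] and P = symmod[OF pdg]
  have "axis_in p g ^ 2 \<le> axis_in p g ^ 3" using axis_in_ge[OF pdg] by (intro power_increasing) auto
  then have "2 * ?M ^ 2 \<le> B" by (simp add: axis_out_def power_mult_distrib B_def)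
  then have PB: "symmod p d g \<le> B" using P(2) by linarith
  have marked: "mark (?M - 1) x \<longleftrightarrow> (\<exists>j. 2 \<le> j \<and> j \<le> ?M \<and> j dvd x)" if "0 < x" "x \<le> B" for x
  proof
    assume "mark (?M - 1) x"
    then obtain i a where i: "i < ?M - 1" and x: "x = a * (i + 2)"
      by (auto simp only: mark_def mult_def)
    have "i + 2 dvd x" unfolding x by (rule dvd_triv_right)
    then show "\<exists>j. 2 \<le> j \<and> j \<le> ?M \<and> j dvd x" using i by (intro exI[of _ "i + 2"]) auto
  next
    assume "\<exists>j. 2 \<le> j \<and> j \<le> ?M \<and> j dvd x"
    then obtain j a where j: "2 \<le> j" "j \<le> ?M" and x: "x = j * a" by (auto elim: dvdE)
    have "1 \<le> a" using that x by (cases a) auto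
    moreover have "a \<le> B" using that(2) x j mult_le_mono1[of 1 j a] by linarith
    moreover have "x = a * (j - 2 + 2)" using j x by (simp add: mult.commute del: mult_Suc_right add_2_eq_Suc')
    moreover have "j - 2 < ?M - 1" using j by linarith
    ultimately have "j - 2 < ?M - 1 \<and> 1 \<le> a \<and> a \<le> B \<and> x = a * (j - 2 + 2)" by blast
    then show "mark (?M - 1) x" unfolding mark_def mult_def by blast
  qed
  have comp: "\<exists>j. 2 \<le> j \<and> j \<le> ?M \<and> j dvd x" if "?M < x" "x < symmod p d g" for x
    using not_less_Least[OF that(2)[unfolded symmod_def code_modulus_def]] that(1) by blast
  show ?thesis
    unfolding SIEVE_def B_def[symmetric]
    apply (simp add: wp_Seq wp_MOV wp_DEC wp_MULC)
    apply (rule wp_FOR[where I = "\<lambda>j s. \<forall>x. arrs s 3 x \<noteq> 0 \<longleftrightarrow> mark j x"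
          and N = "?M - 1" and b = "B * 7 + 15"])
    subgoal by simp
    subgoal using prm by (simp add: prm_def)
    subgoal by simp
    subgoal using z by (simp add: mark_0)
    subgoal premises prems for j s
    proof -
      note j = prems(2) and fr = prems(3) and I = prems(4)
      have 30: "vars s 30 = B" using frD(1)[OF fr, of 30] prm by (simp add: prm_def B_def)
      show ?thesis
        apply (simp add: wp_simps wp_MOV wp_INC)
        apply (rule wp_FOR[where N = B and b = 2 and I = "\<lambda>i s. vars s 26 = i * (j + 2) \<and> vars s 25 = j + 2 \<and>
            vars s 28 = 1 \<and> (\<forall>x. arrs s 3 x \<noteq> 0 \<longleftrightarrow> mark j x \<or> mult j i x)"])
        subgoal by simp
        subgoal using 30 by simp
        subgoal by simp
        subgoal using I j by (simp add: mult_0)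
        subgoal for i s' by (simp add: wp_simps mult_Suc)
        subgoal for t s' by (simp add: mark_Suc algebra_simps)
        done
    qed
    subgoal premises prems for t s
    proof -
      note t = prems(1) and fr = prems(2) and I = prems(3)
      have 9: "vars s 9 = ?M" using frD(1)[OF fr, of 9] prm by (simp add: prm_def)
      have A: "arrs s 3 x \<noteq> 0 \<longleftrightarrow> (\<exists>j. 2 \<le> j \<and> j \<le> ?M \<and> j dvd x)" if "0 < x" "x \<le> B" for x
        using I marked[OF that] by blast
      have t': "t \<le> ?M * (B * 8 + 20) + 4"
        using t mult_le_mono[of "?M - 1" ?M "B * 7 + 15 + 5" "B * 8 + 20"] by simp
      show ?thesis
        apply (simp add: wp_simps wp_MOV wp_INC 9)
        \<comment> \<open>The search from M + 1 upwards ends no later than B, so it meets only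
          numbers whose marks are reliable; all that it passes have a small divisor by minimality of
          the modulus.\<close>
        apply (rule wp_WhileI[where N = "symmod p d g - Suc ?M" and b = 3 and
          I = "\<lambda>j s'. vars s' 10 = Suc ?M + j \<and> vars s' 24 = arrs s 3 (Suc ?M + j) \<and> arrs s' 3 = arrs s 3"])
        subgoal by simp
        subgoal for j s'
          using A[of "Suc ?M + j"] comp[of "Suc ?M + j"] PB by (simp add: wp_simps wp_INC)
        subgoal for s' using A[of "symmod p d g"] P(1,3) PB by (simp del: dvd_imp_le) blast
        subgoal for t2 s' using t' P(1) by (simp add: algebra_simps)
        done
    qed
    done
qed

text \<open>Row x of the table holds the powers of the point x. Multiplication by x is x-fold
  addition, which costs O(k M^2) for the whole table, of order k^3.\<close>

definition SCAL :: com where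
  "SCAL = Seq (SetC 20 0) (FOR 22 23 9 (Seq (SetC 24 1) (FOR 25 26 5 (Seq (Store 4 20 24)
    (Seq (INC 20) (Seq (SetC 27 0) (Seq (FOR 28 29 22 (Add 27 27 24))
    (Seq (DIVMOD 27 10 30 31) (MOV 24 27)))))))))"

lemma SCAL_frame [simp]:
  "wv SCAL = {2, 20, 22, 23, 24, 25, 26, 27, 28, 29, 30, 31}" "wa SCAL = {4}" "silent SCAL"
  by (auto simp: SCAL_def)

lemma wp_SCAL:
  assumes k: "vars st 5 = k" and M: "vars st 9 = M" and P: "vars st 10 = P" "1 < P"
  shows "wp e SCAL (\<lambda>t s. t \<le> M * (k * (M * 12 + 24) + 10) + 5 \<and>
    (\<forall>x<M. \<forall>i<k. arrs s 4 (x * k + i) = x ^ i mod P)) st"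
  unfolding SCAL_def wp_Seq wp_SetC
  apply (rule wp_FOR[where N = M and b = "k * (M * 12 + 24) + 5" and
      I = "\<lambda>x s. vars s 20 = x * k \<and> (\<forall>x'<x. \<forall>i<k. arrs s 4 (x' * k + i) = x' ^ i mod P)"])
  subgoal by simp
  subgoal using M by simp
  subgoal by simp
  subgoal by simp
  subgoal premises prems for x s
  proof -
    note F = frD(1)[OF prems(3)]
    have k': "vars s 5 = k" and P': "vars s 10 = P" using F k P by simp_all
    note I = prems(4) and x = prems(1,2)
    show ?thesis
      apply (simp add: wp_simps)
      apply (rule wp_FOR[where N = k and b = "M * 12 + 19" and
        I = "\<lambda>i s. vars s 20 = x * k + i \<and> vars s 24 = x ^ i mod P \<and>
          (\<forall>x'<x. \<forall>i<k. arrs s 4 (x' * k + i) = x' ^ i mod P) \<and>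
          (\<forall>i'<i. arrs s 4 (x * k + i') = x ^ i' mod P)"])
      subgoal by simp
      subgoal using k' by simp
      subgoal by simp
      subgoal using I P by simp
      subgoal premises prems2 for i s2
      proof -
        note F2 = frD(1)[OF prems2(3)]
        have x2: "vars s2 22 = x" and P2: "vars s2 10 = P" using F2 x P' by simp_all
        note I2 = prems2(4)
        let ?c = "x ^ i mod P"
        have lt: "x' * k + i' \<noteq> x * k + i" if "x' < x" "i' < k" for x' i'
        proof -
          have "x' * k + i' < Suc x' * k" using that by simp
          also have "\<dots> \<le> x * k" using that by (intro mult_right_mono) auto
          finally show ?thesis by simp
        qed
        \<comment> \<open>A residue times x is at most x P, so the reduction by repeated subtraction
          also takes O(M) steps.\<close>
        have q: "x * ?c div P \<le> M"
        proof -
          have "x * ?c \<le> x * P" using P by (intro mult_left_mono) auto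
          then have "x * ?c div P \<le> x" using P div_le_mono[of "x * ?c" "x * P" P] by simp
          then show ?thesis using x by simp
        qed
        have m: "x * ?c mod P = x ^ Suc i mod P" by (simp add: mod_mult_right_eq)
        show ?thesis
          apply (simp add: wp_simps wp_INC)
          apply (rule wp_FOR[where N = x and b = 1 and I = "\<lambda>j s. vars s 27 = j * ?c \<and>
              vars s 24 = ?c \<and> vars s 20 = Suc (x * k + i) \<and> arrs s 4 = (arrs s2 4)(x * k + i := ?c)"])
          subgoal by simp
          subgoal using x2 by simp
          subgoal by simp
          subgoal using I2 by simp
          subgoal by (simp add: wp_simps)
          subgoal premises prems3 for t s3
          proof -
            have P3: "vars s3 10 = P" using frD(1)[OF prems3(2)] P2 by simp
            note I3 = prems3(3)
            have t: "t \<le> M * 6 + 4" using prems3(1) x by (simp add: mult.commute)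
            show ?thesis
              apply (rule wp_DIVMOD)
              subgoal by simp
              subgoal using P3 P by simp
              subgoal premises prems4 for t4 s4
                using prems4 I3 I2 P3 t q m lt frD(1)[OF prems4(2)] frD(2)[OF prems4(2)]
                by (auto simp: wp_MOV less_Suc_eq algebra_simps)
              done
          qed
          done
      qed
      subgoal premises prems2 for t s2
        using prems2(1,3) by (auto simp: less_Suc_eq add_ac)
      done
  qed
  subgoal by (auto simp: add_ac)
  done

section \<open>The greedy inner code, computed in place\<close>

lemma conf_cong: "(\<And>v. v < w \<Longrightarrow> f v = g v) \<Longrightarrow> (\<And>v. v < w \<Longrightarrow> a v = b v) \<Longrightarrow> conf f a w \<sigma> = conf g b w \<sigma>"
  unfolding conf_def by (intro sum.cong) auto

lemma best_cong:
  assumes "\<And>v. v < w \<Longrightarrow> f v = g v" "\<And>v. v < w \<Longrightarrow> a v = b v"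
  shows "best Q f a w n = best Q g b w n"
proof (induction n)
  case (Suc n)
  have "(\<Sum>v<w. a v) = (\<Sum>v<w. b v)" using assms(2) by (intro sum.cong) auto
  then show ?case using Suc conf_cong[of w f g a b n] assms by simp
qed simp

text \<open>The entry of a word depends only on the words before it, so filling a column in
  increasing order produces the final column.\<close>

lemma inner_code_best:
  assumes "w < P"
  shows "inner_code Q P j w = best Q (inner_code Q P j) (gwt Q P j w) w Q"
proof -
  have "inner_code Q P j w = gcol Q (gwt Q P j) (Suc w) w"
    using gcol_stable[of w "Suc w" P Q] assms by (simp add: inner_code_def)
  also have "\<dots> = best Q (gcol Q (gwt Q P j) w) (gwt Q P j w) w Q" by simp
  also have "\<dots> = best Q (inner_code Q P j) (gwt Q P j w) w Q"
    using gcol_stable[of _ w P Q "gwt Q P j"] assms by (intro best_cong) (auto simp: inner_code_def)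
  finally show ?thesis .
qed

lemma index_less: "a < A \<Longrightarrow> b < B \<Longrightarrow> a * B + b < A * (B::nat)"
proof -
  assume "a < A" "b < B"
  then have "a * B + b < Suc a * B" by simp
  also have "\<dots> \<le> A * B" using \<open>a < A\<close> by (intro mult_right_mono) auto
  finally show ?thesis .
qed

lemma index_eq_iff:
  assumes "b < B" "b' < (B::nat)"
  shows "a * B + b = a' * B + b' \<longleftrightarrow> a = a' \<and> b = b'"
proof
  assume eq: "a * B + b = a' * B + b'"
  from arg_cong[OF eq, of "\<lambda>z. z div B"] arg_cong[OF eq, of "\<lambda>z. z mod B"] assms
  show "a = a' \<and> b = b'" by simp
qed simp

text \<open>One pass distributes the weights of all earlier words over the symbols, in array 7,
  instead of one pass per symbol. \<open>GR_BEST\<close> clears the array again while it reads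
  it.\<close>

definition GR_COUNT :: com where
  "GR_COUNT = FOR 27 28 24 (Seq (Add 29 20 27) (Seq (Load 30 5 29) (Seq (Add 29 21 27)
     (Seq (Load 31 6 29) (Seq (Add 26 26 31) (Seq (Load 32 7 30) (Seq (Add 32 32 31)
     (Store 7 30 32))))))))"

definition GR_BEST :: "nat \<Rightarrow> com" where
  "GR_BEST Q = Seq (SetC 33 0) (Seq (SetC 34 Q) (FOR 27 28 34 (Seq (Load 31 7 27)
     (Seq (MULC 32 31 Q) (Seq (Sub 29 32 26) (Seq (IfNZ 29 Skip (MOV 33 27))
     (Seq (SetC 29 0) (Store 7 27 29))))))))"

text \<open>Equality is tested by adding the two truncated differences; the sum is 0 exactly if the
  values agree. The same device recurs in the programs below.\<close>

definition GR_WEIGHT :: "nat \<Rightarrow> com" where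
  "GR_WEIGHT Q = FOR 27 28 24 (Seq (Add 29 20 27) (Seq (Load 30 5 29) (Seq (Sub 31 30 33)
     (Seq (Sub 32 33 30) (Seq (Add 31 31 32) (IfNZ 31 Skip (Seq (Add 29 21 27)
     (Seq (Load 30 6 29) (Seq (MULC 31 30 Q) (Store 6 29 31))))))))))"

definition GREEDY :: "nat \<Rightarrow> nat \<Rightarrow> com" where
  "GREEDY Q c = Seq (MULC 20 7 c) (Seq (FOR 22 23 20 (Seq (SetC 21 1) (Store 6 22 21)))
     (Seq (SetC 20 0) (FOR 22 23 11 (Seq (SetC 21 0) (Seq (FOR 24 25 10 (Seq (SetC 26 0)
       (Seq GR_COUNT (Seq (GR_BEST Q) (Seq (Add 29 20 24) (Seq (Store 5 29 33)
       (Seq (GR_WEIGHT Q) (Add 21 21 10))))))))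
     (Add 20 20 10))))))"

lemma GREEDY_frames [simp]:
  "wv GR_COUNT = {2, 26, 27, 28, 29, 30, 31, 32}" "wa GR_COUNT = {7}" "silent GR_COUNT"
  "wv (GR_BEST Q) = {2, 27, 28, 29, 31, 32, 33, 34}" "wa (GR_BEST Q) = {7}" "silent (GR_BEST Q)"
  "wv (GR_WEIGHT Q) = {2, 27, 28, 29, 30, 31, 32}" "wa (GR_WEIGHT Q) = {6}" "silent (GR_WEIGHT Q)"
  "wv (GREEDY Q c) = {2, 20, 21, 22, 23, 24, 25, 26, 27, 28, 29, 30, 31, 32, 33, 34}"
  "wa (GREEDY Q c) = {5, 6, 7}" "silent (GREEDY Q c)"
  by (auto simp: GR_COUNT_def GR_BEST_def GR_WEIGHT_def GREEDY_def)

lemma wp_GR_COUNT: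
  assumes "vars st 24 = w" "vars st 26 = 0" "\<And>x. arrs st 7 x = 0"
    and "\<And>v. v < w \<Longrightarrow> arrs st 5 (vars st 20 + v) = f v"
    and "\<And>v. v < w \<Longrightarrow> arrs st 6 (vars st 21 + v) = a v"
  shows "wp e GR_COUNT (\<lambda>t s. t \<le> w * 13 + 4 \<and> vars s 26 = (\<Sum>v<w. a v) \<and>
    (\<forall>x. arrs s 7 x = conf f a w x)) st"
  unfolding GR_COUNT_def
  apply (rule wp_FOR[where N = w and b = 8 and
      I = "\<lambda>v s. vars s 26 = (\<Sum>v<v. a v) \<and> (\<forall>x. arrs s 7 x = conf f a v x)"])
  subgoal by simp
  subgoal using assms(1) by simp
  subgoal by simp
  subgoal using assms(2,3) by (simp add: conf_def)
  subgoal premises prems for v s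
  proof -
    note F = frD(1)[OF prems(3)] frD(2)[OF prems(3)]
    show ?thesis using prems assms(4,5)[of v] by (auto simp: wp_simps F conf_def)
  qed
  subgoal by simp
  done

lemma wp_GR_BEST:
  assumes "vars st 26 = (\<Sum>v<w. a v)" "\<And>x. arrs st 7 x = conf f a w x" "\<And>v. v < w \<Longrightarrow> f v < Q"
  shows "wp e (GR_BEST Q) (\<lambda>t s. t \<le> Q * (Q + 15) + 6 \<and> vars s 33 = best Q f a w Q \<and>
    (\<forall>x. arrs s 7 x = 0)) st"
proof -
  have z: "conf f a w x = 0" if "Q \<le> x" for x
    unfolding conf_def using assms(3) that by (intro sum.neutral) fastforce
  show ?thesis
    unfolding GR_BEST_def wp_Seq wp_SetC
    apply (rule wp_FOR[where N = Q and b = "Q + 10" and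
        I = "\<lambda>j s. vars s 33 = best Q f a w j \<and> (\<forall>x. arrs s 7 x = (if x < j then 0 else conf f a w x))"])
    subgoal by simp
    subgoal by simp
    subgoal by simp
    subgoal using assms(2) by simp
    subgoal premises prems for j s
    proof -
      note F = frD(1)[OF prems(3)]
      have "vars s 26 = (\<Sum>v<w. a v)" using F assms(1) by simp
      then show ?thesis using prems by (auto simp: wp_simps wp_MULC wp_MOV)
    qed
    subgoal using z by (auto simp: not_less add_ac)
    done
qed

lemma wp_GR_WEIGHT:
  assumes "vars st 24 = w" "vars st 21 = w * P" "w < P"
    and f: "\<And>v. v \<le> w \<Longrightarrow> arrs st 5 (vars st 20 + v) = f v" "vars st 33 = f w"
    and a: "\<And>u v. u < P \<Longrightarrow> v < u \<Longrightarrow> arrs st 6 (u * P + v) = (if u < w then b u v else a u v)"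
    and b: "\<And>v. v < w \<Longrightarrow> b w v = (if f w = f v then Q * a w v else a w v)"
  shows "wp e (GR_WEIGHT Q) (\<lambda>t s. t \<le> w * (Q + 20) + 4 \<and>
    (\<forall>u v. u < P \<longrightarrow> v < u \<longrightarrow> arrs s 6 (u * P + v) = (if u < Suc w then b u v else a u v))) st"
  unfolding GR_WEIGHT_def
  apply (rule wp_FOR[where N = w and b = "Q + 15" and I = "\<lambda>j s. \<forall>u v. u < P \<longrightarrow> v < u \<longrightarrow>
      arrs s 6 (u * P + v) = (if u < w \<or> u = w \<and> v < j then b u v else a u v)"])
  subgoal by simp
  subgoal using assms(1) by simp
  subgoal by simp
  subgoal using a by simp
  subgoal premises prems for j s
  proof -
    note F = frD(1)[OF prems(3)] frD(2)[OF prems(3)]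
    have v: "vars s 20 = vars st 20" "vars s 21 = w * P" "vars s 33 = f w" "arrs s 5 = arrs st 5"
      using F assms by simp_all
    have fj: "arrs st 5 (vars st 20 + j) = f j" using f(1) prems(1) by simp
    have old: "arrs s 6 (w * P + j) = a w j" using prems assms(3) by auto
    have idx: "u * P + v = w * P + j \<longleftrightarrow> u = w \<and> v = j" if "u < P" "v < u" for u v
      using index_eq_iff[of v P j u w] that prems(1) assms(3) by simp
    show ?thesis
    proof (cases "f w = f j")
      case True
      then show ?thesis using prems(1,2,4) v fj old b[of j]
        by (auto simp: wp_simps wp_MULC idx less_Suc_eq)
    next
      case False
      then have "f j - f w + (f w - f j) \<noteq> 0" by linarith
      then show ?thesis using False prems(1,2,4) v fj b[of j]
        by (auto simp: wp_simps wp_MULC less_Suc_eq)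
    qed
  qed
  subgoal by (auto simp: add_ac)
  done

text \<open>P^2 is not among the computed parameters, so the initial weights 1 are written to c k^4
  cells, which cover the indices of all pairs. The cost is dominated by the pairs, of order P^2 for
  each of the L columns.\<close>

lemma wp_GREEDY:
  assumes P: "vars st 10 = P" "P * P \<le> c * vars st 7" and L: "vars st 11 = L" and Q: "0 < Q"
    and z: "\<And>x. arrs st 7 x = 0"
  shows "wp e (GREEDY Q c) (\<lambda>t s. t \<le> c * vars st 7 * 7 + c + L * (P * (P * (Q + 40) + Q * (Q + 15) + 30) + 15) + 15 \<and>
    (\<forall>j<L. \<forall>w<P. arrs s 5 (j * P + w) = inner_code Q P j w)) st"
  unfolding GREEDY_def wp_Seq wp_SetC wp_MULC
  apply (simp add: wp_MULC)
  apply (rule wp_FOR[where N = "c * vars st 7" and b = 2 and I = "\<lambda>j s. \<forall>i<j. arrs s 6 i = 1"])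
  subgoal by simp
  subgoal by simp
  subgoal by simp
  subgoal by simp
  subgoal by (auto simp: wp_simps less_Suc_eq)
  subgoal premises prems0 for t0 s0
  proof -
    note F0 = frD(1)[OF prems0(2)] frD(2)[OF prems0(2)]
    have v0: "vars s0 10 = P" "vars s0 11 = L" "\<And>x. arrs s0 7 x = 0" using F0 P L z by simp_all
    have w0: "arrs s0 6 (u * P + v) = 1" if "u < P" "v < u" for u v
      using prems0(3) index_less[of u P v P] that P(2) by simp
    show ?thesis
      apply (rule wp_FOR[where N = L and b = "P * (P * (Q + 40) + Q * (Q + 15) + 30) + 10" and
        I = "\<lambda>j s. vars s 20 = j * P \<and> (\<forall>x. arrs s 7 x = 0) \<and>
          (\<forall>j'<j. \<forall>w<P. arrs s 5 (j' * P + w) = inner_code Q P j' w) \<and>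
          (\<forall>u v. u < P \<longrightarrow> v < u \<longrightarrow> arrs s 6 (u * P + v) = gwt Q P j u v)"])
      subgoal by simp
      subgoal using v0 by simp
      subgoal by simp
      subgoal using v0 w0 by simp
      subgoal premises prems1 for j s1
      proof -
        note F1 = frD(1)[OF prems1(3)]
        have v1: "vars s1 10 = P" using F1 v0 by simp
        note I1 = prems1(4)
        show ?thesis
          unfolding wp_Seq wp_SetC
          apply (rule wp_FOR[where N = P and b = "P * (Q + 40) + Q * (Q + 15) + 25" and
            I = "\<lambda>w s. vars s 20 = j * P \<and> vars s 21 = w * P \<and> (\<forall>x. arrs s 7 x = 0) \<and>
              (\<forall>j'<j. \<forall>w<P. arrs s 5 (j' * P + w) = inner_code Q P j' w) \<and>
              (\<forall>v<w. arrs s 5 (j * P + v) = inner_code Q P j v) \<and>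
              (\<forall>u v. u < P \<longrightarrow> v < u \<longrightarrow> arrs s 6 (u * P + v) =
                (if u < w then gwt Q P (Suc j) u v else gwt Q P j u v))"])
          subgoal by simp
          subgoal using v1 by simp
          subgoal by (simp del: gwt.simps)
          subgoal using I1 by (simp del: gwt.simps)
          subgoal premises prems2 for w s2
          proof -
            let ?f = "inner_code Q P j" and ?a = "gwt Q P j w"
            note F2 = frD(1)[OF prems2(3)]
            have v2: "vars s2 10 = P" using F2 v1 by simp
            have w: "w < P" "vars s2 24 = w" using prems2 by auto
            note I2 = prems2(4)
            have c1: "wp e GR_COUNT (\<lambda>t s. t \<le> w * 13 + 4 \<and> vars s 26 = (\<Sum>v<w. ?a v) \<and>
              (\<forall>x. arrs s 7 x = conf ?f ?a w x)) (set_var 26 0 s2)"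
              by (rule wp_GR_COUNT) (use w I2 in \<open>auto simp del: gwt.simps\<close>)
            show ?thesis
              apply (simp only: wp_Seq wp_SetC)
              apply (rule wp_fr, rule wp_mono[OF c1], clarify)
              subgoal premises prems3 for t3 s3
              proof -
                note F3 = frD(1)[OF prems3(4)] frD(2)[OF prems3(4)]
                have v3: "vars s3 20 = j * P" "vars s3 21 = w * P" "vars s3 10 = P" "vars s3 24 = w"
                  "arrs s3 5 = arrs s2 5" "arrs s3 6 = arrs s2 6"
                  using F3 I2 v2 w by simp_all
                have c2: "wp e (GR_BEST Q) (\<lambda>t s. t \<le> Q * (Q + 15) + 6 \<and> vars s 33 = best Q ?f ?a w Q \<and>
                  (\<forall>x. arrs s 7 x = 0)) s3"
                  by (rule wp_GR_BEST) (use prems3 Q in \<open>auto simp: inner_code_less\<close>)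
                show ?thesis
                  apply (rule wp_fr, rule wp_mono[OF c2], clarify)
                  subgoal premises prems4 for t4 s4
                  proof -
                    note F4 = frD(1)[OF prems4(4)] frD(2)[OF prems4(4)]
                    let ?s4 = "set_arr 5 (j * P + w) (?f w) (set_var 29 (j * P + w) s4)"
                    have v4: "vars s4 20 = j * P" "vars s4 21 = w * P" "vars s4 10 = P"
                      "vars s4 24 = w" "arrs s4 5 = arrs s2 5" "arrs s4 6 = arrs s2 6"
                      "vars s4 33 = ?f w"
                      using F4 v3 prems4(2) inner_code_best[OF w(1), of Q j] by simp_all
                    have c3: "wp e (GR_WEIGHT Q) (\<lambda>t s. t \<le> w * (Q + 20) + 4 \<and>
                      (\<forall>u v. u < P \<longrightarrow> v < u \<longrightarrow> arrs s 6 (u * P + v) =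
                        (if u < Suc w then gwt Q P (Suc j) u v else gwt Q P j u v))) ?s4"
                      by (rule wp_GR_WEIGHT[where f = ?f])
                        (use v4 w I2 in \<open>auto simp: inner_code_def\<close>)
                    have old: "arrs ?s4 5 (j' * P + v) = arrs s2 5 (j' * P + v)"
                      if "v < P" "j' < j \<or> v < w" for j' v
                      using that v4 index_eq_iff[of v P w j' j] w by auto
                    have wP: "w \<le> P" using w by simp
                    have m1: "w * 13 \<le> P * 13" "w * (Q + 20) \<le> P * (Q + 20)" using wP by simp_all
                    show ?thesis
                      apply (simp only: wp_Seq wp_Add wp_Store state_simps v4 if_True if_False
                          numeral_eq_iff num.simps simp_thms)
                      apply (rule wp_fr, rule wp_mono[OF c3], clarify)
                      subgoal premises prems5 for t5 s5
                      proof -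
                        note F5 = frD(1)[OF prems5(3)] frD(2)[OF prems5(3)]
                        have a5: "arrs s5 5 = arrs ?s4 5" "arrs s5 7 = arrs s4 7" "vars s5 20 = j * P"
                          "vars s5 21 = w * P" "vars s5 10 = P"
                          using F5 v4 by simp_all
                        have "t3 + (t4 + (1 + (1 + (t5 + 1)))) + 1 \<le> P * (Q + 40) + Q * (Q + 15) + 25"
                          using prems3(1) prems4(1) prems5(1) m1 by (simp add: algebra_simps)
                        moreover have "arrs s5 5 (j' * P + v) = inner_code Q P j' v"
                          if "j' < j" "v < P" for j' v
                          using old[of v j'] that a5(1) I2 by simp
                        moreover have "arrs s5 5 (j * P + v) = inner_code Q P j v" if "v < Suc w" for v
                          using old[of v j] that a5(1) I2 w by (auto simp: less_Suc_eq)
                        ultimately show ?thesis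
                          using prems5(2) prems4(3) a5 by (simp add: wp_simps del: gwt.simps)
                      qed
                      done
                  qed
                  done
              qed
              done
          qed
          subgoal premises prems2 for t2 s2
          proof -
            have "vars s2 10 = P" using frD(1)[OF prems2(2)] v1 by simp
            then show ?thesis using prems2(1,3)
              by (auto simp: wp_simps less_Suc_eq add_ac simp del: gwt.simps)
          qed
          done
      qed
      subgoal premises prems1 for t1 s1
        using prems1 prems0(1) by (simp add: algebra_simps)
      done
  qed
  done

section \<open>Encoding\<close>

lemma slot_value: "(Y::nat) mod p ^ (a + b) div p ^ a = Y div p ^ a mod p ^ b"
proof (cases "p = 0")
  case True
  then show ?thesis by (cases a; cases b) auto
next
  case False
  have "Y mod (p ^ a * p ^ b) = p ^ a * (Y div p ^ a mod p ^ b) + Y mod p ^ a" by (rule mod_mult2_eq)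
  then show ?thesis using False by (simp add: power_add)
qed

text \<open>Horner's rule modulo P on the digits of a slot, read from the top. Reducing after every
  digit keeps the quotient of the reduction below p.\<close>

lemma digit_step:
  fixes Y p :: nat
  assumes "0 < p" "Suc e \<le> H"
  shows "(p * (Y mod p ^ H div p ^ Suc e mod P) + Y mod p ^ Suc e div p ^ e) mod P =
    Y mod p ^ H div p ^ e mod P"
proof -
  let ?V = "Y mod p ^ H"
  have "?V mod p ^ Suc e = Y mod p ^ Suc e" using assms(2) by (intro mod_mod_cancel le_imp_power_dvd)
  then have dg: "Y mod p ^ Suc e div p ^ e = ?V div p ^ e mod p"
    using slot_value[of ?V p e 1] by simp
  have "?V div p ^ Suc e = ?V div p ^ e div p"
    by (simp only: power_Suc2 div_mult2_eq)
  then have "p * (?V div p ^ Suc e) + ?V div p ^ e mod p = ?V div p ^ e" by simp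
  then show ?thesis unfolding dg by (metis mod_add_left_eq mod_mult_right_eq)
qed

text \<open>The number is consumed from its most significant digit, by division by a stored power of
  p; the rest is below the next power, so the quotient is a digit and the division takes bounded
  time. Dividing by p from the bottom would take as many steps as the number is large. Results are
  written with an offset and a stride, so that a column of a matrix can be filled.\<close>

definition UNPACK :: "nat \<Rightarrow> nat \<Rightarrow> com" where
  "UNPACK p out = Seq (SetC 25 0) (Seq (FOR 26 27 21 (Add 25 25 22)) (FOR 26 27 21 (Seq (SetC 28 0)
    (Seq (FOR 29 30 22 (Seq (DEC 25) (Seq (Load 31 2 25) (Seq (DIVMOD 20 31 32 33)
      (Seq (MULC 34 28 p) (Seq (Add 28 34 32) (DIVMOD 28 10 32 33)))))))
    (Seq (Store out 23 28) (Add 23 23 24))))))"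

lemma UNPACK_frame [simp]:
  "wv (UNPACK p out) = {2, 20, 23, 25, 26, 27, 28, 29, 30, 31, 32, 33, 34}"
  "wa (UNPACK p out) = {out}" "silent (UNPACK p out)"
  by (auto simp: UNPACK_def)

lemma wp_UNPACK:
  assumes p: "2 \<le> p" and v: "vars st 20 = Y" "vars st 21 = S" "vars st 22 = b" "vars st 23 = i0"
    "vars st 24 = h" "vars st 10 = P" and pos: "0 < h" "0 < P"
    and Y: "Y < p ^ (S * b)" and pw: "\<And>i. i < S * b \<Longrightarrow> arrs st 2 i = p ^ i" and out: "out \<noteq> 2"
  shows "wp e (UNPACK p out) (\<lambda>t s. t \<le> S * (b * (13 * p + 30) + 26) + 20 \<and>
    (\<forall>j<S. arrs s out (i0 + j * h) = sl (p ^ b) S Y j mod P) \<and>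
    (\<forall>i. (\<forall>j<S. i \<noteq> i0 + j * h) \<longrightarrow> arrs s out i = arrs st out i)) st"
  unfolding UNPACK_def wp_Seq wp_SetC
  apply (rule wp_FOR[where N = S and b = 1 and I = "\<lambda>j s. vars s 25 = j * b"])
  subgoal by simp
  subgoal using v by simp
  subgoal by simp
  subgoal by simp
  subgoal premises prems for j s
    using prems(4) frD(1)[OF prems(3), of 22] v by (simp add: wp_simps)
  subgoal premises prems0 for t0 s0
  proof -
    note F0 = frD(1)[OF prems0(2)] frD(2)[OF prems0(2)]
    have v0: "vars s0 20 = Y" "vars s0 21 = S" "vars s0 22 = b" "vars s0 23 = i0"
      "vars s0 24 = h" "vars s0 10 = P" "arrs s0 = arrs st" "vars s0 25 = S * b"
      using F0 v prems0(3) by auto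
    show ?thesis
      apply (rule wp_FOR[where N = S and b = "b * (13 * p + 30) + 10" and I = "\<lambda>j s.
        vars s 20 = Y mod p ^ ((S - j) * b) \<and> vars s 25 = (S - j) * b \<and> vars s 23 = i0 + j * h \<and>
        (\<forall>j'<j. arrs s out (i0 + j' * h) = sl (p ^ b) S Y j' mod P) \<and>
        (\<forall>i. (\<forall>j'<j. i \<noteq> i0 + j' * h) \<longrightarrow> arrs s out i = arrs st out i)"])
      subgoal by simp
      subgoal using v0 by simp
      subgoal by simp
      subgoal using v0 Y by simp
      subgoal premises prems1 for j s1
      proof -
        note F1 = frD(1)[OF prems1(3)] frD(2)[OF prems1(3)]
        have v1: "vars s1 22 = b" "vars s1 24 = h" "vars s1 10 = P" "arrs s1 2 = arrs st 2"
          using F1 v0 out by simp_all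
        note I1 = prems1(4)
        define H where "H = (S - j) * b"
        have "S - j = Suc (S - Suc j)" using prems1(1) by simp
        then have Hb: "H = (S - Suc j) * b + b" by (simp add: H_def)
        have HS: "H \<le> S * b" by (simp add: H_def)
        show ?thesis
          unfolding wp_Seq wp_SetC
          apply (rule wp_FOR[where N = b and b = "13 * p + 25" and I = "\<lambda>i s.
            vars s 20 = Y mod p ^ (H - i) \<and> vars s 25 = H - i \<and> vars s 28 = Y mod p ^ H div p ^ (H - i) mod P"])
          subgoal by simp
          subgoal using v1 by simp
          subgoal by simp
          subgoal using I1 p by (simp add: H_def)
          subgoal premises prems2 for i s2
          proof -
            note F2 = frD(1)[OF prems2(3)] frD(2)[OF prems2(3)]
            have v2: "vars s2 10 = P" "arrs s2 2 = arrs st 2" using F2 v1 by simp_all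
            define E where "E = H - Suc i"
            have HE: "H - i = Suc E" "Suc E \<le> H" using prems2(1) Hb by (auto simp: E_def)
            have pE: "arrs st 2 E = p ^ E" using pw[of E] HE HS by simp
            note I2 = prems2(4)[unfolded HE(1)]
            have dg: "Y mod p ^ Suc E div p ^ E < p"
              using p by (intro less_mult_imp_div_less) simp
            have mE: "Y mod p ^ Suc E mod p ^ E = Y mod p ^ E" by (intro mod_mod_cancel) simp
            let ?S = "p * (Y mod p ^ H div p ^ Suc E mod P) + Y mod p ^ Suc E div p ^ E"
            have SP: "?S div P < p"
            proof (rule less_mult_imp_div_less)
              have "?S < p * (Y mod p ^ H div p ^ Suc E mod P) + p" using dg by simp
              also have "\<dots> = p * Suc (Y mod p ^ H div p ^ Suc E mod P)" by simp
              also have "\<dots> \<le> p * P" using pos(2) by (intro mult_le_mono2 Suc_leI mod_less_divisor)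
              finally show "?S < p * P" .
            qed
            show ?thesis
              apply (simp only: wp_Seq)
              apply (simp add: wp_DEC wp_Load)
              apply (rule wp_DIVMOD)
              subgoal by simp
              subgoal using I2 v2 pE p HE by simp
              subgoal premises prems3 for t3 s3
              proof -
                note F3 = frD(1)[OF prems3(2)]
                have v3: "vars s3 20 = Y mod p ^ E" "vars s3 32 = Y mod p ^ Suc E div p ^ E"
                  "vars s3 25 = E" "vars s3 10 = P" "vars s3 28 = Y mod p ^ H div p ^ Suc E mod P"
                  using prems3(3,4) F3 I2 v2 pE mE by auto
                have t3: "t3 \<le> 6 * p" using prems3(1) dg I2 v2 pE by simp
                show ?thesis
                  apply (simp add: wp_MULC wp_Add v3)
                  apply (rule wp_DIVMOD)
                  subgoal by simp
                  subgoal using v3 pos by simp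
                  subgoal premises prems4 for t4 s4
                  proof -
                    note F4 = frD(1)[OF prems4(2)]
                    have "vars s4 28 = ?S mod P" "t4 \<le> 6 * (?S div P) + 5"
                      using prems4(1,3) v3 by simp_all
                    moreover have "H - Suc i = E" by (simp add: E_def)
                    ultimately show ?thesis
                      using digit_step[of p E H Y P] p HE(2) SP t3 F4 v3 by simp
                  qed
                  done
              qed
              done
          qed
          subgoal premises prems2 for t2 s2
          proof -
            note F2 = frD(1)[OF prems2(2)] frD(2)[OF prems2(2)]
            have v2: "vars s2 23 = i0 + j * h" "vars s2 24 = h" "arrs s2 out = arrs s1 out"
              using F2 v1 I1 by simp_all
            have e: "H - b = (S - Suc j) * b" using Hb by simp
            have sl: "Y mod p ^ H div p ^ (H - b) = sl (p ^ b) S Y j"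
              using slot_value[of Y p "(S - Suc j) * b" b] e Hb
              by (simp add: sl_def power_mult[symmetric] mult.commute)
            have ne: "i0 + j' * h \<noteq> i0 + j * h" if "j' < j" for j' using that pos by simp
            show ?thesis using prems2(1,3) I1 v2 e sl ne pos(1)
              by (auto simp: wp_simps less_Suc_eq algebra_simps)
          qed
          done
      qed
      subgoal premises prems1 for t1 s1 using prems1(1,3) prems0(1) by (simp add: algebra_simps)
      done
  qed
  done

text \<open>A shift by one slot consists of as many multiplications by the literal p as the slot has
  digits, because the slot length depends on the input.\<close>

definition PACK :: "nat \<Rightarrow> nat \<Rightarrow> com" where
  "PACK p a = Seq (SetC 20 0) (FOR 22 23 5 (Seq (SetC 24 0) (Seq (FOR 25 26 35
    (Seq (FOR 27 28 13 (Seq (MULC 29 24 p) (MOV 24 29))) (Seq (Load 29 a 20)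
    (Seq (Add 24 24 29) (INC 20))))) (Store 8 22 24))))"

lemma PACK_frame [simp]:
  "wv (PACK p a) = {2, 20, 22, 23, 24, 25, 26, 27, 28, 29}" "wa (PACK p a) = {8}" "silent (PACK p a)"
  by (auto simp: PACK_def)

lemma wp_PACK:
  assumes v: "vars st 5 = k" "vars st 35 = r" "vars st 13 = b" and a: "a \<noteq> 8"
  shows "wp e (PACK p a) (\<lambda>t s. t \<le> k * (r * (b * (p + 9) + 13) + 11) + 5 \<and>
    (\<forall>i<k. arrs s 8 i = hn (\<lambda>j. arrs st a (i * r + j)) (p ^ b) r)) st"
  unfolding PACK_def wp_Seq wp_SetC
  apply (rule wp_FOR[where N = k and b = "r * (b * (p + 9) + 13) + 6" and I = "\<lambda>i s.
    vars s 20 = i * r \<and> (\<forall>i'<i. arrs s 8 i' = hn (\<lambda>j. arrs st a (i' * r + j)) (p ^ b) r)"])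
  subgoal by simp
  subgoal using v by simp
  subgoal by simp
  subgoal by simp
  subgoal premises prems0 for i s0
  proof -
    note F0 = frD(1)[OF prems0(3)] frD(2)[OF prems0(3)]
    have v0: "vars s0 35 = r" "vars s0 13 = b" "arrs s0 a = arrs st a" using F0 v a by simp_all
    note I0 = prems0(4)
    show ?thesis
      unfolding wp_Seq wp_SetC
      apply (rule wp_FOR[where N = r and b = "b * (p + 9) + 8" and I = "\<lambda>j s.
        vars s 20 = i * r + j \<and> vars s 24 = hn (\<lambda>j. arrs st a (i * r + j)) (p ^ b) j"])
      subgoal by simp
      subgoal using v0 by simp
      subgoal by simp
      subgoal using I0 by simp
      subgoal premises prems1 for j s1
      proof -
        note F1 = frD(1)[OF prems1(3)] frD(2)[OF prems1(3)]
        have v1: "vars s1 13 = b" "arrs s1 a = arrs st a" using F1 v0 by simp_all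
        note I1 = prems1(4)
        show ?thesis
          unfolding wp_Seq
          apply (rule wp_FOR[where N = b and b = "p + 4" and I = "\<lambda>l s.
            vars s 24 = hn (\<lambda>j. arrs st a (i * r + j)) (p ^ b) j * p ^ l"])
          subgoal by simp
          subgoal using v1 by simp
          subgoal by simp
          subgoal using I1 by simp
          subgoal by (simp add: wp_simps wp_MULC wp_MOV)
          subgoal premises prems2 for t2 s2
            using prems2(1,3) frD(1)[OF prems2(2)] frD(2)[OF prems2(2)] I1 v1
            by (simp add: wp_simps wp_INC add_ac)
          done
      qed
      subgoal premises prems1 for t1 s1
      proof -
        note F1 = frD(1)[OF prems1(2)] frD(2)[OF prems1(2)]
        have "vars s1 22 = i" "arrs s1 8 = arrs s0 8" using F1 prems0(2) by simp_all
        then show ?thesis using prems1(1,3) I0 by (auto simp: wp_simps less_Suc_eq add_ac)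
      qed
      done
  qed
  subgoal by (auto simp: add_ac)
  done

text \<open>For each evaluation point the k packed rows are combined: multiplying a row by a residue
  takes fewer than P additions, whatever the number of its entries. This arithmetic costs M k P, of
  order k^4; only packing and unpacking touch single entries.\<close>

definition AXIS :: "nat \<Rightarrow> nat \<Rightarrow> nat \<Rightarrow> com" where
  "AXIS p a b = Seq (PACK p a) (Seq (SetC 36 0) (FOR 37 38 9 (Seq (SetC 20 0)
    (Seq (FOR 25 26 5 (Seq (Load 27 4 36) (Seq (INC 36) (Seq (Load 28 8 25) (FOR 29 30 27 (Add 20 20 28))))))
    (Seq (MOV 21 35) (Seq (MOV 22 13) (Seq (MOV 23 37) (Seq (MOV 24 9) (UNPACK p b)))))))))"

lemma AXIS_frame [simp]:
  "wv (AXIS p a b) = {2, 20, 21, 22, 23, 24, 25, 26, 27, 28, 29, 30, 31, 32, 33, 34, 36, 37, 38}"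
  "wa (AXIS p a b) = {8, b}" "silent (AXIS p a b)"
  by (auto simp: AXIS_def)

lemma wp_AXIS:
  assumes p: "2 \<le> p" and v: "vars st 5 = k" "vars st 35 = r" "vars st 13 = b" "vars st 9 = M"
    "vars st 10 = P" and pos: "0 < M" "0 < P" and ab: "a \<noteq> 8" "out \<noteq> 8" "out \<noteq> 2" "out \<noteq> 4"
    and sc: "\<And>x i. x < M \<Longrightarrow> i < k \<Longrightarrow> arrs st 4 (x * k + i) = x ^ i mod P"
    and pw: "\<And>i. i < r * b \<Longrightarrow> arrs st 2 i = p ^ i"
    and A: "\<And>i. i < k * r \<Longrightarrow> arrs st a i < P" and b: "k * (P * P) \<le> p ^ b"
  shows "wp e (AXIS p a out) (\<lambda>t s. t \<le> k * (r * (b * (p + 9) + 13) + 11) +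
      M * (k * (6 * P + 13) + r * (b * (13 * p + 30) + 26) + 50) + 15 \<and>
    (\<forall>i<r * M. arrs s out i = ax P k M r (arrs st a) i)) st"
  unfolding AXIS_def
  apply (rule wp_SeqI[OF wp_PACK[OF v(1-3) ab(1)]])
  subgoal premises prems0 for t0 s0
  proof -
    note F0 = frD(1)[OF prems0(2)] frD(2)[OF prems0(2)]
    have v0: "vars s0 5 = k" "vars s0 35 = r" "vars s0 13 = b" "vars s0 9 = M" "vars s0 10 = P"
      "arrs s0 4 = arrs st 4" "arrs s0 2 = arrs st 2"
      using F0 v by simp_all
    have V: "arrs s0 8 i = hn (\<lambda>j. arrs st a (i * r + j)) (p ^ b) r" if "i < k" for i
      using prems0(1) that by simp
    show ?thesis
      unfolding wp_Seq wp_SetC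
      apply (rule wp_FOR[where N = M and b = "k * (6 * P + 13) + r * (b * (13 * p + 30) + 26) + 40" and
        I = "\<lambda>x s. vars s 36 = x * k \<and> (\<forall>j<r. \<forall>y<x. arrs s out (j * M + y) = ax P k M r (arrs st a) (j * M + y))"])
      subgoal by simp
      subgoal using v0 by simp
      subgoal by simp
      subgoal by simp
      subgoal premises prems1 for x s1
      proof -
        note F1 = frD(1)[OF prems1(3)] frD(2)[OF prems1(3)]
        have v1: "vars s1 5 = k" "vars s1 35 = r" "vars s1 13 = b" "vars s1 9 = M" "vars s1 10 = P"
          "vars s1 37 = x" "arrs s1 4 = arrs st 4" "arrs s1 2 = arrs st 2" "arrs s1 8 = arrs s0 8"
          using F1 v0 ab prems1(2) by simp_all
        have x: "x < M" by fact
        note I1 = prems1(4)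
        let ?c = "\<lambda>i. x ^ i mod P"
        have cP: "?c i < P" for i using pos by simp
        let ?f = "\<lambda>j. \<Sum>i<k. ?c i * arrs st a (i * r + j)"
        \<comment> \<open>No carry crosses a slot: each coordinate of the combination is a sum of k
          products of residues.\<close>
        have fb: "?f j < p ^ b" if "j < r" for j
        proof (cases "k = 0")
          case True
          then show ?thesis using p by simp
        next
          case False
          have "?f j < (\<Sum>i<k. P * P)"
            using False A index_less[of _ k j r] that cP pos
            by (intro sum_strict_mono) (auto intro!: mult_strict_mono)
          also have "\<dots> \<le> p ^ b" using b by simp
          finally show ?thesis .
        qed
        show ?thesis
          unfolding wp_Seq wp_SetC
          apply (rule wp_FOR[where N = k and b = "6 * P + 8" and I = "\<lambda>i s. vars s 36 = x * k + i \<and>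
            vars s 20 = (\<Sum>i<i. ?c i * hn (\<lambda>j. arrs st a (i * r + j)) (p ^ b) r)"])
          subgoal by simp
          subgoal using v1 by simp
          subgoal by simp
          subgoal using I1 by simp
          subgoal premises prems2 for i s2
          proof -
            note F2 = frD(1)[OF prems2(3)] frD(2)[OF prems2(3)]
            have v2: "arrs s2 4 (x * k + i) = ?c i" "arrs s2 8 i = hn (\<lambda>j. arrs st a (i * r + j)) (p ^ b) r"
              using F2 v1 sc[OF x prems2(1)] V[OF prems2(1)] by simp_all
            note I2 = prems2(4)
            show ?thesis
              apply (simp add: wp_simps wp_INC)
              apply (rule wp_FOR[where N = "?c i" and b = 1 and I = "\<lambda>l s. vars s 36 = x * k + Suc i \<and>
                vars s 28 = hn (\<lambda>j. arrs st a (i * r + j)) (p ^ b) r \<and> vars s 20 =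
                (\<Sum>i<i. ?c i * hn (\<lambda>j. arrs st a (i * r + j)) (p ^ b) r) + l * hn (\<lambda>j. arrs st a (i * r + j)) (p ^ b) r"])
              subgoal by simp
              subgoal using I2 v2 by simp
              subgoal by simp
              subgoal using I2 v2 prems2(2) by simp
              subgoal by (simp add: wp_simps)
              subgoal for t3 s3 using cP[of i] by simp
              done
          qed
          subgoal premises prems2 for t2 s2
          proof -
            note F2 = frD(1)[OF prems2(2)] frD(2)[OF prems2(2)]
            have v2: "vars s2 35 = r" "vars s2 13 = b" "vars s2 9 = M" "vars s2 10 = P"
              "vars s2 37 = x" "arrs s2 2 = arrs st 2" "arrs s2 out = arrs s1 out"
              using F2 v1 by simp_all
            have 20: "vars s2 20 = hn ?f (p ^ b) r"
              using prems2(3) hn_linear[of ?c "\<lambda>i j. arrs st a (i * r + j)" "p ^ b" r k] by simp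
            let ?s = "set_var 24 M (set_var 2 0 (set_var 23 x (set_var 2 0
              (set_var 22 b (set_var 2 0 (set_var 21 r (set_var 2 0 s2)))))))"
            have c: "wp e (UNPACK p out) (\<lambda>t s. t \<le> r * (b * (13 * p + 30) + 26) + 20 \<and>
              (\<forall>j<r. arrs s out (x + j * M) = sl (p ^ b) r (hn ?f (p ^ b) r) j mod P) \<and>
              (\<forall>i. (\<forall>j<r. i \<noteq> x + j * M) \<longrightarrow> arrs s out i = arrs ?s out i)) ?s"
            proof (rule wp_UNPACK[OF p])
              have "hn ?f (p ^ b) r < (p ^ b) ^ r" by (rule hn_less) (rule fb)
              then show "hn ?f (p ^ b) r < p ^ (r * b)" by (simp add: power_mult[symmetric] mult.commute)
            qed (use v2 20 pos pw ab in auto)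
            show ?thesis
              apply (simp add: wp_MOV v2)
              apply (rule wp_fr, rule wp_mono[OF c], clarify)
              subgoal premises prems3 for t3 s3
              proof -
                note F3 = frD(1)[OF prems3(4)]
                have "arrs s3 out (j * M + y) = ax P k M r (arrs st a) (j * M + y)"
                  if "j < r" "y < Suc x" for j y
                proof (cases "y = x")
                  case True
                  have "arrs s3 out (x + j * M) = ?f j mod P"
                    using prems3(2) that fb by (simp add: sl_hn)
                  then show ?thesis using True x by (simp add: ax_def mult.commute add.commute)
                next
                  case False
                  then have "y < x" using that by simp
                  then have "j * M + y \<noteq> x + j' * M" for j'
                    using index_eq_iff[of y M x j j'] x by (simp add: add.commute)
                  then show ?thesis using prems3(3) I1 v2 \<open>y < x\<close> that by simp
                qed
                moreover have "vars s3 36 = Suc x * k" using F3 prems2(3) by (simp add: add.commute)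
                moreover have "t2 \<le> k * (6 * P + 13) + 4" using prems2(1) by (simp add: add_ac)
                ultimately show ?thesis using prems3(1) by simp
              qed
              done
          qed
          done
      qed
      subgoal premises prems1 for t1 s1
      proof -
        have "arrs s1 out i = ax P k M r (arrs st a) i" if "i < r * M" for i
        proof -
          have "i div M < r" "i mod M < M" using that pos by (auto simp: less_mult_imp_div_less)
          then show ?thesis using prems1(3) by (metis div_mult_mod_eq)
        qed
        moreover have "t0 + (1 + t1) \<le> k * (r * (b * (p + 9) + 13) + 11) +
          M * (k * (6 * P + 13) + r * (b * (13 * p + 30) + 26) + 50) + 15"
          using prems1(1) prems0(1) by (simp add: algebra_simps)
        ultimately show ?thesis by blast
      qed
      done
  qed
  done

lemma wp_Seq_MOV: "y \<noteq> 2 \<Longrightarrow> wp e (Seq (MOV x y) c) Q st =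
    wp e c (\<lambda>u. Q (2 + u)) (set_var x (vars st y) (set_var 2 0 st))"
  by (simp add: wp_Seq wp_MOV)

lemma wp_Seq_SetC: "wp e (Seq (SetC x v) c) Q st = wp e c (\<lambda>u. Q (1 + u)) (set_var x v st)"
  by (simp add: wp_Seq wp_SetC)

definition ready :: "nat \<Rightarrow> nat \<Rightarrow> nat \<Rightarrow> state \<Rightarrow> bool" where
  "ready p d g st \<longleftrightarrow> prm p d g st \<and> vars st 10 = symmod p d g \<and>
     (\<forall>i<axis_out p d g ^ 4 * slot_len d g. arrs st 2 i = p ^ i) \<and>
     (\<forall>x<axis_out p d g. \<forall>i<axis_in p g. arrs st 4 (x * axis_in p g + i) = x ^ i mod symmod p d g) \<and>
     (\<forall>j<inner_len p d g. \<forall>w<symmod p d g.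
        arrs st 5 (j * symmod p d g + w) = inner_code (8 ^ d) (symmod p d g) j w)"

lemma ready_fr:
  assumes "ready p d g st" "fr c st s" "{4..14} \<inter> wv c = {}" "{2, 4, 5} \<inter> wa c = {}"
  shows "ready p d g s"
proof -
  have v: "vars s x = vars st x" if "x \<in> {4..14}" for x
    by (rule frD(1)[OF assms(2)]) (use assms(3) that in blast)
  have a: "arrs s x = arrs st x" if "x \<in> {2, 4, 5}" for x
    using frD(2)[OF assms(2), of x] assms(4) that by auto
  show ?thesis using assms(1) by (simp add: ready_def prm_def v a)
qed

definition CODE_SETUP :: "nat \<Rightarrow> nat \<Rightarrow> com" where
  "CODE_SETUP p d = Seq (PARAMS p d) (Seq (POWERS p) (Seq (SIEVE d) (Seq SCAL
     (GREEDY (8 ^ d) (4 * (4 * d) ^ 4)))))"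

definition setup_time :: "nat \<Rightarrow> nat \<Rightarrow> nat \<Rightarrow> nat" where
  "setup_time p d g = (g * (2 * p ^ 4 + p ^ 3 + p + 22) +
      (4 * d) ^ 4 * (2 * p + 24 * d + 8) + 4 * d + 2 * p + 60) +
    ((axis_out p d g ^ 4 * slot_len d g * (p + 10) + 5) +
    ((axis_out p d g * (2 * (4 * d) ^ 2 * axis_in p g ^ 3 * 8 + 20) +
      4 * symmod p d g + 2 * (4 * d) ^ 2 + 30) +
    ((axis_out p d g * (axis_in p g * (axis_out p d g * 12 + 24) + 10) + 5) +
    (4 * (4 * d) ^ 4 * axis_in p g ^ 4 * 7 + 4 * (4 * d) ^ 4 + inner_len p d g *
      (symmod p d g * (symmod p d g * (8 ^ d + 40) + 8 ^ d * (8 ^ d + 15) + 30) + 15) + 15))))"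

lemma CODE_SETUP_frame [simp]:
  "wv (CODE_SETUP p d) = {2, 4, 5, 6, 7, 8, 9, 10, 11, 12, 13, 14, 20, 21, 22, 23, 24, 25, 26, 27, 28, 29, 30, 31, 32, 33, 34}"
  "wa (CODE_SETUP p d) = {2, 3, 4, 5, 6, 7}" "silent (CODE_SETUP p d)"
  by (auto simp: CODE_SETUP_def)

lemma wp_CODE_SETUP:
  assumes p: "2 \<le> p" and d: "0 < d" and n: "vars st 3 = n"
    and z: "\<And>a i. a \<in> {3, 7} \<Longrightarrow> arrs st a i = 0"
  shows "wp e (CODE_SETUP p d) (\<lambda>t s. t \<le> setup_time p d (code_size p n) \<and>
    ready p d (code_size p n) s) st"
proof -
  let ?g = "code_size p n"
  have pdg: "2 \<le> p" "0 < d" "0 < ?g" using p d code_size(1)[OF p, of n] by auto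
  note P = symmod[OF pdg] and k = axis_in_ge[OF pdg] and M = axis_out_ge[OF pdg]
  have PP: "symmod p d ?g * symmod p d ?g \<le> 4 * (4 * d) ^ 4 * axis_in p ?g ^ 4"
  proof -
    have "symmod p d ?g * symmod p d ?g \<le> (2 * axis_out p d ?g ^ 2) * (2 * axis_out p d ?g ^ 2)"
      using P(2) by (intro mult_le_mono)
    also have "\<dots> = 4 * (4 * d) ^ 4 * axis_in p ?g ^ 4"
      by (simp add: axis_out_def power2_eq_square power4_eq_xxxx)
    finally show ?thesis .
  qed
  show ?thesis
    unfolding CODE_SETUP_def
    apply (rule wp_SeqI[OF wp_PARAMS[OF p n]])
    subgoal premises p0 for t0 s0
    proof -
      note F0 = frD(1)[OF p0(2)] frD(2)[OF p0(2)]
      have prm0: "prm p d ?g s0" using p0 by simp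
      show ?thesis
        apply (rule wp_SeqI[OF wp_POWERS])
        subgoal premises p1 for t1 s1
        proof -
          note F1 = frD(1)[OF p1(2)] frD(2)[OF p1(2)]
          have prm1: "prm p d ?g s1" using prm0 by (simp add: prm_def F1)
          have "vars s0 14 = axis_out p d ?g ^ 4 * slot_len d ?g" using prm0 by (simp add: prm_def)
          with p1(1) have t1: "t1 \<le> axis_out p d ?g ^ 4 * slot_len d ?g * (p + 10) + 5"
            and pw1: "\<forall>i<axis_out p d ?g ^ 4 * slot_len d ?g. arrs s1 2 i = p ^ i" by simp_all
          have z1: "arrs s1 3 i = 0" "arrs s1 7 i = 0" for i using F0 F1 z by simp_all
          show ?thesis
            apply (rule wp_SeqI[OF wp_SIEVE[OF pdg prm1 z1(1)]])
            subgoal premises p2 for t2 s2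
            proof -
              note F2 = frD(1)[OF p2(2)] frD(2)[OF p2(2)]
              have prm2: "prm p d ?g s2" using prm1 by (simp add: prm_def F2)
              have P2: "vars s2 10 = symmod p d ?g" using p2(1) by simp
              show ?thesis
                apply (rule wp_SeqI[OF wp_SCAL[where st = s2 and k = "axis_in p ?g" and
                      M = "axis_out p d ?g" and P = "symmod p d ?g"]])
                subgoal using prm2 by (simp add: prm_def)
                subgoal using prm2 by (simp add: prm_def)
                subgoal by (rule P2)
                subgoal using P(1) M by simp
                subgoal premises p3 for t3 s3
                proof -
                  note F3 = frD(1)[OF p3(2)] frD(2)[OF p3(2)]
                  have prm3: "prm p d ?g s3" using prm2 by (simp add: prm_def F3)
                  have c: "wp e (GREEDY (8 ^ d) (4 * (4 * d) ^ 4)) (\<lambda>t s. t \<le> 4 * (4 * d) ^ 4 * vars s3 7 * 7 +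
                    4 * (4 * d) ^ 4 + inner_len p d ?g * (symmod p d ?g * (symmod p d ?g * (8 ^ d + 40) +
                    8 ^ d * (8 ^ d + 15) + 30) + 15) + 15 \<and> (\<forall>j<inner_len p d ?g. \<forall>w<symmod p d ?g.
                    arrs s 5 (j * symmod p d ?g + w) = inner_code (8 ^ d) (symmod p d ?g) j w)) s3"
                    by (rule wp_GREEDY) (use prm3 F3 P2 PP F2 z1 in \<open>simp_all add: prm_def\<close>)
                  have k7: "vars s3 7 = axis_in p ?g ^ 4" using prm3 by (simp add: prm_def)
                  show ?thesis
                    apply (rule wp_fr, rule wp_mono[OF c], clarify)
                    subgoal premises p4 for t4 s4
                    proof -
                      note F4 = frD(1)[OF p4(3)] frD(2)[OF p4(3)]
                      have "ready p d ?g s4"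
                        using prm3 p4(2) p3(1) pw1 P2 by (simp add: ready_def prm_def F4 F3 F2)
                      moreover have "t0 + (t1 + (t2 + (t3 + t4))) \<le> setup_time p d ?g"
                        unfolding setup_time_def using p0(1) t1 p2(1) p3(1) p4(1)
                        unfolding k7 by (intro add_mono) (blast+)
                      ultimately show ?thesis by (simp add: add.assoc)
                    qed
                    done
                qed
                done
            qed
            done
        qed
        done
    qed
    done
qed

definition axis_time :: "nat \<Rightarrow> nat \<Rightarrow> nat \<Rightarrow> nat \<Rightarrow> nat" where
  "axis_time p d g c = c + 2 + (axis_in p g * (c * axis_in p g ^ 3 * (slot_len d g * (p + 9) + 13) + 11) +
      axis_out p d g * (axis_in p g * (6 * symmod p d g + 13) +
        c * axis_in p g ^ 3 * (slot_len d g * (13 * p + 30) + 26) + 50) + 15)"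

lemma ax_cong:
  assumes "\<And>i. i < k * r \<Longrightarrow> A i = B i" "x < r * M"
  shows "ax P k M r A x = ax P k M r B x"
proof -
  have "x div M < r" using assms(2) by (simp add: less_mult_imp_div_less)
  then show ?thesis unfolding ax_def
    by (intro arg_cong[where f = "\<lambda>z. z mod P"] sum.cong) (auto intro!: assms(1) index_less)
qed

text \<open>P^2 is at most 4 (4d)^4 k^4. Thus 5g digits pay for k^5, 16d digits for (4d)^4, and 2
  digits for the factor 4.\<close>

lemma slot_capacity:
  assumes "2 \<le> p" "0 < d" "0 < g"
  shows "axis_in p g * (symmod p d g * symmod p d g) \<le> p ^ slot_len d g"
proof -
  have "symmod p d g \<le> 2 * ((4 * d) ^ 2 * axis_in p g ^ 2)"
    using symmod(2)[OF assms] by (simp add: axis_out_def power_mult_distrib)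
  then have "symmod p d g * symmod p d g \<le> 2 * ((4 * d) ^ 2 * axis_in p g ^ 2) * (2 * ((4 * d) ^ 2 * axis_in p g ^ 2))"
    by (intro mult_le_mono)
  also have "\<dots> = 4 * (4 * d) ^ 4 * axis_in p g ^ 4" by (simp add: power2_eq_square power4_eq_xxxx)
  finally have "axis_in p g * (symmod p d g * symmod p d g) \<le> axis_in p g * (4 * (4 * d) ^ 4 * axis_in p g ^ 4)"
    by simp
  also have "\<dots> = 2 ^ 2 * (4 * d) ^ 4 * axis_in p g ^ 5" by (simp add: eval_nat_numeral)
  also have "\<dots> \<le> p ^ 2 * (p ^ (4 * d)) ^ 4 * axis_in p g ^ 5"
  proof (intro mult_le_mono power_mono order.refl)
    have "4 * d \<le> 2 ^ (4 * d)" using less_exp[of "4 * d"] by simp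
    also have "\<dots> \<le> p ^ (4 * d)" using assms by (intro power_mono) auto
    finally show "4 * d \<le> p ^ (4 * d)" .
  qed (use assms in auto)
  also have "\<dots> = p ^ slot_len d g"
    by (simp add: slot_len_def axis_in_def power_add power_mult[symmetric] algebra_simps power2_eq_square)
  finally show ?thesis .
qed

text \<open>After j axes the remaining coordinates take k^(3 - j) M^j = (4d)^j k^3 values. This is
  k^3 times a literal, so the length of a row is available without a general multiplication.\<close>

lemma wp_AXSTEP:
  assumes pdg: "2 \<le> p" "0 < d" "0 < g" and r: "ready p d g st" and ab: "a \<in> {9, 10}" "out \<in> {9, 10}"
    and c: "c \<le> (4 * d) ^ 3"
    and F: "\<And>i. i < axis_in p g * (c * axis_in p g ^ 3) \<Longrightarrow> arrs st a i = F i"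
      "\<And>i. i < axis_in p g * (c * axis_in p g ^ 3) \<Longrightarrow> F i < symmod p d g"
  shows "wp e (Seq (MULC 35 6 c) (AXIS p a out)) (\<lambda>t s. t \<le> axis_time p d g c \<and>
    (\<forall>i<c * axis_in p g ^ 3 * axis_out p d g.
      arrs s out i = ax (symmod p d g) (axis_in p g) (axis_out p d g) (c * axis_in p g ^ 3) F i)) st"
proof -
  let ?k = "axis_in p g" and ?M = "axis_out p d g" and ?P = "symmod p d g" and ?b = "slot_len d g"
  let ?st = "set_var 35 (c * vars st 6) st"
  have k1: "1 \<le> ?k" using axis_in_ge[OF pdg] by simp
  have "c * ?k ^ 3 \<le> (4 * d) ^ 3 * ?k ^ 3" using c by simp
  also have "\<dots> = ?M ^ 3" by (simp only: axis_out_def power_mult_distrib)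
  also have "\<dots> \<le> ?M ^ 4" using axis_out_ge(1)[OF pdg] by (intro power_increasing) auto
  finally have rM: "c * ?k ^ 3 * ?b \<le> ?M ^ 4 * ?b" by simp
  have v6: "vars st 6 = ?k ^ 3" using r by (simp add: ready_def prm_def)
  have "wp e (AXIS p a out) (\<lambda>t s. t \<le> ?k * (c * ?k ^ 3 * (?b * (p + 9) + 13) + 11) +
      ?M * (?k * (6 * ?P + 13) + c * ?k ^ 3 * (?b * (13 * p + 30) + 26) + 50) + 15 \<and>
    (\<forall>i<c * ?k ^ 3 * ?M. arrs s out i = ax ?P ?k ?M (c * ?k ^ 3) (arrs ?st a) i)) ?st"
  proof (rule wp_AXIS[OF pdg(1)])
    show "\<And>i. i < c * ?k ^ 3 * ?b \<Longrightarrow> arrs ?st 2 i = p ^ i"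
      using r less_le_trans[OF _ rM] by (simp add: ready_def)
    show "\<And>i. i < ?k * (c * ?k ^ 3) \<Longrightarrow> arrs ?st a i < ?P" using F by simp
    show "?k * (?P * ?P) \<le> p ^ ?b" by (rule slot_capacity[OF pdg])
    show "a \<noteq> 8" "out \<noteq> 8" "out \<noteq> 2" "out \<noteq> 4" using ab by auto
    show "0 < ?M" "0 < ?P" using symmod(1)[OF pdg] axis_out_ge[OF pdg] by simp_all
    show "arrs ?st 4 (x * ?k + i) = x ^ i mod ?P" if "x < ?M" "i < ?k" for x i
      using r that by (simp add: ready_def)
  qed (use r v6 in \<open>simp_all add: ready_def prm_def\<close>)
  moreover have "ax ?P ?k ?M (c * ?k ^ 3) (arrs ?st a) i = ax ?P ?k ?M (c * ?k ^ 3) F i"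
    if "i < c * ?k ^ 3 * ?M" for i
    by (rule ax_cong) (use F that in auto)
  ultimately show ?thesis
    unfolding wp_Seq by (simp add: wp_MULC) (erule wp_mono, simp add: axis_time_def)
qed

definition EMIT :: "nat \<Rightarrow> com" where
  "EMIT d = Seq (MULC 42 7 ((4 * d) ^ 4)) (FOR 43 44 42 (Seq (Load 45 9 43) (FOR 47 48 11
    (Seq (Load 49 5 45) (Seq (Store 11 41 49) (Seq (INC 41) (Add 45 45 10)))))))"

text \<open>The four axes alternate between the arrays 9 and 10. The codeword is appended at the
  position in variable 41, so that successive calls lay out the codewords of several messages one
  after the other.\<close>

definition ENCODE :: "nat \<Rightarrow> nat \<Rightarrow> com" where
  "ENCODE p d = Seq (MOV 20 40) (Seq (MOV 21 7) (Seq (MOV 22 4) (Seq (SetC 23 0) (Seq (SetC 24 1)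
    (Seq (UNPACK p 9) (Seq (Seq (MULC 35 6 1) (AXIS p 9 10)) (Seq (Seq (MULC 35 6 (4 * d)) (AXIS p 10 9))
    (Seq (Seq (MULC 35 6 ((4 * d) ^ 2)) (AXIS p 9 10)) (Seq (Seq (MULC 35 6 ((4 * d) ^ 3)) (AXIS p 10 9))
    (EMIT d))))))))))"

lemma EMIT_frame [simp]:
  "wv (EMIT d) = {2, 41, 42, 43, 44, 45, 47, 48, 49}" "wa (EMIT d) = {11}" "silent (EMIT d)"
  by (auto simp: EMIT_def)

lemma ENCODE_frame [simp]:
  "wv (ENCODE p d) = {2, 20, 21, 22, 23, 24, 25, 26, 27, 28, 29, 30, 31, 32, 33, 34, 35, 36, 37, 38, 41, 42, 43, 44, 45, 47, 48, 49}"
  "wa (ENCODE p d) = {8, 9, 10, 11}" "silent (ENCODE p d)"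
  by (auto simp: ENCODE_def)

lemma wp_EMIT:
  assumes pdg: "2 \<le> p" "0 < d" "0 < g" and r: "ready p d g st"
    and F: "\<And>i. i < axis_out p d g ^ 4 \<Longrightarrow> arrs st 9 i = outer_code p d g X i"
  shows "wp e (EMIT d) (\<lambda>t s. t \<le> axis_out p d g ^ 4 * (inner_len p d g * 10 + 11) + (4 * d) ^ 4 + 10 \<and>
    vars s 41 = vars st 41 + code_len p d g \<and>
    (\<forall>i<code_len p d g. arrs s 11 (vars st 41 + i) = code p d g X i) \<and>
    (\<forall>i<vars st 41. arrs s 11 i = arrs st 11 i)) st"
proof -
  let ?M = "axis_out p d g" and ?P = "symmod p d g" and ?L = "inner_len p d g" and ?p = "vars st 41"
  have L: "0 < ?L" by (simp add: inner_len_def)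
  show ?thesis
    unfolding EMIT_def wp_Seq
    apply (simp add: wp_MULC)
    apply (rule wp_FOR[where N = "?M ^ 4" and b = "?L * 10 + 6" and I = "\<lambda>i s. vars s 41 = ?p + i * ?L \<and>
      (\<forall>x<i * ?L. arrs s 11 (?p + x) = code p d g X x) \<and> (\<forall>x<?p. arrs s 11 x = arrs st 11 x)"])
    subgoal by simp
    subgoal using r by (simp add: ready_def prm_def axis_out_def power_mult_distrib)
    subgoal by simp
    subgoal by simp
    subgoal premises p1 for i s1
    proof -
      note F1 = frD(1)[OF p1(3)] frD(2)[OF p1(3)]
      have v1: "arrs s1 9 i = outer_code p d g X i" "vars s1 11 = ?L" "arrs s1 5 = arrs st 5" "vars s1 10 = ?P"
        using F1 F[OF p1(1)] r by (simp_all add: ready_def prm_def)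
      note I1 = p1(4)
      let ?w = "outer_code p d g X i"
      have w: "?w < ?P" by (rule outer_code_less[OF pdg])
      show ?thesis
        apply (simp add: wp_simps)
        apply (rule wp_FOR[where N = ?L and b = 5 and I = "\<lambda>j s. vars s 41 = ?p + (i * ?L + j) \<and>
          vars s 45 = j * ?P + ?w \<and>
          (\<forall>x<i * ?L + j. arrs s 11 (?p + x) = code p d g X x) \<and> (\<forall>x<?p. arrs s 11 x = arrs st 11 x)"])
        subgoal by simp
        subgoal using v1 by simp
        subgoal by simp
        subgoal using I1 v1 p1(2) by simp
        subgoal premises p2 for j s2
        proof -
          note F2 = frD(1)[OF p2(3)] frD(2)[OF p2(3)]
          have v2: "vars s2 10 = ?P" "arrs s2 5 (j * ?P + ?w) = inner_code (8 ^ d) ?P j ?w"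
            using F2 v1 r p2(1) w by (simp_all add: ready_def)
          have "code p d g X (i * ?L + j) = inner_code (8 ^ d) ?P j ?w"
            using p2(1) by (simp add: code_def)
          then show ?thesis using p2(4) v2
            by (auto simp: wp_simps wp_INC less_Suc_eq)
        qed
        subgoal premises p2 for t2 s2 using p2(1,3) by (simp add: add_ac)
        done
    qed
    subgoal premises p1 for t1 s1 using p1(1,3) by (simp add: code_len_def algebra_simps)
    done
qed

definition enc_time :: "nat \<Rightarrow> nat \<Rightarrow> nat \<Rightarrow> nat" where
  "enc_time p d g = 8 + ((axis_in p g ^ 4 * (g * (13 * p + 30) + 26) + 20) + (axis_time p d g 1 +
     (axis_time p d g (4 * d) + (axis_time p d g ((4 * d) ^ 2) + (axis_time p d g ((4 * d) ^ 3) +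
     (axis_out p d g ^ 4 * (inner_len p d g * 10 + 11) + (4 * d) ^ 4 + 10))))))"

lemma wp_ENCODE:
  assumes pdg: "2 \<le> p" "0 < d" "0 < g" and r: "ready p d g st"
    and X: "vars st 40 = X" "X < p ^ (g * axis_in p g ^ 4)"
  shows "wp e (ENCODE p d) (\<lambda>t s. t \<le> enc_time p d g \<and>
    vars s 41 = vars st 41 + code_len p d g \<and>
    (\<forall>i<code_len p d g. arrs s 11 (vars st 41 + i) = code p d g X i) \<and>
    (\<forall>i<vars st 41. arrs s 11 i = arrs st 11 i)) st"
proof -
  let ?k = "axis_in p g" and ?M = "axis_out p d g" and ?P = "symmod p d g"
  let ?S = "sl ?k (?k ^ 4) X"
  let ?F1 = "ax ?P ?k ?M (1 * ?k ^ 3) ?S"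
  let ?F2 = "ax ?P ?k ?M (4 * d * ?k ^ 3) ?F1"
  let ?F3 = "ax ?P ?k ?M ((4 * d) ^ 2 * ?k ^ 3) ?F2"
  let ?F4 = "ax ?P ?k ?M ((4 * d) ^ 3 * ?k ^ 3) ?F3"
  have k: "0 < ?k" and P: "0 < ?P" using axis_in_ge[OF pdg] axis_in_less_symmod[OF pdg] by auto
  have S: "?S i < ?P" for i
    using axis_in_less_symmod[OF pdg] mod_less_divisor[OF k] unfolding sl_def by (meson less_trans)
  have axP: "ax ?P ?k ?M r A i < ?P" for r A i using P by (simp add: ax_def)
  have d1: "1 \<le> 4 * d" using pdg by simp
  have oc: "outer_code p d g X = ?F4"
    by (simp add: outer_code_def eval_nat_numeral axis_out_def algebra_simps)
  let ?st = "set_var 24 1 (set_var 23 0 (set_var 22 g (set_var 2 0 (set_var 21 (?k ^ 4)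
    (set_var 2 0 (set_var 20 X (set_var 2 0 st)))))))"
  have v: "vars st 7 = ?k ^ 4" "vars st 4 = g" "vars st 10 = ?P" using r by (simp_all add: ready_def prm_def)
  have gs: "g \<le> slot_len d g" by (simp add: slot_len_def)
  have "?k ^ 4 \<le> ?M ^ 4" using axis_out_ge(2)[OF pdg] by (rule power_mono) simp
  then have "?k ^ 4 * g \<le> ?M ^ 4 * slot_len d g" using gs by (rule mult_le_mono)
  then have c0: "wp e (UNPACK p 9) (\<lambda>t s. t \<le> ?k ^ 4 * (g * (13 * p + 30) + 26) + 20 \<and>
    (\<forall>j<?k ^ 4. arrs s 9 (0 + j * 1) = sl (p ^ g) (?k ^ 4) X j mod ?P) \<and>
    (\<forall>i. (\<forall>j<?k ^ 4. i \<noteq> 0 + j * 1) \<longrightarrow> arrs s 9 i = arrs ?st 9 i)) ?st"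
    by (intro wp_UNPACK[OF pdg(1)]) (use v X P r in \<open>auto simp: ready_def mult.commute\<close>)
  have rst: "ready p d g ?st" using r by (simp add: ready_def prm_def)
  have 35: "ready p d g s'" if "ready p d g s" "fr (Seq (MULC 35 6 c) (AXIS p a b)) s s'" "a \<in> {9, 10}" "b \<in> {9, 10}"
    for s s' a b c by (rule ready_fr[OF that(1,2)]) (use that in auto)
  show ?thesis
    unfolding ENCODE_def
    apply (simp only: wp_Seq_MOV wp_Seq_SetC state_simps v X if_False if_True numeral_eq_iff
        num.simps simp_thms)
    apply (rule wp_SeqI[OF c0])
    subgoal premises p0 for t0 s0
    proof -
      have r0: "ready p d g s0" by (rule ready_fr[OF rst p0(2)]) auto
      have a0: "arrs s0 9 i = ?S i" if "i < ?k * (1 * ?k ^ 3)" for i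
        using p0(1) that S[of i] by (simp add: axis_in_def eval_nat_numeral)
      show ?thesis
        apply (rule wp_SeqI[OF wp_AXSTEP[OF pdg r0 _ _ _ a0 S]])
        subgoal by simp
        subgoal by simp
        subgoal using d1 by (simp add: one_le_power)
        subgoal by simp
        subgoal premises p1 for t1 s1
        proof -
          have r1: "ready p d g s1" by (rule 35[OF r0 p1(2)]) auto
          have a1: "arrs s1 10 i = ?F1 i" if "i < ?k * (4 * d * ?k ^ 3)" for i
            using p1(1) that by (simp add: axis_out_def algebra_simps)
          show ?thesis
            apply (rule wp_SeqI[OF wp_AXSTEP[OF pdg r1 _ _ _ a1 axP]])
            subgoal by simp
            subgoal by simp
            subgoal using d1 by (intro self_le_power) auto
            subgoal by assumption
            subgoal premises p2 for t2 s2
            proof -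
              have r2: "ready p d g s2" by (rule 35[OF r1 p2(2)]) auto
              have a2: "arrs s2 9 i = ?F2 i" if "i < ?k * ((4 * d) ^ 2 * ?k ^ 3)" for i
                using p2(1) that by (simp add: axis_out_def algebra_simps power2_eq_square)
              show ?thesis
                apply (rule wp_SeqI[OF wp_AXSTEP[OF pdg r2 _ _ _ a2 axP]])
                subgoal by simp
                subgoal by simp
                subgoal using d1 by (intro power_increasing) auto
                subgoal by assumption
                subgoal premises p3 for t3 s3
                proof -
                  have r3: "ready p d g s3" by (rule 35[OF r2 p3(2)]) auto
                  have a3: "arrs s3 10 i = ?F3 i" if "i < ?k * ((4 * d) ^ 3 * ?k ^ 3)" for i
                    using p3(1) that by (simp add: axis_out_def algebra_simps power2_eq_square power3_eq_cube)
                  show ?thesis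
                    apply (rule wp_SeqI[OF wp_AXSTEP[OF pdg r3 _ _ _ a3 axP]])
                    subgoal by simp
                    subgoal by simp
                    subgoal by simp
                    subgoal by assumption
                    subgoal premises p4 for t4 s4
                    proof -
                      have r4: "ready p d g s4" by (rule 35[OF r3 p4(2)]) auto
                      have M4: "?M ^ 4 = (4 * d) ^ 3 * ?k ^ 3 * ?M"
                        by (simp add: axis_out_def eval_nat_numeral)
                      have a4: "arrs s4 9 i = outer_code p d g X i" if "i < ?M ^ 4" for i
                        using p4(1) that unfolding M4 oc by blast
                      have e: "vars s4 41 = vars st 41" "arrs s4 11 = arrs st 11"
                        using frD(1)[OF p4(2), of 41] frD(1)[OF p3(2), of 41] frD(1)[OF p2(2), of 41]
                          frD(1)[OF p1(2), of 41] frD(1)[OF p0(2), of 41]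
                          frD(2)[OF p4(2), of 11] frD(2)[OF p3(2), of 11] frD(2)[OF p2(2), of 11]
                          frD(2)[OF p1(2), of 11] frD(2)[OF p0(2), of 11] by simp_all
                      show ?thesis
                        apply (rule wp_mono[OF wp_EMIT[OF pdg r4 a4]], assumption)
                        subgoal premises p5 for t5 s5
                        proof -
                          note t = conjunct1[OF p0(1)] conjunct1[OF p1(1)] conjunct1[OF p2(1)]
                            conjunct1[OF p3(1)] conjunct1[OF p4(1)] conjunct1[OF p5]
                          show ?thesis
                            using conjunct2[OF p5] unfolding e
                            by (rule conjI[rotated]) (unfold enc_time_def, use t in linarith)
                        qed
                        done
                    qed
                    done
                qed
                done
            qed
            done
        qed
        done
    qed
    done
qed

section \<open>Running the given scheme with additional symbols\<close>

text \<open>The programs below use the variables and arrays with names below 100 themselves; the names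
  from 100 on are divided into \<open>m\<close> disjoint classes, one for each run of the given scheme.\<close>

definition emb :: "nat \<Rightarrow> nat \<Rightarrow> nat \<Rightarrow> nat" where
  "emb m r x = 100 + (x * m + r)"

lemma emb_neq [simp]: "v < 100 \<Longrightarrow> emb m r x \<noteq> v" "v < 100 \<Longrightarrow> v \<noteq> emb m r x"
  by (auto simp: emb_def)

lemma emb_eq_iff: "r < m \<Longrightarrow> r' < m \<Longrightarrow> emb m r x = emb m r' y \<longleftrightarrow> r = r' \<and> x = y"
  using index_eq_iff[of r m r' x y] by (auto simp: emb_def)

lemma emb_inj [simp]: "r < m \<Longrightarrow> emb m r x = emb m r y \<longleftrightarrow> x = y"
  by (simp add: emb_eq_iff)

text \<open>A transmitted number is q times the additional symbol plus the symbol of the run. Array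
  12 already holds the multiples of q, and variable 51 walks through it cyclically. On reception the
  quotient goes to array 13 and the run sees only the remainder.\<close>

primrec lift :: "nat \<Rightarrow> nat \<Rightarrow> nat \<Rightarrow> com \<Rightarrow> com" where
  "lift q m r Skip = Skip"
| "lift q m r (SetC x v) = SetC (emb m r x) v"
| "lift q m r (Add x y z) = Add (emb m r x) (emb m r y) (emb m r z)"
| "lift q m r (Sub x y z) = Sub (emb m r x) (emb m r y) (emb m r z)"
| "lift q m r (Load x a i) = Load (emb m r x) (emb m r a) (emb m r i)"
| "lift q m r (Store a i x) = Store (emb m r a) (emb m r i) (emb m r x)"
| "lift q m r (Send x) = Seq (Load 50 12 51) (Seq (Add 50 50 (emb m r x)) (Seq (Send 50)
     (Seq (INC 51) (Seq (Sub 52 12 51) (IfNZ 52 Skip (SetC 51 0))))))"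
| "lift q m r (Recv x) = Seq (Recv (emb m r x)) (Seq (SetC 53 q) (Seq (DIVMOD (emb m r x) 53 54 55)
     (Seq (Store 13 56 54) (INC 56))))"
| "lift q m r (Query x a i l) = Query (emb m r x) (emb m r a) (emb m r i) (emb m r l)"
| "lift q m r (Seq c d) = Seq (lift q m r c) (lift q m r d)"
| "lift q m r (IfNZ x c d) = IfNZ (emb m r x) (lift q m r c) (lift q m r d)"
| "lift q m r (WhileNZ x c) = WhileNZ (emb m r x) (lift q m r c)"

lemma lift_frame:
  "wv (lift q m r c) \<subseteq> {2, 50, 51, 52, 54, 55, 56, 53} \<union> range (emb m r)"
  "wa (lift q m r c) \<subseteq> {13} \<union> range (emb m r)"
  by (induction c) auto

definition snds :: "event list \<Rightarrow> nat list" where "snds tr = map sym (filter is_Snd tr)"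
definition rcvs :: "event list \<Rightarrow> nat list" where "rcvs tr = map sym (filter (\<lambda>e. \<not> is_Snd e) tr)"

lemma snds_simps [simp]: "snds [] = []" "snds (a @ b) = snds a @ snds b"
  "snds (Snd v # b) = v # snds b" "snds (Rcv v # b) = snds b"
  by (simp_all add: snds_def)

lemma rcvs_simps [simp]: "rcvs [] = []" "rcvs (a @ b) = rcvs a @ rcvs b"
  "rcvs (Snd v # b) = rcvs b" "rcvs (Rcv v # b) = v # rcvs b"
  by (simp_all add: rcvs_def)

primrec strip :: "nat \<Rightarrow> event \<Rightarrow> event" where
  "strip q (Snd v) = Snd (v mod q)"
| "strip q (Rcv v) = Rcv (v mod q)"

text \<open>The relation between a state \<open>st\<close> of the given program and the state \<open>ST\<close> of its
  translation; \<open>pre\<close> is the trace before the run, \<open>b\<close> the number of symbols sent before the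
  current block of runs, and \<open>x\<close> the sequence of additional symbols (repeated with
  period \<open>M\<close>).\<close>

definition rcv_inv :: "nat \<Rightarrow> nat \<Rightarrow> state \<Rightarrow> bool" where
  "rcv_inv q E ST \<longleftrightarrow> vars ST 56 = length (rcvs (trace ST)) \<and>
     (\<forall>j<length (rcvs (trace ST)). arrs ST 13 j = rcvs (trace ST) ! j div q \<and>
        rcvs (trace ST) ! j div q < E)"

definition snd_inv :: "nat \<Rightarrow> nat \<Rightarrow> (nat \<Rightarrow> nat) \<Rightarrow> nat \<Rightarrow> state \<Rightarrow> bool" where
  "snd_inv q M x b ST \<longleftrightarrow> vars ST 12 = M \<and> (\<forall>i<M. arrs ST 12 i = q * x i) \<and>
     b \<le> length (snds (trace ST)) \<and> vars ST 51 = (length (snds (trace ST)) - b) mod M \<and>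
     (\<forall>j. b \<le> j \<longrightarrow> j < length (snds (trace ST)) \<longrightarrow> snds (trace ST) ! j div q = x ((j - b) mod M))"

definition sim :: "nat \<Rightarrow> nat \<Rightarrow> nat \<Rightarrow> event list \<Rightarrow> state \<Rightarrow> state \<Rightarrow> bool" where
  "sim q m r pre st ST \<longleftrightarrow> (\<forall>v. vars ST (emb m r v) = vars st v) \<and>
     (\<forall>a. arrs ST (emb m r a) = arrs st a) \<and>
     (\<exists>mid. trace ST = pre @ mid \<and> map (strip q) mid = trace st)"

lemma big_step_trace: "big_step orc inp c st t st' \<Longrightarrow> \<exists>new. trace st' = trace st @ new"
  by (induction rule: big_step.induct) auto

text \<open>The induction follows the given execution. The bound on the symbols is required of its
  final trace and passes to the intermediate ones, since traces only grow. The factor in the time is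
  due to reception, where the quotient of the division is below E.\<close>

lemma simulation:
  assumes "big_step orc inp0 c st t st'" "inp0 = (\<lambda>i. inp (length pre + i) mod q)"
    and "sim q m r pre st ST" "rcv_inv q E ST" "snd_inv q M x b ST"
    and "\<And>ev. ev \<in> set (trace st') \<Longrightarrow> sym ev < q" "\<And>i. inp i < q * E" "0 < q" "0 < M" "r < m"
  shows "wp (orc, inp) (lift q m r c) (\<lambda>T ST'. T \<le> (6 * E + 12) * t \<and> sim q m r pre st' ST' \<and>
    rcv_inv q E ST' \<and> snd_inv q M x b ST') ST"
  using assms
proof (induction arbitrary: ST rule: big_step.induct)
  case (Skip st)
  then show ?case by (simp add: wp_simps)
next
  case (SetC y v st)
  then show ?case by (simp add: wp_simps sim_def rcv_inv_def snd_inv_def)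
next
  case (Add y1 st y2 z)
  then show ?case by (simp add: wp_simps sim_def rcv_inv_def snd_inv_def)
next
  case (Sub y1 st y2 z)
  then show ?case by (simp add: wp_simps sim_def rcv_inv_def snd_inv_def)
next
  case (Load y st a i)
  then show ?case by (simp add: wp_simps sim_def rcv_inv_def snd_inv_def)
next
  case (Store a i y st)
  then show ?case by (simp add: wp_simps sim_def rcv_inv_def snd_inv_def)
next
  case (Send y st)
  obtain mid where mid: "trace ST = pre @ mid" "map (strip q) mid = trace st"
    using Send.prems by (auto simp: sim_def)
  let ?n = "length (snds (trace ST)) - b"
  let ?v = "q * x (?n mod M) + vars st y"
  have y: "vars st y < q" using Send.prems(5)[of "Snd (vars st y)"] by simp
  have v: "vars ST 51 = ?n mod M" "vars ST 12 = M" "arrs ST 12 (?n mod M) = q * x (?n mod M)"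
    "vars ST (emb m r y) = vars st y" "b \<le> length (snds (trace ST))"
    using Send.prems by (auto simp: snd_inv_def sim_def)
  have vq: "?v mod q = vars st y" "?v div q = x (?n mod M)" using y Send.prems by simp_all
  have wrap: "Suc ?n mod M = (if M - Suc (?n mod M) = 0 then 0 else Suc (?n mod M))"
    using mod_less_divisor[OF Send.prems(8), of ?n] by (auto simp: mod_Suc)
  have post: "sim q m r pre (log_event (Snd (vars st y)) st) F \<and> rcv_inv q E F \<and> snd_inv q M x b F"
    if F: "\<And>z. vars F (emb m r z) = vars ST (emb m r z)" "arrs F = arrs ST" "vars F 12 = M"
      "vars F 56 = vars ST 56" "vars F 51 = Suc ?n mod M" "trace F = trace ST @ [Snd ?v]" for F
  proof (intro conjI)
    have "strip q (Snd ?v) = Snd (vars st y)" using vq by simp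
    then show "sim q m r pre (log_event (Snd (vars st y)) st) F"
      using Send.prems(2) mid F by (simp add: sim_def)
    show "rcv_inv q E F" using Send.prems(3) F by (simp add: rcv_inv_def)
    show "snd_inv q M x b F" using Send.prems(4) F v(5) vq Suc_diff_le[OF v(5)]
      by (auto simp: snd_inv_def nth_append less_Suc_eq)
  qed
  show ?case
  proof (cases "M - Suc (?n mod M) = 0")
    case True
    then show ?thesis
      using v wrap post by (simp add: wp_simps wp_INC)
  next
    case False
    then show ?thesis
      using v wrap post by (simp add: wp_simps wp_INC)
  qed
next
  case (Recv v st y)
  obtain mid where mid: "trace ST = pre @ mid" "map (strip q) mid = trace st"
    using Recv.prems by (auto simp: sim_def)
  have len: "length (trace ST) = length pre + length (trace st)"
    using mid by (metis length_append length_map)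
  let ?v = "inp (length (trace ST))"
  have v: "v = ?v mod q" using Recv.hyps Recv.prems(1) len by simp
  have vE: "?v div q < E" using Recv.prems(6)[of "length (trace ST)"]
    by (simp add: less_mult_imp_div_less mult.commute)
  show ?case
    apply (simp add: wp_Seq wp_Recv wp_SetC)
    apply (rule wp_DIVMOD)
    subgoal by simp
    subgoal using Recv.prems by simp
    subgoal premises p for t s
    proof -
      note F = frD(1)[OF p(2)] frD(2)[OF p(2)] frD(3)[OF p(2)]
      have t: "t \<le> 6 * E + 5" using p(1) vE by simp
      have strp: "strip q (Rcv ?v) = Rcv v" using v by simp
      let ?F = "set_var 56 (Suc (vars s 56)) (set_var 2 1 (set_arr 13 (vars s 56) (vars s 54) s))"
      have "sim q m r pre (log_event (Rcv v) (set_var y v st)) ?F"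
        using Recv.prems(2,9) mid F p(3) strp v by (auto simp: sim_def)
      moreover have "rcv_inv q E ?F" using Recv.prems(3) F p(4) vE
        by (auto simp: rcv_inv_def nth_append less_Suc_eq)
      moreover have "snd_inv q M x b ?F" using Recv.prems(4) F by (simp add: snd_inv_def)
      ultimately show ?thesis using t by (simp add: wp_simps wp_INC)
    qed
    done
next
  case (Query h st a i l y)
  then show ?case by (simp add: wp_simps sim_def rcv_inv_def snd_inv_def)
next
  case (Seq c st t st1 d u st2)
  have "\<exists>new. trace st2 = trace st1 @ new" using Seq.hyps(2) by (rule big_step_trace)
  then have sub: "sym ev < q" if "ev \<in> set (trace st1)" for ev using Seq.prems(5) that by auto
  show ?case
    apply (simp only: lift.simps)
    apply (rule wp_SeqI[OF Seq.IH(1)[OF Seq.prems(1-4) _ Seq.prems(6-9)]])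
    subgoal by (rule sub)
    subgoal premises p for T S
      apply (rule wp_mono[OF Seq.IH(2)[of S]])
      using Seq.prems p by (auto simp: algebra_simps)
    done
next
  case (IfTrue st y c t st' d)
  have "vars ST (emb m r y) \<noteq> 0" using IfTrue by (simp add: sim_def)
  with IfTrue.IH[OF IfTrue.prems] show ?case
    by (simp add: wp_If) (erule wp_mono, auto)
next
  case (IfFalse st y d t st' c)
  have "vars ST (emb m r y) = 0" using IfFalse by (simp add: sim_def)
  with IfFalse.IH[OF IfFalse.prems] show ?case
    by (simp add: wp_If) (erule wp_mono, auto)
next
  case (WhileTrue st y c t st1 u st2)
  have nz: "vars ST (emb m r y) \<noteq> 0" using WhileTrue by (simp add: sim_def)
  have "\<exists>new. trace st2 = trace st1 @ new" using WhileTrue.hyps(3) by (rule big_step_trace)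
  then have "\<And>ev. ev \<in> set (trace st1) \<Longrightarrow> sym ev < q" using WhileTrue.prems(5) by auto
  from WhileTrue.IH(1)[OF WhileTrue.prems(1-4) this WhileTrue.prems(6-9)]
  obtain T1 S1 where 1: "big_step orc inp (lift q m r c) ST T1 S1" "T1 \<le> (6 * E + 12) * t"
    "sim q m r pre st1 S1" "rcv_inv q E S1" "snd_inv q M x b S1" unfolding wp_def by auto
  from WhileTrue.IH(2)[OF WhileTrue.prems(1) 1(3-5) WhileTrue.prems(5-9)]
  obtain T2 S2 where 2: "big_step orc inp (WhileNZ (emb m r y) (lift q m r c)) S1 T2 S2" "T2 \<le> (6 * E + 12) * u"
    "sim q m r pre st2 S2" "rcv_inv q E S2" "snd_inv q M x b S2" unfolding wp_def by auto
  from big_step.WhileTrue[OF nz 1(1) 2(1)] 1 2 show ?case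
    unfolding wp_def by (intro exI[of _ "Suc (T1 + T2)"] exI[of _ S2]) (auto simp: algebra_simps)
next
  case (WhileFalse st y c)
  have "vars ST (emb m r y) = 0" using WhileFalse by (simp add: sim_def)
  from big_step.WhileFalse[OF this] WhileFalse.prems show ?case
    unfolding wp_def by (intro exI[of _ 1] exI[of _ ST]) (auto simp: )
qed

section \<open>Candidate transcripts\<close>

text \<open>The test that a party can make with its own oracle. The range check makes the number in
  base p determine the transcript, also in the rounds of the other party.\<close>

definition consistent :: "(nat list \<Rightarrow> nat) \<Rightarrow> nat \<Rightarrow> (nat \<Rightarrow> nat) \<Rightarrow> nat \<Rightarrow> nat \<Rightarrow> bool" where
  "consistent orc p A i l \<longleftrightarrow> (\<forall>j<l. A (i + j) < p \<and>
     (orc (segment A i j) = 0 \<or> orc (segment A i j) = Suc (A (i + j))))"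

text \<open>A transcript is represented by the number that it denotes in base \<open>p\<close>, plus one.\<close>

definition entry :: "(nat list \<Rightarrow> nat) \<Rightarrow> nat \<Rightarrow> nat \<Rightarrow> nat \<Rightarrow> (nat \<Rightarrow> nat) \<Rightarrow> nat \<Rightarrow> nat" where
  "entry orc p n c A e = (if e < c \<and> consistent orc p A (e * n) n
     then Suc (hn (\<lambda>j. A (e * n + j)) p n) else 0)"

definition SCAN :: "nat \<Rightarrow> nat \<Rightarrow> com" where
  "SCAN p a = FOR 66 67 3 (Seq (Add 68 61 66) (Seq (Load 69 a 68) (Seq (SetC 70 p) (Seq (MOV 71 69)
     (Seq (INC 71) (Seq (Sub 72 71 70) (Seq (IfNZ 72 (SetC 65 0) Skip) (Seq (Query 73 a 61 66)
     (Seq (IfNZ 73 (Seq (Sub 72 73 71) (Seq (Sub 74 71 73) (Seq (Add 72 72 74)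
       (IfNZ 72 (SetC 65 0) Skip)))) Skip)
     (Seq (MULC 74 64 p) (Add 64 74 69)))))))))))"

text \<open>Every run contributes exactly s entries, with 0 where the output list is shorter or the
  transcript is refuted. Hence entry j of an epoch belongs to run j div s.\<close>

definition EXTRACT :: "nat \<Rightarrow> nat \<Rightarrow> nat \<Rightarrow> nat \<Rightarrow> com" where
  "EXTRACT p s v a = Seq (SetC 60 s) (Seq (SetC 61 0) (FOR 62 63 60 (Seq (SetC 64 0) (Seq (SetC 65 1)
     (Seq (SCAN p a) (Seq (Sub 68 v 62) (Seq (IfNZ 68 Skip (SetC 65 0))
     (Seq (IfNZ 65 (INC 64) (SetC 64 0)) (Seq (Store 14 58 64) (Seq (INC 58) (Add 61 61 3)))))))))))"

lemma EXTRACT_frame [simp]: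
  "wv (SCAN p a) = {2, 64, 65, 66, 67, 68, 69, 70, 71, 72, 73, 74}" "wa (SCAN p a) = {}"
  "silent (SCAN p a)"
  "wv (EXTRACT p s v a) = {2, 58, 60, 61, 62, 63, 64, 65, 66, 67, 68, 69, 70, 71, 72, 73, 74}"
  "wa (EXTRACT p s v a) = {14}" "silent (EXTRACT p s v a)"
  by (auto simp: SCAN_def EXTRACT_def)

lemma wp_SCAN:
  assumes "vars st 3 = n" "vars st 61 = i" "vars st 64 = 0" "vars st 65 = 1"
  shows "wp e (SCAN p a) (\<lambda>t s. t \<le> n * (p + 30) + 4 \<and>
    vars s 64 = hn (\<lambda>j. arrs st a (i + j)) p n \<and>
    (vars s 65 \<noteq> 0 \<longleftrightarrow> consistent (fst e) p (arrs st a) i n)) st"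
  unfolding SCAN_def
  apply (rule wp_FOR[where N = n and b = "p + 25" and I = "\<lambda>l s.
    vars s 64 = hn (\<lambda>j. arrs st a (i + j)) p l \<and>
    (vars s 65 \<noteq> 0 \<longleftrightarrow> consistent (fst e) p (arrs st a) i l)"])
  subgoal by simp
  subgoal using assms by simp
  subgoal by simp
  subgoal using assms by (simp add: consistent_def)
  subgoal premises p for l s
  proof -
    note F = frD(1)[OF p(3)] frD(2)[OF p(3)]
    have v: "vars s 61 = i" "vars s 66 = l" "arrs s a = arrs st a" using F p(2) assms by simp_all
    let ?d = "arrs st a (i + l)" and ?o = "fst e (segment (arrs st a) i l)"
    have c: "consistent (fst e) p (arrs st a) i (Suc l) \<longleftrightarrow>
      consistent (fst e) p (arrs st a) i l \<and> ?d < p \<and> (?o = 0 \<or> ?o = Suc ?d)"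
      by (auto simp: consistent_def less_Suc_eq)
    have eq: "?o - Suc ?d + (Suc ?d - ?o) = 0 \<longleftrightarrow> ?o = Suc ?d" by auto
    show ?thesis using p(4) v c eq
      by (auto simp: wp_simps wp_MOV wp_INC wp_MULC)
  qed
  subgoal premises p for t s using p(1,3) by (simp add: add_ac)
  done

lemma wp_EXTRACT:
  assumes n: "vars st 3 = n" and a: "14 \<noteq> a" and v: "100 \<le> v"
  shows "wp e (EXTRACT p s v a) (\<lambda>t s'. t \<le> s * (n * (p + 30) + 40) + 10 \<and>
    vars s' 58 = vars st 58 + s \<and>
    (\<forall>j<s. arrs s' 14 (vars st 58 + j) = entry (fst e) p n (vars st v) (arrs st a) j) \<and>
    (\<forall>i<vars st 58. arrs s' 14 i = arrs st 14 i)) st"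
  unfolding EXTRACT_def wp_Seq wp_SetC
  apply (rule wp_FOR[where N = s and b = "n * (p + 30) + 30" and I = "\<lambda>j s'. vars s' 61 = j * n \<and>
    vars s' 58 = vars st 58 + j \<and>
    (\<forall>j'<j. arrs s' 14 (vars st 58 + j') = entry (fst e) p n (vars st v) (arrs st a) j') \<and>
    (\<forall>i<vars st 58. arrs s' 14 i = arrs st 14 i)"])
  subgoal by simp
  subgoal by simp
  subgoal by simp
  subgoal by simp
  subgoal premises p1 for j s1
  proof -
    note F1 = frD(1)[OF p1(3)] frD(2)[OF p1(3)]
    have v1: "vars s1 3 = n" "vars s1 v = vars st v" "arrs s1 a = arrs st a" "vars s1 62 = j"
      using F1 n a v p1(2) by auto
    note I1 = p1(4)
    have c: "wp e (SCAN p a) (\<lambda>t s. t \<le> n * (p + 30) + 4 \<and>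
      vars s 64 = hn (\<lambda>i. arrs (set_var 65 1 (set_var 64 0 s1)) a (j * n + i)) p n \<and>
      (vars s 65 \<noteq> 0 \<longleftrightarrow> consistent (fst e) p (arrs (set_var 65 1 (set_var 64 0 s1)) a) (j * n) n))
      (set_var 65 1 (set_var 64 0 s1))"
      by (rule wp_SCAN) (use v1 I1 in auto)
    show ?thesis
      unfolding wp_Seq wp_SetC
      apply (rule wp_fr, rule wp_mono[OF c], clarify)
      subgoal premises p2 for t2 s2
      proof -
        note F2 = frD(1)[OF p2(4)] frD(2)[OF p2(4)]
        have v2: "vars s2 3 = n" "vars s2 v = vars st v" "vars s2 62 = j" "vars s2 61 = j * n"
          "vars s2 58 = vars st 58 + j" "arrs s2 14 = arrs s1 14"
          using F2 v1 I1 v by auto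
        have vv: "v \<noteq> 68" "v \<noteq> 65" "v \<noteq> 64" using v by auto
        show ?thesis using p2(1-3) v1 v2 I1 vv
          by (auto simp: wp_simps wp_INC entry_def less_Suc_eq)
      qed
      done
  qed
  subgoal premises p1 for t s1 using p1(1,3) by (simp add: algebra_simps)
  done

section \<open>Selection of candidates and the additional symbols that carry them\<close>

definition sel :: "nat \<Rightarrow> nat \<Rightarrow> nat list \<Rightarrow> nat \<Rightarrow> nat list \<Rightarrow> nat list" where
  "sel th m E x cs = (if x \<noteq> 0 \<and> th \<le> count_list E x \<and> x \<notin> set cs \<and> length cs < m
     then cs @ [x] else cs)"

definition cands :: "nat list \<Rightarrow> state \<Rightarrow> bool" where
  "cands cs st \<longleftrightarrow> vars st 57 = length cs \<and> (\<forall>i<length cs. arrs st 15 i = cs ! i)"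

definition SELECT :: "nat \<Rightarrow> nat \<Rightarrow> nat \<Rightarrow> com" where
  "SELECT N th m = Seq (SetC 60 N) (FOR 61 62 60 (Seq (Load 63 14 61) (Seq (SetC 64 0)
    (Seq (FOR 65 66 60 (Seq (Load 67 14 65) (Seq (Sub 68 67 63) (Seq (Sub 74 63 67)
      (Seq (Add 68 68 74) (IfNZ 68 Skip (INC 64)))))))
    (Seq (SetC 69 0) (Seq (FOR 65 66 57 (Seq (Load 67 15 65) (Seq (Sub 68 67 63) (Seq (Sub 74 63 67)
      (Seq (Add 68 68 74) (IfNZ 68 Skip (SetC 69 1)))))))
    (Seq (SetC 70 th) (Seq (Sub 71 70 64) (Seq (SetC 72 m) (Seq (Sub 73 72 57)
    (IfNZ 63 (IfNZ 71 Skip (IfNZ 69 Skip (IfNZ 73 (Seq (Store 15 57 63) (INC 57)) Skip))) Skip)))))))))))"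

lemma SELECT_frame [simp]:
  "wv (SELECT N th m) = {2, 57, 60, 61, 62, 63, 64, 65, 66, 67, 68, 69, 70, 71, 72, 73, 74}"
  "wa (SELECT N th m) = {15}" "silent (SELECT N th m)"
  by (auto simp: SELECT_def)

lemma length_sel: "length cs \<le> m \<Longrightarrow> length (fold (sel th m E) xs cs) \<le> m"
  by (induction xs arbitrary: cs) (auto simp: sel_def)

lemma wp_SELECT:
  assumes c: "cands cs st" "length cs \<le> m" and E: "E = map (arrs st 14) [0..<N]"
  shows "wp e (SELECT N th m) (\<lambda>t s. t \<le> N * (N * 20 + m * 20 + 60) + 20 \<and>
    cands (fold (sel th m E) E cs) s) st"
  unfolding SELECT_def wp_Seq wp_SetC
  apply (rule wp_FOR[where N = N and b = "N * 20 + m * 20 + 50" and I = "\<lambda>j s.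
    cands (fold (sel th m E) (take j E) cs) s"])
  subgoal by simp
  subgoal by simp
  subgoal by (simp add: cands_def)
  subgoal using c by (simp add: cands_def)
  subgoal premises p1 for j s1
  proof -
    note F1 = frD(1)[OF p1(3)] frD(2)[OF p1(3)]
    let ?cs = "fold (sel th m E) (take j E) cs" and ?x = "E ! j"
    have lE: "length E = N" by (simp add: E)
    have v1: "vars s1 60 = N" "vars s1 61 = j" "arrs s1 14 j = ?x" "\<And>i. i < N \<Longrightarrow> arrs s1 14 i = E ! i"
      using F1 p1(1,2) by (simp_all add: E)
    have nc: "vars s1 57 = length ?cs" "\<And>i. i < length ?cs \<Longrightarrow> arrs s1 15 i = ?cs ! i"
      using p1(4) by (auto simp: cands_def)
    have lcs: "length ?cs \<le> m" by (rule length_sel[OF c(2)])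
    show ?thesis
      apply (simp add: wp_Seq wp_Load wp_SetC v1)
      apply (rule wp_FOR[where N = N and b = 10 and I = "\<lambda>i s. vars s 63 = ?x \<and>
        vars s 64 = count_list (take i E) ?x"])
      subgoal by simp
      subgoal using v1 by simp
      subgoal by simp
      subgoal by simp
      subgoal premises p2 for i s2
      proof -
        have v2: "arrs s2 14 i = E ! i" "vars s2 65 = i" using frD(2)[OF p2(3)] v1 p2(1,2) by simp_all
        have tk: "take (Suc i) E = take i E @ [E ! i]" using p2(1) lE by (simp add: take_Suc_conv_app_nth)
        show ?thesis
        proof (cases "E ! i = ?x")
          case True
          then show ?thesis using p2(4) v2 by (simp add: wp_simps wp_INC tk)
        next
          case False
          then have "E ! i - ?x + (?x - E ! i) \<noteq> 0" by linarith
          then show ?thesis using False p2(4) v2 by (simp add: wp_simps wp_INC tk)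
        qed
      qed
      subgoal premises p2 for t2 s2
      proof -
        note F2 = frD(1)[OF p2(2)] frD(2)[OF p2(2)]
        have v2: "vars s2 57 = length ?cs" "\<And>i. i < length ?cs \<Longrightarrow> arrs s2 15 i = ?cs ! i" "vars s2 63 = ?x"
          "vars s2 64 = count_list E ?x"
          using F2 nc p2(3) lE by simp_all
        show ?thesis
          apply (rule wp_FOR[where N = "length ?cs" and b = 10 and I = "\<lambda>i s. vars s 69 =
            (if ?x \<in> set (take i ?cs) then 1 else 0)"])
          subgoal by simp
          subgoal using v2 by simp
          subgoal by simp
          subgoal by simp
          subgoal premises p3 for i s3
          proof -
            note F3 = frD(1)[OF p3(3)] frD(2)[OF p3(3)]
            have v3: "arrs s3 15 i = ?cs ! i" "vars s3 65 = i" "vars s3 63 = ?x"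
              using F3 v2 p3(1,2) by simp_all
            have tk: "take (Suc i) ?cs = take i ?cs @ [?cs ! i]"
              using p3(1) by (rule take_Suc_conv_app_nth)
            show ?thesis
            proof (cases "?cs ! i = ?x")
              case True
              then show ?thesis using p3(4) v3 by (simp add: wp_simps tk)
            next
              case False
              then have "?cs ! i - ?x + (?x - ?cs ! i) \<noteq> 0" by linarith
              then show ?thesis using False p3(4) v3 by (auto simp: wp_simps tk)
            qed
          qed
          subgoal premises p3 for t3 s3
          proof -
            note F3 = frD(1)[OF p3(2)] frD(2)[OF p3(2)]
            have v3: "vars s3 57 = length ?cs" "\<And>i. i < length ?cs \<Longrightarrow> arrs s3 15 i = ?cs ! i" "vars s3 63 = ?x"
              "vars s3 64 = count_list E ?x" "vars s3 69 = (if ?x \<in> set ?cs then 1 else 0)"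
              using F3 v2 p3(3) by simp_all
            have t3: "t3 \<le> m * 15 + 4" using p3(1) mult_le_mono1[OF lcs, of 15] by simp
            have tk: "fold (sel th m E) (take (Suc j) E) cs = sel th m E ?x ?cs"
              using p1(1) lE by (simp add: take_Suc_conv_app_nth)
            show ?thesis using p2(1) t3 v3 unfolding tk sel_def
              by (auto simp: wp_simps wp_INC cands_def nth_append less_Suc_eq)
          qed
          done
      qed
      done
  qed
  subgoal premises p1 for t s1
    using p1(1,3) E by (simp add: algebra_simps)
  done

definition coded :: "nat \<Rightarrow> nat \<Rightarrow> nat \<Rightarrow> nat list \<Rightarrow> state \<Rightarrow> bool" where
  "coded p d g cs st \<longleftrightarrow> (\<forall>a<length cs. \<forall>i<code_len p d g.
     arrs st 11 (a * code_len p d g + i) = code p d g (cs ! a - 1) i)"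

definition ENCALL :: "nat \<Rightarrow> nat \<Rightarrow> com" where
  "ENCALL p d = Seq (SetC 41 0) (FOR 60 61 57 (Seq (Load 40 15 60) (Seq (DEC 40) (ENCODE p d))))"

lemma ENCALL_frame [simp]:
  "wv (ENCALL p d) = {2, 20, 21, 22, 23, 24, 25, 26, 27, 28, 29, 30, 31, 32, 33, 34, 35, 36, 37, 38,
     40, 41, 42, 43, 44, 45, 47, 48, 49, 60, 61}"
  "wa (ENCALL p d) = {8, 9, 10, 11}" "silent (ENCALL p d)"
  by (auto simp: ENCALL_def)

lemma wp_ENCALL:
  assumes pdg: "2 \<le> p" "0 < d" "0 < g" and r: "ready p d g st" and c: "cands cs st"
    and X: "\<And>x. x \<in> set cs \<Longrightarrow> x - 1 < p ^ (g * axis_in p g ^ 4)"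
  shows "wp e (ENCALL p d) (\<lambda>t s. t \<le> length cs * (enc_time p d g + 10) + 10 \<and> coded p d g cs s) st"
  unfolding ENCALL_def wp_Seq wp_SetC
  apply (rule wp_FOR[where N = "length cs" and b = "enc_time p d g + 5" and I = "\<lambda>a s.
    vars s 41 = a * code_len p d g \<and> (\<forall>a'<a. \<forall>i<code_len p d g.
     arrs s 11 (a' * code_len p d g + i) = code p d g (cs ! a' - 1) i)"])
  subgoal by simp
  subgoal using c by (simp add: cands_def)
  subgoal by simp
  subgoal by simp
  subgoal premises p1 for a s1
  proof -
    note F1 = frD(1)[OF p1(3)] frD(2)[OF p1(3)]
    have v1: "arrs s1 15 a = cs ! a" "vars s1 60 = a" using F1 c p1(1,2) by (simp_all add: cands_def)
    have "ready p d g (set_var 41 0 st)" using r by (simp add: ready_def prm_def)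
    then have "ready p d g s1" by (rule ready_fr[OF _ p1(3)]) auto
    then have r1: "ready p d g (set_var 40 (cs ! a - Suc 0) (set_var 2 (Suc 0) (set_var 40 (cs ! a) s1)))"
      by (simp add: ready_def prm_def)
    have lt: "a' * code_len p d g + i < a * code_len p d g" if "a' < a" "i < code_len p d g" for a' i
      using that by (rule index_less)
    show ?thesis
      apply (simp add: wp_Seq wp_Load wp_DEC v1)
      apply (rule wp_mono[OF wp_ENCODE[OF pdg r1, where X = "cs ! a - Suc 0"]])
      subgoal by simp
      subgoal using X[of "cs ! a"] p1(1) by simp
      subgoal premises p2 for t2 s2
        using p2 p1(4) lt by (auto simp: less_Suc_eq add.commute)
      done
  qed
  subgoal premises p1 for t1 s1
    using p1(1,3) by (simp add: coded_def add_ac)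
  done

text \<open>The code symbols are shifted by one, so that the digit 0 in base 8^d + 1 means that
  there is no such candidate.\<close>

definition xsym :: "nat \<Rightarrow> nat \<Rightarrow> nat \<Rightarrow> nat list \<Rightarrow> nat \<Rightarrow> nat" where
  "xsym p d g cs i = (\<Sum>a<length cs. Suc (code p d g (cs ! a - 1) i) * (8 ^ d + 1) ^ a)"

definition EXTB :: "nat \<Rightarrow> nat \<Rightarrow> com" where
  "EXTB q Q = Seq (FOR 60 61 12 (Seq (SetC 62 0) (Store 12 60 62))) (Seq (SetC 63 q) (Seq (SetC 64 0)
    (FOR 65 66 57 (Seq (FOR 67 68 12 (Seq (Load 69 11 64) (Seq (INC 69) (Seq (Load 70 12 67)
      (Seq (FOR 71 72 69 (Add 70 70 63)) (Seq (Store 12 67 70) (INC 64)))))))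
    (Seq (MULC 73 63 (Q + 1)) (MOV 63 73))))))"

lemma EXTB_frame [simp]:
  "wv (EXTB q Q) = {2, 60, 61, 62, 63, 64, 65, 66, 67, 68, 69, 70, 71, 72, 73}"
  "wa (EXTB q Q) = {12}" "silent (EXTB q Q)"
  by (auto simp: EXTB_def)

lemma wp_EXTB:
  assumes M: "vars st 12 = code_len p d g" and nc: "vars st 57 = length cs" and c: "coded p d g cs st"
  shows "wp e (EXTB q (8 ^ d)) (\<lambda>t s. t \<le> code_len p d g * 10 + length cs * (code_len p d g * (6 * 8 ^ d + 30) + 8 ^ d + 30) + 20 \<and>
    (\<forall>i<code_len p d g. arrs s 12 i = q * xsym p d g cs i)) st"
proof -
  let ?M = "code_len p d g"
  define S where "S a i = q * (\<Sum>a<a. Suc (code p d g (cs ! a - 1) i) * (8 ^ d + 1) ^ a)" for a i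
  have S_0: "S 0 i = 0" for i by (simp add: S_def)
  have S_Suc: "S (Suc a) i = S a i + Suc (code p d g (cs ! a - 1) i) * (q * (8 ^ d + 1) ^ a)" for a i
    by (simp add: S_def algebra_simps)
  have S_len: "S (length cs) i = q * xsym p d g cs i" for i by (simp add: S_def xsym_def)
  show ?thesis
    unfolding EXTB_def wp_Seq
    apply (rule wp_FOR[where N = ?M and b = 2 and I = "\<lambda>j s. \<forall>i<j. arrs s 12 i = 0"])
    subgoal by simp
    subgoal using M by simp
    subgoal by simp
    subgoal by simp
    subgoal by (auto simp: wp_simps less_Suc_eq)
    subgoal premises p0 for t0 s0
    proof -
      note F0 = frD(1)[OF p0(2)] frD(2)[OF p0(2)]
      have v0: "vars s0 57 = length cs" "vars s0 12 = ?M" "arrs s0 11 = arrs st 11"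
        using F0 nc M by simp_all
      show ?thesis
        unfolding wp_SetC
        apply (rule wp_FOR[where N = "length cs" and b = "?M * (6 * 8 ^ d + 30) + 8 ^ d + 20" and
          I = "\<lambda>a s. vars s 63 = q * (8 ^ d + 1) ^ a \<and> vars s 64 = a * ?M \<and> (\<forall>i<?M. arrs s 12 i = S a i)"])
        subgoal by simp
        subgoal using v0 by simp
        subgoal by simp
        subgoal using p0(3) by (simp add: S_0)
        subgoal premises p1 for a s1
        proof -
          note F1 = frD(1)[OF p1(3)] frD(2)[OF p1(3)]
          have v1: "vars s1 12 = ?M" "arrs s1 11 = arrs st 11" using F1 v0 by simp_all
          note I1 = p1(4)
          show ?thesis
            unfolding wp_Seq
            apply (rule wp_FOR[where N = ?M and b = "6 * 8 ^ d + 22" and I = "\<lambda>i s. vars s 64 = a * ?M + i \<and>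
              (\<forall>i'<?M. arrs s 12 i' = (if i' < i then S (Suc a) i' else S a i'))"])
            subgoal by simp
            subgoal using v1 by simp
            subgoal by simp
            subgoal using I1 by simp
            subgoal premises p2 for i s2
            proof -
              note F2 = frD(1)[OF p2(3)] frD(2)[OF p2(3)]
              let ?c = "code p d g (cs ! a - 1) i"
              have v2: "vars s2 63 = q * (8 ^ d + 1) ^ a" "vars s2 67 = i"
                "arrs s2 11 (a * ?M + i) = ?c"
                using F2 I1 p2(1,2) v1 c p1(1) by (simp_all add: coded_def)
              have cQ: "?c < 8 ^ d" by (rule code_less)
              note I2 = p2(4)
              have old: "arrs s2 12 i = S a i" using I2 p2(1) by simp
              show ?thesis
                apply (simp add: wp_simps wp_INC)
                apply (rule wp_FOR[where N = "Suc ?c" and b = 1 and I = "\<lambda>l s. vars s 63 = q * (8 ^ d + 1) ^ a \<and>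
                  vars s 70 = S a i + l * (q * (8 ^ d + 1) ^ a)"])
                subgoal by simp
                subgoal using v2 I2 by simp
                subgoal by simp
                subgoal using v2 old by simp
                subgoal by (simp add: wp_simps)
                subgoal premises p3 for t3 s3
                proof -
                  note F3 = frD(1)[OF p3(2)] frD(2)[OF p3(2)]
                  have "t3 \<le> 6 * 8 ^ d + 10" using p3(1) cQ by simp
                  moreover have "vars s3 70 = S (Suc a) i" using p3(3) by (simp add: S_Suc)
                  moreover have "vars s3 67 = i" "vars s3 64 = a * ?M + i" "arrs s3 12 = arrs s2 12"
                    using F3 v2 I2 by simp_all
                  ultimately show ?thesis using I2
                    by (auto simp: wp_simps wp_INC less_Suc_eq)
                qed
                done
            qed
            subgoal premises p2 for t2 s2
            proof -
              note F2 = frD(1)[OF p2(2)]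
              have "vars s2 63 = q * (8 ^ d + 1) ^ a" using F2 I1 by simp
              then show ?thesis using p2(1,3)
                by (simp add: wp_MULC wp_MOV algebra_simps)
            qed
            done
        qed
        subgoal premises p1 for t1 s1
          using p1(1,3) p0(1) by (simp add: S_len algebra_simps)
        done
    qed
    done
qed

section \<open>The final decision\<close>

text \<open>The receiver does not know at which place of the sender's list a transcript stands, so a
  match with any of the m digits counts.\<close>

definition hold :: "nat \<Rightarrow> nat \<Rightarrow> nat \<Rightarrow> nat \<Rightarrow> nat list \<Rightarrow> nat \<Rightarrow> nat \<Rightarrow> nat \<Rightarrow> bool" where
  "hold p d g m cs e i a \<longleftrightarrow>
     (\<exists>c<m. e div (8 ^ d + 1) ^ c mod (8 ^ d + 1) = Suc (code p d g (cs ! a - 1) i))"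

text \<open>A symbol that fits several own candidates counts for none of them, which keeps the
  supports of different candidates disjoint.\<close>

definition wins :: "nat \<Rightarrow> nat \<Rightarrow> nat \<Rightarrow> nat \<Rightarrow> nat list \<Rightarrow> nat \<Rightarrow> nat \<Rightarrow> nat \<Rightarrow> bool" where
  "wins p d g m cs e i a \<longleftrightarrow> a < length cs \<and> hold p d g m cs e i a \<and>
     (\<forall>a'<length cs. hold p d g m cs e i a' \<longrightarrow> a' = a)"

definition DIGITS :: com where
  "DIGITS = FOR 71 72 69 (Seq (DIVMOD 68 70 73 74) (Seq (Store 16 71 68) (MOV 68 73)))"

text \<open>Variable 75 counts the candidates that hold and variable 76 remembers the last of them,
  which is the winner if the count is 1.\<close>

definition SUPP :: com where
  "SUPP = Seq (SetC 75 0) (Seq (SetC 76 0) (Seq (MOV 77 65) (FOR 71 72 57 (Seq (Load 78 11 77)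
    (Seq (INC 78) (Seq (SetC 79 0) (Seq (FOR 80 81 69 (Seq (Load 82 16 80) (Seq (Sub 83 82 78)
      (Seq (Sub 84 78 82) (Seq (Add 83 83 84) (IfNZ 83 Skip (SetC 79 1)))))))
    (Seq (IfNZ 79 (Seq (INC 75) (MOV 76 71)) Skip) (Add 77 77 12)))))))))"

definition VOTE1 :: "nat \<Rightarrow> nat \<Rightarrow> com" where
  "VOTE1 m B = Seq (Load 68 13 61) (Seq (SetC 69 m) (Seq (SetC 70 B) (Seq DIGITS (Seq SUPP
    (Seq (MOV 83 75) (Seq (DEC 83) (Seq (IfNZ 83 Skip (IfNZ 75 (Seq (Add 83 62 76) (Seq (Load 84 17 83)
      (Seq (INC 84) (Seq (Store 17 83 84) (Seq (Load 84 18 63) (Seq (INC 84) (Store 18 63 84)))))))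
      Skip))
    (Seq (INC 61) (Seq (INC 65) (Seq (Sub 83 12 65) (IfNZ 83 Skip (SetC 65 0))))))))))))"

definition VOTE :: "nat \<Rightarrow> nat \<Rightarrow> nat \<Rightarrow> com" where
  "VOTE R m B = Seq (SetC 60 R) (Seq (SetC 61 0) (Seq (SetC 62 0) (FOR 63 64 60 (Seq (SetC 65 0)
    (Seq (FOR 66 67 59 (VOTE1 m B)) (Seq (SetC 83 m) (Add 62 62 83)))))))"

lemma VOTE_frame [simp]:
  "wv DIGITS = {2, 68, 71, 72, 73, 74}" "wa DIGITS = {16}" "silent DIGITS"
  "wv SUPP = {2, 71, 72, 75, 76, 77, 78, 79, 80, 81, 82, 83, 84}" "wa SUPP = {}" "silent SUPP"
  "wv (VOTE1 m B) = {2, 61, 65, 68, 69, 70, 71, 72, 73, 74, 75, 76, 77, 78, 79, 80, 81, 82, 83, 84}"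
  "wa (VOTE1 m B) = {16, 17, 18}" "silent (VOTE1 m B)"
  "wv (VOTE R m B) = {2, 60, 61, 62, 63, 64, 65, 66, 67, 68, 69, 70, 71, 72, 73, 74, 75, 76, 77, 78,
     79, 80, 81, 82, 83, 84}"
  "wa (VOTE R m B) = {16, 17, 18}" "silent (VOTE R m B)"
  by (auto simp: DIGITS_def SUPP_def VOTE1_def VOTE_def)

lemma wp_DIGITS:
  assumes "vars st 68 = x" "vars st 69 = m" "vars st 70 = B" "0 < B"
  shows "wp e DIGITS (\<lambda>t s. t \<le> m * (6 * x + 20) + 4 \<and> (\<forall>c<m. arrs s 16 c = x div B ^ c mod B)) st"
  unfolding DIGITS_def
  apply (rule wp_FOR[where N = m and b = "6 * x + 10" and I = "\<lambda>c s. vars s 68 = x div B ^ c \<and>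
    (\<forall>c'<c. arrs s 16 c' = x div B ^ c' mod B)"])
  subgoal by simp
  subgoal using assms by simp
  subgoal by simp
  subgoal using assms by simp
  subgoal premises p1 for c s1
  proof -
    have v1: "vars s1 70 = B" "vars s1 71 = c" using frD(1)[OF p1(3)] assms p1(2) by simp_all
    have le: "x div B ^ c div B \<le> x" by (meson div_le_dividend le_trans)
    have Suc: "x div B ^ Suc c = x div B ^ c div B" by (simp only: power_Suc2 div_mult2_eq)
    show ?thesis
      unfolding wp_Seq
      apply (rule wp_DIVMOD)
      subgoal by simp
      subgoal using v1 assms by simp
      subgoal premises p2 for t2 s2
        using p2(1,3,4) p1(4) v1 le frD(1)[OF p2(2)] frD(2)[OF p2(2)] unfolding Suc
        by (auto simp: wp_simps wp_MOV less_Suc_eq)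
      done
  qed
  subgoal premises p1 for t s1 using p1(1,3) by (simp add: algebra_simps)
  done

lemma wp_SUPP:
  assumes "vars st 57 = n" "vars st 65 = i" "vars st 69 = m" "vars st 12 = M"
    and h: "\<And>a. a < n \<Longrightarrow> h a \<longleftrightarrow> (\<exists>c<m. arrs st 16 c = Suc (arrs st 11 (a * M + i)))"
  shows "wp e SUPP (\<lambda>t s. t \<le> n * (m * 15 + 30) + 10 \<and> vars s 75 = card {a. a < n \<and> h a} \<and>
    (vars s 75 \<noteq> 0 \<longrightarrow> vars s 76 < n \<and> h (vars s 76))) st"
  unfolding SUPP_def
  apply (simp add: wp_Seq wp_SetC wp_MOV)
  apply (rule wp_FOR[where N = n and b = "m * 15 + 20" and I = "\<lambda>a s. vars s 77 = a * M + i \<and>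
    vars s 75 = card {a'. a' < a \<and> h a'} \<and> (vars s 75 \<noteq> 0 \<longrightarrow> vars s 76 < a \<and> h (vars s 76))"])
  subgoal by simp
  subgoal using assms by simp
  subgoal by simp
  subgoal using assms by simp
  subgoal premises p1 for a s1
  proof -
    note F1 = frD(1)[OF p1(3)] frD(2)[OF p1(3)]
    have v1: "vars s1 69 = m" "vars s1 12 = M" "arrs s1 11 = arrs st 11" "arrs s1 16 = arrs st 16" "vars s1 71 = a"
      using F1 assms p1(2) by simp_all
    note I1 = p1(4)
    let ?y = "Suc (arrs st 11 (a * M + i))"
    have set: "{a'. a' < Suc a \<and> h a'} = (if h a then insert a {a'. a' < a \<and> h a'} else {a'. a' < a \<and> h a'})"
      by (auto simp: less_Suc_eq)
    show ?thesis
      apply (simp add: wp_simps wp_INC)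
      apply (rule wp_FOR[where N = m and b = 8 and I = "\<lambda>c s. vars s 78 = ?y \<and>
        vars s 79 = (if \<exists>c'<c. arrs st 16 c' = ?y then 1 else 0)"])
      subgoal by simp
      subgoal using v1 by simp
      subgoal by simp
      subgoal using v1 I1 by simp
      subgoal premises p2 for c s2
      proof -
        note F2 = frD(1)[OF p2(3)] frD(2)[OF p2(3)]
        have v2: "arrs s2 16 c = arrs st 16 c" "vars s2 80 = c" using F2 v1 p2(2) by simp_all
        show ?thesis
        proof (cases "arrs st 16 c = ?y")
          case True
          then show ?thesis using p2(4) v2 by (auto simp: wp_simps less_Suc_eq)
        next
          case False
          then have "arrs st 16 c - ?y + (?y - arrs st 16 c) \<noteq> 0" by linarith
          then show ?thesis using False p2(4) v2 by (auto simp: wp_simps less_Suc_eq)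
        qed
      qed
      subgoal premises p2 for t2 s2
      proof -
        note F2 = frD(1)[OF p2(2)] frD(2)[OF p2(2)]
        have v2: "vars s2 75 = vars s1 75" "vars s2 76 = vars s1 76" "vars s2 77 = a * M + i" "vars s2 71 = a"
          "vars s2 12 = M" "vars s2 79 = (if h a then 1 else 0)"
          using F2 v1 I1 p2(3) h[OF p1(1)] by auto
        show ?thesis using p2(1) v2 I1 unfolding set
          by (auto simp: wp_simps wp_INC wp_MOV less_Suc_eq)
      qed
      done
  qed
  subgoal premises p1 for t s1 using p1(1,3) by (simp add: algebra_simps)
  done

lemma wp_VOTE1:
  assumes c: "coded p d g cs st" "vars st 57 = length cs" "vars st 12 = code_len p d g"
    and i: "vars st 65 = i" "i < code_len p d g" and x: "arrs st 13 (vars st 61) = x" "x \<le> E"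
  shows "wp e (VOTE1 m (8 ^ d + 1)) (\<lambda>t s. t \<le> m * (6 * E + 20) + length cs * (m * 15 + 30) + 60 \<and>
    vars s 61 = Suc (vars st 61) \<and> vars s 65 = Suc i mod code_len p d g \<and>
    (\<forall>j. arrs s 17 j = arrs st 17 j + (if \<exists>a. wins p d g m cs x i a \<and> j = vars st 62 + a then 1 else 0)) \<and>
    (\<forall>j. arrs s 18 j = arrs st 18 j + (if (\<exists>a. wins p d g m cs x i a) \<and> j = vars st 63 then 1 else 0))) st"
proof -
  let ?M = "code_len p d g" and ?h = "hold p d g m cs x i" and ?n = "length cs"
  let ?st = "set_var 70 (8 ^ d + 1) (set_var 69 m (set_var 68 x st))"
  have c1: "wp e DIGITS (\<lambda>t s. t \<le> m * (6 * x + 20) + 4 \<and>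
    (\<forall>c<m. arrs s 16 c = x div (8 ^ d + 1) ^ c mod (8 ^ d + 1))) ?st"
    by (rule wp_DIGITS) auto
  have xE: "m * (6 * x + 20) \<le> m * (6 * E + 20)" using x by (intro mult_le_mono) auto
  have wrap: "(if ?M - Suc i = 0 then 0 else Suc i) = Suc i mod ?M" using i by (auto simp: mod_Suc)
  show ?thesis
    unfolding VOTE1_def
    apply (simp only: wp_Seq wp_Load wp_SetC x)
    apply (rule wp_fr, rule wp_mono[OF c1], clarify)
    subgoal premises p1 for t1 s1
    proof -
      note F1 = frD(1)[OF p1(3)] frD(2)[OF p1(3)]
      have v1: "vars s1 57 = ?n" "vars s1 65 = i" "vars s1 69 = m" "vars s1 12 = ?M" "arrs s1 11 = arrs st 11"
        "vars s1 61 = vars st 61" "vars s1 62 = vars st 62" "vars s1 63 = vars st 63"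
        "arrs s1 17 = arrs st 17" "arrs s1 18 = arrs st 18"
        using F1 c i by simp_all
      have c2: "wp e SUPP (\<lambda>t s. t \<le> ?n * (m * 15 + 30) + 10 \<and> vars s 75 = card {a. a < ?n \<and> ?h a} \<and>
        (vars s 75 \<noteq> 0 \<longrightarrow> vars s 76 < ?n \<and> ?h (vars s 76))) s1"
      proof (rule wp_SUPP[OF v1(1-4)])
        fix a assume "a < ?n"
        then have "arrs st 11 (a * ?M + i) = code p d g (cs ! a - 1) i" using c(1) i by (simp add: coded_def)
        then show "?h a \<longleftrightarrow> (\<exists>c<m. arrs s1 16 c = Suc (arrs s1 11 (a * ?M + i)))"
          using p1(2) v1(5) by (auto simp: hold_def)
      qed
      show ?thesis
        apply (rule wp_fr, rule wp_mono[OF c2], rule impI)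
        subgoal premises p2' for t2 s2
        proof -
          note p2 = p2'(1) and fr2 = p2'(2)
          note F2 = frD(1)[OF fr2] frD(2)[OF fr2]
          have v2: "vars s2 65 = i" "vars s2 12 = ?M" "vars s2 61 = vars st 61" "vars s2 62 = vars st 62"
            "vars s2 63 = vars st 63" "arrs s2 17 = arrs st 17" "arrs s2 18 = arrs st 18"
            using F2 v1 by simp_all
          have t: "t1 \<le> m * (6 * E + 20) + 4" "t2 \<le> ?n * (m * 15 + 30) + 10"
            using le_trans[OF p1(1) add_right_mono[OF xE]] conjunct1[OF p2] by simp_all
          let ?A = "{a. a < ?n \<and> ?h a}"
          show ?thesis
          proof (cases "card ?A = 1")
            case True
            then obtain a where a: "?A = {a}" by (auto simp: card_1_singleton_iff)
            have 75: "vars s2 75 = 1" using p2 True by simp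
            then have "vars s2 76 \<in> ?A" using p2 by simp
            then have "vars s2 76 = a" using a by blast
            note a76 = 75 this
            have w: "wins p d g m cs x i b \<longleftrightarrow> b = a" for b

            proof -
              have "a < ?n \<and> ?h a" "\<And>b. b < ?n \<Longrightarrow> ?h b \<Longrightarrow> b = a" using a by blast+
              then show ?thesis unfolding wins_def by metis
            qed
            show ?thesis
            proof (cases "?M - Suc i = 0")
              case M: True
              then show ?thesis using v2 a76 t wrap by (simp add: wp_simps wp_INC wp_DEC wp_MOV w)
            next
              case M: False
              then show ?thesis using v2 a76 t wrap by (simp add: wp_simps wp_INC wp_DEC wp_MOV w)
            qed
          next
            case False
            have w: "\<not> wins p d g m cs x i b" for b
            proof
              assume "wins p d g m cs x i b"
              then have "b < ?n" "?h b" "\<forall>a<?n. ?h a \<longrightarrow> a = b" by (simp_all add: wins_def)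
              then have "?A = {b}" by blast
              then show False using False by simp
            qed
            have n75: "vars s2 75 = 0 \<or> vars s2 75 - 1 \<noteq> 0" using p2 False by linarith
            show ?thesis
            proof (cases "?M - Suc i = 0")
              case M: True
              then show ?thesis using v2 n75 t wrap by (auto simp: wp_simps wp_INC wp_DEC wp_MOV w)
            next
              case M: False
              then show ?thesis using v2 n75 t wrap by (auto simp: wp_simps wp_INC wp_DEC wp_MOV w)
            qed
          qed
        qed
        done
    qed
    done
qed

text \<open>The symbols of all epochs are evaluated at the end against one list \<open>cs\<close>,
  the final one. A candidate found late thus still collects its support from earlier epochs.\<close>

definition support :: "nat \<Rightarrow> nat \<Rightarrow> nat \<Rightarrow> nat \<Rightarrow> nat list \<Rightarrow> nat \<Rightarrow> (nat \<Rightarrow> nat) \<Rightarrow> nat \<Rightarrow> nat \<Rightarrow> nat" where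
  "support p d g m cs W rc k a =
     card {j. j < W \<and> wins p d g m cs (rc (k * W + j)) (j mod code_len p d g) a}"

definition decided :: "nat \<Rightarrow> nat \<Rightarrow> nat \<Rightarrow> nat \<Rightarrow> nat list \<Rightarrow> nat \<Rightarrow> (nat \<Rightarrow> nat) \<Rightarrow> nat \<Rightarrow> nat" where
  "decided p d g m cs W rc k =
     card {j. j < W \<and> (\<exists>a. wins p d g m cs (rc (k * W + j)) (j mod code_len p d g) a)}"

lemma card_less_Suc: "card {j. j < Suc n \<and> P j} = card {j. j < n \<and> P j} + (if P n then 1 else 0)"
proof -
  have "{j. j < Suc n \<and> P j} = (if P n then insert n {j. j < n \<and> P j} else {j. j < n \<and> P j})"
    by (auto simp: less_Suc_eq)
  then show ?thesis by simp
qed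

lemma wins_less: "wins p d g m cs x i a \<Longrightarrow> a < length cs" by (simp add: wins_def)

lemma wp_VOTE:
  assumes c: "coded p d g cs st" "vars st 57 = length cs" "length cs \<le> m" "vars st 12 = code_len p d g"
    and M: "0 < code_len p d g" and W: "vars st 59 = W" and E: "\<And>j. j < R * W \<Longrightarrow> arrs st 13 j \<le> E"
    and z: "\<And>j. arrs st 17 j = 0" "\<And>j. arrs st 18 j = 0"
  shows "wp e (VOTE R m (8 ^ d + 1)) (\<lambda>t s. t \<le> R * (W * (m * (6 * E + 20) + m * (m * 15 + 30) + 70) + 20) + 20 \<and>
    (\<forall>k<R. \<forall>a<length cs. arrs s 17 (k * m + a) = support p d g m cs W (arrs st 13) k a) \<and>
    (\<forall>k<R. arrs s 18 k = decided p d g m cs W (arrs st 13) k)) st"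
proof -
  let ?M = "code_len p d g" and ?rc = "arrs st 13"
  let ?w = "\<lambda>k j a. wins p d g m cs (?rc (k * W + j)) (j mod ?M) a"
  let ?T = "m * (6 * E + 20) + m * (m * 15 + 30) + 60"
  have mm: "length cs * (m * 15 + 30) \<le> m * (m * 15 + 30)" using c(3) by simp
  show ?thesis
    unfolding VOTE_def wp_Seq wp_SetC
    apply (rule wp_FOR[where N = R and b = "W * (m * (6 * E + 20) + m * (m * 15 + 30) + 70) + 10" and I = "\<lambda>k s.
      vars s 61 = k * W \<and> vars s 62 = k * m \<and>
      (\<forall>j. j \<ge> k * m \<longrightarrow> arrs s 17 j = 0) \<and> (\<forall>j. j \<ge> k \<longrightarrow> arrs s 18 j = 0) \<and>
      (\<forall>k'<k. \<forall>a<length cs. arrs s 17 (k' * m + a) = support p d g m cs W ?rc k' a) \<and>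
      (\<forall>k'<k. arrs s 18 k' = decided p d g m cs W ?rc k')"])
    subgoal by simp
    subgoal by simp
    subgoal by simp
    subgoal using z by simp
    subgoal premises p1 for k s1
    proof -
      note F1 = frD(1)[OF p1(3)] frD(2)[OF p1(3)]
      have v1: "vars s1 59 = W" "vars s1 63 = k" "vars s1 57 = length cs" "vars s1 12 = ?M"
        "arrs s1 11 = arrs st 11" "arrs s1 13 = ?rc"
        using F1 c W p1(2) by simp_all
      note I1 = p1(4)
      have lt: "k' * m + a < k * m" if "k' < k" "a < length cs" for k' a
        using index_less[of k' k a m] that c(3) by simp
      show ?thesis
        unfolding wp_Seq wp_SetC
        apply (rule wp_FOR[where N = W and b = ?T and I = "\<lambda>j s. vars s 61 = k * W + j \<and> vars s 65 = j mod ?M \<and>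
          (\<forall>i<k * m. arrs s 17 i = arrs s1 17 i) \<and>
          (\<forall>a. arrs s 17 (k * m + a) = card {j'. j' < j \<and> ?w k j' a}) \<and>
          (\<forall>i. i \<noteq> k \<longrightarrow> arrs s 18 i = arrs s1 18 i) \<and>
          arrs s 18 k = card {j'. j' < j \<and> (\<exists>a. ?w k j' a)}"])
        subgoal by simp
        subgoal using v1 by simp
        subgoal by simp
        subgoal using I1 by simp
        subgoal premises p2 for j s2
        proof -
          note F2 = frD(1)[OF p2(3)] frD(2)[OF p2(3)]
          have v2: "vars s2 62 = k * m" "vars s2 63 = k" "vars s2 57 = length cs" "vars s2 12 = ?M"
            "arrs s2 11 = arrs st 11" "arrs s2 13 = ?rc"
            using F2 v1 I1 by simp_all
          note I2 = p2(4)
          have cd: "coded p d g cs s2" using c(1) v2 by (simp add: coded_def)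
          have xE: "?rc (k * W + j) \<le> E" using E[OF index_less[OF p1(1) p2(1)]] .
          have jM: "j mod ?M < ?M" using M by simp
          have md: "Suc (j mod ?M) mod ?M = Suc j mod ?M" by (rule mod_Suc_eq)
          show ?thesis
            apply (rule wp_mono[OF wp_VOTE1[OF cd v2(3,4) _ jM _ xE, where m = m]])
            subgoal using I2 by simp
            subgoal using I2 v2 by simp
            subgoal premises p3 for t3 s3
            proof -
              have "arrs s3 17 i = arrs s1 17 i" if "i < k * m" for i
                using p3 I2 v2 that by auto
              moreover have "arrs s3 17 (k * m + a) = card {j'. j' < Suc j \<and> ?w k j' a}" for a
                using p3 I2 v2 by (simp add: card_less_Suc)
              moreover have "arrs s3 18 i = arrs s1 18 i" if "i \<noteq> k" for i
                using p3 I2 v2 that by auto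
              moreover have "arrs s3 18 k = card {j'. j' < Suc j \<and> (\<exists>a. ?w k j' a)}"
                using p3 I2 v2 by (simp add: card_less_Suc)
              moreover have "t3 \<le> ?T" using p3 mm by linarith
              ultimately show ?thesis using p3 I2 md by simp
            qed
            done
        qed
        subgoal premises p2 for t2 s2
        proof -
          note F2 = frD(1)[OF p2(2)] frD(2)[OF p2(2)]
          have 62: "vars s2 62 = k * m" using F2 I1 by simp
          note I2 = p2(3)
          have a: "arrs s2 17 j = 0" if "j \<ge> k * m + m" for j
          proof -
            define a where "a = j - k * m"
            have a: "j = k * m + a" "a \<ge> m" using that by (auto simp: a_def)
            have "\<not> ?w k j' a" for j'
            proof
              assume "?w k j' a"
              then have "a < length cs" by (rule wins_less)
              then show False using c(3) a by linarith
            qed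
            then show ?thesis using I2 a by simp
          qed
          have b: "arrs s2 18 j = 0" if "j \<ge> Suc k" for j using I2 I1 that by simp
          have cc: "arrs s2 17 (k' * m + a) = support p d g m cs W ?rc k' a" if "k' < Suc k" "a < length cs" for k' a
          proof (cases "k' = k")
            case True
            then show ?thesis using I2 by (simp add: support_def)
          next
            case False
            then show ?thesis using I2 I1 that lt[of k' a] by simp
          qed
          have dd: "arrs s2 18 k' = decided p d g m cs W ?rc k'" if "k' < Suc k" for k'
            using I2 I1 that by (cases "k' = k") (auto simp: decided_def)
          show ?thesis using p2(1) 62 a b cc dd I2
            by (simp add: wp_simps algebra_simps)
        qed
        done
    qed
    subgoal premises p1 for t s1 using p1(1,3) by (simp add: algebra_simps)
    done
qed

text \<open>Twice the number of corruptions of the symbols of an epoch that is necessary if the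
  candidate with support \<open>H\<close> is correct and common to both parties from epoch \<open>j\<close> on. An earlier
  epoch costs at least \<open>W\<close> (up to a term in \<open>\<epsilon>\<close>), because too many of its runs failed.\<close>

definition cost :: "nat \<Rightarrow> nat \<Rightarrow> (nat \<Rightarrow> nat) \<Rightarrow> (nat \<Rightarrow> nat) \<Rightarrow> nat \<Rightarrow> nat" where
  "cost R W D H j = (\<Sum>k<R. if k < j then max W (2 * (D k - H k)) else 2 * (W - H k))"

text \<open>The default 0 represents no transcript. Among several acceptable candidates the last one
  would be returned, as in a loop that overwrites its result.\<close>

primrec judge :: "nat \<Rightarrow> nat \<Rightarrow> (nat \<Rightarrow> nat) \<Rightarrow> (nat \<Rightarrow> nat \<Rightarrow> nat) \<Rightarrow> nat list \<Rightarrow> nat \<Rightarrow> nat" where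
  "judge R W D H cs 0 = 0"
| "judge R W D H cs (Suc a) = (if \<exists>j\<le>R. cost R W D (\<lambda>k. H k a) j < R * W then cs ! a
     else judge R W D H cs a)"

definition JUDGE :: "nat \<Rightarrow> nat \<Rightarrow> com" where
  "JUDGE R m = Seq (SetC 85 0) (Seq (SetC 60 R) (Seq (SetC 61 (R + 1)) (Seq (MULC 86 59 R)
    (FOR 62 63 57 (FOR 64 65 61 (Seq (SetC 66 0) (Seq (MOV 67 62) (Seq
      (FOR 68 69 60 (Seq (Load 70 17 67) (Seq (Load 71 18 68) (Seq (Sub 72 64 68)
        (Seq (IfNZ 72 (Seq (Sub 73 71 70) (Seq (Add 73 73 73) (Seq (Sub 74 59 73) (Add 73 73 74))))
          (Seq (Sub 73 59 70) (Add 73 73 73)))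
        (Seq (Add 66 66 73) (Seq (SetC 74 m) (Add 67 67 74))))))))
      (Seq (Sub 75 86 66) (IfNZ 75 (Load 85 15 62) Skip))))))))))"

lemma JUDGE_frame [simp]:
  "wv (JUDGE R m) = {2, 60, 61, 62, 63, 64, 65, 66, 67, 68, 69, 70, 71, 72, 73, 74, 75, 85, 86}"
  "wa (JUDGE R m) = {}" "silent (JUDGE R m)"
  by (auto simp: JUDGE_def)

lemma wp_JUDGE:
  assumes c: "cands cs st" and W: "vars st 59 = W"
    and H: "\<And>k a. k < R \<Longrightarrow> a < length cs \<Longrightarrow> arrs st 17 (k * m + a) = H k a"
    and D: "\<And>k. k < R \<Longrightarrow> arrs st 18 k = D k"
  shows "wp e (JUDGE R m) (\<lambda>t s. t \<le> length cs * ((R + 1) * (R * 25 + 30) + 10) + R + 20 \<and>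
    vars s 85 = judge R W D H cs (length cs)) st"
  unfolding JUDGE_def
  apply (simp add: wp_Seq wp_SetC wp_MULC)
  apply (rule wp_FOR[where N = "length cs" and b = "(R + 1) * (R * 25 + 30) + 5" and I = "\<lambda>a s.
    vars s 85 = judge R W D H cs a"])
  subgoal by simp
  subgoal using c by (simp add: cands_def)
  subgoal by simp
  subgoal by simp
  subgoal premises p1 for a s1
  proof -
    note F1 = frD(1)[OF p1(3)] frD(2)[OF p1(3)]
    have v1: "vars s1 61 = R + 1" "vars s1 60 = R" "vars s1 62 = a" "vars s1 59 = W" "vars s1 86 = R * W"
      "arrs s1 17 = arrs st 17" "arrs s1 18 = arrs st 18" "arrs s1 15 a = cs ! a"
      using F1 W p1(1,2) c by (simp_all add: cands_def)
    let ?c = "cost R W D (\<lambda>k. H k a)"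
    show ?thesis
      apply (rule wp_FOR[where N = "R + 1" and b = "R * 25 + 24" and I = "\<lambda>j s. vars s 85 =
        (if \<exists>j'<j. ?c j' < R * W then cs ! a else judge R W D H cs a)"])
      subgoal by simp
      subgoal using v1 by simp
      subgoal by simp
      subgoal using p1(4) by simp
      subgoal premises p2 for j s2
      proof -
        note F2 = frD(1)[OF p2(3)] frD(2)[OF p2(3)]
        have v2: "vars s2 60 = R" "vars s2 62 = a" "vars s2 59 = W" "vars s2 86 = R * W" "vars s2 64 = j"
          "arrs s2 17 = arrs st 17" "arrs s2 18 = arrs st 18" "arrs s2 15 a = cs ! a"
          using F2 v1 p2(2) by simp_all
        let ?f = "\<lambda>k. if k < j then max W (2 * (D k - H k a)) else 2 * (W - H k a)"
        show ?thesis
          apply (simp add: wp_Seq wp_SetC wp_MOV split del: if_split)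
          apply (rule wp_FOR[where N = R and b = 14 and I = "\<lambda>k s. vars s 67 = k * m + a \<and> vars s 66 = (\<Sum>k<k. ?f k)"])
          subgoal by simp
          subgoal using v2 by simp
          subgoal by simp
          subgoal using v2 by simp
          subgoal premises p3 for k s3
          proof -
            note F3 = frD(1)[OF p3(3)] frD(2)[OF p3(3)]
            have v3: "vars s3 64 = j" "vars s3 59 = W" "arrs s3 17 (k * m + a) = H k a" "arrs s3 18 k = D k" "vars s3 68 = k"
              using F3 v2 p3(1,2) H[OF p3(1) p1(1)] D[OF p3(1)] by simp_all
            show ?thesis using p3(4) v3 by (auto simp: wp_simps max_def)
          qed
          subgoal premises p3 for t3 s3
          proof -
            note F3 = frD(1)[OF p3(2)] frD(2)[OF p3(2)]
            have v3: "vars s3 86 = R * W" "vars s3 62 = a" "arrs s3 15 a = cs ! a" "vars s3 66 = ?c j"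
              "vars s3 85 = vars s2 85"
              using F3 v2 p3(3) by (simp_all add: cost_def)
            have lt: "R * W - ?c j \<noteq> 0 \<longleftrightarrow> ?c j < R * W" by auto
            show ?thesis
            proof (cases "?c j < R * W")
              case True
              then show ?thesis using p3(1) p2(4) v3 by (auto simp: wp_simps less_Suc_eq)
            next
              case False
              then show ?thesis using p3(1) p2(4) v3 by (auto simp: wp_simps less_Suc_eq)
            qed
          qed
          done
      qed
      subgoal premises p2 for t2 s2 using p2(1,3) by (simp add: less_Suc_eq_le algebra_simps)
      done
  qed
  subgoal premises p1 for t s1 using p1(1,3) by (simp add: algebra_simps)
  done

definition OUTPUT :: "nat \<Rightarrow> com" where
  "OUTPUT p = Seq (MOV 20 85) (Seq (DEC 20) (Seq (MOV 21 3) (Seq (SetC 22 1) (Seq (SetC 23 0)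
    (Seq (SetC 24 1) (Seq (UNPACK p 0) (SetC 0 1)))))))"

lemma OUTPUT_silent [simp]: "silent (OUTPUT p)"
  by (simp add: OUTPUT_def)

lemma wp_OUTPUT:
  assumes pdg: "2 \<le> p" "0 < d" "0 < g" and r: "ready p d g st" and n: "vars st 3 = n" "n \<le> g * axis_in p g ^ 4"
    and X: "vars st 85 - 1 < p ^ n"
  shows "wp e (OUTPUT p) (\<lambda>t s. t \<le> n * (13 * p + 56) + 40 \<and> vars s 0 = 1 \<and>
    (\<forall>j<n. arrs s 0 j = sl p n (vars st 85 - 1) j)) st"
proof -
  let ?P = "symmod p d g" and ?X = "vars st 85 - 1"
  let ?st = "set_var 24 1 (set_var 23 0 (set_var 22 1 (set_var 21 n (set_var 2 0 (set_var 20 ?X (set_var 2 1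
    (set_var 20 (vars st 85) (set_var 2 0 st))))))))"
  have P: "0 < ?P" "p < ?P"
    using axis_in_less_symmod[OF pdg] power_increasing[of 1 g p] pdg by (simp_all add: axis_in_def)
  have "axis_in p g ^ 4 \<le> axis_out p d g ^ 4" using axis_out_ge(2)[OF pdg] by (rule power_mono) simp
  moreover have "g \<le> slot_len d g" by (simp add: slot_len_def)
  ultimately have "axis_in p g ^ 4 * g \<le> axis_out p d g ^ 4 * slot_len d g" by (rule mult_le_mono)
  then have le: "n \<le> axis_out p d g ^ 4 * slot_len d g" using n(2) by (simp add: mult.commute)
  have c: "wp e (UNPACK p 0) (\<lambda>t s. t \<le> n * (1 * (13 * p + 30) + 26) + 20 \<and>
    (\<forall>j<n. arrs s 0 (0 + j * 1) = sl (p ^ 1) n ?X j mod ?P) \<and>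
    (\<forall>i. (\<forall>j<n. i \<noteq> 0 + j * 1) \<longrightarrow> arrs s 0 i = arrs ?st 0 i)) ?st"
    by (rule wp_UNPACK[OF pdg(1)]) (use r n X P le in \<open>auto simp: ready_def prm_def\<close>)
  \<comment> \<open>A digit is below p < P, so the reduction modulo P inside \<open>UNPACK\<close>
    does not change it.\<close>
  have small: "sl p n ?X j mod ?P = sl p n ?X j" for j
  proof -
    have "sl p n ?X j < p" unfolding sl_def using pdg by (intro mod_less_divisor) simp
    then show ?thesis using P by simp
  qed
  show ?thesis
    unfolding OUTPUT_def
    apply (simp only: wp_Seq_MOV wp_Seq_SetC wp_Seq[where c = "DEC 20"] wp_DEC state_simps n if_False if_True numeral_eq_iff
        num.simps simp_thms)
    apply (rule wp_SeqI[OF c])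
    subgoal premises p1 for t1 s1
      using p1(1) small by (simp add: wp_SetC algebra_simps)
    done
qed

section \<open>The program of one party\<close>

definition RUN :: "nat \<Rightarrow> nat \<Rightarrow> nat \<Rightarrow> nat \<Rightarrow> com \<Rightarrow> nat \<Rightarrow> com" where
  "RUN p q s nr c r = Seq (MOV (emb nr r 0) 3) (Seq (lift q nr r c)
     (EXTRACT p s (emb nr r 0) (emb nr r 0)))"

text \<open>The runs are unrolled instead of looped: each needs names of its own, because it expects
  zeroed memory, and names are literals.\<close>

primrec RUNS :: "nat \<Rightarrow> nat \<Rightarrow> nat \<Rightarrow> nat \<Rightarrow> com \<Rightarrow> nat \<Rightarrow> nat \<Rightarrow> com" where
  "RUNS p q s nr c r 0 = Skip"
| "RUNS p q s nr c r (Suc u) = Seq (RUNS p q s nr c r u) (RUN p q s nr c (r + u))"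

primrec EPOCHS :: "nat \<Rightarrow> nat \<Rightarrow> nat \<Rightarrow> nat \<Rightarrow> nat \<Rightarrow> nat \<Rightarrow> nat \<Rightarrow> nat \<Rightarrow> com \<Rightarrow> nat \<Rightarrow> com" where
  "EPOCHS p d q s nr v th m c 0 = Skip"
| "EPOCHS p d q s nr v th m c (Suc k) = Seq (EPOCHS p d q s nr v th m c k) (Seq (ENCALL p d)
     (Seq (EXTB q (8 ^ d)) (Seq (SetC 51 0) (Seq (SetC 58 0) (Seq (RUNS p q s nr c (k * v) v)
     (SELECT (v * s) th m))))))"

definition PROG :: "nat \<Rightarrow> nat \<Rightarrow> nat \<Rightarrow> nat \<Rightarrow> nat \<Rightarrow> nat \<Rightarrow> nat \<Rightarrow> nat \<Rightarrow> nat \<Rightarrow> com \<Rightarrow> com" where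
  "PROG p d q s R v th m n0 c = Seq (SetC 3 n0) (Seq (Sub 20 0 3) (Seq (Add 3 3 20)
     (Seq (CODE_SETUP p d) (Seq (EPOCHS p d q s (R * v) v th m c R) (Seq (ENCALL p d)
     (Seq (SetC 60 R) (Seq (MOV 61 56) (Seq (DIVMOD 61 60 59 62)
     (Seq (VOTE R m (8 ^ d + 1)) (Seq (JUDGE R m) (OUTPUT p)))))))))))"

lemma big_step_rcv:
  assumes "big_step orc inp c st t st'" "length (trace st) \<le> i" "i < length (trace st')"
    "trace st' ! i = Rcv v"
  shows "v = inp i"
  using assms
proof (induction rule: big_step.induct)
  case (Seq c st t st1 d u st2)
  obtain new where new: "trace st2 = trace st1 @ new" using big_step_trace[OF Seq.hyps(2)] by blast
  then show ?case using Seq by (cases "i < length (trace st1)") (auto simp: nth_append)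
next
  case (WhileTrue st x c t st1 u st2)
  obtain new where new: "trace st2 = trace st1 @ new" using big_step_trace[OF WhileTrue.hyps(3)] by blast
  then show ?case using WhileTrue by (cases "i < length (trace st1)") (auto simp: nth_append)
qed (auto simp: nth_append less_Suc_eq)

lemma positional_less:
  fixes B :: nat
  assumes "\<And>a. a < l \<Longrightarrow> f a < B"
  shows "(\<Sum>a<l. f a * B ^ a) < B ^ l"
  using assms
proof (induction l)
  case (Suc l)
  have "f l * B ^ l + B ^ l \<le> B * B ^ l" using Suc.prems[of l] mult_le_mono1[of "Suc (f l)" B "B ^ l"] by simp
  then show ?case using Suc by fastforce
qed simp

lemma xsym_less:
  assumes "length cs \<le> m"
  shows "xsym p d g cs i < (8 ^ d + 1) ^ m"
proof -
  have "xsym p d g cs i < (8 ^ d + 1) ^ length cs"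
    unfolding xsym_def by (rule positional_less) (use code_less[of p d g _ i] in auto)
  also have "\<dots> \<le> (8 ^ d + 1) ^ m" using assms by (intro power_increasing) auto
  finally show ?thesis .
qed

lemma is_Snd_strip [simp]: "is_Snd (strip q e) = is_Snd e"
  by (cases e) auto

text \<open>Alice and Bob run the same construction, so it is verified once, for an arbitrary
  oracle, input, program and schedule. \<open>H\<close> is the number of transmissions in one
  run.\<close>

locale party =
  fixes p d q s R v th m n n0 N H T :: nat and orc :: "nat list \<Rightarrow> nat" and inp :: "nat \<Rightarrow> nat"
    and c :: com and sends :: "nat \<Rightarrow> bool"
  assumes p2: "2 \<le> p" and d0: "0 < d" and q0: "0 < q"
    and inp: "\<And>i. inp i < q * (8 ^ d + 1) ^ m"
    and run: "\<And>inp0. (\<And>i. inp0 i < q) \<Longrightarrow> \<exists>t st. big_step orc inp0 c (init_state (max n n0)) t st \<and>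
      t \<le> T \<and> conforms q N sends (trace st)"
    and HS: "\<And>tr. conforms q N sends tr \<Longrightarrow> length (filter is_Snd tr) = H"
begin

definition "n1 = max n n0"
definition "g = code_size p n1"
definition "M = code_len p d g"
definition "inpr r = (\<lambda>i. inp (r * N + i) mod q)"
text \<open>The result of run r depends only on the received symbols modulo q. Naming it by choice
  lets the candidate lists be defined apart from the memory of the program.\<close>

definition "res r = (SOME st. \<exists>t\<le>T. big_step orc (inpr r) c (init_state n1) t st \<and>
  conforms q N sends (trace st))"

lemma res: "\<exists>t\<le>T. big_step orc (inpr r) c (init_state n1) t (res r) \<and>
  conforms q N sends (trace (res r))"
  unfolding res_def n1_def
  by (rule someI_ex) (use run[of "inpr r"] q0 in \<open>auto simp: inpr_def\<close>)

definition "entf k j = entry orc p n1 (vars (res (k * v + j div s)) 0) (arrs (res (k * v + j div s)) 0) (j mod s)"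
definition "ents k = map (entf k) [0..<v * s]"

primrec CL :: "nat \<Rightarrow> nat list" where
  "CL 0 = []"
| "CL (Suc k) = fold (sel th m (ents k)) (ents k) (CL k)"

lemma pdg: "2 \<le> p" "0 < d" "0 < g"
  using p2 d0 code_size(1)[OF p2, of n1] by (auto simp: g_def)

lemma n1_le: "n1 \<le> g * axis_in p g ^ 4"
  using code_size(2)[OF p2, of n1] by (simp add: g_def axis_in_def)

lemma M0: "0 < M"
  using axis_out_ge[OF pdg] by (simp add: M_def code_len_def inner_len_def)

lemma length_CL: "length (CL k) \<le> m"
  by (induction k) (auto intro: length_sel)

lemma set_sel: "set (fold (sel th m E) xs cs) \<subseteq> set cs \<union> {x \<in> set xs. x \<noteq> 0}"
proof (induction xs arbitrary: cs)
  case (Cons a xs)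
  have "set (sel th m E a cs) \<subseteq> set cs \<union> {x \<in> {a}. x \<noteq> 0}" by (auto simp: sel_def)
  then show ?case using Cons[of "sel th m E a cs"] by auto
qed simp

lemma CL_cases:
  assumes "x \<in> set (CL k)"
  obtains k' j where "k' < k" "j < v * s" "x = entf k' j" "x \<noteq> 0"
  using assms
proof (induction k arbitrary: thesis)
  case (Suc k)
  from Suc.prems(2) set_sel[of "ents k" "ents k" "CL k"]
  consider "x \<in> set (CL k)" | "x \<in> set (ents k)" "x \<noteq> 0" by auto
  then show ?case
  proof cases
    case 1
    then obtain k' j where "k' < k" "j < v * s" "x = entf k' j" "x \<noteq> 0" using Suc.IH by blast
    then show ?thesis using Suc.prems(1)[of k' j] by simp
  next
    case 2
    then show ?thesis using Suc.prems(1)[of k] by (auto simp: ents_def)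
  qed
qed simp

lemma entf_bound: "entf k j - 1 < p ^ n1"
proof -
  have "hn f p n1 < p ^ n1" if "\<And>j. j < n1 \<Longrightarrow> f j < p" for f using hn_less[of n1 f p] that by blast
  then show ?thesis using p2 by (auto simp: entf_def entry_def consistent_def)
qed

lemma CL_bound: "x \<in> set (CL k) \<Longrightarrow> x - 1 < p ^ n1"
  using entf_bound by (auto elim: CL_cases)

lemma CL_bound': "x \<in> set (CL k) \<Longrightarrow> x - 1 < p ^ (g * axis_in p g ^ 4)"
  by (rule less_le_trans[OF CL_bound power_increasing[OF n1_le]]) (use p2 in simp_all)

definition traced :: "nat \<Rightarrow> state \<Rightarrow> bool" where
  "traced r S \<longleftrightarrow> length (trace S) = r * N \<and>
     (\<forall>r'<r. map (strip q) (take N (drop (r' * N) (trace S))) = trace (res r')) \<and>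
     length (snds (trace S)) = r * H"

text \<open>\<open>k\<close> counts finished epochs and \<open>r\<close> finished runs; they are
  separate because the candidates stay fixed while the runs of an epoch go on. The names of the runs
  still to come have to be untouched, as these runs start from zeroed memory.\<close>

definition epoch_inv :: "nat \<Rightarrow> nat \<Rightarrow> state \<Rightarrow> bool" where
  "epoch_inv k r S \<longleftrightarrow> ready p d g S \<and> vars S 3 = n1 \<and> cands (CL k) S \<and> rcv_inv q ((8 ^ d + 1) ^ m) S \<and> traced r S \<and>
     (\<forall>k'<k. \<forall>j<v * H. snds (trace S) ! (k' * (v * H) + j) div q = xsym p d g (CL k') (j mod M)) \<and>
     (\<forall>r'. r \<le> r' \<longrightarrow> r' < R * v \<longrightarrow> (\<forall>x. vars S (emb (R * v) r' x) = 0 \<and>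
        arrs S (emb (R * v) r' x) = (\<lambda>i. 0))) \<and>
     arrs S 17 = (\<lambda>i. 0) \<and> arrs S 18 = (\<lambda>i. 0)"

definition run_inv :: "nat \<Rightarrow> nat \<Rightarrow> state \<Rightarrow> bool" where
  "run_inv k u S \<longleftrightarrow> epoch_inv k (k * v + u) S \<and>
     snd_inv q M (xsym p d g (CL k)) (k * (v * H)) S \<and>
     vars S 58 = u * s \<and> (\<forall>j<u * s. arrs S 14 j = entf k j)"

definition "run_time = 3 + (6 * (8 ^ d + 1) ^ m + 12) * T + s * (n1 * (p + 30) + 40) + 10"

lemma length_trace_res: "length (trace (res r)) = N" "length (filter is_Snd (trace (res r))) = H"
  using res[of r] HS[of "trace (res r)"] by (auto simp: conforms_def)

lemma wp_RUN:
  assumes I: "run_inv k u S" and ku: "k < R" "u < v"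
  shows "wp (orc, inp) (RUN p q s (R * v) c (k * v + u)) (\<lambda>t S'. t \<le> run_time \<and> run_inv k (Suc u) S') S"
proof -
  let ?r = "k * v + u" and ?nr = "R * v" and ?E = "(8 ^ d + 1) ^ m :: nat"
  have r: "?r < ?nr" using index_less[OF ku] .
  let ?e = "emb ?nr ?r"
  let ?S = "set_var (?e 0) n1 (set_var 2 0 S)"
  note I' = I[unfolded run_inv_def epoch_inv_def traced_def]
  have v3: "vars S 3 = n1" using I' by blast
  have fresh: "vars S (?e x) = 0" "arrs S (?e x) = (\<lambda>i. 0)" for x using I' r by blast+
  have len: "length (trace S) = ?r * N" using I' by blast
  obtain t where t: "t \<le> T" "big_step orc (inpr ?r) c (init_state n1) t (res ?r)"
    "conforms q N sends (trace (res ?r))" using res by blast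
  have sym: "sym ev < q" if "ev \<in> set (trace (res ?r))" for ev
    using t(3) that by (auto simp: conforms_def in_set_conv_nth)
  have c1: "wp (orc, inp) (lift q ?nr ?r c) (\<lambda>t' S'. t' \<le> (6 * ?E + 12) * t \<and>
    sim q ?nr ?r (trace S) (res ?r) S' \<and> rcv_inv q ((8 ^ d + 1) ^ m) S' \<and>
    snd_inv q M (xsym p d g (CL k)) (k * (v * H)) S') ?S"
  proof (rule simulation[OF t(2) _ _ _ _ sym inp q0 M0 r])
    show "inpr ?r = (\<lambda>i. inp (length (trace S) + i) mod q)" by (simp add: inpr_def len)
    show "sim q ?nr ?r (trace S) (init_state n1) ?S"
      using fresh r by (auto simp: sim_def init_state_def)
    show "rcv_inv q ((8 ^ d + 1) ^ m) ?S" using I' by (simp add: rcv_inv_def)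
    show "snd_inv q M (xsym p d g (CL k)) (k * (v * H)) ?S" using I' by (simp add: snd_inv_def)
  qed
  show ?thesis
    unfolding RUN_def
    apply (simp add: wp_Seq_MOV v3)
    apply (rule wp_SeqI[OF c1])
    subgoal premises p1 for t1 S1
    proof -
      have F: "vars S1 x = vars ?S x" if "x \<notin> {2, 50, 51, 52, 54, 55, 56, 53} \<union> range ?e" for x
        using frD(1)[OF p1(2)] lift_frame(1)[of q ?nr ?r c] that by blast
      have G: "arrs S1 a = arrs ?S a" if "a \<notin> {13} \<union> range ?e" for a
        using frD(2)[OF p1(2)] lift_frame(2)[of q ?nr ?r c] that by blast
      have own: "vars S1 x = vars S x" if "x < 50 \<or> x \<ge> 57" "x < 100" "x \<noteq> 2" for x
      proof -
        have "x \<notin> range ?e" using that by (auto simp: emb_def)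
        then have "vars S1 x = vars ?S x" using that by (intro F) auto
        then show ?thesis using that by simp
      qed
      have owna: "arrs S1 a = arrs S a" if "a \<noteq> 13" "a < 100" for a
      proof -
        have "a \<notin> range ?e" using that by (auto simp: emb_def)
        then show ?thesis using that G[of a] by auto
      qed
      have other: "vars S1 (emb ?nr r' x) = vars S (emb ?nr r' x)" "arrs S1 (emb ?nr r' x) = arrs S (emb ?nr r' x)"
        if "r' < ?nr" "r' \<noteq> ?r" for r' x
      proof -
        have "emb ?nr r' x \<notin> range ?e" using that r by (auto simp: emb_eq_iff)
        then have "vars S1 (emb ?nr r' x) = vars ?S (emb ?nr r' x)" "arrs S1 (emb ?nr r' x) = arrs ?S (emb ?nr r' x)"
          by (intro F G; auto)+
        moreover have "emb ?nr r' x \<noteq> ?e 0" using \<open>emb ?nr r' x \<notin> range ?e\<close> by auto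
        ultimately show "vars S1 (emb ?nr r' x) = vars S (emb ?nr r' x)" "arrs S1 (emb ?nr r' x) = arrs S (emb ?nr r' x)"
          by auto
      qed
      have sim: "sim q ?nr ?r (trace S) (res ?r) S1" using p1(1) by blast
      then obtain mid where mid: "trace S1 = trace S @ mid" "map (strip q) mid = trace (res ?r)"
        by (auto simp: sim_def)
      have lmid: "length mid = N" using mid(2) length_trace_res(1)[of ?r] by (metis length_map)
      have hmid: "length (snds mid) = H"
      proof -
        have "length (snds mid) = length (filter is_Snd (map (strip q) mid))"
          by (simp add: snds_def filter_map comp_def)
        then show ?thesis using mid(2) length_trace_res(2)[of ?r] by simp
      qed
      have tr1: "traced (Suc ?r) S1"
      proof -
        have "map (strip q) (take N (drop (r' * N) (trace S1))) = trace (res r')" if "r' < Suc ?r" for r'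
        proof (cases "r' = ?r")
          case True
          then show ?thesis using mid lmid len by simp
        next
          case False
          then have r': "r' < ?r" using that by simp
          have "Suc r' * N \<le> ?r * N" using r' by (intro mult_right_mono) auto
          then have le: "r' * N + N \<le> length (trace S)" using len by simp
          then have "take N (drop (r' * N) (trace S1)) = take N (drop (r' * N) (trace S))"
            by (simp add: mid(1))
          then show ?thesis using I' r' by simp
        qed
        then show ?thesis using mid lmid hmid I' by (simp add: traced_def)
      qed
      have old9: "snds (trace S1) ! (k' * (v * H) + j) = snds (trace S) ! (k' * (v * H) + j)"
        if "k' < k" "j < v * H" for k' j
      proof -
        have "k' * (v * H) + j < k * (v * H)" using that by (rule index_less)
        also have "\<dots> \<le> length (snds (trace S))" using I' by (simp add: algebra_simps)
        finally show ?thesis by (simp add: mid(1) nth_append)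
      qed
      have e1: "vars S1 (?e 0) = vars (res ?r) 0" "arrs S1 (?e 0) = arrs (res ?r) 0"
        using sim by (auto simp: sim_def)
      have n1': "vars S1 3 = n1" "vars S1 58 = u * s" "arrs S1 14 = arrs S 14" using own owna I' by auto
      have ready1: "ready p d g S1" using I' own owna unfolding ready_def prm_def by auto
      have cands1: "cands (CL k) S1" using I' own owna by (auto simp: cands_def)
      have z1: "arrs S1 17 = (\<lambda>i. 0)" "arrs S1 18 = (\<lambda>i. 0)" using I' owna by auto
      have ep1: "epoch_inv k (Suc ?r) S1"
        unfolding epoch_inv_def using ready1 n1' cands1 p1(1) tr1 z1 old9 I' other by auto
      have c2: "wp (orc, inp) (EXTRACT p s (?e 0) (?e 0)) (\<lambda>t s'. t \<le> s * (n1 * (p + 30) + 40) + 10 \<and>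
        vars s' 58 = vars S1 58 + s \<and>
        (\<forall>j<s. arrs s' 14 (vars S1 58 + j) = entry (fst (orc, inp)) p n1 (vars S1 (?e 0)) (arrs S1 (?e 0)) j) \<and>
        (\<forall>i<vars S1 58. arrs s' 14 i = arrs S1 14 i)) S1"
        by (rule wp_EXTRACT) (use n1' in \<open>auto simp: emb_def\<close>)
      show ?thesis
        apply (rule wp_fr, rule wp_mono[OF c2], clarify)
        subgoal premises p2 for t2 S2
        proof -
          note F2 = frD(1)[OF p2(5)] frD(2)[OF p2(5)] frD(3)[OF p2(5)]
          have own2: "vars S2 x = vars S1 x" if "x < 58 \<or> 86 \<le> x" "x \<noteq> 2" for x using F2(1)[of x] that by auto
          have owna2: "arrs S2 a = arrs S1 a" if "a \<noteq> 14" for a using F2(2)[of a] that by auto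
          have tr2: "trace S2 = trace S1" using F2(3) by simp
          have "ready p d g S2" by (rule ready_fr[OF ready1 p2(5)]) auto
          moreover have "vars S2 (emb ?nr r' x) = vars S1 (emb ?nr r' x)" "arrs S2 (emb ?nr r' x) = arrs S1 (emb ?nr r' x)" for r' x
            using own2[of "emb ?nr r' x"] owna2[of "emb ?nr r' x"] by (auto simp: emb_def)
          ultimately have "epoch_inv k (Suc ?r) S2"
            using ep1 own2 owna2 tr2 unfolding epoch_inv_def traced_def rcv_inv_def cands_def by simp
          moreover have "snd_inv q M (xsym p d g (CL k)) (k * (v * H)) S2"
            using p1(1) own2 owna2 tr2 unfolding snd_inv_def by simp
          moreover have "arrs S2 14 j = entf k j" if "j < Suc u * s" for j
          proof (cases "j < u * s")
            case True
            then show ?thesis using p2(4) n1' I' by simp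
          next
            case False
            define i where "i = j - u * s"
            have i: "j = u * s + i" "i < s" using False that by (auto simp: i_def)
            have "j div s = u" "j mod s = i" using i by simp_all
            then show ?thesis using p2(3) i n1' e1 by (simp add: entf_def)
          qed
          moreover have "vars S2 58 = Suc u * s" using p2(2) n1' by simp
          moreover have "2 + (t1 + t2) \<le> run_time"
          proof -
            have "t1 \<le> (6 * ?E + 12) * T" using p1(1) mult_le_mono2[OF t(1), of "6 * ?E + 12"] by linarith
            then show ?thesis using p2(1) unfolding run_time_def by linarith
          qed
          ultimately show ?thesis by (simp add: run_inv_def)
        qed
        done
    qed
    done
qed

end

context party
begin

lemma wp_RUNS:
  assumes "run_inv k 0 S" "k < R" "u \<le> v"
  shows "wp (orc, inp) (RUNS p q s (R * v) c (k * v) u) (\<lambda>t S'. t \<le> u * run_time + 1 \<and> run_inv k u S') S"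
  using assms(3)
proof (induction u)
  case 0
  then show ?case using assms by (simp add: wp_Skip)
next
  case (Suc u)
  then have IH: "wp (orc, inp) (RUNS p q s (R * v) c (k * v) u) (\<lambda>t S'. t \<le> u * run_time + 1 \<and> run_inv k u S') S" by simp
  show ?case
    unfolding RUNS.simps
    apply (rule wp_SeqI[OF IH])
    subgoal premises p1 for t1 S1
      apply (rule wp_mono[OF wp_RUN[of k u S1]])
      using p1(1) assms(2) Suc.prems by (auto simp: add.commute)
    done
qed

definition "encall_time = m * (enc_time p d g + 10) + 10"
definition "extb_time = M * 10 + m * (M * (6 * 8 ^ d + 30) + 8 ^ d + 30) + 20"
definition "select_time = v * s * (v * s * 20 + m * 20 + 60) + 20"
definition "epoch_time = encall_time + extb_time + (v * run_time + 1) + select_time + 2"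

lemma snd_inv_start:
  assumes "vars S 12 = M" "\<And>i. i < M \<Longrightarrow> arrs S 12 i = q * x i" "length (snds (trace S)) = b" "vars S 51 = 0"
  shows "snd_inv q M x b S"
  using assms by (simp add: snd_inv_def)

lemma wp_EPOCH:
  assumes I: "epoch_inv k (k * v) S" and k: "k < R"
  shows "wp (orc, inp) (Seq (ENCALL p d) (Seq (EXTB q (8 ^ d)) (Seq (SetC 51 0) (Seq (SetC 58 0)
    (Seq (RUNS p q s (R * v) c (k * v) v) (SELECT (v * s) th m)))))) (\<lambda>t S'. t \<le> epoch_time \<and> epoch_inv (Suc k) (Suc k * v) S') S"
proof -
  have cd: "cands (CL k) S" and rd: "ready p d g S" using I by (auto simp: epoch_inv_def)
  have c1: "wp (orc, inp) (ENCALL p d) (\<lambda>t s. t \<le> length (CL k) * (enc_time p d g + 10) + 10 \<and> coded p d g (CL k) s) S"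
    by (rule wp_ENCALL[OF pdg rd cd CL_bound'])
  have stab: "epoch_inv k (k * v) S'" if "epoch_inv k (k * v) S0" "fr cc S0 S'" "silent cc"
    "wv cc \<subseteq> {2} \<union> {20..49} \<union> {51} \<union> {58..99}" "wa cc \<subseteq> {6..12}" for S0 S' cc
  proof -
    have own: "vars S' x = vars S0 x" if "x \<notin> {2} \<union> {20..49} \<union> {51} \<union> {58..99}" for x
      using frD(1)[OF \<open>fr cc S0 S'\<close>] \<open>wv cc \<subseteq> _\<close> that by blast
    have owna: "arrs S' a = arrs S0 a" if "a \<notin> {6..12}" for a
      using frD(2)[OF \<open>fr cc S0 S'\<close>] \<open>wa cc \<subseteq> _\<close> that by blast
    have tr: "trace S' = trace S0" using frD(3)[OF \<open>fr cc S0 S'\<close> \<open>silent cc\<close>] .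
    have e: "vars S' (emb (R * v) r' x) = vars S0 (emb (R * v) r' x)" "arrs S' (emb (R * v) r' x) = arrs S0 (emb (R * v) r' x)" for r' x
      by (rule own owna, simp add: emb_def)+
    have "ready p d g S0" using \<open>epoch_inv k (k * v) S0\<close> by (simp add: epoch_inv_def)
    then have "ready p d g S'" by (simp add: ready_def prm_def own owna)
    then show ?thesis using \<open>epoch_inv k (k * v) S0\<close>
      unfolding epoch_inv_def traced_def rcv_inv_def cands_def by (simp add: own owna tr e)
  qed
  show ?thesis
    apply (rule wp_SeqI[OF c1])
    subgoal premises p1 for t1 S1
    proof -
      have I1: "epoch_inv k (k * v) S1" by (rule stab[OF I p1(2)]) auto
      have v1: "vars S1 12 = code_len p d g" "vars S1 57 = length (CL k)"
        using I1 by (auto simp: epoch_inv_def ready_def prm_def cands_def)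
      show ?thesis
        apply (rule wp_SeqI[OF wp_EXTB[OF v1 conjunct2[OF p1(1)], where q = q]])
        subgoal premises p2 for t2 S2
        proof -
          have I2: "epoch_inv k (k * v) S2" by (rule stab[OF I1 p2(2)]) auto
          let ?S = "set_var 58 0 (set_var 51 0 S2)"
          have "epoch_inv k (k * v) ?S"
            by (rule stab[OF I2, where cc = "Seq (SetC 51 0) (SetC 58 0)"]) (auto simp: fr_def)
          moreover have "snd_inv q M (xsym p d g (CL k)) (k * (v * H)) ?S"
          proof (rule snd_inv_start)
            show "vars ?S 12 = M" using I2 by (simp add: epoch_inv_def ready_def prm_def M_def)
            show "arrs ?S 12 i = q * xsym p d g (CL k) i" if "i < M" for i
              using p2(1) that by (simp add: M_def)
            show "length (snds (trace ?S)) = k * (v * H)"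
              using I2 by (simp add: epoch_inv_def traced_def)
          qed simp
          ultimately have RI: "run_inv k 0 ?S" by (simp add: run_inv_def)
          have c3: "wp (orc, inp) (RUNS p q s (R * v) c (k * v) v) (\<lambda>t S'. t \<le> v * run_time + 1 \<and> run_inv k v S') ?S"
            by (rule wp_RUNS[OF RI k]) simp
          show ?thesis
            apply (simp only: wp_Seq_SetC)
            apply (rule wp_SeqI[OF c3])
            subgoal premises p3 for t3 S3
            proof -
              note I3 = p3(1)[THEN conjunct2, unfolded run_inv_def epoch_inv_def traced_def]
              have E: "ents k = map (arrs S3 14) [0..<v * s]"
                using I3 by (simp add: ents_def)
              have cd3: "cands (CL k) S3" using I3 by blast
              show ?thesis
                apply (rule wp_fr, rule wp_mono[OF wp_SELECT[OF cd3 length_CL E, where th = th]], rule impI)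
                subgoal premises p4 for t4 S4
                proof -
                  note F4 = frD(1)[OF p4(2)] frD(2)[OF p4(2)] frD(3)[OF p4(2)]
                  have tr: "trace S4 = trace S3" using F4(3) by simp
                  have e: "vars S4 (emb (R * v) r' x) = vars S3 (emb (R * v) r' x)" "arrs S4 (emb (R * v) r' x) = arrs S3 (emb (R * v) r' x)" for r' x
                    using F4 by simp_all
                  have "ready p d g S4" by (rule ready_fr[OF _ p4(2)]) (use I3 in auto)
                  moreover have "snds (trace S3) ! (k' * (v * H) + j) div q = xsym p d g (CL k') (j mod M)"
                    if "k' < Suc k" "j < v * H" for k' j
                  proof (cases "k' = k")
                    case True
                    have "length (snds (trace S3)) = (k * v + v) * H" using I3 by blast
                    then have "k * (v * H) + j < length (snds (trace S3))"
                      using that by (simp add: algebra_simps)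
                    moreover have "snd_inv q M (xsym p d g (CL k)) (k * (v * H)) S3" using I3 by blast
                    ultimately show ?thesis using True by (simp add: snd_inv_def)
                  next
                    case False
                    then have "k' < k" using that by simp
                    then show ?thesis using I3 that by blast
                  qed
                  moreover have "cands (CL (Suc k)) S4" using p4(1) by simp
                  ultimately have "epoch_inv (Suc k) (Suc k * v) S4"
                    using I3 unfolding epoch_inv_def traced_def rcv_inv_def
                    by (simp add: F4 tr e add.commute del: CL.simps)
                  moreover have "length (CL k) * (enc_time p d g + 10) \<le> m * (enc_time p d g + 10)"
                    "length (CL k) * (M * (6 * 8 ^ d + 30) + 8 ^ d + 30) \<le> m * (M * (6 * 8 ^ d + 30) + 8 ^ d + 30)"
                    using length_CL[of k] by (intro mult_right_mono; simp)+
                  then have "t1 + (t2 + (1 + (1 + (t3 + t4)))) \<le> epoch_time"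
                    using conjunct1[OF p1(1)] conjunct1[OF p2(1)] conjunct1[OF p3(1)] conjunct1[OF p4(1)]
                    unfolding epoch_time_def encall_time_def extb_time_def select_time_def M_def[symmetric]
                    by linarith
                  ultimately show ?thesis by simp
                qed
                done
            qed
            done
        qed
        done
    qed
    done
qed

lemma wp_EPOCHS:
  assumes "epoch_inv 0 0 S" "k \<le> R"
  shows "wp (orc, inp) (EPOCHS p d q s (R * v) v th m c k) (\<lambda>t S'. t \<le> k * epoch_time + 1 \<and> epoch_inv k (k * v) S') S"
  using assms(2)
proof (induction k)
  case 0
  then show ?case using assms by (simp add: wp_Skip)
next
  case (Suc k)
  then have IH: "wp (orc, inp) (EPOCHS p d q s (R * v) v th m c k) (\<lambda>t S'. t \<le> k * epoch_time + 1 \<and> epoch_inv k (k * v) S') S" by simp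
  show ?case
    unfolding EPOCHS.simps
    apply (rule wp_SeqI[OF IH])
    subgoal premises p1 for t1 S1
      apply (rule wp_mono[OF wp_EPOCH[of k S1]])
      using p1(1) Suc.prems by auto
    done
qed

definition "answer W rc = judge R W (decided p d g m (CL R) W rc) (support p d g m (CL R) W rc) (CL R) (length (CL R))"

definition "prog_time = 3 + setup_time p d g + (R * epoch_time + 1) + encall_time + 8 + 6 * (v * N) +
  (R * (v * N * (m * (6 * (8 ^ d + 1) ^ m + 20) + m * (m * 15 + 30) + 70) + 20) + 20) +
  (m * ((R + 1) * (R * 25 + 30) + 10) + R + 20) + (n1 * (13 * p + 56) + 40)"

lemma judge_in: "judge R' W D H' cs l = 0 \<or> (\<exists>a<l. judge R' W D H' cs l = cs ! a)"
  by (induction l) (auto simp: less_Suc_eq)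

text \<open>The function \<open>rc\<close> is the content of array 13, of which only the cells of
  received symbols are known. The answer is expressed through it and the final candidates, so that
  the two parties can be compared without looking at their programs again.\<close>

lemma wp_PROG:
  assumes R: "0 < R"
  shows "wp (orc, inp) (PROG p d q s R v th m n0 c) (\<lambda>t S. t \<le> prog_time \<and>
    traced (R * v) S \<and>
    (\<forall>k<R. \<forall>j<v * H. snds (trace S) ! (k * (v * H) + j) div q = xsym p d g (CL k) (j mod M)) \<and>
    vars S 0 = 1 \<and>
    (\<exists>rc. (\<forall>j<R * (v * (N - H)). rc j = rcvs (trace S) ! j div q) \<and>
       (\<forall>j<n1. arrs S 0 j = sl p n1 (answer (v * (N - H)) rc - 1) j))) (init_state n)"
proof -
  let ?S = "set_var 3 n1 (set_var 20 (n - n0) (set_var 3 n0 (init_state n)))"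
  have n1: "n0 + (n - n0) = n1" by (simp add: n1_def)
  have i0: "vars (init_state n) 0 = n" by (simp add: init_state_def)
  have c0: "wp (orc, inp) (CODE_SETUP p d) (\<lambda>t s. t \<le> setup_time p d g \<and> ready p d g s) ?S"
    unfolding g_def by (rule wp_CODE_SETUP[OF p2 d0]) (auto simp: init_state_def)
  let ?E = "(8 ^ d + 1) ^ m :: nat" and ?W = "v * (N - H)"
  have HN: "H \<le> N" using length_trace_res[of 0] by (metis length_filter_le)
  show ?thesis
    unfolding PROG_def
    apply (simp only: wp_Seq_SetC wp_Seq[where c = "Sub 20 0 3"] wp_Seq[where c = "Add 3 3 20"] wp_Sub wp_Add)
    apply (simp only: state_simps i0 n1 if_False if_True numeral_eq_iff num.simps simp_thms zero_neq_numeral)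
    apply (rule wp_SeqI[OF c0])
    subgoal premises p1 for t1 S1
    proof -
      note F1 = frD(1)[OF p1(2)] frD(2)[OF p1(2)] frD(3)[OF p1(2)]
      have e1: "vars S1 (emb (R * v) r' x) = 0" "arrs S1 (emb (R * v) r' x) = (\<lambda>i. 0)" for r' x
        using F1(1,2)[of "emb (R * v) r' x"] by (simp_all add: init_state_def)
      have I1: "epoch_inv 0 0 S1"
        using p1(1) F1 e1 unfolding epoch_inv_def traced_def rcv_inv_def cands_def
        by (simp add: init_state_def)
      show ?thesis
        apply (rule wp_SeqI[OF wp_EPOCHS[OF I1 order.refl]])
        subgoal premises p2 for t2 S2
        proof -
          note I2 = p2(1)[THEN conjunct2, unfolded epoch_inv_def]
          have rd2: "ready p d g S2" and cd2: "cands (CL R) S2" using I2 by blast+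
          have c3: "wp (orc, inp) (ENCALL p d) (\<lambda>t s. t \<le> length (CL R) * (enc_time p d g + 10) + 10 \<and> coded p d g (CL R) s) S2"
            by (rule wp_ENCALL[OF pdg rd2 cd2 CL_bound'])
          show ?thesis
            apply (rule wp_SeqI[OF c3])
            subgoal premises p3 for t3 S3
            proof -
              note F3 = frD(1)[OF p3(2)] frD(2)[OF p3(2)] frD(3)[OF p3(2)]
              have rd3: "ready p d g S3" by (rule ready_fr[OF rd2 p3(2)]) auto
              have cd3: "cands (CL R) S3" using cd2 F3 by (simp add: cands_def)
              have tr3: "trace S3 = trace S2" using F3(3) by simp
              have lr: "length (rcvs (trace S2)) = R * ?W"
              proof -
                have "length (snds (trace S2)) + length (rcvs (trace S2)) = length (trace S2)"
                  by (simp add: snds_def rcvs_def sum_length_filter_compl)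
                moreover have "length (trace S2) = R * v * N" "length (snds (trace S2)) = R * v * H"
                  using I2 by (auto simp: traced_def)
                ultimately have "length (rcvs (trace S2)) = R * v * N - R * v * H" by linarith
                then show ?thesis by (simp add: diff_mult_distrib2 mult.assoc)
              qed
              have ri3: "vars S3 56 = R * ?W" "\<And>j. j < R * ?W \<Longrightarrow> arrs S3 13 j = rcvs (trace S2) ! j div q"
                using I2 lr F3 by (auto simp: rcv_inv_def)
              have Wd: "R * ?W div R = ?W" using R by simp
              show ?thesis
                apply (simp only: wp_Seq_SetC)
                apply (simp only: wp_Seq_MOV state_simps ri3 if_False if_True numeral_eq_iff num.simps simp_thms)
                apply (subst wp_Seq)
                apply (rule wp_DIVMOD)
                subgoal by simp
                subgoal using R by simp
                subgoal premises p4 for t4 S4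
                proof -
                  note F4 = frD(1)[OF p4(2)] frD(2)[OF p4(2)] frD(3)[OF p4(2)]
                  have v4: "vars S4 59 = ?W" "vars S4 57 = length (CL R)" "vars S4 12 = M" "arrs S4 = arrs S3"
                    "vars S4 3 = n1" "trace S4 = trace S2"
                    using p4(4) F4 Wd cd3 rd3 I2 F3 tr3 by (auto simp: cands_def ready_def prm_def M_def)
                  have t4: "t4 \<le> 6 * ?W + 5" using p4(1) Wd by simp
                  have rd4: "ready p d g S4" using rd3 F4 by (simp add: ready_def prm_def)
                  have co4: "coded p d g (CL R) S4" using p3(1) v4 by (simp add: coded_def)
                  have cd4: "cands (CL R) S4" using cd3 v4 by (simp add: cands_def)
                  have rE: "arrs S4 13 j \<le> ?E" if "j < R * ?W" for j
                    using I2 lr F3 v4(4) that by (auto simp: rcv_inv_def less_imp_le)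
                  have M4: "0 < code_len p d g" using M0 by (simp add: M_def)
                  have z4: "arrs S4 17 j = 0" "arrs S4 18 j = 0" for j using v4 F3 I2 by simp_all
                  show ?thesis
                    apply (rule wp_SeqI[OF wp_VOTE[OF co4 v4(2) length_CL _ M4 v4(1) rE z4, where R = R]])
                    subgoal using v4 by (simp add: M_def)
                    subgoal by assumption
                    subgoal premises p5 for t5 S5
                    proof -
                      note F5 = frD(1)[OF p5(2)] frD(2)[OF p5(2)] frD(3)[OF p5(2)]
                      have cd5: "cands (CL R) S5" using cd4 F5 by (simp add: cands_def)
                      have W5: "vars S5 59 = ?W" using F5 v4 by simp
                      have rd5: "ready p d g S5" by (rule ready_fr[OF rd4 p5(2)]) auto
                      show ?thesis
                        apply (rule wp_SeqI[OF wp_JUDGE[OF cd5 W5, where R = R and m = m and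
                          H = "support p d g m (CL R) ?W (arrs S4 13)" and D = "decided p d g m (CL R) ?W (arrs S4 13)"]])
                        subgoal using p5(1) by blast
                        subgoal using p5(1) by blast
                        subgoal premises p6 for t6 S6
                        proof -
                          note F6 = frD(1)[OF p6(2)] frD(2)[OF p6(2)] frD(3)[OF p6(2)]
                          have rd6: "ready p d g S6" by (rule ready_fr[OF rd5 p6(2)]) auto
                          have n6: "vars S6 3 = n1" using F6 F5 v4 by simp
                          have a6: "vars S6 85 = answer ?W (arrs S4 13)" using p6(1) by (simp add: answer_def)
                          have b6: "vars S6 85 - 1 < p ^ n1"
                          proof (cases "answer ?W (arrs S4 13) = 0")
                            case True
                            then show ?thesis using a6 pdg(1) by simp
                          next
                            case False
                            then have "answer ?W (arrs S4 13) \<in> set (CL R)"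
                              using judge_in[of R ?W "decided p d g m (CL R) ?W (arrs S4 13)"
                                  "support p d g m (CL R) ?W (arrs S4 13)" "CL R" "length (CL R)"]
                              unfolding answer_def by auto
                            then show ?thesis using a6 CL_bound by simp
                          qed
                          show ?thesis
                            apply (rule wp_fr, rule wp_mono[OF wp_OUTPUT[OF pdg rd6 n6 n1_le b6]], rule impI)
                            subgoal premises p7 for t7 S7
                            proof -
                              have tr7: "trace S7 = trace S2"
                                using frD(3)[OF p7(2)] F6(3) F5(3) v4 by simp
                              have "traced (R * v) S7" using I2 tr7 by (simp add: traced_def)
                              moreover have "\<exists>rc. (\<forall>j<R * ?W. rc j = rcvs (trace S7) ! j div q) \<and>
                                (\<forall>j<n1. arrs S7 0 j = sl p n1 (answer ?W rc - 1) j)"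
                                using p7(1) ri3(2) v4 a6 tr7 by (intro exI[of _ "arrs S4 13"]) simp
                              moreover have "\<forall>k<R. \<forall>j<v * H. snds (trace S7) ! (k * (v * H) + j) div q = xsym p d g (CL k) (j mod M)"
                                using I2 tr7 by simp
                              moreover have "?W \<le> v * N" by simp
                              moreover have "R * (?W * (m * (6 * ?E + 20) + m * (m * 15 + 30) + 70) + 20) \<le>
                                R * (v * N * (m * (6 * ?E + 20) + m * (m * 15 + 30) + 70) + 20)"
                                by (intro mult_le_mono add_mono order.refl) simp
                              moreover have "length (CL R) * (enc_time p d g + 10) \<le> m * (enc_time p d g + 10)"
                                "length (CL R) * ((R + 1) * (R * 25 + 30) + 10) \<le> m * ((R + 1) * (R * 25 + 30) + 10)"
                                using length_CL[of R] by (intro mult_right_mono; simp)+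
                              then have "1 + (1 + (1 + (t1 + (t2 + (t3 + (1 + (2 + (t4 + (t5 + (t6 + t7)))))))))) \<le> prog_time"
                                using conjunct1[OF p1(1)] conjunct1[OF p2(1)] conjunct1[OF p3(1)] t4 calculation(4,5)
                                  conjunct1[OF p5(1)] conjunct1[OF p6(1)] conjunct1[OF p7(1)]
                                unfolding prog_time_def encall_time_def by linarith
                              ultimately show ?thesis using p7(1) by simp
                            qed
                            done
                        qed
                        done
                    qed
                    done
                qed
                done
            qed
            done
        qed
        done
    qed
    done
qed

end

section \<open>Noiseless executions and the lower bound on the number of rounds\<close>

lemma big_step_causalI:
  "big_step orc inp' c st t st' \<Longrightarrow> (length (trace st') \<le> k \<longrightarrow> big_step orc inp' c st t st') \<and>
    (k < length (trace st') \<longrightarrow> (\<forall>u st''. big_step orc inp' c st u st'' \<longrightarrow>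
       take k (trace st'') = take k (trace st')))"
  by (auto dest: big_step_det)

text \<open>The first k events depend only on the inputs before round k. An execution with at most k
  events is unchanged. A longer one may continue differently, and could fail to halt, so only
  halting executions are compared with it.\<close>

lemma big_step_causal:
  assumes "big_step orc inp c st t st'" "\<And>i. i < k \<Longrightarrow> inp i = inp' i"
  shows "(length (trace st') \<le> k \<longrightarrow> big_step orc inp' c st t st') \<and>
    (k < length (trace st') \<longrightarrow> (\<forall>u st''. big_step orc inp' c st u st'' \<longrightarrow>
       take k (trace st'') = take k (trace st')))"
  using assms
proof (induction rule: big_step.induct)
  case (Recv v st x)
  have 1: "big_step orc inp' (Recv x) st 1 (log_event (Rcv v) (set_var x v st))" if "length (trace st) < k"
    using Recv that by (intro big_step.Recv) auto
  show ?case using 1 by (auto elim!: big_step_RecvE)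
next
  case (Seq c st t st1 d u st2)
  obtain new where new: "trace st2 = trace st1 @ new" using big_step_trace[OF Seq.hyps(2)] by blast
  note IH = Seq.IH[OF Seq.prems]
  show ?case
  proof (intro conjI impI allI)
    assume "length (trace st2) \<le> k"
    then show "big_step orc inp' (Seq c d) st (t + u) st2"
      using IH new by (intro big_step.Seq) auto
  next
    fix w st'' assume k: "k < length (trace st2)" and "big_step orc inp' (Seq c d) st w st''"
    then obtain w1 w2 s1 where s1: "big_step orc inp' c st w1 s1" "big_step orc inp' d s1 w2 st''"
      by (auto elim: big_step_SeqE)
    show "take k (trace st'') = take k (trace st2)"
    proof (cases "length (trace st1) \<le> k")
      case True
      then have "s1 = st1" using IH big_step_det[OF s1(1)] by blast
      then show ?thesis using IH(2) k s1(2) by blast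
    next
      case False
      then have eq: "take k (trace s1) = take k (trace st1)" using IH(1) s1(1) by auto
      then have "k \<le> length (trace s1)" using False by (metis length_take min.absorb_iff2 nat_le_linear)
      moreover obtain new' where "trace st'' = trace s1 @ new'" using big_step_trace[OF s1(2)] by blast
      ultimately show ?thesis using eq new False by simp
    qed
  qed
next
  case (IfTrue st x c t st' d)
  then show ?case by (auto intro: big_step.IfTrue elim!: big_step_IfE)
next
  case (IfFalse st x d t st' c)
  then show ?case by (auto intro: big_step.IfFalse elim!: big_step_IfE)
next
  case (WhileTrue st x c t st1 u st2)
  obtain new where new: "trace st2 = trace st1 @ new" using big_step_trace[OF WhileTrue.hyps(3)] by blast
  note IH = WhileTrue.IH[OF WhileTrue.prems]
  show ?case
  proof (intro conjI impI allI)
    assume "length (trace st2) \<le> k"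
    then show "big_step orc inp' (WhileNZ x c) st (Suc (t + u)) st2"
      using IH new WhileTrue.hyps(1) by (intro big_step.WhileTrue) auto
  next
    fix w st'' assume k: "k < length (trace st2)" and "big_step orc inp' (WhileNZ x c) st w st''"
    then obtain w1 w2 s1 where s1: "big_step orc inp' c st w1 s1" "big_step orc inp' (WhileNZ x c) s1 w2 st''"
      using WhileTrue.hyps(1) by (auto elim: big_step_WhileE)
    show "take k (trace st'') = take k (trace st2)"
    proof (cases "length (trace st1) \<le> k")
      case True
      then have "s1 = st1" using IH big_step_det[OF s1(1)] by blast
      then show ?thesis using IH(2) k s1(2) by blast
    next
      case False
      then have eq: "take k (trace s1) = take k (trace st1)" using IH(1) s1(1) by auto
      then have "k \<le> length (trace s1)" using False by (metis length_take min.absorb_iff2 nat_le_linear)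
      moreover obtain new' where "trace st'' = trace s1 @ new'" using big_step_trace[OF s1(2)] by blast
      ultimately show ?thesis using eq new False by simp
    qed
  qed
qed (rule big_step_causalI, (rule big_step.Skip big_step.SetC big_step.Add big_step.Sub
      big_step.Load big_step.Store big_step.Send big_step.Query big_step.WhileFalse; assumption))+

text \<open>An execution can be repeated from the symbols in its own trace. With determinism this
  makes the final state a function of these symbols, as the counting argument requires.\<close>

lemma big_step_replay:
  assumes "big_step orc inp c st t st'"
    and "\<And>i v. length (trace st) \<le> i \<Longrightarrow> i < length (trace st') \<Longrightarrow> trace st' ! i = Rcv v \<Longrightarrow> inp' i = v"
  shows "big_step orc inp' c st t st'"
  using assms
proof (induction rule: big_step.induct)
  case (Recv v st x)
  then show ?case by (intro big_step.Recv) (auto simp: nth_append)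
next
  case (Seq c st t st1 d u st2)
  obtain n1 where n1: "trace st1 = trace st @ n1" using big_step_trace[OF Seq.hyps(1)] by blast
  obtain n2 where n2: "trace st2 = trace st1 @ n2" using big_step_trace[OF Seq.hyps(2)] by blast
  have "big_step orc inp' c st t st1"
    using Seq.prems n2 by (intro Seq.IH(1)) (auto simp: nth_append)
  moreover have "big_step orc inp' d st1 u st2"
    using Seq.prems n1 by (intro Seq.IH(2)) auto
  ultimately show ?case by (rule big_step.Seq)
next
  case (WhileTrue st x c t st1 u st2)
  obtain n1 where n1: "trace st1 = trace st @ n1" using big_step_trace[OF WhileTrue.hyps(2)] by blast
  obtain n2 where n2: "trace st2 = trace st1 @ n2" using big_step_trace[OF WhileTrue.hyps(3)] by blast
  have "big_step orc inp' c st t st1"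
    using WhileTrue.prems n2 by (intro WhileTrue.IH(1)) (auto simp: nth_append)
  moreover have "big_step orc inp' (WhileNZ x c) st1 u st2"
    using WhileTrue.prems n1 by (intro WhileTrue.IH(2)) auto
  ultimately show ?case using WhileTrue.hyps(1) by (intro big_step.WhileTrue) auto
next
  case (IfTrue st x c t st' d)
  then show ?case by (intro big_step.IfTrue) auto
next
  case (IfFalse st x d t st' c)
  then show ?case by (intro big_step.IfFalse) auto
qed (rule big_step.Skip big_step.SetC big_step.Add big_step.Sub big_step.Load big_step.Store
    big_step.Send big_step.Query big_step.WhileFalse; assumption)+

lemma trace_init_state [simp]: "trace (init_state n) = []"
  by (simp add: init_state_def)

text \<open>The inputs are functions given in advance, so an undisturbed channel is a fixed point
  between the two parties. It is reached round by round: the listener's input in round k is set to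
  what the sender transmits there. The sender's execution stays the same, and by causality so do the
  listener's earlier rounds.\<close>

lemma noiseless_execution:
  assumes cs: "coding_scheme p q S T" and pr: "protocol_over p \<Pi>"
  obtains stA stB where "execution q S n \<Pi> stA stB" "corruptions stA stB = 0"
    "conforms q (rounds S n) (alice_sends S n) (trace stA)"
proof -
  let ?N = "rounds S n"
  have q: "0 < q" using cs by (simp add: coding_scheme_def)
  have A: "\<exists>t st. big_step (alice_oracle \<Pi>) inp (alice_prog S) (init_state n) t st \<and>
      conforms q ?N (alice_sends S n) (trace st)" if "\<And>i. inp i < q" for inp
    using cs pr that unfolding coding_scheme_def by blast
  have B: "\<exists>t st. big_step (bob_oracle \<Pi>) inp (bob_prog S) (init_state n) t st \<and>
      conforms q ?N (\<lambda>i. \<not> alice_sends S n i) (trace st)" if "\<And>i. inp i < q" for inp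
    using cs pr that unfolding coding_scheme_def by blast
  have "\<exists>inA inB tA tB stA stB. (\<forall>i. inA i < q \<and> inB i < q) \<and>
      big_step (alice_oracle \<Pi>) inA (alice_prog S) (init_state n) tA stA \<and>
      conforms q ?N (alice_sends S n) (trace stA) \<and>
      big_step (bob_oracle \<Pi>) inB (bob_prog S) (init_state n) tB stB \<and>
      conforms q ?N (\<lambda>i. \<not> alice_sends S n i) (trace stB) \<and>
      (\<forall>i<k. sym (trace stA ! i) = sym (trace stB ! i))" if "k \<le> ?N" for k
    using that
  proof (induction k)
    case 0
    show ?case using A[of "\<lambda>_. 0"] B[of "\<lambda>_. 0"] q by (intro exI[of _ "\<lambda>_. 0"]) auto
  next
    case (Suc k)
    then obtain inA inB tA tB stA stB where H: "\<forall>i. inA i < q \<and> inB i < q"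
      "big_step (alice_oracle \<Pi>) inA (alice_prog S) (init_state n) tA stA"
      "conforms q ?N (alice_sends S n) (trace stA)"
      "big_step (bob_oracle \<Pi>) inB (bob_prog S) (init_state n) tB stB"
      "conforms q ?N (\<lambda>i. \<not> alice_sends S n i) (trace stB)"
      "\<forall>i<k. sym (trace stA ! i) = sym (trace stB ! i)" by auto
    have "inA i < q" "inB i < q" for i using H(1) by auto
    note * = this H(2-5) H(6)[rule_format]
    have k: "k < ?N" using Suc.prems by simp
    have lA: "length (trace stA) = ?N" and lB: "length (trace stB) = ?N" using * by (auto simp: conforms_def)
    have sA: "sym (trace stA ! k) < q" and sB: "sym (trace stB ! k) < q" using * k by (auto simp: conforms_def)
    show ?case
    proof (cases "alice_sends S n k")
      case True
      let ?in = "inB(k := sym (trace stA ! k))"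
      have in': "?in i < q" for i using *(2) sA by simp
      obtain t st where st: "big_step (bob_oracle \<Pi>) ?in (bob_prog S) (init_state n) t st"
        "conforms q ?N (\<lambda>i. \<not> alice_sends S n i) (trace st)"
        using B[of ?in, OF in'] by blast
      have tk: "take k (trace st) = take k (trace stB)"
        using big_step_causal[OF *(5), of k ?in] st(1) lB k by auto
      have "\<not> is_Snd (trace st ! k)" using st(2) True k by (simp add: conforms_def)
      then have "trace st ! k = Rcv (sym (trace st ! k))" by (cases "trace st ! k") auto
      from big_step_rcv[OF st(1) _ _ this] have "sym (trace st ! k) = sym (trace stA ! k)"
        using st(2) k by (simp add: conforms_def)
      moreover have "trace st ! i = trace stB ! i" if "i < k" for i
        using arg_cong[OF tk, of "\<lambda>l. l ! i"] that by simp
      ultimately have "\<forall>i<Suc k. sym (trace stA ! i) = sym (trace st ! i)"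
        using *(7) by (auto simp: less_Suc_eq)
      then show ?thesis using *(1,3,4) st in' by blast
    next
      case False
      let ?in = "inA(k := sym (trace stB ! k))"
      have in': "?in i < q" for i using *(1) sB by simp
      obtain t st where st: "big_step (alice_oracle \<Pi>) ?in (alice_prog S) (init_state n) t st"
        "conforms q ?N (alice_sends S n) (trace st)"
        using A[of ?in, OF in'] by blast
      have tk: "take k (trace st) = take k (trace stA)"
        using big_step_causal[OF *(3), of k ?in] st(1) lA k by auto
      have "\<not> is_Snd (trace st ! k)" using st(2) False k by (simp add: conforms_def)
      then have "trace st ! k = Rcv (sym (trace st ! k))" by (cases "trace st ! k") auto
      from big_step_rcv[OF st(1) _ _ this] have "sym (trace st ! k) = sym (trace stB ! k)"
        using st(2) k by (simp add: conforms_def)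
      moreover have "trace st ! i = trace stA ! i" if "i < k" for i
        using arg_cong[OF tk, of "\<lambda>l. l ! i"] that by simp
      ultimately have "\<forall>i<Suc k. sym (trace st ! i) = sym (trace stB ! i)"
        using *(7) by (auto simp: less_Suc_eq)
      then show ?thesis using *(2,5,6) st in' by blast
    qed
  qed
  from this[OF order.refl] obtain inA inB tA tB stA stB where *: "\<And>i. inA i < q \<and> inB i < q"
      "big_step (alice_oracle \<Pi>) inA (alice_prog S) (init_state n) tA stA"
      "conforms q ?N (alice_sends S n) (trace stA)"
      "big_step (bob_oracle \<Pi>) inB (bob_prog S) (init_state n) tB stB"
      "\<And>i. i < ?N \<Longrightarrow> sym (trace stA ! i) = sym (trace stB ! i)" by blast
  have "execution q S n \<Pi> stA stB" unfolding execution_def using * by blast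
  moreover have "corruptions stA stB = 0" using * by (auto simp: corruptions_def conforms_def)
  ultimately show ?thesis using that *(3) by blast
qed

text \<open>Any word is the transcript of a protocol in which Alice never speaks. Her oracle is then
  constant, so her output depends only on what she receives.\<close>

definition bob_tells :: "nat list \<Rightarrow> protocol" where
  "bob_tells x = \<lparr>alice_speaks = (\<lambda>_. False), alice_msg = (\<lambda>_. 0),
     bob_msg = (\<lambda>h. if length h < length x then x ! length h else 0)\<rparr>"

lemma length_transcript [simp]: "length (transcript \<Pi> k) = k"
  by (induction k) (auto simp: Let_def)

lemma transcript_bob_tells: "k \<le> length x \<Longrightarrow> transcript (bob_tells x) k = take k x"
  by (induction k) (auto simp: Let_def bob_tells_def take_Suc_conv_app_nth)

text \<open>The symbols in Alice's trace determine her final state, and this state together with an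
  index below s determines the word; hence p^n <= s q^N. The crude bounds p >= 2, q <= 2^q and s <=
  2^s turn this into the linear form.\<close>

lemma rounds_lower_bound:
  assumes cs: "coding_scheme p q S T" and ld: "list_decoding s p q \<rho> S" and \<rho>: "0 \<le> \<rho> * real (rounds S n)" and p: "2 \<le> p"
  shows "n \<le> s + q * rounds S n"
proof -
  let ?N = "rounds S n" and ?X = "{x. set x \<subseteq> {..<p} \<and> length x = n}"
  have q: "0 < q" using cs by (simp add: coding_scheme_def)
  have ex: "\<exists>stA i. (\<exists>inA t. big_step (\<lambda>h. 0) inA (alice_prog S) (init_state n) t stA) \<and>
      length (trace stA) = ?N \<and> (\<forall>e\<in>set (trace stA). sym e < q) \<and> i < s \<and> outputs n stA ! i = x"
    if x: "x \<in> ?X" for x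
  proof -
    have pr: "protocol_over p (bob_tells x)"
      using x p by (auto simp: protocol_over_def bob_tells_def subset_iff)
    obtain stA stB where st: "execution q S n (bob_tells x) stA stB" "corruptions stA stB = 0"
      "conforms q ?N (alice_sends S n) (trace stA)"
      by (rule noiseless_execution[OF cs pr])
    have "length (outputs n stA) \<le> s \<and> transcript (bob_tells x) n \<in> set (outputs n stA)"
      using ld pr st(1,2) \<rho> unfolding list_decoding_def by fastforce
    moreover have "transcript (bob_tells x) n = x" using x transcript_bob_tells[of n x] by simp
    ultimately obtain i where i: "i < s" "outputs n stA ! i = x"
      by (metis in_set_conv_nth less_le_trans)
    have "alice_oracle (bob_tells x) = (\<lambda>h. 0)" by (simp add: alice_oracle_def bob_tells_def fun_eq_iff)
    then have "\<exists>inA t. big_step (\<lambda>h. 0) inA (alice_prog S) (init_state n) t stA"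
      using st(1) unfolding execution_def by auto
    then show ?thesis using i st(3) by (intro exI[of _ stA] exI[of _ i]) (auto simp: conforms_def in_set_conv_nth)
  qed
  then obtain stA i where st: "\<And>x. x \<in> ?X \<Longrightarrow> (\<exists>inA t. big_step (\<lambda>h. 0) inA (alice_prog S) (init_state n) t (stA x)) \<and>
      length (trace (stA x)) = ?N \<and> (\<forall>e\<in>set (trace (stA x)). sym e < q) \<and> i x < s \<and> outputs n (stA x) ! i x = x"
    by metis
  let ?L = "\<lambda>x. map sym (trace (stA x))"
  have det: "stA x = stA y" if "x \<in> ?X" "y \<in> ?X" "?L x = ?L y" for x y
  proof -
    have "\<exists>t. big_step (\<lambda>h. 0) (\<lambda>i. ?L z ! i) (alice_prog S) (init_state n) t (stA z)" if z: "z \<in> ?X" for z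
    proof -
      obtain inA t where "big_step (\<lambda>h. 0) inA (alice_prog S) (init_state n) t (stA z)" using st[OF z] by blast
      then have "big_step (\<lambda>h. 0) (\<lambda>i. ?L z ! i) (alice_prog S) (init_state n) t (stA z)"
        by (rule big_step_replay) auto
      then show ?thesis by blast
    qed
    from this[OF \<open>x \<in> ?X\<close>] this[OF \<open>y \<in> ?X\<close>] that(3) show ?thesis using big_step_det by metis
  qed
  let ?f = "\<lambda>x. (?L x, i x)"
  have "inj_on ?f ?X"
  proof (rule inj_onI)
    fix x y assume xy: "x \<in> ?X" "y \<in> ?X" "?f x = ?f y"
    then have "stA x = stA y" "i x = i y" using det by auto
    then show "x = y" using st[OF xy(1)] st[OF xy(2)] by metis
  qed
  moreover have "?f ` ?X \<subseteq> {l. set l \<subseteq> {..<q} \<and> length l = ?N} \<times> {..<s}"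
    using st by auto
  ultimately have "card ?X \<le> card ({l. set l \<subseteq> {..<q} \<and> length l = ?N} \<times> {..<s})"
    by (intro card_inj_on_le) (auto simp: finite_lists_length_eq)
  then have "p ^ n \<le> q ^ ?N * s" by (simp add: card_lists_length_eq card_cartesian_product)
  moreover have "2 ^ n \<le> p ^ n" using p by (rule power_mono) simp
  moreover have "q ^ ?N \<le> (2 ^ q) ^ ?N" using less_exp[of q] by (intro power_mono) auto
  moreover have "s \<le> 2 ^ s" using less_exp[of s] by simp
  ultimately have "2 ^ n \<le> ((2::nat) ^ q) ^ ?N * 2 ^ s" by (meson le_trans mult_le_mono)
  also have "\<dots> = 2 ^ (s + q * ?N)" by (simp add: power_add power_mult)
  finally show ?thesis by (simp add: power_increasing_iff)
qed

section \<open>Traces\<close>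

lemma filter_prefix_blocks:
  assumes "\<And>k'. k' < k \<Longrightarrow> length (filter P (take L (drop (k' * L) xs))) = h"
  shows "length (filter P (take (k * L) xs)) = k * h"
  using assms
proof (induction k)
  case (Suc k)
  have "take (Suc k * L) xs = take (k * L) xs @ take L (drop (k * L) xs)"
    using take_add[of "k * L" L xs] by (simp add: add.commute)
  then show ?case using Suc by simp
qed simp

lemma filter_block_nth:
  assumes "\<And>k'. k' < K \<Longrightarrow> length (filter P (take L (drop (k' * L) xs))) = h" "k < K" "j < h"
  shows "filter P xs ! (k * h + j) = filter P (take L (drop (k * L) xs)) ! j"
proof -
  have "xs = take (k * L) xs @ take L (drop (k * L) xs) @ drop L (drop (k * L) xs)"
    by (metis append_take_drop_id)
  then have "filter P xs = filter P (take (k * L) xs) @ filter P (take L (drop (k * L) xs)) @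
      filter P (drop L (drop (k * L) xs))" by (metis filter_append)
  moreover have "length (filter P (take (k * L) xs)) = k * h"
    using assms by (intro filter_prefix_blocks) auto
  ultimately show ?thesis using assms by (simp add: nth_append)
qed

section \<open>Hamming distance of traces\<close>

definition mism :: "'a list \<Rightarrow> 'a list \<Rightarrow> nat" where
  "mism xs ys = length (filter (\<lambda>(x, y). x \<noteq> y) (zip xs ys))"

lemma mism_card: "length xs = length ys \<Longrightarrow> mism xs ys = card {i. i < length xs \<and> xs ! i \<noteq> ys ! i}"
  by (auto simp: mism_def length_filter_conv_card intro!: arg_cong[where f = card])

text \<open>Under complementary schedules the j-th symbol that one party receives belongs to the
  j-th symbol that the other sends, so corruptions can be counted separately for each
  direction.\<close>

lemma mism_split:
  assumes "length xs = length ys" "\<And>i. i < length xs \<Longrightarrow> is_Snd (xs ! i) \<noteq> is_Snd (ys ! i)"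
  shows "mism (map sym xs) (map sym ys) = mism (rcvs xs) (snds ys) + mism (snds xs) (rcvs ys) \<and>
    length (rcvs xs) = length (snds ys) \<and> length (snds xs) = length (rcvs ys)"
  using assms
proof (induction xs ys rule: list_induct2)
  case (Cons x xs y ys)
  have "is_Snd x \<noteq> is_Snd y" using Cons.prems[of 0] by simp
  moreover have "is_Snd (xs ! i) \<noteq> is_Snd (ys ! i)" if "i < length xs" for i
    using Cons.prems[of "Suc i"] that by simp
  ultimately show ?case using Cons.IH by (cases x; cases y) (auto simp: mism_def)
qed (simp add: mism_def)

lemma mism_append: "length xs = length ys \<Longrightarrow> mism (xs @ xs') (ys @ ys') = mism xs ys + mism xs' ys'"
  by (simp add: mism_def)

lemma mism_blocks:
  assumes "length xs = K * L" "length ys = K * L"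
  shows "mism xs ys = (\<Sum>k<K. mism (take L (drop (k * L) xs)) (take L (drop (k * L) ys)))"
  using assms
proof (induction K arbitrary: xs ys)
  case (Suc K)
  let ?m = "K * L"
  have xs: "xs = take ?m xs @ drop ?m xs" "ys = take ?m ys @ drop ?m ys" by simp_all
  have "mism xs ys = mism (take ?m xs) (take ?m ys) + mism (drop ?m xs) (drop ?m ys)"
    by (subst xs(1), subst xs(2), rule mism_append) (use Suc.prems in simp)
  also have "mism (take ?m xs) (take ?m ys) = (\<Sum>k<K. mism (take L (drop (k * L) (take ?m xs))) (take L (drop (k * L) (take ?m ys))))"
    by (rule Suc.IH) (use Suc.prems in simp_all)
  also have "\<dots> = (\<Sum>k<K. mism (take L (drop (k * L) xs)) (take L (drop (k * L) ys)))"
  proof (rule sum.cong)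
    fix k assume "k \<in> {..<K}"
    then have "Suc k * L \<le> K * L" by (intro mult_right_mono) auto
    then have "L \<le> K * L - k * L" by simp
    then have "take L (drop (k * L) (take ?m zs)) = take L (drop (k * L) zs)" for zs :: "'a list"
      by (simp add: drop_take min_def)
    then show "mism (take L (drop (k * L) (take ?m xs))) (take L (drop (k * L) (take ?m ys))) =
      mism (take L (drop (k * L) xs)) (take L (drop (k * L) ys))" by simp
  qed simp
  also have "drop ?m xs = take L (drop ?m xs)" using Suc.prems by simp
  also have "drop ?m ys = take L (drop ?m ys)" using Suc.prems by simp
  finally show ?case by simp
qed (simp add: mism_def)

section \<open>Correctness of the decision\<close>

lemma positional_digit:
  fixes B :: nat
  assumes "\<And>a. a < l \<Longrightarrow> f a < B" "0 < B"
  shows "(\<Sum>a<l. f a * B ^ a) div B ^ c mod B = (if c < l then f c else 0)"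
  using assms(1)
proof (induction l)
  case (Suc l)
  let ?X = "\<Sum>a<l. f a * B ^ a"
  have X: "?X < B ^ l" by (rule positional_less) (use Suc.prems in simp)
  consider "c < l" | "c = l" | "l < c" by linarith
  then show ?case
  proof cases
    case 1
    obtain e where e: "l = c + Suc e" using less_iff_Suc_add[of c l] 1 by auto
    have "B ^ l = B ^ Suc e * B ^ c" by (simp add: e power_add)
    then have "f l * B ^ l = (f l * B ^ Suc e) * B ^ c" by (simp only: mult.assoc)
    moreover have "(?X + (f l * B ^ Suc e) * B ^ c) div B ^ c = f l * B ^ Suc e + ?X div B ^ c"
      by (rule div_mult_self1) (use assms(2) in simp)
    ultimately have "(?X + f l * B ^ l) div B ^ c = ?X div B ^ c + f l * B ^ Suc e"
      by (simp only: add.commute)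
    moreover have "(?X div B ^ c + (f l * B ^ e) * B) mod B = ?X div B ^ c mod B" by (rule mod_mult_self1)
    ultimately show ?thesis using Suc 1 by (simp add: mult_ac)
  next
    case 2
    have "(?X + f l * B ^ l) div B ^ l = f l" using X assms(2) by simp
    then show ?thesis using 2 Suc.prems[of l] by simp
  next
    case 3
    have "(\<Sum>a<Suc l. f a * B ^ a) < B ^ Suc l" by (rule positional_less) (use Suc.prems in simp)
    also have "\<dots> \<le> B ^ c" using 3 assms(2) by (intro power_increasing) auto
    finally show ?thesis using 3 by simp
  qed
qed simp

lemma xsym_digit:
  "xsym p d g cs i div (8 ^ d + 1) ^ c mod (8 ^ d + 1) =
    (if c < length cs then Suc (code p d g (cs ! c - 1) i) else 0)"
  unfolding xsym_def
  by (rule positional_digit) (use code_less[of p d g _ i] in auto)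

text \<open>Digits beyond the sender's list are 0 and never equal a shifted code symbol, so only the
  sender's candidates can produce a match.\<close>

lemma hold_xsym:
  assumes "length cs' \<le> m"
  shows "hold p d g m cs (xsym p d g cs' i) i a \<longleftrightarrow>
    (\<exists>c<length cs'. code p d g (cs ! a - 1) i = code p d g (cs' ! c - 1) i)"
  unfolding hold_def xsym_digit using assms by (auto split: if_splits intro: less_le_trans)

lemma card_mod_le:
  assumes "0 < (M::nat)"
  shows "card {j. j < W \<and> P (j mod M)} \<le> (W div M + 1) * card {i. i < M \<and> P i}"
proof -
  let ?A = "{j. j < W \<and> P (j mod M)}" and ?B = "{i. i < M \<and> P i}"
  have "inj_on (\<lambda>j. (j div M, j mod M)) ?A"
    by (rule inj_onI) (metis div_mult_mod_eq prod.inject)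
  moreover have "(\<lambda>j. (j div M, j mod M)) ` ?A \<subseteq> {..W div M} \<times> ?B"
    using assms by (auto simp: div_le_mono)
  ultimately have "card ?A \<le> card ({..W div M} \<times> ?B)" by (intro card_inj_on_le) auto
  then show ?thesis by (simp add: card_cartesian_product)
qed

context
  fixes p d g :: nat
  assumes pdg: "2 \<le> p" "0 < d" "0 < g"
begin

text \<open>The incomplete last period is counted as a full one. As W covers at least one period,
  this at most doubles the bound.\<close>

lemma code_agreements_periodic:
  assumes "X < p ^ (g * axis_in p g ^ 4)" "Y < p ^ (g * axis_in p g ^ 4)" "X \<noteq> Y"
    and W: "code_len p d g \<le> W"
  shows "d * card {j. j < W \<and> code p d g X (j mod code_len p d g) = code p d g Y (j mod code_len p d g)} \<le> 4 * W"
proof -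
  let ?M = "code_len p d g"
  have M: "0 < ?M" using axis_out_ge[OF pdg] by (simp add: code_len_def inner_len_def)
  let ?C = "card {i. i < ?M \<and> code p d g X i = code p d g Y i}"
  have "d * card {j. j < W \<and> code p d g X (j mod ?M) = code p d g Y (j mod ?M)} \<le> d * ((W div ?M + 1) * ?C)"
    using card_mod_le[OF M] by (intro mult_left_mono) auto
  also have "\<dots> = (W div ?M + 1) * (d * ?C)" by (rule mult.left_commute)
  also have "\<dots> \<le> (W div ?M + 1) * (2 * ?M)"
    by (intro mult_left_mono code_agreements[OF pdg assms(1-3)]) simp
  also have "\<dots> = 2 * (W div ?M * ?M) + 2 * ?M" by (simp add: algebra_simps)
  also have "\<dots> \<le> 2 * W + 2 * W" using W div_times_less_eq_dividend[of W ?M] by (intro add_mono) auto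
  finally show ?thesis by simp
qed

text \<open>At a position that is neither corrupted nor a coincidence between another own candidate
  and a candidate of the sender, no wrong candidate holds; and \<open>a0\<close> wins there if the
  sender has it. By \<open>excl\<close> the coincidences concern different codewords, so each of the
  at most m^2 pairs accounts for at most 4 W / d positions.\<close>

lemma epoch_votes:
  fixes rc :: "nat \<Rightarrow> nat"
  assumes cs: "length cs \<le> m" "\<And>x. x \<in> set cs \<Longrightarrow> x \<noteq> 0 \<and> x - 1 < p ^ (g * axis_in p g ^ 4)"
    and cs': "length cs' \<le> m" "\<And>x. x \<in> set cs' \<Longrightarrow> x \<noteq> 0 \<and> x - 1 < p ^ (g * axis_in p g ^ 4)"
    and W: "code_len p d g \<le> W" and a0: "a0 < length cs"
    and excl: "\<And>a. a < length cs \<Longrightarrow> a \<noteq> a0 \<Longrightarrow> cs ! a \<notin> set cs'"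
    and A: "card {j. j < W \<and> rc (k * W + j) \<noteq> xsym p d g cs' (j mod code_len p d g)} \<le> A"
  shows "\<exists>b. d * b \<le> 4 * m * m * W \<and>
    decided p d g m cs W rc k - support p d g m cs W rc k a0 \<le> A + b \<and>
    (cs ! a0 \<in> set cs' \<longrightarrow> W - support p d g m cs W rc k a0 \<le> A + b)"
proof -
  let ?M = "code_len p d g"
  let ?c = "\<lambda>x j. code p d g (x - 1) (j mod ?M)"
  let ?Corr = "{j. j < W \<and> rc (k * W + j) \<noteq> xsym p d g cs' (j mod ?M)}"
  define Pr where "Pr = {(a, c). a < length cs \<and> a \<noteq> a0 \<and> c < length cs'}"
  have Pr: "Pr \<subseteq> {..<length cs} \<times> {..<length cs'}" by (auto simp: Pr_def)
  then have finPr: "finite Pr" using finite_subset by blast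
  have cPr: "card Pr \<le> m * m"
    using card_mono[OF _ Pr] mult_le_mono[OF cs(1) cs'(1)] by (simp add: card_cartesian_product)
  let ?B1 = "\<lambda>(a, c). {j. j < W \<and> ?c (cs ! a) j = ?c (cs' ! c) j}"
  define Bad where "Bad = (\<Union>x\<in>Pr. ?B1 x)"
  have finB: "finite Bad" unfolding Bad_def using finPr by auto
  have dB: "d * card Bad \<le> 4 * m * m * W"
  proof -
    have "card Bad \<le> (\<Sum>x\<in>Pr. card (?B1 x))" unfolding Bad_def by (rule card_UN_le[OF finPr])
    then have "d * card Bad \<le> d * (\<Sum>x\<in>Pr. card (?B1 x))" by simp
    also have "\<dots> = (\<Sum>x\<in>Pr. d * card (?B1 x))" by (simp add: sum_distrib_left)
    also have "\<dots> \<le> (\<Sum>x\<in>Pr. 4 * W)"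
    proof (intro sum_mono)
      fix x assume "x \<in> Pr"
      then obtain a c where x: "x = (a, c)" "a < length cs" "a \<noteq> a0" "c < length cs'" by (auto simp: Pr_def)
      have "cs ! a \<in> set cs" "cs' ! c \<in> set cs'" using x by auto
      moreover have "cs ! a \<noteq> cs' ! c" using excl[OF x(2,3)] nth_mem[OF x(4)] by auto
      moreover have "cs ! a \<noteq> 0" "cs' ! c \<noteq> 0" using cs(2) cs'(2) calculation(1,2) by blast+
      ultimately have "cs ! a - 1 \<noteq> cs' ! c - 1" by arith
      then show "d * card (?B1 x) \<le> 4 * W"
        using code_agreements_periodic[of "cs ! a - 1" "cs' ! c - 1" W] cs(2) cs'(2) x W by auto
    qed
    also have "\<dots> \<le> m * m * (4 * W)" using cPr by simp
    finally show ?thesis by (simp add: algebra_simps)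
  qed
  have quiet: "\<not> hold p d g m cs (rc (k * W + j)) (j mod ?M) a"
    if "j < W" "j \<notin> ?Corr" "j \<notin> Bad" "a < length cs" "a \<noteq> a0" for j a
  proof
    assume "hold p d g m cs (rc (k * W + j)) (j mod ?M) a"
    moreover have "rc (k * W + j) = xsym p d g cs' (j mod ?M)" using that by auto
    ultimately obtain c where "c < length cs'" "?c (cs ! a) j = ?c (cs' ! c) j"
      using hold_xsym[OF cs'(1), of p d g cs "j mod ?M" a] by auto
    then have "(a, c) \<in> Pr" "j \<in> ?B1 (a, c)" using that by (auto simp: Pr_def)
    then show False using that(3) unfolding Bad_def by blast
  qed
  let ?D = "{j. j < W \<and> (\<exists>a. wins p d g m cs (rc (k * W + j)) (j mod ?M) a)}"
  let ?S = "{j. j < W \<and> wins p d g m cs (rc (k * W + j)) (j mod ?M) a0}"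
  have AB: "card (?Corr \<union> Bad) \<le> A + card Bad"
    using card_Un_le[of ?Corr Bad] A by linarith
  have finCB: "finite (?Corr \<union> Bad)" using finB by simp
  have "?D - ?S \<subseteq> ?Corr \<union> Bad"
  proof
    fix j assume j: "j \<in> ?D - ?S"
    then obtain a where a: "wins p d g m cs (rc (k * W + j)) (j mod ?M) a" "j < W" by blast
    then have "a \<noteq> a0" using j by blast
    moreover have "a < length cs" "hold p d g m cs (rc (k * W + j)) (j mod ?M) a"
      using a(1) by (simp_all add: wins_def)
    ultimately show "j \<in> ?Corr \<union> Bad" using quiet[of j a] a(2) by blast
  qed
  then have f1: "card (?D - ?S) \<le> A + card Bad" using card_mono[OF finCB] AB le_trans by blast
  have f2: "card (?D - ?S) = card ?D - card ?S" by (rule card_Diff_subset) auto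
  have f3: "W - card ?S \<le> A + card Bad" if in0: "cs ! a0 \<in> set cs'"
  proof -
    have "{..<W} - ?S \<subseteq> ?Corr \<union> Bad"
    proof
      fix j assume j: "j \<in> {..<W} - ?S"
      show "j \<in> ?Corr \<union> Bad"
      proof (rule ccontr)
        assume no: "j \<notin> ?Corr \<union> Bad"
        obtain c where "c < length cs'" "cs' ! c = cs ! a0" using in0 by (auto simp: in_set_conv_nth)
        moreover have "rc (k * W + j) = xsym p d g cs' (j mod ?M)" using no j by auto
        ultimately have "hold p d g m cs (rc (k * W + j)) (j mod ?M) a0"
          using hold_xsym[OF cs'(1), of p d g cs "j mod ?M" a0] by force
        moreover have "a' = a0" if "a' < length cs" "hold p d g m cs (rc (k * W + j)) (j mod ?M) a'" for a'
          using quiet[of j a'] no j that by blast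
        ultimately have "wins p d g m cs (rc (k * W + j)) (j mod ?M) a0"
          using a0 unfolding wins_def by blast
        then show False using j by blast
      qed
    qed
    then have "card ({..<W} - ?S) \<le> A + card Bad" using card_mono[OF finCB] AB le_trans by blast
    moreover have "card ({..<W} - ?S) = W - card ?S" by (subst card_Diff_subset) auto
    ultimately show ?thesis by simp
  qed
  have "d * card Bad \<le> 4 * m * m * W \<and> card ?D - card ?S \<le> A + card Bad \<and>
      (cs ! a0 \<in> set cs' \<longrightarrow> W - card ?S \<le> A + card Bad)"
    using f1 unfolding f2 by (intro conjI impI dB f3)
  then show ?thesis unfolding decided_def support_def by (rule exI[of _ "card Bad"])
qed

end

lemma support_le:
  assumes "a \<noteq> a'"
  shows "support p d g m cs W rc k a + support p d g m cs W rc k a' \<le> decided p d g m cs W rc k"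
    "decided p d g m cs W rc k \<le> W"
proof -
  let ?w = "\<lambda>j a. wins p d g m cs (rc (k * W + j)) (j mod code_len p d g) a"
  have "card {j. j < W \<and> ?w j a} + card {j. j < W \<and> ?w j a'} = card ({j. j < W \<and> ?w j a} \<union> {j. j < W \<and> ?w j a'})"
    using assms by (intro card_Un_disjoint[symmetric]) (auto simp: wins_def)
  also have "\<dots> \<le> card {j. j < W \<and> (\<exists>a. ?w j a)}" by (intro card_mono) auto
  finally show "support p d g m cs W rc k a + support p d g m cs W rc k a' \<le> decided p d g m cs W rc k"
    by (simp add: support_def decided_def)
  have "card {j. j < W \<and> (\<exists>a. ?w j a)} \<le> card {..<W}" by (intro card_mono) auto
  then show "decided p d g m cs W rc k \<le> W" by (simp add: decided_def)
qed

text \<open>Two different candidates cannot both be cheap: in every epoch, whatever supports one of them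
  speaks against the other one.\<close>

lemma cost_pair:
  assumes "\<And>k. k < R \<Longrightarrow> F k + G k \<le> D k" "\<And>k. k < R \<Longrightarrow> D k \<le> W"
  shows "2 * (R * W) \<le> cost R W D F i + cost R W D G j"
proof -
  have "2 * (R * W) = (\<Sum>k<R. 2 * W)" by simp
  also have "\<dots> \<le> (\<Sum>k<R. (if k < i then max W (2 * (D k - F k)) else 2 * (W - F k)) +
      (if k < j then max W (2 * (D k - G k)) else 2 * (W - G k)))"
  proof (rule sum_mono)
    fix k assume "k \<in> {..<R}"
    then have "F k + G k \<le> D k" "D k \<le> W" using assms by auto
    \<comment> \<open>Before both thresholds each maximum is at least W; after both, F + G <= W; in
      the mixed cases D - F >= G complements W - G, or the other way round.\<close>
    then show "2 * W \<le> (if k < i then max W (2 * (D k - F k)) else 2 * (W - F k)) +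
      (if k < j then max W (2 * (D k - G k)) else 2 * (W - G k))"
      by (auto simp: max_def)
  qed
  also have "\<dots> = cost R W D F i + cost R W D G j" by (simp add: cost_def sum.distrib)
  finally show ?thesis .
qed

lemma judge_unique:
  assumes "a0 < l" "\<exists>j\<le>R. cost R W D (\<lambda>k. H k a0) j < R * W"
    and "\<And>a j. a < l \<Longrightarrow> a \<noteq> a0 \<Longrightarrow> \<not> cost R W D (\<lambda>k. H k a) j < R * W"
  shows "judge R W D H cs l = cs ! a0"
  using assms
proof (induction l)
  case (Suc l)
  then show ?case by (cases "l = a0") auto
qed simp

text \<open>The budget, in units of R W, for the threshold Suc \<kappa>: twice the corruptions is at
  most 1 - 8 \<epsilon>. Raising the epochs before \<kappa> to W costs at most 6 \<epsilon>, and
  coincidences cost \<epsilon> / 2. The symbols of epoch \<kappa> need not carry the candidate yet,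
  so it is charged in full with 2 W, which is at most \<epsilon> / 2 because R >= 4 / \<epsilon>.
  The sum 1 - \<epsilon> is below 1, and \<open>cost_pair\<close> then rules out every other
  candidate.\<close>

lemma decision_correct:
  fixes \<epsilon> :: real and a b Bd :: "nat \<Rightarrow> nat"
  assumes \<epsilon>: "1 \<le> \<epsilon> * i0" "0 < i0" and R: "R = 4 * i0" and W: "0 < W" and \<kappa>: "\<kappa> < R"
    and a0: "a0 < length cs"
    and Bd: "\<And>k. k < R \<Longrightarrow> 4 * i0 * Bd k \<le> W"
    and tot: "(\<Sum>k<R. real (a k + b k)) \<le> (1/2 - 4 * \<epsilon>) * real (R * W)"
    and early: "\<And>k. k < \<kappa> \<Longrightarrow> (1/2 - 3 * \<epsilon>) * real W \<le> real (a k + b k)"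
    and dec: "\<And>k. k < R \<Longrightarrow> decided p d g m cs W rc k - support p d g m cs W rc k a0 \<le> a k + Bd k"
    and late: "\<And>k. \<kappa> < k \<Longrightarrow> k < R \<Longrightarrow> W - support p d g m cs W rc k a0 \<le> a k + Bd k"
  shows "judge R W (decided p d g m cs W rc) (support p d g m cs W rc) cs (length cs) = cs ! a0"
proof (rule judge_unique[OF a0])
  let ?D = "decided p d g m cs W rc" and ?H = "support p d g m cs W rc"
  have e0: "0 < \<epsilon>"
  proof (rule ccontr)
    assume "\<not> 0 < \<epsilon>"
    then have "\<epsilon> * real i0 \<le> 0" by (simp add: mult_nonpos_nonneg)
    then show False using \<epsilon>(1) by linarith
  qed
  have Bd': "real (Bd k) \<le> \<epsilon> / 4 * real W" if "k < R" for k
  proof -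
    have "4 * real i0 * real (Bd k) \<le> real W" using Bd[OF that] by (metis of_nat_le_iff of_nat_mult of_nat_numeral)
    moreover have "4 * real (Bd k) \<le> \<epsilon> * (4 * real i0 * real (Bd k))"
      using mult_right_mono[OF \<epsilon>(1), of "4 * real (Bd k)"] by (simp add: algebra_simps)
    ultimately have "4 * real (Bd k) \<le> \<epsilon> * real W" using e0
      by (meson less_imp_le mult_left_mono order_trans)
    then show ?thesis by simp
  qed
  have bound: "real (if k < Suc \<kappa> then max W (2 * (?D k - ?H k a0)) else 2 * (W - ?H k a0)) \<le>
      2 * real (a k + b k) + (6 * \<epsilon> + \<epsilon> / 2) * real W + (if k = \<kappa> then 2 * real W else 0)" if k: "k < R" for k
  proof -
    have DW: "?D k \<le> W" using support_le(2)[of 0 1] by simp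
    consider "k < \<kappa>" | "k = \<kappa>" | "\<kappa> < k" by linarith
    then show ?thesis
    proof cases
      case 1
      have "real (2 * (?D k - ?H k a0)) \<le> 2 * real (a k) + 2 * real (Bd k)" using dec[OF k] by linarith
      also have "\<dots> \<le> 2 * real (a k + b k) + (\<epsilon> / 2) * real W" using Bd'[OF k] by simp
      also have "\<dots> \<le> 2 * real (a k + b k) + (6 * \<epsilon> + \<epsilon> / 2) * real W" using e0 by (simp add: mult_right_mono)
      finally have 1: "real (2 * (?D k - ?H k a0)) \<le> 2 * real (a k + b k) + (6 * \<epsilon> + \<epsilon> / 2) * real W" .
      have "real W \<le> 2 * real (a k + b k) + 6 * \<epsilon> * real W"
        using early[OF \<open>k < \<kappa>\<close>] by (simp add: algebra_simps)
      also have "\<dots> \<le> 2 * real (a k + b k) + (6 * \<epsilon> + \<epsilon> / 2) * real W" using e0 by (simp add: mult_right_mono)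
      finally have 2: "real W \<le> 2 * real (a k + b k) + (6 * \<epsilon> + \<epsilon> / 2) * real W" .
      show ?thesis using 1 2 \<open>k < \<kappa>\<close> by (auto simp: max_def)
    next
      case 2
      have "max W (2 * (?D k - ?H k a0)) \<le> 2 * W" using DW by auto
      then have "real (max W (2 * (?D k - ?H k a0))) \<le> 2 * real W" by linarith
      moreover have "0 \<le> 2 * real (a k + b k) + (6 * \<epsilon> + \<epsilon> / 2) * real W" using e0 by simp
      ultimately show ?thesis using 2 by simp
    next
      case 3
      have "real (2 * (W - ?H k a0)) \<le> 2 * real (a k) + 2 * real (Bd k)" using late[OF 3 k] by linarith
      also have "\<dots> \<le> 2 * real (a k + b k) + (\<epsilon> / 2) * real W" using Bd'[OF k] by simp
      also have "\<dots> \<le> 2 * real (a k + b k) + (6 * \<epsilon> + \<epsilon> / 2) * real W" using e0 by (simp add: mult_right_mono)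
      finally show ?thesis using 3 by simp
    qed
  qed
  have "real (cost R W ?D (\<lambda>k. ?H k a0) (Suc \<kappa>)) \<le>
    (\<Sum>k<R. 2 * real (a k + b k) + (6 * \<epsilon> + \<epsilon> / 2) * real W + (if k = \<kappa> then 2 * real W else 0))"
    unfolding cost_def of_nat_sum by (intro sum_mono bound) simp
  also have "\<dots> = 2 * (\<Sum>k<R. real (a k + b k)) + (6 * \<epsilon> + \<epsilon> / 2) * real W * real R + 2 * real W"
    using \<kappa> by (simp add: sum.distrib sum_distrib_left)
  also have "\<dots> \<le> (1 - 8 * \<epsilon>) * real (R * W) + (6 * \<epsilon> + \<epsilon> / 2) * real W * real R + 2 * real W"
    using tot by (simp add: algebra_simps)
  also have "2 * real W \<le> \<epsilon> / 2 * real (R * W)"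
    using mult_right_mono[OF \<epsilon>(1), of "2 * real W"] by (simp add: R algebra_simps)
  also have "(1 - 8 * \<epsilon>) * real (R * W) + (6 * \<epsilon> + \<epsilon> / 2) * real W * real R + \<epsilon> / 2 * real (R * W) =
      (1 - \<epsilon>) * real (R * W)" by (simp add: algebra_simps)
  also have "\<dots> < real (R * W)" using e0 W R \<epsilon>(2) by simp
  finally have c0: "cost R W ?D (\<lambda>k. ?H k a0) (Suc \<kappa>) < R * W" by linarith
  then show "\<exists>j\<le>R. cost R W ?D (\<lambda>k. ?H k a0) j < R * W" using \<kappa> by (intro exI[of _ "Suc \<kappa>"]) auto
  fix a j assume "a < length cs" "a \<noteq> a0"
  have "2 * (R * W) \<le> cost R W ?D (\<lambda>k. ?H k a0) (Suc \<kappa>) + cost R W ?D (\<lambda>k. ?H k a) j"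
    by (rule cost_pair) (use support_le[of a0 a] \<open>a \<noteq> a0\<close> in auto)
  then show "\<not> cost R W ?D (\<lambda>k. ?H k a) j < R * W" using c0 by linarith
qed

section \<open>Frequent entries\<close>

lemma fold_sel_prefix:
  "\<exists>new. fold (sel th m E) xs cs = cs @ new \<and> distinct new \<and> set new \<inter> set cs = {} \<and>
    set new \<subseteq> {x. x \<noteq> 0 \<and> x \<in> set xs \<and> th \<le> count_list E x}"
proof (induction xs rule: rev_induct)
  case (snoc x xs)
  then obtain new where new: "fold (sel th m E) xs cs = cs @ new" "distinct new" "set new \<inter> set cs = {}"
    "set new \<subseteq> {x. x \<noteq> 0 \<and> x \<in> set xs \<and> th \<le> count_list E x}" by blast
  show ?case
  proof (cases "x \<noteq> 0 \<and> th \<le> count_list E x \<and> x \<notin> set (cs @ new) \<and> length (cs @ new) < m")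
    case True
    then have "sel th m E x (cs @ new) = cs @ new @ [x]" by (simp add: sel_def)
    then show ?thesis using new True by (intro exI[of _ "new @ [x]"]) auto
  next
    case False
    then have "sel th m E x (cs @ new) = cs @ new" unfolding sel_def by (simp only: if_False)
    then show ?thesis using new by (intro exI[of _ new]) auto
  qed
qed simp

lemma card_frequent:
  assumes "0 < th"
  shows "card {x \<in> set E. th \<le> count_list E x} * th \<le> length E"
proof -
  let ?F = "{x \<in> set E. th \<le> count_list E x}"
  have "card ?F * th = (\<Sum>x\<in>?F. th)" by simp
  also have "\<dots> \<le> (\<Sum>x\<in>?F. count_list E x)" by (intro sum_mono) simp
  also have "\<dots> \<le> (\<Sum>x\<in>set E. count_list E x)" by (intro sum_mono2) auto
  also have "\<dots> = length E" by (simp add: sum_count_set)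
  finally show ?thesis .
qed

text \<open>Whatever was appended before \<open>x\<close> is distinct and frequent, so together with
  \<open>x\<close> it is counted among the frequent entries; hence there was still room when
  \<open>x\<close> was inspected.\<close>

lemma fold_sel_contains:
  assumes "x \<in> set xs" "x \<noteq> 0" "th \<le> count_list E x" "set xs \<subseteq> set E"
    and "length cs + card {y \<in> set E. th \<le> count_list E y} \<le> m"
  shows "x \<in> set (fold (sel th m E) xs cs)"
  using assms(1,4)
proof (induction xs rule: rev_induct)
  case (snoc y ys)
  obtain new where new: "fold (sel th m E) ys cs = cs @ new" "distinct new" "set new \<inter> set cs = {}"
    "set new \<subseteq> {x. x \<noteq> 0 \<and> x \<in> set ys \<and> th \<le> count_list E x}" using fold_sel_prefix by blast
  have eq: "fold (sel th m E) (ys @ [y]) cs = sel th m E y (cs @ new)" using new(1) by simp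
  show ?case
  proof (cases "x \<in> set (cs @ new)")
    case True
    then show ?thesis unfolding eq by (auto simp: sel_def)
  next
    case False
    then have y: "y = x" using snoc new by auto
    have sub: "insert x (set new) \<subseteq> {y \<in> set E. th \<le> count_list E y}"
      using new(4) snoc.prems assms(3) y by auto
    have "Suc (length new) = card (insert x (set new))"
      using False new(2) by (simp add: distinct_card)
    also have "\<dots> \<le> card {y \<in> set E. th \<le> count_list E y}" using sub by (intro card_mono) auto
    finally have "length (cs @ new) < m" using assms(5) by simp
    then show ?thesis unfolding eq using y False assms(2,3) by (simp add: sel_def)
  qed
qed simp

text \<open>Given the common prefix, the party whose turn it is pins down the next symbol.
  Consistency with both halves therefore leaves only the true transcript.\<close>

lemma consistent_transcript:
  assumes "consistent (alice_oracle \<Pi>) p A i n" "consistent (bob_oracle \<Pi>) p B i' n"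
    and eq: "\<And>j. j < n \<Longrightarrow> A (i + j) = B (i' + j)" and "l \<le> n"
  shows "segment A i l = transcript \<Pi> l \<and> segment B i' l = transcript \<Pi> l"
  using assms(4)
proof (induction l)
  case (Suc l)
  have IH: "segment A i l = transcript \<Pi> l" "segment B i' l = transcript \<Pi> l" using Suc by auto
  have "A (i + l) = (if alice_speaks \<Pi> l then alice_msg \<Pi> (transcript \<Pi> l) else bob_msg \<Pi> (transcript \<Pi> l))"
    using assms(1,2) eq[of l] Suc.prems IH
    by (auto simp: consistent_def alice_oracle_def bob_oracle_def Suc_le_eq segment_def dest!: spec[of _ l])
  then show ?case using IH eq[of l] Suc.prems by (simp add: segment_def Let_def)
qed (simp add: segment_def)

lemma take_transcript: "l \<le> n \<Longrightarrow> take l (transcript \<Pi> n) = transcript \<Pi> l"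
proof (induction n)
  case (Suc n)
  then show ?case by (cases "l = Suc n") (auto simp: Let_def)
qed simp

lemma transcript_consistent:
  assumes "segment A i n = transcript \<Pi> n" "protocol_over p \<Pi>"
  shows "consistent (alice_oracle \<Pi>) p A i n" "consistent (bob_oracle \<Pi>) p A i n"
proof -
  have sg: "segment A i l = transcript \<Pi> l" if "l \<le> n" for l
    using take_transcript[OF that, of \<Pi>] assms(1) that by (simp add: segment_def take_map flip: assms(1))
  have nx: "A (i + l) = (if alice_speaks \<Pi> l then alice_msg \<Pi> (transcript \<Pi> l) else bob_msg \<Pi> (transcript \<Pi> l))"
    if "l < n" for l
  proof -
    have "segment A i (Suc l) = transcript \<Pi> (Suc l)" using sg that by simp
    then show ?thesis by (simp add: segment_def Let_def)
  qed
  show "consistent (alice_oracle \<Pi>) p A i n" "consistent (bob_oracle \<Pi>) p A i n"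
    using assms(2) sg nx
    by (auto simp: consistent_def alice_oracle_def bob_oracle_def protocol_over_def)
qed

section \<open>Two parties\<close>

context party
begin

lemma set_CL_Suc: "set (CL k) \<subseteq> set (CL (Suc k))"
proof -
  obtain new where "fold (sel th m (ents k)) (ents k) (CL k) = CL k @ new"
    using fold_sel_prefix by blast
  then show ?thesis by simp
qed

lemma set_CL_mono: "k \<le> l \<Longrightarrow> set (CL k) \<subseteq> set (CL l)"
  by (induction l rule: dec_induct) (use set_CL_Suc in blast)+

lemma distinct_CL: "distinct (CL k)"
proof (induction k)
  case (Suc k)
  obtain new where new: "fold (sel th m (ents k)) (ents k) (CL k) = CL k @ new" "distinct new"
    "set new \<inter> set (CL k) = {}" using fold_sel_prefix by blast
  have "CL (Suc k) = CL k @ new" using new(1) by simp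
  then show ?case using Suc new by auto
qed simp

text \<open>At most b values can occur \<open>th\<close> times among the s v entries of an epoch.
  The list thus holds at most k b candidates after k epochs, and the cap m never turns a frequent
  entry away.\<close>

lemma CL_frequent:
  assumes th: "0 < th" "s * v \<le> b * th" and m: "R * b \<le> m" and k: "k < R"
    and x: "x \<noteq> 0" "th \<le> count_list (ents k) x"
  shows "x \<in> set (CL (Suc k))"
proof -
  have F: "card {y \<in> set (ents k). th \<le> count_list (ents k) y} \<le> b" for k
  proof -
    have "card {y \<in> set (ents k). th \<le> count_list (ents k) y} * th \<le> v * s"
      using card_frequent[OF th(1), of "ents k"] by (simp add: ents_def)
    also have "\<dots> \<le> b * th" using th(2) by (simp add: mult.commute)
    finally show ?thesis using th(1) by simp
  qed
  have len: "length (CL k) \<le> k * b" for k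
  proof (induction k)
    case (Suc k)
    obtain new where new: "fold (sel th m (ents k)) (ents k) (CL k) = CL k @ new" "distinct new"
      "set new \<subseteq> {x. x \<noteq> 0 \<and> x \<in> set (ents k) \<and> th \<le> count_list (ents k) x}" using fold_sel_prefix by blast
    have "length new = card (set new)" using new(2) by (simp add: distinct_card)
    also have "\<dots> \<le> card {y \<in> set (ents k). th \<le> count_list (ents k) y}"
      using new(3) by (intro card_mono) auto
    also have "\<dots> \<le> b" by (rule F)
    finally have "length new \<le> b" .
    moreover have "CL (Suc k) = CL k @ new" using new(1) by simp
    ultimately show ?case using Suc by simp
  qed simp
  have "x \<in> set (ents k)" using x(2) th(1) by (metis count_notin not_less)
  moreover have "length (CL k) + card {y \<in> set (ents k). th \<le> count_list (ents k) y} \<le> m"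
  proof -
    have "length (CL k) + card {y \<in> set (ents k). th \<le> count_list (ents k) y} \<le> Suc k * b"
      using len[of k] F[of k] by simp
    also have "\<dots> \<le> R * b" using k by (intro mult_right_mono) auto
    finally show ?thesis using m by simp
  qed
  ultimately show ?thesis using fold_sel_contains[of x "ents k" th "ents k" "CL k" m] x by simp
qed

lemma CL_nonzero: "x \<in> set (CL k) \<Longrightarrow> x \<noteq> 0"
  by (auto elim: CL_cases)

lemma CL_consistent:
  assumes "x \<in> set (CL k)"
  obtains A i where "consistent orc p A i n1" "x = Suc (hn (\<lambda>j. A (i + j)) p n1)"
proof -
  from assms obtain k' j where "x = entf k' j" "x \<noteq> 0" by (auto elim: CL_cases)
  then show ?thesis using that by (auto simp: entf_def entry_def split: if_splits)
qed

lemma traced_nth: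
  assumes "traced r S" "i < r * N"
  shows "strip q (trace S ! i) = trace (res (i div N)) ! (i mod N)"
proof -
  have N: "0 < N" using assms(2) by (cases N) auto
  have r: "i div N < r" using assms(2) by (simp add: less_mult_imp_div_less)
  have "map (strip q) (take N (drop (i div N * N) (trace S))) = trace (res (i div N))"
    using assms(1) r by (simp add: traced_def)
  then have "trace (res (i div N)) ! (i mod N) = map (strip q) (take N (drop (i div N * N) (trace S))) ! (i mod N)"
    by simp
  also have "\<dots> = strip q (trace S ! i)"
  proof -
    have len: "length (trace S) = r * N" using assms(1) by (simp add: traced_def)
    have "Suc (i div N) * N \<le> r * N" using r by (intro mult_right_mono) auto
    then have "i mod N < length (take N (drop (i div N * N) (trace S)))"
      using len mod_less_divisor[OF N, of i] by simp
    moreover have "i div N * N \<le> length (trace S)" using len assms(2) div_times_less_eq_dividend[of i N] by linarith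
    ultimately show ?thesis by simp
  qed
  finally show ?thesis by simp
qed

lemma traced_is_Snd:
  assumes "traced r S" "i < r * N"
  shows "is_Snd (trace S ! i) = sends (i mod N)"
proof -
  have N: "0 < N" using assms(2) by (cases N) auto
  have "is_Snd (trace S ! i) = is_Snd (trace (res (i div N)) ! (i mod N))"
    using traced_nth[OF assms] is_Snd_strip by metis
  also have "\<dots> = sends (i mod N)"
    using res[of "i div N"] mod_less_divisor[OF N, of i] by (auto simp: conforms_def)
  finally show ?thesis .
qed

lemma traced_run_count:
  assumes "traced r S" "r' < r"
  shows "length (filter is_Snd (take N (drop (r' * N) (trace S)))) = H"
proof -
  have "length (filter is_Snd (take N (drop (r' * N) (trace S)))) =
    length (filter is_Snd (map (strip q) (take N (drop (r' * N) (trace S)))))"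
    by (simp add: filter_map comp_def)
  also have "map (strip q) (take N (drop (r' * N) (trace S))) = trace (res r')"
    using assms by (simp add: traced_def)
  finally show ?thesis using length_trace_res(2)[of r'] by simp
qed

lemma traced_epoch_count:
  assumes "traced (R * v) S" "k < R"
  shows "length (filter is_Snd (take (v * N) (drop (k * (v * N)) (trace S)))) = v * H"
proof -
  let ?X = "drop (k * (v * N)) (trace S)"
  have "length (filter is_Snd (take N (drop (u * N) ?X))) = H" if "u < v" for u
  proof -
    have "drop (u * N) ?X = drop ((k * v + u) * N) (trace S)" by (simp add: algebra_simps)
    then show ?thesis using traced_run_count[OF assms(1) index_less[OF assms(2) that]] by simp
  qed
  then show ?thesis by (rule filter_prefix_blocks)
qed

lemma traced_epoch_length:
  assumes "traced (R * v) S" "k < R"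
  shows "length (take (v * N) (drop (k * (v * N)) (trace S))) = v * N"
proof -
  have "Suc k * (v * N) \<le> R * (v * N)" using assms(2) by (intro mult_right_mono) auto
  then show ?thesis using assms(1) by (simp add: traced_def mult.assoc)
qed

lemma epoch_snds:
  assumes "traced (R * v) S" "k < R" "j < v * H"
  shows "snds (trace S) ! (k * (v * H) + j) = snds (take (v * N) (drop (k * (v * N)) (trace S))) ! j"
proof -
  have c: "length (filter is_Snd (take (v * N) (drop (k' * (v * N)) (trace S)))) = v * H" if "k' < R" for k'
    by (rule traced_epoch_count[OF assms(1) that])
  have "k * (v * H) + j < R * (v * H)" using assms(2,3) by (rule index_less)
  then have "k * (v * H) + j < length (filter is_Snd (trace S))"
    using assms(1) by (simp add: traced_def snds_def mult.assoc)
  then show ?thesis using filter_block_nth[of R is_Snd "v * N" "trace S" "v * H", OF c assms(2,3)] c[OF assms(2)] assms(3)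
    by (simp add: snds_def)
qed

lemma epoch_rcvs:
  assumes "traced (R * v) S" "k < R" "j < v * (N - H)"
  shows "rcvs (trace S) ! (k * (v * (N - H)) + j) = rcvs (take (v * N) (drop (k * (v * N)) (trace S))) ! j"
    "length (rcvs (take (v * N) (drop (k * (v * N)) (trace S)))) = v * (N - H)"
proof -
  have c: "length (filter (\<lambda>e. \<not> is_Snd e) (take (v * N) (drop (k' * (v * N)) (trace S)))) = v * (N - H)"
    if "k' < R" for k'
    using sum_length_filter_compl[of is_Snd "take (v * N) (drop (k' * (v * N)) (trace S))"]
      traced_epoch_count[OF assms(1) that] traced_epoch_length[OF assms(1) that]
    by (simp add: diff_mult_distrib2)
  then show "length (rcvs (take (v * N) (drop (k * (v * N)) (trace S)))) = v * (N - H)"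
    using assms(2) by (simp add: rcvs_def)
  have "length (filter (\<lambda>e. \<not> is_Snd e) (trace S)) = R * (v * (N - H))"
    using sum_length_filter_compl[of is_Snd "trace S"] assms(1)
    by (simp add: traced_def snds_def diff_mult_distrib2 mult.assoc)
  moreover have "k * (v * (N - H)) + j < R * (v * (N - H))" using assms(2,3) by (rule index_less)
  ultimately show "rcvs (trace S) ! (k * (v * (N - H)) + j) = rcvs (take (v * N) (drop (k * (v * N)) (trace S))) ! j"
    using filter_block_nth[of R "\<lambda>e. \<not> is_Snd e" "v * N" "trace S" "v * (N - H)", OF c assms(2,3)] c[OF assms(2)] assms(3)
    by (simp add: rcvs_def)
qed

lemma count_entry:
  assumes g: "G \<subseteq> {..<v}" "\<And>u. u \<in> G \<Longrightarrow> \<exists>e<s. e < vars (res (k * v + u)) 0 \<and>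
      segment (arrs (res (k * v + u)) 0) (e * n1) n1 = \<tau>"
    and c: "\<And>A i. segment A i n1 = \<tau> \<Longrightarrow> consistent orc p A i n1"
  shows "card G \<le> count_list (ents k) (Suc (hn (\<lambda>j. \<tau> ! j) p n1))"
proof -
  let ?x = "Suc (hn (\<lambda>j. \<tau> ! j) p n1)"
  from g(2) obtain e where e: "\<And>u. u \<in> G \<Longrightarrow> e u < s \<and> e u < vars (res (k * v + u)) 0 \<and>
      segment (arrs (res (k * v + u)) 0) (e u * n1) n1 = \<tau>" by metis
  have "count_list (ents k) ?x = card {j. j < v * s \<and> entf k j = ?x}"
  proof -
    have "count_list xs y = card {j. j < length xs \<and> xs ! j = y}" for xs and y :: nat
      using count_list_eq_length_filter[of xs y] length_filter_conv_card[of "(=) y" xs]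
      by (auto intro: arg_cong[where f = card])
    from this[of "ents k" ?x] show ?thesis by (auto simp: ents_def intro!: arg_cong[where f = card])
  qed
  moreover have "card G \<le> card {j. j < v * s \<and> entf k j = ?x}"
  proof (rule card_inj_on_le[where f = "\<lambda>u. u * s + e u"])
    show "inj_on (\<lambda>u. u * s + e u) G"
    proof (rule inj_onI)
      fix u u' assume "u \<in> G" "u' \<in> G" "u * s + e u = u' * s + e u'"
      then show "u = u'" using index_eq_iff[of "e u" s "e u'" u u'] e by simp
    qed
    show "(\<lambda>u. u * s + e u) ` G \<subseteq> {j. j < v * s \<and> entf k j = ?x}"
    proof (clarify, intro conjI)
      fix u assume u: "u \<in> G"
      let ?A = "arrs (res (k * v + u)) 0"
      have eu: "e u < s" "e u < vars (res (k * v + u)) 0" "segment ?A (e u * n1) n1 = \<tau>" using e[OF u] by auto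
      show "u * s + e u < v * s" using u g(1) eu by (intro index_less) auto
      have "hn (\<lambda>j. ?A (e u * n1 + j)) p n1 = hn (\<lambda>j. \<tau> ! j) p n1"
        by (rule hn_cong) (simp add: eu(3)[symmetric] segment_def)
      then show "entf k (u * s + e u) = ?x"
        using eu c[OF eu(3)] by (simp add: entf_def entry_def)
    qed
  qed simp
  ultimately show ?thesis by simp
qed

end

text \<open>Stated from the side of the receiver A; \<open>swap\<close> exchanges the roles.
  \<open>v = i0 * th\<close> makes the threshold at most \<epsilon> v, the bound on \<open>d\<close>
  keeps all coincidences 4 m^2 W / d in an epoch below W / (4 i0), and \<open>WM\<close> puts a full
  period of the code into every epoch.\<close>

locale duel = A: party p d q s R v th m n n0 N H T orcA inA cA sA +
  B: party p d q s R v th m n n0 N H T orcB inB cB sB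
  for p d q s R v th m n n0 N H T orcA inA cA sA orcB inB cB sB +
  fixes \<tau> :: "nat list" and \<epsilon> :: real and i0 :: nat
  assumes N: "N = 2 * H" and comp: "\<And>i. i < N \<Longrightarrow> sA i \<noteq> sB i"
    and \<epsilon>: "1 \<le> \<epsilon> * i0" "0 < i0" "\<epsilon> \<le> 1 / 8"
    and R: "R = 4 * i0" and vth: "v = i0 * th" "0 < th" and mR: "R * (s * i0) \<le> m"
    and d: "16 * (m + 1) ^ 2 * i0 \<le> d"
    and WM: "A.M \<le> v * H" and \<tau>: "length \<tau> = A.n1"
    and cons: "\<And>A i B i'. consistent orcA p A i A.n1 \<Longrightarrow> consistent orcB p B i' A.n1 \<Longrightarrow>
      (\<And>j. j < A.n1 \<Longrightarrow> A (i + j) = B (i' + j)) \<Longrightarrow> segment A i A.n1 = \<tau>"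
    and true: "\<And>A i. segment A i A.n1 = \<tau> \<Longrightarrow> consistent orcA p A i A.n1 \<and> consistent orcB p A i A.n1"
    and good: "\<And>r. real (card {i. i < N \<and> sym (trace (A.res r) ! i) \<noteq> sym (trace (B.res r) ! i)}) \<le>
      (1/4 - \<epsilon>) * real N \<Longrightarrow>
      length (outputs A.n1 (A.res r)) \<le> s \<and> \<tau> \<in> set (outputs A.n1 (A.res r)) \<and>
      length (outputs A.n1 (B.res r)) \<le> s \<and> \<tau> \<in> set (outputs A.n1 (B.res r))"
begin

abbreviation "n1 \<equiv> A.n1"
abbreviation "xt \<equiv> Suc (hn (\<lambda>j. \<tau> ! j) p n1)"

lemma e0: "0 < \<epsilon>"
proof (rule ccontr)
  assume "\<not> 0 < \<epsilon>"
  then have "\<epsilon> * real i0 \<le> 0" by (simp add: mult_nonpos_nonneg)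
  then show False using \<epsilon>(1) by linarith
qed

lemma common_candidate:
  assumes "x \<in> set (A.CL k)" "x \<in> set (B.CL l)"
  shows "x = xt"
proof -
  obtain A i where A: "consistent orcA p A i n1" "x = Suc (hn (\<lambda>j. A (i + j)) p n1)"
    using A.CL_consistent[OF assms(1)] by blast
  obtain B i' where B: "consistent orcB p B i' n1" "x = Suc (hn (\<lambda>j. B (i' + j)) p n1)"
    using B.CL_consistent[OF assms(2)] by blast
  have lt: "A (i + j) < p" "B (i' + j) < p" if "j < n1" for j
    using A(1) B(1) that by (auto simp: consistent_def)
  have "A (i + j) = B (i' + j)" if "j < n1" for j
  proof -
    have "A (i + j) = sl p n1 (hn (\<lambda>j. A (i + j)) p n1) j" using lt that by (intro sl_hn[symmetric]) auto
    also have "\<dots> = sl p n1 (hn (\<lambda>j. B (i' + j)) p n1) j" using A(2) B(2) by simp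
    also have "\<dots> = B (i' + j)" using lt that by (intro sl_hn) auto
    finally show ?thesis .
  qed
  then have "segment A i n1 = \<tau>" by (intro cons[OF A(1) B(1)])
  then have "A (i + j) = \<tau> ! j" if "j < n1" for j using that by (auto simp: segment_def)
  then show ?thesis using A(2) hn_cong[of n1 "\<lambda>j. A (i + j)" "\<lambda>j. \<tau> ! j"] by simp
qed

lemma xt_digit:
  assumes "j < n1"
  shows "sl p n1 (xt - 1) j = \<tau> ! j"
proof -
  have "segment (\<lambda>j. \<tau> ! j) 0 n1 = \<tau>" using \<tau> by (simp add: segment_def flip: \<tau>) (rule map_nth)
  from true[OF this] have "\<tau> ! j < p" if "j < n1" for j using that by (simp add: consistent_def)
  then show ?thesis using assms sl_hn[of n1 "\<lambda>j. \<tau> ! j" p j] by simp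
qed

lemma sizes: "0 < R" "0 < v * H" "N - H = H"
proof -
  show "0 < v * H" using WM A.M0 by linarith
qed (use R \<epsilon>(2) N in auto)

section \<open>The decision of the receiver after two complete executions\<close>

context
  fixes SA SB :: state and rc :: "nat \<Rightarrow> nat"
  assumes trA: "A.traced (R * v) SA" and trB: "B.traced (R * v) SB"
    and snd: "\<And>k j. k < R \<Longrightarrow> j < v * H \<Longrightarrow>
      snds (trace SB) ! (k * (v * H) + j) div q = xsym p d A.g (B.CL k) (j mod A.M)"
    and rc: "\<And>j. j < R * (v * H) \<Longrightarrow> rc j = rcvs (trace SA) ! j div q"
    and few: "real (card {i. i < R * v * N \<and> sym (trace SA ! i) \<noteq> sym (trace SB ! i)}) \<le>
      (1/4 - 2 * \<epsilon>) * real (R * v * N)"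
begin

definition "EA k = take (v * N) (drop (k * (v * N)) (trace SA))"
definition "EB k = take (v * N) (drop (k * (v * N)) (trace SB))"
definition "ea k = mism (rcvs (EA k)) (snds (EB k))"
definition "eb k = mism (snds (EA k)) (rcvs (EB k))"

lemma length_traces: "length (trace SA) = R * v * N" "length (trace SB) = R * v * N"
  using trA trB by (simp_all add: A.traced_def B.traced_def)

lemma length_E: "k < R \<Longrightarrow> length (EA k) = v * N" "k < R \<Longrightarrow> length (EB k) = v * N"
  using A.traced_epoch_length[OF trA] B.traced_epoch_length[OF trB] by (simp_all add: EA_def EB_def)

lemma nth_E:
  assumes "k < R" "i < v * N"
  shows "EA k ! i = trace SA ! (k * (v * N) + i)" "EB k ! i = trace SB ! (k * (v * N) + i)"
    "k * (v * N) + i < R * v * N"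
proof -
  show *: "k * (v * N) + i < R * v * N" using index_less[OF assms] by (simp add: mult.assoc)
  show "EA k ! i = trace SA ! (k * (v * N) + i)" "EB k ! i = trace SB ! (k * (v * N) + i)"
    using assms(2) * add_lessD1[OF *, THEN less_imp_le] length_traces nth_drop[of "k * (v * N)" "trace SA" i] nth_drop[of "k * (v * N)" "trace SB" i]
    by (simp_all add: EA_def EB_def)
qed

lemma E_split:
  assumes "k < R"
  shows "mism (map sym (EA k)) (map sym (EB k)) = ea k + eb k"
    "length (rcvs (EA k)) = length (snds (EB k))"
proof -
  have "is_Snd (EA k ! i) \<noteq> is_Snd (EB k ! i)" if "i < length (EA k)" for i
  proof -
    have i: "i < v * N" using that length_E(1)[OF assms] by simp
    have "0 < N" using i by (cases N) auto
    then show ?thesis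
      using nth_E[OF assms i] A.traced_is_Snd[OF trA] B.traced_is_Snd[OF trB] comp mod_less_divisor by metis
  qed
  from mism_split[OF _ this] show "mism (map sym (EA k)) (map sym (EB k)) = ea k + eb k"
    "length (rcvs (EA k)) = length (snds (EB k))"
    using length_E[OF assms] by (simp_all add: ea_def eb_def)
qed

lemma few_epochs: "(\<Sum>k<R. real (ea k + eb k)) \<le> (1/2 - 4 * \<epsilon>) * real (R * (v * H))"
proof -
  have eq: "{i. i < length (map sym (trace SA)) \<and> map sym (trace SA) ! i \<noteq> map sym (trace SB) ! i} =
      {i. i < R * v * N \<and> sym (trace SA ! i) \<noteq> sym (trace SB ! i)}"
    using length_traces by auto
  have "card {i. i < R * v * N \<and> sym (trace SA ! i) \<noteq> sym (trace SB ! i)} =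
      mism (map sym (trace SA)) (map sym (trace SB))"
    using mism_card[of "map sym (trace SA)" "map sym (trace SB)"] length_traces unfolding eq by simp
  also have "\<dots> = (\<Sum>k<R. mism (take (v * N) (drop (k * (v * N)) (map sym (trace SA))))
      (take (v * N) (drop (k * (v * N)) (map sym (trace SB)))))"
    by (rule mism_blocks) (simp_all add: length_traces mult.assoc)
  also have "\<dots> = (\<Sum>k<R. ea k + eb k)"
    using E_split(1) by (intro sum.cong) (simp_all add: EA_def EB_def take_map drop_map)
  finally have "(\<Sum>k<R. real (ea k + eb k)) \<le> (1/4 - 2 * \<epsilon>) * real (R * v * N)"
    using few by simp
  \<comment> \<open>Each party receives half of the symbols, so the rate doubles when it is measured
    against \<open>v * H\<close> instead of \<open>v * N\<close>.\<close>
  then show ?thesis using N by (simp add: algebra_simps)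
qed

text \<open>Removing the additional symbols can only hide corruptions: different residues modulo q
  come from different symbols.\<close>

lemma run_corruptions:
  assumes k: "k < R"
  shows "(\<Sum>u<v. card {i. i < N \<and> sym (trace (A.res (k * v + u)) ! i) \<noteq> sym (trace (B.res (k * v + u)) ! i)}) \<le>
    ea k + eb k"
proof -
  let ?C = "\<lambda>u. {i. i < N \<and> sym (trace (A.res (k * v + u)) ! i) \<noteq> sym (trace (B.res (k * v + u)) ! i)}"
  let ?bA = "\<lambda>u. take N (drop (u * N) (map sym (EA k)))" and ?bB = "\<lambda>u. take N (drop (u * N) (map sym (EB k)))"
  have "card (?C u) \<le> mism (?bA u) (?bB u)" if u: "u < v" for u
  proof -
    have uN: "u * N + N \<le> v * N" using u mult_right_mono[of "Suc u" v N] by simp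
    have len: "length (?bA u) = N" "length (?bB u) = N" using length_E[OF k] uN by simp_all
    have "?C u \<subseteq> {i. i < length (?bA u) \<and> ?bA u ! i \<noteq> ?bB u ! i}"
    proof (clarify, intro conjI notI)
      fix i assume i: "i < N" "sym (trace (A.res (k * v + u)) ! i) \<noteq> sym (trace (B.res (k * v + u)) ! i)"
      show "i < length (?bA u)" using i len by simp
      assume eq: "?bA u ! i = ?bB u ! i"
      have un: "u * N + i < v * N" using i uN by simp
      let ?j = "k * (v * N) + (u * N + i)"
      have j: "?j = (k * v + u) * N + i" by (simp add: algebra_simps)
      have jd: "?j div N = k * v + u" "?j mod N = i" unfolding j using i by simp_all
      have jl: "?j < R * v * N" by (rule nth_E(3)[OF k un])
      have ss: "sym (strip q e) = sym e mod q" for e by (cases e) simp_all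
      have "sym (trace SA ! ?j) = sym (trace SB ! ?j)"
      proof -
        have "u * N \<le> length (EA k)" "u * N \<le> length (EB k)" using un unfolding length_E[OF k] by linarith+
        then have "?bA u ! i = sym (EA k ! (u * N + i))" "?bB u ! i = sym (EB k ! (u * N + i))"
          using i un length_E[OF k] by simp_all
        then show ?thesis using eq nth_E(1,2)[OF k un] by simp
      qed
      moreover have "sym (trace (A.res (k * v + u)) ! i) = sym (trace SA ! ?j) mod q"
        using A.traced_nth[OF trA jl] unfolding jd by (metis ss)
      moreover have "sym (trace (B.res (k * v + u)) ! i) = sym (trace SB ! ?j) mod q"
        using B.traced_nth[OF trB jl] unfolding jd by (metis ss)
      ultimately show False using i(2) by simp
    qed
    then have "card (?C u) \<le> card {i. i < length (?bA u) \<and> ?bA u ! i \<noteq> ?bB u ! i}"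
      by (intro card_mono) auto
    then show ?thesis using mism_card[OF trans[OF len(1) len(2)[symmetric]]] by linarith
  qed
  then have "(\<Sum>u<v. card (?C u)) \<le> (\<Sum>u<v. mism (?bA u) (?bB u))" by (intro sum_mono) simp
  also have "\<dots> = mism (map sym (EA k)) (map sym (EB k))"
    by (rule mism_blocks[symmetric]) (simp_all add: length_E[OF k])
  finally show ?thesis using E_split(1)[OF k] by simp
qed

text \<open>Averaging: with fewer than th <= \<epsilon> v good runs, at least (1 - \<epsilon>) v
  runs would exceed the rate 1/4 - \<epsilon>. But (1 - \<epsilon>) (1/4 - \<epsilon>) > 1/4 - 3/2
  \<epsilon>, which is the origin of the rate that makes an epoch good. Each good run adds one
  occurrence of the true transcript to the entries of both parties.\<close>

lemma good_epoch:
  assumes k: "k < R" and low: "real (ea k + eb k) < (1/2 - 3 * \<epsilon>) * real (v * H)"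
  shows "xt \<in> set (A.CL (Suc k))" "xt \<in> set (B.CL (Suc k))"
proof -
  let ?C = "\<lambda>u. card {i. i < N \<and> sym (trace (A.res (k * v + u)) ! i) \<noteq> sym (trace (B.res (k * v + u)) ! i)}"
  define G where "G = {u. u < v \<and> real (?C u) \<le> (1/4 - \<epsilon>) * real N}"
  have G: "G \<subseteq> {..<v}" by (auto simp: G_def)
  have "th \<le> card G"
  proof (rule ccontr)
    assume "\<not> th \<le> card G"
    then have cG: "real (card G) \<le> real th" by simp
    have th: "real th \<le> \<epsilon> * real v" using mult_right_mono[OF \<epsilon>(1), of "real th"] vth(1) by (simp add: mult_ac)
    let ?B = "{..<v} - G"
    have cB: "card ?B = v - card G" "card G \<le> v" using card_Diff_subset[of G "{..<v}"] G card_mono[OF _ G] finite_subset[OF G] by auto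
    have N0: "0 < real N" using sizes N by auto
    have v0: "0 < real v" using sizes(2) by simp
    have "real (card ?B) * ((1/4 - \<epsilon>) * real N) = (\<Sum>u\<in>?B. (1/4 - \<epsilon>) * real N)" by simp
    also have "\<dots> \<le> (\<Sum>u\<in>?B. real (?C u))" by (intro sum_mono) (auto simp: G_def)
    also have "\<dots> \<le> (\<Sum>u<v. real (?C u))" by (intro sum_mono2) auto
    also have "\<dots> \<le> real (ea k + eb k)" using run_corruptions[OF k] by (simp only: of_nat_sum[symmetric] of_nat_le_iff)
    also note low
    also have "(1/2 - 3 * \<epsilon>) * real (v * H) = (1/4 - 3/2 * \<epsilon>) * real v * real N" using N by (simp add: algebra_simps)
    finally have "real (card ?B) * (1/4 - \<epsilon>) * real N < (1/4 - 3/2 * \<epsilon>) * real v * real N" by (simp add: mult_ac)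
    then have 1: "real (card ?B) * (1/4 - \<epsilon>) < (1/4 - 3/2 * \<epsilon>) * real v" using N0 by simp
    have "(1 - \<epsilon>) * real v \<le> real (card ?B)" using cB cG th by (simp add: algebra_simps of_nat_diff)
    then have "(1 - \<epsilon>) * real v * (1/4 - \<epsilon>) \<le> real (card ?B) * (1/4 - \<epsilon>)"
      using \<epsilon>(3) by (intro mult_right_mono) auto
    then have "(1 - \<epsilon>) * (1/4 - \<epsilon>) * real v < (1/4 - 3/2 * \<epsilon>) * real v" using 1 by (simp add: mult_ac)
    then have "(1 - \<epsilon>) * (1/4 - \<epsilon>) < 1/4 - 3/2 * \<epsilon>" using v0 by simp
    moreover have "(1 - \<epsilon>) * (1/4 - \<epsilon>) = 1/4 - 5/4 * \<epsilon> + \<epsilon> * \<epsilon>" by (simp add: field_simps)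
    moreover have "0 \<le> \<epsilon> * \<epsilon>" by simp
    ultimately show False using e0 by linarith
  qed
  moreover have idx: "\<exists>e<s. e < vars st 0 \<and> segment (arrs st 0) (e * n1) n1 = \<tau>"
    if "length (outputs n1 st) \<le> s" "\<tau> \<in> set (outputs n1 st)" for st
  proof -
    from that(2) obtain e where "e < vars st 0" "segment (arrs st 0) (e * n1) n1 = \<tau>" by (auto simp: outputs_def)
    then show ?thesis using that(1) by (intro exI[of _ e]) (simp add: outputs_def)
  qed
  have gA: "\<exists>e<s. e < vars (A.res (k * v + u)) 0 \<and> segment (arrs (A.res (k * v + u)) 0) (e * n1) n1 = \<tau>"
    and gB: "\<exists>e<s. e < vars (B.res (k * v + u)) 0 \<and> segment (arrs (B.res (k * v + u)) 0) (e * n1) n1 = \<tau>"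
    if "u \<in> G" for u using good[of "k * v + u"] that idx by (auto simp: G_def)
  have "card G \<le> count_list (A.ents k) xt" by (rule A.count_entry[OF G gA]) (use true in auto)
  moreover have "card G \<le> count_list (B.ents k) xt"
    by (rule B.count_entry[OF G gB]) (use true in auto)
  moreover have "s * v \<le> (s * i0) * th" using vth(1) by simp
  ultimately show "xt \<in> set (A.CL (Suc k))" "xt \<in> set (B.CL (Suc k))"
    using A.CL_frequent[OF vth(2) _ mR k, of xt] B.CL_frequent[OF vth(2) _ mR k, of xt] by auto
qed

lemma received_corruptions:
  assumes k: "k < R"
  shows "card {j. j < v * H \<and> rc (k * (v * H) + j) \<noteq> xsym p d A.g (B.CL k) (j mod A.M)} \<le> ea k"
proof -
  have l: "length (rcvs (EA k)) = v * H"
    using A.epoch_rcvs(2)[OF trA k, of 0] sizes by (simp add: EA_def)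
  have "{j. j < v * H \<and> rc (k * (v * H) + j) \<noteq> xsym p d A.g (B.CL k) (j mod A.M)} \<subseteq>
      {j. j < length (rcvs (EA k)) \<and> rcvs (EA k) ! j \<noteq> snds (EB k) ! j}"
  proof (clarify, intro conjI notI)
    fix j assume j: "j < v * H" "rc (k * (v * H) + j) \<noteq> xsym p d A.g (B.CL k) (j mod A.M)"
    show "j < length (rcvs (EA k))" using j l by simp
    assume eq: "rcvs (EA k) ! j = snds (EB k) ! j"
    have "rc (k * (v * H) + j) = rcvs (trace SA) ! (k * (v * H) + j) div q"
      by (rule rc[OF index_less[OF k j(1)]])
    also have "rcvs (trace SA) ! (k * (v * H) + j) = rcvs (EA k) ! j"
      using A.epoch_rcvs(1)[OF trA k, of j] j sizes by (simp add: EA_def)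
    also have "\<dots> = snds (trace SB) ! (k * (v * H) + j)"
      using B.epoch_snds[OF trB k j(1)] eq by (simp add: EB_def)
    finally show False using snd[OF k j(1)] j(2) by simp
  qed
  then have "card {j. j < v * H \<and> rc (k * (v * H) + j) \<noteq> xsym p d A.g (B.CL k) (j mod A.M)} \<le>
      card {j. j < length (rcvs (EA k)) \<and> rcvs (EA k) ! j \<noteq> snds (EB k) ! j}"
    by (intro card_mono) auto
  then show ?thesis using mism_card[OF E_split(2)[OF k]] by (simp add: ea_def)
qed

lemma answer_correct: "A.answer (v * H) rc = xt"
proof -
  let ?W = "v * H"
  let ?P = "\<lambda>k. k < R \<and> real (ea k + eb k) < (1/2 - 3 * \<epsilon>) * real ?W"
  \<comment> \<open>Otherwise all epochs would suffer at least the rate 1/2 - 3 \<epsilon>, more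
    than the 1/2 - 4 \<epsilon> that they have on average.\<close>
  have "\<exists>k. ?P k"
  proof (rule ccontr)
    assume "\<not> (\<exists>k. ?P k)"
    then have "(1/2 - 3 * \<epsilon>) * real ?W \<le> real (ea k + eb k)" if "k < R" for k using that by force
    then have "(\<Sum>k<R. (1/2 - 3 * \<epsilon>) * real ?W) \<le> (\<Sum>k<R. real (ea k + eb k))" by (intro sum_mono) simp
    then have "(1/2 - 3 * \<epsilon>) * real (R * ?W) \<le> (1/2 - 4 * \<epsilon>) * real (R * ?W)"
      using few_epochs by (simp add: mult_ac)
    moreover have "0 < real (R * ?W)" using sizes by simp
    ultimately have "1/2 - 3 * \<epsilon> \<le> 1/2 - 4 * \<epsilon>" by (simp only: mult_le_cancel_right_pos)
    then show False using e0 by simp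
  qed
  then obtain \<kappa> where \<kappa>: "?P \<kappa>" and first: "\<And>k. k < \<kappa> \<Longrightarrow> \<not> ?P k" using exists_least_iff[of ?P] by blast
  have kR: "\<kappa> < R" using \<kappa> by simp
  have xt: "xt \<in> set (A.CL (Suc \<kappa>))" "xt \<in> set (B.CL (Suc \<kappa>))" using good_epoch \<kappa> by blast+
  have "xt \<in> set (A.CL R)" using A.set_CL_mono[of "Suc \<kappa>" R] kR xt by auto
  then obtain a0 where a0: "a0 < length (A.CL R)" "A.CL R ! a0 = xt" by (auto simp: in_set_conv_nth)
  \<comment> \<open>A candidate of both parties is the true transcript, and it occurs in the list
    only once.\<close>
  have excl: "A.CL R ! a \<notin> set (B.CL k)" if "a < length (A.CL R)" "a \<noteq> a0" for a k
  proof
    assume "A.CL R ! a \<in> set (B.CL k)"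
    then have "A.CL R ! a = xt" using common_candidate nth_mem[OF that(1)] by blast
    then show False using a0 that nth_eq_iff_index_eq[OF A.distinct_CL[of R]] by metis
  qed
  have cA: "x \<noteq> 0 \<and> x - 1 < p ^ (A.g * axis_in p A.g ^ 4)" if "x \<in> set (A.CL l)" for x l
    using A.CL_nonzero[OF that] A.CL_bound'[OF that] by simp
  have cB: "x \<noteq> 0 \<and> x - 1 < p ^ (A.g * axis_in p A.g ^ 4)" if "x \<in> set (B.CL l)" for x l
    using B.CL_nonzero[OF that] B.CL_bound'[OF that] by simp
  let ?D = "\<lambda>k. decided p d A.g m (A.CL R) ?W rc k" and ?S = "\<lambda>k. support p d A.g m (A.CL R) ?W rc k a0"
  have "\<exists>b. d * b \<le> 4 * m * m * ?W \<and> ?D k - ?S k \<le> ea k + b \<and>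
      (A.CL R ! a0 \<in> set (B.CL k) \<longrightarrow> ?W - ?S k \<le> ea k + b)" if k: "k < R" for k
    by (rule epoch_votes[OF A.pdg A.length_CL cA B.length_CL cB WM[unfolded A.M_def] a0(1) excl
          received_corruptions[OF k, unfolded A.M_def]])
  then obtain Bd where Bd: "\<And>k. k < R \<Longrightarrow> d * Bd k \<le> 4 * m * m * ?W \<and> ?D k - ?S k \<le> ea k + Bd k \<and>
      (A.CL R ! a0 \<in> set (B.CL k) \<longrightarrow> ?W - ?S k \<le> ea k + Bd k)" by metis
  have small: "4 * i0 * Bd k \<le> ?W" if k: "k < R" for k
  proof -
    have "(4 * (m + 1) ^ 2) * (4 * i0 * Bd k) \<le> d * Bd k"
      using mult_right_mono[OF d, of "Bd k"] by (simp add: mult_ac)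
    also have "\<dots> \<le> 4 * m * m * ?W" using Bd[OF k] by simp
    also have "\<dots> \<le> (4 * (m + 1) ^ 2) * ?W" by (intro mult_right_mono) (simp_all add: power2_eq_square)
    finally show ?thesis by (simp only: mult_le_cancel1) simp
  qed
  have late: "A.CL R ! a0 \<in> set (B.CL k)" if "\<kappa> < k" for k
    using a0 xt(2) B.set_CL_mono[of "Suc \<kappa>" k] that by auto
  have "judge R ?W (decided p d A.g m (A.CL R) ?W rc) (support p d A.g m (A.CL R) ?W rc) (A.CL R) (length (A.CL R)) =
      A.CL R ! a0"
    by (rule decision_correct[where \<kappa> = \<kappa> and a = ea and b = eb and Bd = Bd, OF \<epsilon>(1,2) R sizes(2) kR a0(1) small few_epochs])
      (use first Bd late kR in \<open>auto simp: not_less\<close>)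
  then show ?thesis using a0 by (simp add: A.answer_def)
qed

end

lemma swap: "duel p d q s R v th m n n0 N H T orcB inB cB sB orcA inA cA sA \<tau> \<epsilon> i0"
proof (intro_locales, unfold duel_axioms_def, intro conjI allI impI)
  show "sB i \<noteq> sA i" if "i < N" for i using comp[OF that] by simp
  show "segment A i B.n1 = \<tau>"
    if "consistent orcB p A i B.n1" "consistent orcA p B i' B.n1" "\<forall>j<B.n1. A (i + j) = B (i' + j)" for A i B i'
  proof -
    have "segment A i B.n1 = segment B i' B.n1" using that(3) by (auto simp: segment_def intro: nth_equalityI)
    then show ?thesis using cons[of B i' A i] that by simp
  qed
qed (use N \<epsilon> R vth mR d WM \<tau> true good in \<open>auto simp: eq_commute\<close>)

end

section \<open>Running time\<close>

text \<open>Bounds up to a constant on a given domain. The constants of the explicit step counts are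
  never evaluated.\<close>

definition dominated :: "('a \<Rightarrow> bool) \<Rightarrow> ('a \<Rightarrow> nat) \<Rightarrow> ('a \<Rightarrow> nat) \<Rightarrow> bool" where
  "dominated D w f \<longleftrightarrow> (\<exists>C. \<forall>x. D x \<longrightarrow> f x \<le> C * w x)"

lemma dominated_add:
  assumes "dominated D w f" "dominated D w h"
  shows "dominated D w (\<lambda>x. f x + h x)"
proof -
  obtain C C' where "\<forall>x. D x \<longrightarrow> f x \<le> C * w x" "\<forall>x. D x \<longrightarrow> h x \<le> C' * w x"
    using assms by (auto simp: dominated_def)
  then have "\<forall>x. D x \<longrightarrow> f x + h x \<le> (C + C') * w x" by (auto simp: add_mult_distrib intro: add_mono)
  then show ?thesis unfolding dominated_def by blast
qed

lemma dominated_mult: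
  assumes "dominated D w f" "dominated D w' h"
  shows "dominated D (\<lambda>x. w x * w' x) (\<lambda>x. f x * h x)"
proof -
  obtain C C' where C: "\<forall>x. D x \<longrightarrow> f x \<le> C * w x" "\<forall>x. D x \<longrightarrow> h x \<le> C' * w' x"
    using assms by (auto simp: dominated_def)
  have "f x * h x \<le> (C * C') * (w x * w' x)" if "D x" for x
  proof -
    have "f x * h x \<le> (C * w x) * (C' * w' x)" using C that by (intro mult_le_mono) auto
    then show ?thesis by (simp add: mult_ac)
  qed
  then show ?thesis unfolding dominated_def by blast
qed

lemma dominated_trans:
  assumes "dominated D w f" "dominated D w' w"
  shows "dominated D w' f"
proof -
  obtain C C' where C: "\<forall>x. D x \<longrightarrow> f x \<le> C * w x" "\<forall>x. D x \<longrightarrow> w x \<le> C' * w' x"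
    using assms by (auto simp: dominated_def)
  have "f x \<le> (C * C') * w' x" if "D x" for x
  proof -
    have "C * w x \<le> C * (C' * w' x)" using C that by (intro mult_left_mono) auto
    then show ?thesis using C(1)[rule_format, OF that] unfolding mult.assoc by linarith
  qed
  then show ?thesis unfolding dominated_def by blast
qed

lemma dominatedI: "(\<And>x. D x \<Longrightarrow> f x \<le> C * w x) \<Longrightarrow> dominated D w f"
  by (auto simp: dominated_def)

text \<open>The class O(g^a k^b) for k = \<open>p ^ g\<close>. The rules compute the exponents from
  the shape of an expression, and it remains to compare them with (1, 4), which corresponds to the
  order of n.\<close>

definition growth :: "nat \<Rightarrow> nat \<Rightarrow> nat \<Rightarrow> (nat \<Rightarrow> nat) \<Rightarrow> bool" where
  "growth p a b = dominated (\<lambda>g. 1 \<le> g) (\<lambda>g. g ^ a * (p ^ g) ^ b)"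

context
  fixes p :: nat
  assumes p2: "2 \<le> p"
begin

lemma growth_mono:
  assumes "growth p a b f" "a \<le> a'" "b \<le> b'"
  shows "growth p a' b' f"
proof -
  have "g ^ a * (p ^ g) ^ b \<le> 1 * (g ^ a' * (p ^ g) ^ b')" if "1 \<le> g" for g
    unfolding mult_1 using that assms p2 by (intro mult_le_mono power_increasing) auto
  then have "dominated (\<lambda>g. 1 \<le> g) (\<lambda>g. g ^ a' * (p ^ g) ^ b') (\<lambda>g. g ^ a * (p ^ g) ^ b)"
    by (rule dominatedI)
  with assms(1) show ?thesis unfolding growth_def by (rule dominated_trans)
qed

lemma growth_add:
  assumes "growth p a b f" "growth p a' b' h"
  shows "growth p (max a a') (max b b') (\<lambda>g. f g + h g)"
  using growth_mono[OF assms(1), of "max a a'" "max b b'"] growth_mono[OF assms(2), of "max a a'" "max b b'"]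
  by (simp add: growth_def dominated_add)

lemma growth_mult:
  assumes "growth p a b f" "growth p a' b' h"
  shows "growth p (a + a') (b + b') (\<lambda>g. f g * h g)"
  using dominated_mult[OF assms[unfolded growth_def]] by (simp add: growth_def power_add mult_ac)

lemma growth_const: "growth p 0 0 (\<lambda>g. c)"
  unfolding growth_def by (rule dominatedI[where C = c]) simp

lemma growth_power: "growth p a b f \<Longrightarrow> growth p (k * a) (k * b) (\<lambda>g. f g ^ k)"
proof (induction k)
  case 0
  then show ?case using growth_const[of 1] by simp
next
  case (Suc k)
  then show ?case using growth_mult[of a b f "k * a" "k * b" "\<lambda>g. f g ^ k"] by simp
qed

lemma growth_id: "growth p 1 0 (\<lambda>g. g)"
  unfolding growth_def by (rule dominatedI[where C = 1]) simp

lemma growth_axis_in: "growth p 0 1 (axis_in p)"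
  unfolding growth_def by (rule dominatedI[where C = 1]) (simp add: axis_in_def)

lemma growth_axis_out: "growth p 0 1 (axis_out p d)"
  unfolding growth_def by (rule dominatedI[where C = "4 * d"]) (simp add: axis_out_def axis_in_def)

lemma growth_symmod:
  assumes "0 < d"
  shows "growth p 0 2 (symmod p d)"
  unfolding growth_def
proof (rule dominatedI[where C = "2 * (4 * d) ^ 2"])
  fix g :: nat assume "1 \<le> g"
  then have "symmod p d g \<le> 2 * axis_out p d g ^ 2" using symmod(2)[OF p2 assms] by simp
  then show "symmod p d g \<le> 2 * (4 * d) ^ 2 * (g ^ 0 * (p ^ g) ^ 2)"
    by (simp add: axis_out_def axis_in_def power_mult_distrib mult_ac)
qed

lemma growth_slot_len: "growth p 1 0 (slot_len d)"
proof -
  have "growth p 1 0 (\<lambda>g. 5 * g + 16 * d + 2)"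
    by (rule growth_mono, (rule growth_const growth_id growth_add growth_mult)+) simp_all
  then show ?thesis by (simp add: slot_len_def[abs_def])
qed

lemma growth_inner_len: "growth p 1 0 (inner_len p d)"
proof -
  have "growth p 1 0 (\<lambda>g. 2 * p * g + 8 * d + 1)"
    by (rule growth_mono, (rule growth_const growth_id growth_add growth_mult)+) simp_all
  then show ?thesis by (simp add: inner_len_def[abs_def])
qed

lemmas growth_intros = growth_const growth_id growth_add growth_mult growth_power growth_axis_in
  growth_axis_out growth_symmod growth_slot_len growth_inner_len

lemma growth_code_len:
  shows "growth p 1 4 (code_len p d)"
proof -
  have "growth p 1 4 (\<lambda>g. axis_out p d g ^ 4 * inner_len p d g)"
    by (rule growth_mono, (rule growth_intros)+) simp_all
  then show ?thesis by (simp add: code_len_def[abs_def])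
qed

lemma growth_setup_time:
  assumes "0 < d"
  shows "growth p 1 4 (setup_time p d)"
  unfolding setup_time_def[abs_def]
  by (rule growth_mono, (rule growth_intros assms)+) simp_all

lemma growth_axis_time:
  assumes "0 < d"
  shows "growth p 1 4 (\<lambda>g. axis_time p d g c)"
  unfolding axis_time_def
  by (rule growth_mono, (rule growth_intros assms)+) simp_all

lemma growth_enc_time:
  assumes "0 < d"
  shows "growth p 1 4 (enc_time p d)"
  unfolding enc_time_def[abs_def]
  by (rule growth_mono, (rule growth_const growth_axis_time assms | rule growth_intros)+) simp_all

text \<open>By minimality the preceding size is too small for n, and one step multiplies the
  capacity by at most 2 p^4. Size 1 has no predecessor and is treated separately.\<close>

lemma code_size_upper:
  assumes "1 \<le> n"
  shows "code_size p n * (p ^ code_size p n) ^ 4 \<le> 2 * p ^ 4 * n"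
proof -
  obtain k where k: "code_size p n = Suc k" using code_size(1)[OF p2, of n] by (cases "code_size p n") auto
  show ?thesis
  proof (cases "k = 0")
    case True
    then have "code_size p n * (p ^ code_size p n) ^ 4 = p ^ 4 * 1" using k by simp
    also have "\<dots> \<le> 2 * p ^ 4 * n" using assms by (intro mult_le_mono) auto
    finally show ?thesis .
  next
    case False
    have "Suc k * (p ^ Suc k) ^ 4 = p ^ 4 * (Suc k * (p ^ k) ^ 4)" by (simp add: power_mult_distrib algebra_simps)
    also have "\<dots> \<le> p ^ 4 * ((2 * k) * (p ^ k) ^ 4)" using False by (intro mult_le_mono) auto
    also have "\<dots> = 2 * p ^ 4 * (k * (p ^ k) ^ 4)" by (simp add: mult_ac)
    also have "\<dots> \<le> 2 * p ^ 4 * n" using code_size(3)[OF p2, of k n] False k by (intro mult_le_mono) auto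
    finally show ?thesis using k by simp
  qed
qed

lemma growth_linear:
  assumes "growth p 1 4 f"
  shows "dominated (\<lambda>n. 1 \<le> n) (\<lambda>n. n) (\<lambda>n. f (code_size p n))"
proof -
  obtain C where C: "\<And>g. 1 \<le> g \<Longrightarrow> f g \<le> C * (g * (p ^ g) ^ 4)"
    using assms by (auto simp: growth_def dominated_def)
  have "f (code_size p n) \<le> (C * (2 * p ^ 4)) * n" if "1 \<le> n" for n
  proof -
    have "f (code_size p n) \<le> C * (code_size p n * (p ^ code_size p n) ^ 4)"
      by (rule C[OF code_size(1)[OF p2]])
    also have "\<dots> \<le> C * (2 * p ^ 4 * n)" by (rule mult_le_mono2[OF code_size_upper[OF that]])
    finally show ?thesis by (simp add: mult_ac)
  qed
  then show ?thesis by (rule dominatedI)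
qed

end

text \<open>The running time restated outside the locale of a party, because its constant has to be
  chosen before the scheme, the protocol and the inputs.\<close>

definition "total_time p d s R v m n1 N T = (let e = m * (enc_time p d (code_size p n1) + 10) + 10 in
  3 + setup_time p d (code_size p n1) + (R * (e + (code_len p d (code_size p n1) * 10 +
      m * (code_len p d (code_size p n1) * (6 * 8 ^ d + 30) + 8 ^ d + 30) + 20) +
    (v * (3 + (6 * (8 ^ d + 1) ^ m + 12) * T + s * (n1 * (p + 30) + 40) + 10) + 1) +
    (v * s * (v * s * 20 + m * 20 + 60) + 20) + 2) + 1) + e + 8 + 6 * (v * N) +
  (R * (v * N * (m * (6 * (8 ^ d + 1) ^ m + 20) + m * (m * 15 + 30) + 70) + 20) + 20) +
  (m * ((R + 1) * (R * 25 + 30) + 10) + R + 20) + (n1 * (13 * p + 56) + 40))"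

lemma (in party) prog_time_eq: "prog_time = total_time p d s R v m n1 N T"
  unfolding prog_time_def epoch_time_def encall_time_def extb_time_def run_time_def select_time_def
    total_time_def Let_def M_def g_def ..

lemma total_time_linear:
  assumes p2: "2 \<le> p" and d0: "0 < d"
  shows "\<exists>K. \<forall>n1 N T. 1 \<le> n1 \<longrightarrow> n1 \<le> 2 * q * N \<longrightarrow> N \<le> T \<longrightarrow> total_time p d s R v m n1 N T \<le> K * T"
proof -
  let ?D = "\<lambda>(n1, N, T). 1 \<le> n1 \<and> n1 \<le> 2 * q * N \<and> N \<le> T"
  let ?n = "\<lambda>x::nat \<times> nat \<times> nat. fst x" and ?N = "\<lambda>x::nat \<times> nat \<times> nat. fst (snd x)" and ?T = "\<lambda>x::nat \<times> nat \<times> nat. snd (snd x)"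
  let ?L = "dominated ?D ?T"
  have T1: "1 \<le> T" if "?D (n1, N, T)" for n1 N T using that by (cases N) auto
  have c: "?L (\<lambda>x. b)" for b
    by (rule dominatedI[where C = b]) (use T1 in fastforce)
  have n: "?L ?n"
  proof (rule dominatedI[where C = "2 * q"])
    fix x assume "?D x"
    moreover obtain n1 N T where x: "x = (n1, N, T)" by (cases x)
    ultimately have "n1 \<le> 2 * q * N" "N \<le> T" by auto
    then have "n1 \<le> 2 * q * T" using le_trans mult_le_mono2 by blast
    then show "?n x \<le> 2 * q * ?T x" by (simp add: x)
  qed
  have N: "?L ?N" by (rule dominatedI[where C = 1]) auto
  have T: "?L ?T" by (rule dominatedI[where C = 1]) auto
  have lin: "?L (\<lambda>x. f (code_size p (?n x)))" if gr: "growth p 1 4 f" for f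
  proof -
    obtain C where C: "\<And>n. 1 \<le> n \<Longrightarrow> f (code_size p n) \<le> C * n"
      using growth_linear[OF p2 gr] by (auto simp: dominated_def)
    show ?thesis by (rule dominated_trans[OF dominatedI[where C = C] n]) (use C in auto)
  qed
  have ml: "?L (\<lambda>x. b * f x)" if "?L f" for b f
  proof -
    have "dominated ?D f (\<lambda>x. b * f x)" by (rule dominatedI[where C = b]) simp
    then show ?thesis using that by (rule dominated_trans)
  qed
  have mr: "?L (\<lambda>x. f x * b)" if "?L f" for b f using ml[OF that, of b] by (simp add: mult.commute)
  have "?L (\<lambda>x. total_time p d s R v m (?n x) (?N x) (?T x))"
    unfolding total_time_def Let_def
    by (rule c n N T lin[OF growth_setup_time[OF p2 d0]] lin[OF growth_enc_time[OF p2 d0]]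
        lin[OF growth_code_len[OF p2]] | rule dominated_add ml mr)+
  then show ?thesis by (auto simp: dominated_def)
qed

lemma big_step_time: "big_step orc inp c st t st' \<Longrightarrow> length (trace st') \<le> length (trace st) + t"
  by (induction rule: big_step.induct) (auto simp: set_var_def set_arr_def log_event_def)

section \<open>The scheme for unique decoding\<close>

lemma conforms_count:
  assumes "conforms q N sends tr"
  shows "length (filter is_Snd tr) = card {i. i < N \<and> sends i}"
  using assms unfolding length_filter_conv_card conforms_def by (auto intro: arg_cong[where f = card])

text \<open>Balance is a property of executions, but all executions follow the same schedule, so a
  single arbitrary one shows that each party transmits in half of the rounds.\<close>

lemma balanced_schedule:
  assumes cs: "coding_scheme p q S T" and bal: "balanced p q S" and p: "0 < p"
  shows "rounds S n = 2 * (rounds S n div 2)"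
    "card {i. i < rounds S n \<and> alice_sends S n i} = rounds S n div 2"
    "card {i. i < rounds S n \<and> \<not> alice_sends S n i} = rounds S n div 2"
proof -
  let ?N = "rounds S n" and ?\<Pi> = "bob_tells []"
  have pr: "protocol_over p ?\<Pi>" using p by (simp add: protocol_over_def bob_tells_def)
  have q: "0 < q" using cs by (simp add: coding_scheme_def)
  obtain tA stA tB stB where A: "big_step (alice_oracle ?\<Pi>) (\<lambda>_. 0) (alice_prog S) (init_state n) tA stA"
      "conforms q ?N (alice_sends S n) (trace stA)"
    and B: "big_step (bob_oracle ?\<Pi>) (\<lambda>_. 0) (bob_prog S) (init_state n) tB stB"
      "conforms q ?N (\<lambda>i. \<not> alice_sends S n i) (trace stB)"
    using cs pr q unfolding coding_scheme_def by meson
  have "execution q S n ?\<Pi> stA stB" unfolding execution_def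
    using A(1) B(1) q by (intro exI[of _ "\<lambda>_. 0"] exI[of _ tA] exI[of _ tB]) simp
  then have eq: "card {i. i < ?N \<and> alice_sends S n i} = card {i. i < ?N \<and> \<not> alice_sends S n i}"
    using bal pr conforms_count[OF A(2)] conforms_count[OF B(2)] unfolding balanced_def by metis
  have "card ({i. i < ?N \<and> alice_sends S n i} \<union> {i. i < ?N \<and> \<not> alice_sends S n i}) =
      card {i. i < ?N \<and> alice_sends S n i} + card {i. i < ?N \<and> \<not> alice_sends S n i}"
    by (rule card_Un_disjoint) auto
  moreover have "{i. i < ?N \<and> alice_sends S n i} \<union> {i. i < ?N \<and> \<not> alice_sends S n i} = {..<?N}" by auto
  ultimately have sum: "?N = card {i. i < ?N \<and> alice_sends S n i} + card {i. i < ?N \<and> \<not> alice_sends S n i}" by simp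
  have half: "k = 2 * (k div 2) \<and> a = k div 2 \<and> b = k div 2" if "a = b" "k = a + b" for a b k :: nat
    using that by simp
  from half[OF eq sum] show "?N = 2 * (?N div 2)" "card {i. i < ?N \<and> alice_sends S n i} = ?N div 2"
    "card {i. i < ?N \<and> \<not> alice_sends S n i} = ?N div 2" by blast+
qed

lemma (in party) conforms_PROG:
  assumes run: "big_step orc inp c' (init_state n) t S" and tr: "traced (R * v) S"
    and sn: "\<And>k j. k < R \<Longrightarrow> j < v * H \<Longrightarrow> snds (trace S) ! (k * (v * H) + j) div q = xsym p d g (CL k) (j mod M)"
  shows "conforms (q * (8 ^ d + 1) ^ m) (R * v * N) (\<lambda>i. sends (i mod N)) (trace S)"
  unfolding conforms_def
proof (intro conjI allI impI)
  show len: "length (trace S) = R * v * N" using tr by (simp add: traced_def)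
  fix i assume i: "i < R * v * N"
  show "is_Snd (trace S ! i) = sends (i mod N)" by (rule traced_is_Snd[OF tr i])
  show "sym (trace S ! i) < q * (8 ^ d + 1) ^ m"
  proof (cases "trace S ! i")
    case (Snd x)
    have "x \<in> set (snds (trace S))"
      using Snd i len nth_mem[of i "trace S"] by (force simp: snds_def image_iff)
    then obtain j where j: "j < length (snds (trace S))" "x = snds (trace S) ! j" by (auto simp: in_set_conv_nth)
    have jl: "j < R * (v * H)" using j(1) tr by (simp add: traced_def mult.assoc)
    then have vH: "0 < v * H" by (cases "v * H") auto
    have "j div (v * H) < R" using jl by (simp add: less_mult_imp_div_less)
    moreover have "j mod (v * H) < v * H" using vH by simp
    moreover have "j div (v * H) * (v * H) + j mod (v * H) = j" by (rule div_mult_mod_eq)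
    ultimately have "x div q = xsym p d g (CL (j div (v * H))) (j mod (v * H) mod M)"
      using sn j(2) by metis
    also have "\<dots> < (8 ^ d + 1) ^ m" by (rule xsym_less[OF length_CL])
    finally have "x < (8 ^ d + 1) ^ m * q" using q0 by (simp only: div_less_iff_less_mult)
    then show ?thesis using Snd by (simp add: mult.commute)
  next
    case (Rcv x)
    have "x = inp i" by (rule big_step_rcv[OF run _ _ Rcv]) (use i len in simp_all)
    then show ?thesis using Rcv inp[of i] by simp
  qed
qed

definition (in party) halting :: "state \<Rightarrow> bool" where
  "halting S \<longleftrightarrow> traced (R * v) S \<and>
     (\<forall>k<R. \<forall>j<v * H. snds (trace S) ! (k * (v * H) + j) div q = xsym p d g (CL k) (j mod M)) \<and>
     vars S 0 = 1 \<and>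
     (\<exists>rc. (\<forall>j<R * (v * (N - H)). rc j = rcvs (trace S) ! j div q) \<and>
        (\<forall>j<n1. arrs S 0 j = sl p n1 (answer (v * (N - H)) rc - 1) j))"

lemma (in party) PROG_halts:
  assumes "0 < R"
  obtains t S where "big_step orc inp (PROG p d q s R v th m n0 c) (init_state n) t S"
    "t \<le> total_time p d s R v m n1 N T" "halting S"
    "conforms (q * (8 ^ d + 1) ^ m) (R * v * N) (\<lambda>i. sends (i mod N)) (trace S)"
proof -
  obtain t S where S: "big_step orc inp (PROG p d q s R v th m n0 c) (init_state n) t S"
    "t \<le> total_time p d s R v m n1 N T" "halting S"
    using wp_PROG[OF assms] unfolding wp_def fst_conv snd_conv prog_time_eq halting_def by blast
  have "conforms (q * (8 ^ d + 1) ^ m) (R * v * N) (\<lambda>i. sends (i mod N)) (trace S)"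
    by (rule conforms_PROG[OF S(1)]) (use S(3) in \<open>auto simp: halting_def\<close>)
  with S show ?thesis by (rule that)
qed

lemma (in duel) outputs_correct:
  assumes "A.halting SA" "B.halting SB"
    and few: "real (card {i. i < R * v * N \<and> sym (trace SA ! i) \<noteq> sym (trace SB ! i)}) \<le>
      (1/4 - 2 * \<epsilon>) * real (R * v * N)"
  shows "outputs n SA = [take n \<tau>]"
proof -
  obtain rc where rc: "\<forall>j<R * (v * (N - H)). rc j = rcvs (trace SA) ! j div q"
    "\<forall>j<n1. arrs SA 0 j = sl p n1 (A.answer (v * (N - H)) rc - 1) j"
    using assms(1) by (auto simp: A.halting_def)
  have "A.answer (v * H) rc = xt"
    by (rule answer_correct[of SA SB]) (use assms rc(1) sizes in \<open>auto simp: A.halting_def B.halting_def\<close>)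
  then have arr: "arrs SA 0 j = \<tau> ! j" if "j < n1" for j using rc(2) sizes xt_digit[OF that] that by simp
  have nn: "n \<le> n1" by (simp add: A.n1_def)
  have "segment (arrs SA 0) 0 n = take n \<tau>"
    by (rule nth_equalityI) (use arr nn \<tau> in \<open>auto simp: segment_def\<close>)
  then show ?thesis using assms(1) by (simp add: outputs_def A.halting_def)
qed

text \<open>The choice of \<open>n0\<close> absorbs the additive s: from n <= s + q N and 2 s < n
  follows n <= 2 q N. The code length is then at most 2 q C N = 4 q C H, which explains
  \<open>th\<close>. Since \<open>d\<close> and \<open>m\<close> are built from \<open>i0\<close>
  and \<open>s\<close> alone, so is the growth of the alphabet; \<open>C\<close>, \<open>K\<close>
  and \<open>v\<close> may depend on p and q.\<close>

locale upgrade =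
  fixes \<epsilon> :: real and s p q i0 C K R m d th v n0 :: nat and S :: scheme and T :: "nat \<Rightarrow> nat"
  assumes \<epsilon>: "1 \<le> \<epsilon> * real i0" "0 < i0" "\<epsilon> \<le> 1 / 8"
    and R: "R = 4 * i0" and m: "m = R * (s * i0)" and d: "d = 16 * (m + 1) ^ 2 * i0"
    and th: "th = 4 * q * C" and v: "v = i0 * th" and n0: "n0 = 2 * s + 1" and p2: "2 \<le> p"
    and C: "\<And>n. 1 \<le> n \<Longrightarrow> code_len p d (code_size p n) \<le> C * n" "1 \<le> C"
    and K: "\<And>n1 N T. 1 \<le> n1 \<Longrightarrow> n1 \<le> 2 * q * N \<Longrightarrow> N \<le> T \<Longrightarrow> total_time p d s R v m n1 N T \<le> K * T"
    and cs: "coding_scheme p q S T" and bal: "balanced p q S" and ld: "list_decoding s p q (1/4 - \<epsilon>) S"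
begin

abbreviation "E \<equiv> (8 ^ d + 1 :: nat) ^ m"

definition "S' = \<lparr>alice_prog = PROG p d q s R v th m n0 (alice_prog S),
  bob_prog = PROG p d q s R v th m n0 (bob_prog S),
  rounds = (\<lambda>n. R * v * rounds S (max n n0)),
  alice_sends = (\<lambda>n i. alice_sends S (max n n0) (i mod rounds S (max n n0)))\<rparr>"

lemma q0: "0 < q" using cs by (simp add: coding_scheme_def)
lemma d0: "0 < d" using d \<epsilon>(2) by simp
lemma R0: "0 < R" using R \<epsilon>(2) by simp
lemma th0: "0 < th" using th q0 C(2) by simp

context
  fixes n :: nat
begin

abbreviation "k1 \<equiv> max n n0"
abbreviation "N \<equiv> rounds S k1"
abbreviation "H \<equiv> N div 2"

lemma N2: "N = 2 * H"
  using balanced_schedule(1)[OF cs bal, of k1] p2 by simp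

lemma n1_bound: "1 \<le> k1" "k1 \<le> 2 * q * N"
proof -
  show "1 \<le> k1" using n0 by simp
  have "k1 \<le> s + q * N" by (rule rounds_lower_bound[OF cs ld _ p2]) (use \<epsilon>(3) in simp)
  moreover have "2 * s \<le> k1" using n0 by simp
  ultimately show "k1 \<le> 2 * q * N" by linarith
qed

context
  fixes \<Pi> :: protocol
  assumes pr: "protocol_over p \<Pi>"
begin

lemma alice_party:
  assumes "\<And>i. inp i < q * E"
  shows "party p d q m n n0 N H (T k1) (alice_oracle \<Pi>) inp (alice_prog S) (alice_sends S k1)"
proof (unfold_locales)
  show "\<exists>t st. big_step (alice_oracle \<Pi>) inp0 (alice_prog S) (init_state k1) t st \<and> t \<le> T k1 \<and>
      conforms q N (alice_sends S k1) (trace st)" if "\<And>i. inp0 i < q" for inp0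
    using cs pr that unfolding coding_scheme_def by blast
  show "length (filter is_Snd tr) = H" if "conforms q N (alice_sends S k1) tr" for tr
    using conforms_count[OF that] balanced_schedule(2)[OF cs bal, of k1] p2 by simp
qed (use p2 d0 q0 assms in auto)

lemma bob_party:
  assumes "\<And>i. inp i < q * E"
  shows "party p d q m n n0 N H (T k1) (bob_oracle \<Pi>) inp (bob_prog S) (\<lambda>i. \<not> alice_sends S k1 i)"
proof (unfold_locales)
  show "\<exists>t st. big_step (bob_oracle \<Pi>) inp0 (bob_prog S) (init_state k1) t st \<and> t \<le> T k1 \<and>
      conforms q N (\<lambda>i. \<not> alice_sends S k1 i) (trace st)" if "\<And>i. inp0 i < q" for inp0
    using cs pr that unfolding coding_scheme_def by blast
  show "length (filter is_Snd tr) = H" if "conforms q N (\<lambda>i. \<not> alice_sends S k1 i) tr" for tr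
    using conforms_count[OF that] balanced_schedule(3)[OF cs bal, of k1] p2 by simp
qed (use p2 d0 q0 assms in auto)

context
  fixes inA inB :: "nat \<Rightarrow> nat"
  assumes inAB: "\<And>i. inA i < q * E" "\<And>i. inB i < q * E"
begin

interpretation A: party p d q s R v th m n n0 N H "T k1" "alice_oracle \<Pi>" inA "alice_prog S" "alice_sends S k1"
  by (rule alice_party[OF inAB(1)])
interpretation B: party p d q s R v th m n n0 N H "T k1" "bob_oracle \<Pi>" inB "bob_prog S" "\<lambda>i. \<not> alice_sends S k1 i"
  by (rule bob_party[OF inAB(2)])

lemma n1_eq: "A.n1 = k1"
  by (simp add: A.n1_def)

lemma code_fits: "A.M \<le> v * H"
proof -
  have "A.M \<le> C * k1" using C(1)[OF n1_bound(1)] by (simp add: A.M_def A.g_def n1_eq)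
  also have "\<dots> \<le> C * (2 * q * N)" using n1_bound(2) by (rule mult_le_mono2)
  also have "\<dots> = C * (2 * q * (2 * H))" using N2 by (rule arg_cong)
  also have "\<dots> = th * H" by (simp add: th)
  also have "\<dots> \<le> v * H" using \<epsilon>(2) v by simp
  finally show ?thesis .
qed

lemma good_runs:
  assumes "real (card {i. i < N \<and> sym (trace (A.res r) ! i) \<noteq> sym (trace (B.res r) ! i)}) \<le> (1/4 - \<epsilon>) * real N"
  shows "length (outputs k1 (A.res r)) \<le> s \<and> transcript \<Pi> k1 \<in> set (outputs k1 (A.res r)) \<and>
    length (outputs k1 (B.res r)) \<le> s \<and> transcript \<Pi> k1 \<in> set (outputs k1 (B.res r))"
proof -
  obtain tA where tA: "big_step (alice_oracle \<Pi>) (A.inpr r) (alice_prog S) (init_state k1) tA (A.res r)"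
    using A.res[of r] by (auto simp: n1_eq)
  obtain tB where tB: "big_step (bob_oracle \<Pi>) (B.inpr r) (bob_prog S) (init_state k1) tB (B.res r)"
    using B.res[of r] by (auto simp: n1_eq)
  have "A.inpr r i < q \<and> B.inpr r i < q" for i using q0 by (simp add: A.inpr_def B.inpr_def)
  then have "execution q S k1 \<Pi> (A.res r) (B.res r)" unfolding execution_def using tA tB by blast
  moreover have "corruptions (A.res r) (B.res r) =
      card {i. i < N \<and> sym (trace (A.res r) ! i) \<noteq> sym (trace (B.res r) ! i)}"
    by (simp add: corruptions_def A.length_trace_res)
  ultimately show ?thesis using ld pr assms unfolding list_decoding_def by simp
qed

lemma duel_AB: "duel p d q s R v th m n n0 N H (T k1) (alice_oracle \<Pi>) inA (alice_prog S) (alice_sends S k1)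
  (bob_oracle \<Pi>) inB (bob_prog S) (\<lambda>i. \<not> alice_sends S k1 i) (transcript \<Pi> k1) \<epsilon> i0"
proof (unfold_locales)
  show "segment A i A.n1 = transcript \<Pi> k1"
    if "consistent (alice_oracle \<Pi>) p A i A.n1" "consistent (bob_oracle \<Pi>) p B i' A.n1"
      "\<And>j. j < A.n1 \<Longrightarrow> A (i + j) = B (i' + j)" for A i B i'
    using consistent_transcript[OF that order.refl] by (simp add: n1_eq)
  show "consistent (alice_oracle \<Pi>) p A i A.n1 \<and> consistent (bob_oracle \<Pi>) p A i A.n1"
    if "segment A i A.n1 = transcript \<Pi> k1" for A i
    using transcript_consistent[OF that[unfolded n1_eq] pr] by (simp add: n1_eq)
  show "length (outputs A.n1 (A.res r)) \<le> s \<and> transcript \<Pi> k1 \<in> set (outputs A.n1 (A.res r)) \<and>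
    length (outputs A.n1 (B.res r)) \<le> s \<and> transcript \<Pi> k1 \<in> set (outputs A.n1 (B.res r))"
    if "real (card {i. i < N \<and> sym (trace (A.res r) ! i) \<noteq> sym (trace (B.res r) ! i)}) \<le> (1/4 - \<epsilon>) * real N" for r
    unfolding n1_eq by (rule good_runs[OF that])
  show "N = 2 * H" by (rule N2)
  show "A.M \<le> v * H" by (rule code_fits)
  show "length (transcript \<Pi> k1) = A.n1" by (simp add: n1_eq)
qed (use \<epsilon> R v m d th0 in auto)

lemma alice_halts:
  obtains t st where "big_step (alice_oracle \<Pi>) inA (alice_prog S') (init_state n) t st" "t \<le> K * T k1"
    "conforms (q * E) (rounds S' n) (alice_sends S' n) (trace st)" "A.halting st"
proof -
  have "N \<le> T k1" using A.res[of 0] big_step_time[of _ _ _ "init_state k1"] A.length_trace_res(1)[of 0]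
    by (fastforce simp: n1_eq)
  note bound = K[OF n1_bound this]
  obtain t st where st: "big_step (alice_oracle \<Pi>) inA (PROG p d q s R v th m n0 (alice_prog S)) (init_state n) t st"
    "t \<le> total_time p d s R v m A.n1 N (T k1)" "A.halting st"
    "conforms (q * E) (R * v * N) (\<lambda>i. alice_sends S k1 (i mod N)) (trace st)"
    by (rule A.PROG_halts[OF R0])
  have "t \<le> K * T k1" using st(2) bound unfolding n1_eq by (rule le_trans)
  then show ?thesis by (intro that[OF _ _ _ st(3)]) (use st in \<open>simp_all add: S'_def\<close>)
qed

lemma bob_halts:
  obtains t st where "big_step (bob_oracle \<Pi>) inB (bob_prog S') (init_state n) t st" "t \<le> K * T k1"
    "conforms (q * E) (rounds S' n) (\<lambda>i. \<not> alice_sends S' n i) (trace st)" "B.halting st"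
proof -
  have "N \<le> T k1" using B.res[of 0] big_step_time[of _ _ _ "init_state k1"] B.length_trace_res(1)[of 0]
    by (fastforce simp: n1_eq)
  note bound = K[OF n1_bound this]
  obtain t st where st: "big_step (bob_oracle \<Pi>) inB (PROG p d q s R v th m n0 (bob_prog S)) (init_state n) t st"
    "t \<le> total_time p d s R v m A.n1 N (T k1)" "B.halting st"
    "conforms (q * E) (R * v * N) (\<lambda>i. \<not> alice_sends S k1 (i mod N)) (trace st)"
    by (rule B.PROG_halts[OF R0])
  have "t \<le> K * T k1" using st(2) bound unfolding n1_eq by (rule le_trans)
  then show ?thesis by (intro that[OF _ _ _ st(3)]) (use st in \<open>simp_all add: S'_def\<close>)
qed

lemma decodes:
  assumes "big_step (alice_oracle \<Pi>) inA (alice_prog S') (init_state n) tA stA"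
    "big_step (bob_oracle \<Pi>) inB (bob_prog S') (init_state n) tB stB"
    and few: "real (corruptions stA stB) \<le> (1/4 - 2 * \<epsilon>) * real (rounds S' n)"
  shows "outputs n stA = [transcript \<Pi> n] \<and> outputs n stB = [transcript \<Pi> n]"
proof -
  interpret AB: duel p d q s R v th m n n0 N H "T k1" "alice_oracle \<Pi>" inA "alice_prog S" "alice_sends S k1"
    "bob_oracle \<Pi>" inB "bob_prog S" "\<lambda>i. \<not> alice_sends S k1 i" "transcript \<Pi> k1" \<epsilon> i0
    by (rule duel_AB)
  have hA: "A.halting stA"
    by (rule alice_halts) (use big_step_det[OF assms(1)] in auto)
  have hB: "B.halting stB"
    by (rule bob_halts) (use big_step_det[OF assms(2)] in auto)
  have len: "length (trace stA) = R * v * N" using hA by (simp add: A.halting_def A.traced_def)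
  have f: "real (card {i. i < R * v * N \<and> sym (trace stA ! i) \<noteq> sym (trace stB ! i)}) \<le>
      (1/4 - 2 * \<epsilon>) * real (R * v * N)"
    using few unfolding corruptions_def len by (simp add: S'_def)
  then have f': "real (card {i. i < R * v * N \<and> sym (trace stB ! i) \<noteq> sym (trace stA ! i)}) \<le>
      (1/4 - 2 * \<epsilon>) * real (R * v * N)" by (simp only: eq_commute)
  \<comment> \<open>The parties decode \<open>k1\<close> >= n symbols; the first n of them form the
    transcript of n rounds.\<close>
  show ?thesis
    using AB.outputs_correct[OF hA hB f] duel.outputs_correct[OF AB.swap hB hA f'] take_transcript[of n k1 \<Pi>] by simp
qed

end
end
end

lemma coding_scheme_S': "coding_scheme p (q * E) S' (\<lambda>n. K * T (max n n0))"
  unfolding coding_scheme_def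
proof (intro conjI allI impI)
  show "0 < q * E" using q0 by simp
  fix n \<Pi> and inp :: "nat \<Rightarrow> nat" assume pr: "protocol_over p \<Pi>" and "\<forall>i. inp i < q * E"
  then have i: "inp i < q * E" for i by blast
  show "\<exists>t st. big_step (alice_oracle \<Pi>) inp (alice_prog S') (init_state n) t st \<and> t \<le> K * T (max n n0) \<and>
      conforms (q * E) (rounds S' n) (alice_sends S' n) (trace st)"
    by (rule alice_halts[where n = n and inA = inp and inB = inp, OF pr i i]) blast
  show "\<exists>t st. big_step (bob_oracle \<Pi>) inp (bob_prog S') (init_state n) t st \<and> t \<le> K * T (max n n0) \<and>
      conforms (q * E) (rounds S' n) (\<lambda>i. \<not> alice_sends S' n i) (trace st)"
    by (rule bob_halts[where n = n and inA = inp and inB = inp, OF pr i i]) blast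
qed

lemma unique_decoding_S': "unique_decoding p (q * E) (1/4 - 2 * \<epsilon>) S'"
  unfolding unique_decoding_def
proof (intro allI impI)
  fix n \<Pi> stA stB
  assume pr: "protocol_over p \<Pi>" and ex: "execution (q * E) S' n \<Pi> stA stB"
    and few: "real (corruptions stA stB) \<le> (1/4 - 2 * \<epsilon>) * real (rounds S' n)"
  from ex obtain inA inB tA tB where i: "\<And>i. inA i < q * E" "\<And>i. inB i < q * E"
    and b: "big_step (alice_oracle \<Pi>) inA (alice_prog S') (init_state n) tA stA"
    "big_step (bob_oracle \<Pi>) inB (bob_prog S') (init_state n) tB stB"
    unfolding execution_def by blast
  show "outputs n stA = [transcript \<Pi> n] \<and> outputs n stB = [transcript \<Pi> n]"
    by (rule decodes[where inA = inA and inB = inB, OF pr i b few])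
qed

end

text \<open>Variable 1 is cleared again, so that the given program starts in exactly the initial
  state for the larger length.\<close>

definition padded :: "nat \<Rightarrow> com \<Rightarrow> com" where
  "padded n0 c = Seq (SetC 1 n0) (Seq (Sub 0 0 1) (Seq (Add 0 0 1) (Seq (SetC 1 0) c)))"

lemma padded_iff:
  "big_step orc inp (padded n0 c) (init_state n) t st \<longleftrightarrow>
    (\<exists>u. t = u + 4 \<and> big_step orc inp c (init_state (max n n0)) u st)"
proof -
  let ?st = "set_var 1 0 (set_var 0 (n - n0 + n0) (set_var 0 (n - n0) (set_var 1 n0 (init_state n))))"
  have st: "?st = init_state (max n n0)"
    by (auto simp: set_var_def init_state_def fun_eq_iff)
  have "wp (orc, inp) (padded n0 c) (\<lambda>t' st'. t' = t \<and> st' = st) (init_state n) \<longleftrightarrow>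
      wp (orc, inp) c (\<lambda>t' st'. Suc (Suc (Suc (Suc t'))) = t \<and> st' = st) ?st"
    unfolding padded_def by (simp add: wp_Seq wp_SetC wp_Sub wp_Add set_var_def init_state_def add_ac)
  then show ?thesis unfolding st by (auto simp: wp_def eval_nat_numeral)
qed

text \<open>At a negative error rate unique decoding is vacuous, except for the lengths \<open>n\<close> for which
  the scheme does not communicate at all; these are skipped.\<close>

lemma unique_decoding_trivial:
  assumes cs: "coding_scheme p q S T" and pos: "\<And>n. n0 \<le> n \<Longrightarrow> 0 < rounds S n" and "2 \<le> p" and \<rho>: "\<rho> < 0"
  shows "\<exists>q' S' T'. coding_scheme p q' S' T' \<and> unique_decoding p q' \<rho> S' \<and> q' \<le> 1 * q \<and>
    (\<forall>\<^sub>F n in sequentially. rounds S' n \<le> 5 * rounds S n \<and> T' n \<le> 5 * T n)"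
proof -
  define S' where "S' = \<lparr>alice_prog = padded n0 (alice_prog S), bob_prog = padded n0 (bob_prog S),
    rounds = (\<lambda>n. rounds S (max n n0)), alice_sends = (\<lambda>n. alice_sends S (max n n0))\<rparr>"
  have "coding_scheme p q S' (\<lambda>n. T (max n n0) + 4)"
    unfolding coding_scheme_def
  proof (intro conjI allI impI)
    show "0 < q" using cs by (simp add: coding_scheme_def)
    fix n \<Pi> and inp :: "nat \<Rightarrow> nat" assume *: "protocol_over p \<Pi>" "\<forall>i. inp i < q"
    let ?k = "max n n0"
    have "(\<exists>t st. big_step (alice_oracle \<Pi>) inp (alice_prog S) (init_state ?k) t st \<and> t \<le> T ?k \<and>
           conforms q (rounds S ?k) (alice_sends S ?k) (trace st)) \<and>
        (\<exists>t st. big_step (bob_oracle \<Pi>) inp (bob_prog S) (init_state ?k) t st \<and> t \<le> T ?k \<and>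
           conforms q (rounds S ?k) (\<lambda>i. \<not> alice_sends S ?k i) (trace st))"
      using cs * unfolding coding_scheme_def by blast
    then obtain tA stA tB stB where
      A: "big_step (alice_oracle \<Pi>) inp (alice_prog S) (init_state ?k) tA stA" "tA \<le> T ?k"
        "conforms q (rounds S ?k) (alice_sends S ?k) (trace stA)" and
      B: "big_step (bob_oracle \<Pi>) inp (bob_prog S) (init_state ?k) tB stB" "tB \<le> T ?k"
        "conforms q (rounds S ?k) (\<lambda>i. \<not> alice_sends S ?k i) (trace stB)" by blast
    show "\<exists>t st. big_step (alice_oracle \<Pi>) inp (alice_prog S') (init_state n) t st \<and> t \<le> T ?k + 4 \<and>
        conforms q (rounds S' n) (alice_sends S' n) (trace st)"
      using A by (intro exI[of _ "tA + 4"] exI[of _ stA]) (simp add: S'_def padded_iff)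
    show "\<exists>t st. big_step (bob_oracle \<Pi>) inp (bob_prog S') (init_state n) t st \<and> t \<le> T ?k + 4 \<and>
        conforms q (rounds S' n) (\<lambda>i. \<not> alice_sends S' n i) (trace st)"
      using B by (intro exI[of _ "tB + 4"] exI[of _ stB]) (simp add: S'_def padded_iff)
  qed
  moreover have "unique_decoding p q \<rho> S'"
    unfolding unique_decoding_def
  proof (intro allI impI)
    fix n \<Pi> stA stB assume few: "real (corruptions stA stB) \<le> \<rho> * real (rounds S' n)"
    have "0 < real (rounds S' n)" using pos[of "max n n0"] by (simp add: S'_def)
    then have "\<rho> * real (rounds S' n) < 0" using \<rho> by (simp add: mult_neg_pos)
    then show "outputs n stA = [transcript \<Pi> n] \<and> outputs n stB = [transcript \<Pi> n]" using few by linarith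
  qed
  \<comment> \<open>The 4 additional steps disappear in the factor 5, since \<open>T n\<close> is at
    least the number of rounds and hence at least 1.\<close>
  moreover have "rounds S' n \<le> 5 * rounds S n \<and> T (max n n0) + 4 \<le> 5 * T n" if "n0 \<le> n" for n
  proof -
    have pr: "protocol_over p (bob_tells [])" using assms(3) by (simp add: protocol_over_def bob_tells_def)
    have "0 < q" using cs by (simp add: coding_scheme_def)
    then obtain t st where "big_step (alice_oracle (bob_tells [])) (\<lambda>_. 0) (alice_prog S) (init_state n) t st" "t \<le> T n"
      "conforms q (rounds S n) (alice_sends S n) (trace st)"
      using cs pr unfolding coding_scheme_def by meson
    then have "rounds S n \<le> T n" using big_step_time by (fastforce simp: conforms_def)
    then show ?thesis using pos[OF that] that by (simp add: S'_def max_absorb1)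
  qed
  then have "\<forall>\<^sub>F n in sequentially. rounds S' n \<le> 5 * rounds S n \<and> T (max n n0) + 4 \<le> 5 * T n"
    by (rule eventually_sequentiallyI)
  ultimately show ?thesis by (intro exI[of _ q] exI[of _ S'] exI[of _ "\<lambda>n. T (max n n0) + 4"]) simp
qed

theorem theorem5:
  fixes \<epsilon> :: real and s :: nat
  assumes "0 < \<epsilon>"
  shows "\<exists>A. \<forall>p\<ge>2. \<forall>q. \<exists>K. \<forall>S T.
    coding_scheme p q S T \<longrightarrow> balanced p q S \<longrightarrow> list_decoding s p q (1/4 - \<epsilon>) S \<longrightarrow>
    (\<exists>q' S' T'. coding_scheme p q' S' T' \<and> unique_decoding p q' (1/4 - 2 * \<epsilon>) S' \<and>
       q' \<le> A * q \<and>
       (\<forall>\<^sub>F n in sequentially. rounds S' n \<le> K * rounds S n \<and> T' n \<le> K * T n))"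
proof (cases "\<epsilon> \<le> 1 / 8")
  \<comment> \<open>Here the error rate 1/4 - 2 \<epsilon> is negative.\<close>
  case False
  show ?thesis
  proof (rule exI[of _ 1], intro allI impI, rule exI[of _ 5], intro allI impI)
    fix p q :: nat and S T
    assume p: "2 \<le> p" and *: "coding_scheme p q S T" "list_decoding s p q (1/4 - \<epsilon>) S"
    show "\<exists>q' S' T'. coding_scheme p q' S' T' \<and> unique_decoding p q' (1/4 - 2 * \<epsilon>) S' \<and> q' \<le> 1 * q \<and>
       (\<forall>\<^sub>F n in sequentially. rounds S' n \<le> 5 * rounds S n \<and> T' n \<le> 5 * T n)"
    proof (rule unique_decoding_trivial[OF *(1) _ p])
      show "0 < rounds S n" if "s + 1 \<le> n" for n
      proof (rule ccontr)
        assume "\<not> 0 < rounds S n"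
        \<comment> \<open>Without any rounds the permitted number of errors is 0 whatever the sign
          of the rate, so the counting bound applies and gives n <= s.\<close>
        then show False using rounds_lower_bound[OF *(1,2) _ p, of n] that by simp
      qed
    qed (use False in simp)
  qed
next
  case True
  define i0 where "i0 = nat \<lceil>1 / \<epsilon>\<rceil>"
  define R where "R = 4 * i0"
  define m where "m = R * (s * i0)"
  define d where "d = 16 * (m + 1) ^ 2 * i0"
  have "1 / \<epsilon> \<le> real i0" unfolding i0_def by (rule real_nat_ceiling_ge)
  then have \<epsilon>: "1 \<le> \<epsilon> * real i0" using assms by (simp add: field_simps)
  then have i0: "0 < i0" by (cases i0) auto
  have d0: "0 < d" using i0 by (simp add: d_def)
  show ?thesis
  proof (rule exI[of _ "(8 ^ d + 1) ^ m"], intro allI impI)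
    fix p q :: nat assume p2: "2 \<le> p"
    obtain C' where C': "\<And>n. 1 \<le> n \<Longrightarrow> code_len p d (code_size p n) \<le> C' * n"
      using growth_linear[OF p2 growth_code_len[OF p2]] by (auto simp: dominated_def)
    define C where "C = Suc C'"
    have C: "code_len p d (code_size p n) \<le> C * n" if "1 \<le> n" for n
      using C'[OF that] by (simp add: C_def)
    define v where "v = i0 * (4 * q * C)"
    obtain K where K: "\<And>n1 N T. 1 \<le> n1 \<Longrightarrow> n1 \<le> 2 * q * N \<Longrightarrow> N \<le> T \<Longrightarrow> total_time p d s R v m n1 N T \<le> K * T"
      using total_time_linear[OF p2 d0, of q s R v m] by blast
    show "\<exists>K. \<forall>S T. coding_scheme p q S T \<longrightarrow> balanced p q S \<longrightarrow> list_decoding s p q (1/4 - \<epsilon>) S \<longrightarrow>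
      (\<exists>q' S' T'. coding_scheme p q' S' T' \<and> unique_decoding p q' (1/4 - 2 * \<epsilon>) S' \<and>
         q' \<le> (8 ^ d + 1) ^ m * q \<and>
         (\<forall>\<^sub>F n in sequentially. rounds S' n \<le> K * rounds S n \<and> T' n \<le> K * T n))"
    proof (rule exI[of _ "R * v + K"], intro allI impI)
      fix S T assume *: "coding_scheme p q S T" "balanced p q S" "list_decoding s p q (1/4 - \<epsilon>) S"
      interpret upgrade \<epsilon> s p q i0 C K R m d "4 * q * C" v "2 * s + 1" S T
        by unfold_locales (use \<epsilon> i0 True p2 C K * in \<open>auto simp: R_def m_def d_def v_def C_def\<close>)
      \<comment> \<open>Shorter protocols are run at the length 2 s + 1, so the comparison is made
        only from this length on.\<close>
      have "rounds S' n \<le> (R * v + K) * rounds S n \<and> K * T (max n (2 * s + 1)) \<le> (R * v + K) * T n"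
        if "2 * s + 1 \<le> n" for n
        using that unfolding S'_def by (simp add: max_absorb1 add_mult_distrib)
      then have "\<forall>\<^sub>F n in sequentially. rounds S' n \<le> (R * v + K) * rounds S n \<and>
          K * T (max n (2 * s + 1)) \<le> (R * v + K) * T n"
        by (rule eventually_sequentiallyI)
      then show "\<exists>q' S' T'. coding_scheme p q' S' T' \<and> unique_decoding p q' (1/4 - 2 * \<epsilon>) S' \<and>
          q' \<le> (8 ^ d + 1) ^ m * q \<and>
          (\<forall>\<^sub>F n in sequentially. rounds S' n \<le> (R * v + K) * rounds S n \<and> T' n \<le> (R * v + K) * T n)"
        using coding_scheme_S' unique_decoding_S'
        by (intro exI[of _ "q * E"] exI[of _ S'] exI[of _ "\<lambda>n. K * T (max n (2 * s + 1))"]) (simp add: mult.commute)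
    qed
  qed
qed

end
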